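(* Let $n\ge 1$ be an integer, $0<s<\min\{1,\frac n2\}$, $2<p<2^*_s:=\frac{2n}{n-2s}$, $-2s<\alpha<\frac n2-s$, $\beta-\alpha=s-n\left(\frac12-\frac1p\right)$, and assume additionally $\alpha\ge 0$. There exists $c=c(n,s,\alpha,p)>0$ such that, for all $\Omega\subseteq\mathbb R^n$ with $|\Omega|<\infty$ and all $u\in D^s_\alpha(\mathbb R^n)$ supported in $\Omega$, $$\|u\|_{D^s_\alpha(\mathbb R^n)}^2-\Lambda_{n,s,p,\alpha,\beta}\big\|u|\cdot|^{-\beta}\big\|_{L^p(\Omega)}^2\ge c\,|\Omega|^{-\frac{n-2s-2\alpha}{n}}\,\big\|u|\cdot|^{-\alpha}\big\|_{L^{\frac{n}{n-2s-\alpha},\infty}}^2 .$$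
   Context: $|\Omega|$ denotes Lebesgue measure. $D^s_\alpha(\mathbb R^n)$ is the closure of $C^\infty_c(\mathbb R^n)$ (real-valued functions) with respect to the norm $$\|u\|_{D^s_\alpha(\mathbb R^n)}^2:=\int_{\mathbb R^n}\int_{\mathbb R^n}\frac{(u(x)-u(y))^2}{|x|^\alpha|x-y|^{n+2s}|y|^\alpha}\,dx\,dy .$$ $\Lambda_{n,s,p,\alpha,\beta}>0$ is the optimal constant in the fractional Caffarelli--Kohn--Nirenberg inequality $$\|u\|_{D^s_\alpha(\mathbb R^n)}^2\ge\Lambda_{n,s,p,\alpha,\beta}\,\big\|u|\cdot|^{-\beta}\big\|_{L^p(\mathbb R^n)}^2\qquad\text{for all }u\in D^s_\alpha(\mathbb R^n).$$ For $r\in(1,\infty)$ the weak $L^r$-norm is $\|u\|_{L^{r,\infty}}:=\sup_{A\subset\mathbb R^n,\ |A|>0}|A|^{\frac1r-1}\int_A|u|$. *)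

theory Defs
  imports "HOL-Analysis.Analysis"
begin

primrec C_order :: "nat \<Rightarrow> (real ^ 'n \<Rightarrow> real) \<Rightarrow> bool" where
  "C_order 0 f \<longleftrightarrow> continuous_on UNIV f"
| "C_order (Suc k) f \<longleftrightarrow> (\<forall>x. f differentiable (at x)) \<and>
     (\<forall>i. C_order k (\<lambda>x. frechet_derivative f (at x) (axis i 1)))"

definition test_functions :: "(real ^ 'n \<Rightarrow> real) set" where
  "test_functions = {f. (\<forall>k. C_order k f) \<and> compact (closure {x. f x \<noteq> 0})}"

text \<open>Integrals are taken in \<^typ>\<open>ennreal\<close> and with respect to \<^const>\<open>lebesgue\<close>, so that they make
  sense for every Lebesgue measurable function. The conventions \<open>0 powr a = 0\<close> and \<open>a / 0 = 0\<close>
  only affect the null sets \<open>x = 0\<close>, \<open>y = 0\<close>, \<open>x = y\<close>.\<close>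

definition D_norm_sq :: "real \<Rightarrow> real \<Rightarrow> (real ^ 'n \<Rightarrow> real) \<Rightarrow> ennreal" where
  "D_norm_sq s \<alpha> u =
     (\<integral>\<^sup>+ x. (\<integral>\<^sup>+ y. ennreal ((u x - u y)\<^sup>2 /
        (norm x powr \<alpha> * norm (x - y) powr (real CARD('n) + 2 * s) * norm y powr \<alpha>))
        \<partial>lebesgue) \<partial>lebesgue)"

text \<open>The closure of the test functions, realised as a space of (representatives of) measurable
  functions. On all measurable functions the above is only a seminorm: it vanishes on constants, so
  that norm convergence alone would put every constant function into the closure. Norm convergence
  determines the limit only together with pointwise a.e. convergence. By the
  Caffarelli--Kohn--Nirenberg inequality a Cauchy sequence of test functions converges in a
  weighted \<open>L\<^sup>p\<close> space, hence a.e. along a subsequence, so the set below is the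
  completion of the test functions.\<close>

definition D_space :: "real \<Rightarrow> real \<Rightarrow> (real ^ 'n \<Rightarrow> real) set" where
  "D_space s \<alpha> = {u. u \<in> borel_measurable lebesgue \<and>
     (\<exists>\<phi> :: nat \<Rightarrow> real ^ 'n \<Rightarrow> real. (\<forall>k. \<phi> k \<in> test_functions) \<and>
        (AE x in lebesgue. (\<lambda>k. \<phi> k x) \<longlonglongrightarrow> u x) \<and>
        (\<lambda>k. D_norm_sq s \<alpha> (\<lambda>x. \<phi> k x - u x)) \<longlonglongrightarrow> 0)}"

definition Lp_norm :: "real \<Rightarrow> (real ^ 'n) set \<Rightarrow> (real ^ 'n \<Rightarrow> real) \<Rightarrow> ennreal" where
  "Lp_norm p \<Omega> f = (let I = (\<integral>\<^sup>+ x\<in>\<Omega>. ennreal (\<bar>f x\<bar> powr p) \<partial>lebesgue)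
     in if I = \<infinity> then \<infinity> else ennreal (enn2real I powr (1 / p)))"

text \<open>Sets of infinite measure are left out of the supremum: as \<open>1 / r - 1 < 0\<close> for \<open>r > 1\<close>, they
  would contribute \<open>0\<close>.\<close>

definition weak_norm :: "real \<Rightarrow> (real ^ 'n \<Rightarrow> real) \<Rightarrow> ennreal" where
  "weak_norm r f = (SUP A \<in> {A. A \<in> lmeasurable \<and> measure lebesgue A > 0}.
     ennreal (measure lebesgue A powr (1 / r - 1)) * (\<integral>\<^sup>+ x\<in>A. ennreal \<bar>f x\<bar> \<partial>lebesgue))"

text \<open>The optimal constant. The first argument only serves to fix the dimension.\<close>

definition CKN_const :: "'n::finite itself \<Rightarrow> real \<Rightarrow> real \<Rightarrow> real \<Rightarrow> real \<Rightarrow> ennreal" where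
  "CKN_const _ s p \<alpha> \<beta> = Sup {L. \<forall>u \<in> (D_space s \<alpha> :: (real ^ 'n \<Rightarrow> real) set).
     L * (Lp_norm p UNIV (\<lambda>x. u x * norm x powr (- \<beta>)))\<^sup>2 \<le> D_norm_sq s \<alpha> u}"

end

theory Submission
  imports Defs "HOL-Computational_Algebra.Polynomial"
begin

text \<open>
  Write \<open>Q\<close> for the energy, \<open>\<kappa> = n - 2 * s - 2 * \<alpha>\<close>, and let \<open>d\<close> be the deficit of a function \<open>u \<ge> 0\<close>
  with \<open>Q u = 1\<close>; small \<open>d\<close> is the only interesting case. No stability theory for optimisers is used:
  every step compares \<open>u\<close> with a competitor \<open>w \<ge> u\<close>, whose energy is at least
  \<open>\<Lambda>\<close> times the squared weighted norm of \<open>u\<close>, hence at least \<open>Q u - d\<close>.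

  The competitor \<open>max u v\<close>, where \<open>v\<close> is \<open>sqrt d * r powr (- \<kappa> / 2)\<close> times a plateau function of the ball
  of radius \<open>r\<close>, shows that the interaction energy between \<open>(u - v)\<^sup>+\<close> and \<open>(v - u)\<^sup>+\<close> is \<open>O(d)\<close>. As \<open>u\<close>
  vanishes on half of the ball when \<open>r\<close> exceeds the radius \<open>R\<close> corresponding to the measure of the
  support, this bounds the weighted \<open>L\<^sup>1\<close> norm of \<open>u\<close> on that ball by \<open>O(sqrt d * r powr (n / 2 + s))\<close>.
  Such bounds for all \<open>r \<ge> R\<close> control the error of an IMS localisation \<open>\<chi>1\<^sup>2 + \<chi>2\<^sup>2 = 1\<close>
  at scale \<open>R\<close>, so \<open>\<chi>2 u\<close> has energy \<open>O(d)\<close>, and \<open>\<chi>1 u\<close> has compact support and deficit \<open>O(d)\<close>.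

  For \<open>\<chi>1 u\<close> (again called \<open>u\<close>) and \<open>l = sqrt d * R powr (- \<kappa> / 2)\<close>, the competitor
  \<open>u + min u l - (l / t) * min u t\<close> bounds the energy of \<open>min u t\<close> linearly in \<open>t\<close>. By Hardy's inequality
  \<open>u\<close> is then below \<open>t / 2\<close> on half of every smaller ball, for a suitable \<open>t\<close> depending on its radius, which gives
  \<open>L\<^sup>1\<close> bounds on these balls as well. Localising once more, at the scale \<open>\<rho>\<close> with \<open>\<rho> powr n\<close> comparable to
  the measure of a set \<open>A\<close>, and applying Sobolev's and Hoelder's inequalities to the exterior part bounds the
  weighted integral of \<open>u\<close> over \<open>A\<close>.
\<close>

section \<open>Smooth functions\<close>

text \<open>The energy of \<open>plateau r\<close> is at most C r^\<kappa>, because \<kappa> is the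
  scaling exponent of \<open>Q\<close>. Hence sqrt d r^(-\<kappa>/2) is, up to a constant, the
  largest amplitude at radius r whose energy is O(d), and this fixes the powers of r in every later
  bound. The obstacle is the error of the localisation. Bounds on L1 norms control pairs of distant
  points, but near the diagonal the singular kernel asks for an L2 norm of \<open>u\<close> on the
  cut-off region. It is obtained by interpolating between the L1 norm and the Sobolev norm of
  \<open>\<chi>2 u\<close>, which costs m^\<theta> times the power 1 - \<theta>/2 of the very energy
  that is to be estimated; since this power is below 1, it can be absorbed. The interpolation closes
  only if \<open>\<chi>2\<close> and the error contain nearly the same power of the cut-off
  function, so \<tau> is a high power of \<open>cut\<close> and \<theta> = 2/(N + 1). The loss in
  the weighted norm from \<open>u\<close> to \<open>\<chi>1 u\<close> is absorbed too: it is linear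
  in the energy of \<open>\<chi>2 u\<close>, with a small factor because \<open>u\<close> has little
  weighted p-mass outside the ball.\<close>

lemma C_order_SucI:
  assumes "\<And>x. (f has_derivative f' x) (at x)" and "\<And>i. C_order k (\<lambda>x. f' x (axis i 1))"
  shows "C_order (Suc k) f"
proof -
  have "frechet_derivative f (at x) = f' x" for x
    using frechet_derivative_at[OF assms(1)[of x]] by simp
  with assms show ?thesis by (auto simp: differentiable_def)
qed

lemma C_order_Suc_imp: "C_order (Suc k) f \<Longrightarrow> C_order k f"
proof (induction k arbitrary: f)
  case 0
  then show ?case
    by (auto simp: differentiable_imp_continuous_within continuous_on_eq_continuous_within)
qed auto

lemma C_order_const: "C_order k (\<lambda>x. c)"
  by (induction k arbitrary: c) auto

lemma C_order_continuous_on: "C_order k f \<Longrightarrow> continuous_on S f"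
proof (induction k)
  case 0
  then show ?case by (auto intro: continuous_on_subset)
qed (use C_order_Suc_imp in blast)

lemma C_order_has_derivative:
  "C_order (Suc k) f \<Longrightarrow> (f has_derivative frechet_derivative f (at x)) (at x)"
  by (simp add: frechet_derivative_works[symmetric])

lemma C_order_add: "C_order k f \<Longrightarrow> C_order k g \<Longrightarrow> C_order k (\<lambda>x. f x + g x)"
proof (induction k arbitrary: f g)
  case 0
  then show ?case by (auto intro: continuous_on_add)
next
  case (Suc k)
  show ?case
  proof (rule C_order_SucI)
    show "((\<lambda>x. f x + g x) has_derivative
        (\<lambda>h. frechet_derivative f (at x) h + frechet_derivative g (at x) h)) (at x)" for x
      by (intro has_derivative_add C_order_has_derivative[OF Suc.prems(1)]
          C_order_has_derivative[OF Suc.prems(2)])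
  qed (use Suc in auto)
qed

lemma C_order_mult: "C_order k f \<Longrightarrow> C_order k g \<Longrightarrow> C_order k (\<lambda>x. f x * g x)"
proof (induction k arbitrary: f g)
  case 0
  then show ?case by (auto intro: continuous_on_mult)
next
  case (Suc k)
  show ?case
  proof (rule C_order_SucI)
    show "((\<lambda>x. f x * g x) has_derivative
        (\<lambda>h. f x * frechet_derivative g (at x) h + frechet_derivative f (at x) h * g x)) (at x)" for x
      by (intro has_derivative_mult C_order_has_derivative[OF Suc.prems(1)]
          C_order_has_derivative[OF Suc.prems(2)])
    show "C_order k (\<lambda>x. f x * frechet_derivative g (at x) (axis i 1) +
        frechet_derivative f (at x) (axis i 1) * g x)" for i
      using Suc.prems C_order_Suc_imp[OF Suc.prems(1)] C_order_Suc_imp[OF Suc.prems(2)]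
      by (intro C_order_add Suc.IH) auto
  qed
qed

lemma C_order_cmult: "C_order k f \<Longrightarrow> C_order k (\<lambda>x. c * f x)"
  by (intro C_order_mult C_order_const)

lemma C_order_diff: "C_order k f \<Longrightarrow> C_order k g \<Longrightarrow> C_order k (\<lambda>x. f x - g x)"
  using C_order_add[OF _ C_order_cmult, of k f g "-1"] by simp

lemma C_order_power: "C_order k f \<Longrightarrow> C_order k (\<lambda>x. f x ^ m)"
  by (induction m) (auto intro: C_order_const C_order_mult)

lemma C_order_scaleR_arg: "C_order k f \<Longrightarrow> C_order k (\<lambda>x. f (c *\<^sub>R x))"
proof (induction k arbitrary: f)
  case 0
  then have "continuous_on UNIV f" by simp
  then have "continuous_on UNIV (\<lambda>x. f (c *\<^sub>R x))"
    by (intro continuous_on_compose2[OF \<open>continuous_on UNIV f\<close>] continuous_intros) auto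
  then show ?case by simp
next
  case (Suc k)
  show ?case
  proof (rule C_order_SucI)
    show "((\<lambda>x. f (c *\<^sub>R x)) has_derivative
        (\<lambda>h. frechet_derivative f (at (c *\<^sub>R x)) (c *\<^sub>R h))) (at x)" for x
      by (rule has_derivative_compose[OF _ C_order_has_derivative[OF Suc.prems]])
        (auto intro!: derivative_eq_intros)
    have "frechet_derivative f (at (c *\<^sub>R x)) (c *\<^sub>R h) = c * frechet_derivative f (at (c *\<^sub>R x)) h" for x h
      using linear_frechet_derivative[of f "at (c *\<^sub>R x)"] Suc.prems
      by (simp add: linear_cmul)
    then show "C_order k (\<lambda>x. frechet_derivative f (at (c *\<^sub>R x)) (c *\<^sub>R axis i 1))" for i
      using Suc.IH[of "\<lambda>x. frechet_derivative f (at x) (axis i 1)"] Suc.prems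
      by (auto intro!: C_order_cmult)
  qed
qed

text \<open>The first hypothesis is closure of \<open>F\<close> under differentiation on
  \<open>S\<close>. It lets the induction on \<open>k\<close> run over all members of
  \<open>F\<close> at once: by the chain rule a partial derivative is \<open>g' (f x)\<close>,
  covered by the induction hypothesis, times a partial derivative of \<open>f\<close>.\<close>

lemma C_order_compose:
  fixes f :: "real ^ 'n \<Rightarrow> real"
  assumes D: "\<And>g. g \<in> F \<Longrightarrow> \<exists>g'\<in>F. \<forall>y\<in>S. (g has_real_derivative g' y) (at y)"
    and S: "\<And>x. f x \<in> S" and f: "\<And>k. C_order k f" and g: "g \<in> F"
  shows "C_order k (\<lambda>x. g (f x))"
  using g
proof (induction k arbitrary: g)
  case 0
  obtain g' where g': "\<And>y. y \<in> S \<Longrightarrow> (g has_real_derivative g' y) (at y)" using D[OF 0] by blast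
  have "isCont g (f x)" for x using g'[OF S] by (rule DERIV_isCont)
  moreover have "continuous_on UNIV f" using f by (rule C_order_continuous_on)
  ultimately show ?case
    by (simp add: continuous_on_eq_continuous_at isCont_o2[of _ f g])
next
  case (Suc k)
  obtain g' where g': "g' \<in> F" "\<And>y. y \<in> S \<Longrightarrow> (g has_real_derivative g' y) (at y)"
    using D[OF Suc.prems] by blast
  show ?case
  proof (rule C_order_SucI)
    show "((\<lambda>x. g (f x)) has_derivative
        (\<lambda>h. g' (f x) * frechet_derivative f (at x) h)) (at x)" for x
      using has_derivative_compose[OF C_order_has_derivative[OF f]
          g'(2)[OF S, unfolded has_field_derivative_def]] .
    show "C_order k (\<lambda>x. g' (f x) * frechet_derivative f (at x) (axis i 1))" for i
      using f[of "Suc k"] by (intro C_order_mult Suc.IH g') auto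
  qed
qed

lemma C_order_powr:
  fixes f :: "real ^ 'n \<Rightarrow> real"
  assumes pos: "\<And>x. f x > 0" and f: "\<And>k. C_order k f"
  shows "C_order k (\<lambda>x. f x powr a)"
proof -
  \<comment> \<open>The multiples of powers are closed under differentiation on the positive
    half-line; the powers alone are not.\<close>
  define F where "F = {g :: real \<Rightarrow> real. \<exists>c b. g = (\<lambda>y. c * y powr b)}"
  have D: "\<exists>g'\<in>F. \<forall>y\<in>{0<..}. (g has_real_derivative g' y) (at y)" if "g \<in> F" for g
  proof -
    from that obtain c b where g: "g = (\<lambda>y. c * y powr b)" by (auto simp: F_def)
    have "\<forall>y\<in>{0<..}. (g has_real_derivative (c * b) * y powr (b - 1)) (at y)"
      by (auto simp: g intro!: derivative_eq_intros)
    moreover have "(\<lambda>y. (c * b) * y powr (b - 1)) \<in> F" unfolding F_def by blast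
    ultimately show ?thesis by (rule bexI)
  qed
  have "(\<lambda>y. 1 * y powr a) \<in> F" unfolding F_def by blast
  from C_order_compose[OF D _ f this, of k] pos show ?thesis by simp
qed

lemma C_order_inverse:
  fixes f :: "real ^ 'n \<Rightarrow> real"
  assumes "\<And>x. f x > 0" and "\<And>k. C_order k f"
  shows "C_order k (\<lambda>x. inverse (f x))"
  using C_order_powr[OF assms, of k "-1"] assms(1) by (simp add: powr_minus less_imp_le)

lemma C_order_sqrt:
  fixes f :: "real ^ 'n \<Rightarrow> real"
  assumes "\<And>x. f x > 0" and "\<And>k. C_order k f"
  shows "C_order k (\<lambda>x. sqrt (f x))"
  using C_order_powr[OF assms, of k "1/2"] assms(1) by (simp add: powr_half_sqrt less_imp_le)

lemma C_order_component: "C_order k (\<lambda>x :: real ^ 'n. x $ i)"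
proof (cases k)
  case (Suc k')
  show ?thesis unfolding Suc
    by (rule C_order_SucI[where f' = "\<lambda>x h. h $ i"])
      (auto intro!: bounded_linear_imp_has_derivative bounded_linear_vec_nth C_order_const)
qed (simp add: continuous_on_component)

lemma C_order_sum:
  "(\<And>i. i \<in> I \<Longrightarrow> C_order k (f i)) \<Longrightarrow> C_order k (\<lambda>x. \<Sum>i\<in>I. f i x)"
  by (induction I rule: infinite_finite_induct) (auto intro: C_order_const C_order_add)

lemma C_order_norm_power2: "C_order k (\<lambda>x :: real ^ 'n. (norm x)\<^sup>2)"
  unfolding power2_norm_eq_inner inner_vec_def
  by (auto intro!: C_order_sum C_order_mult C_order_component)

section \<open>A smooth plateau function\<close>

definition bump0 :: "real poly \<Rightarrow> real \<Rightarrow> real" where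
  "bump0 q x = (if x \<le> 0 then 0 else poly q (1 / x) * exp (- 1 / x))"

lemma poly_mult_exp_minus_tendsto: "((\<lambda>y::real. poly q y * exp (- y)) \<longlongrightarrow> 0) at_top"
proof -
  have "((\<lambda>y::real. \<Sum>i\<le>degree q. coeff q i * (y ^ i / exp y)) \<longlongrightarrow> (\<Sum>i\<le>degree q. coeff q i * 0)) at_top"
    by (intro tendsto_intros tendsto_power_div_exp_0)
  then show ?thesis
    by (simp add: poly_altdef sum_distrib_right exp_minus divide_inverse mult.assoc)
qed

lemma bump0_tendsto: "(bump0 q \<longlongrightarrow> 0) (at 0)"
proof -
  have "((\<lambda>x. poly q (inverse x) * exp (- inverse x)) \<longlongrightarrow> 0) (at_right 0)"
    by (rule filterlim_compose[OF poly_mult_exp_minus_tendsto filterlim_inverse_at_top_right])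
  then have "(bump0 q \<longlongrightarrow> 0) (at_right 0)"
    by (rule Lim_transform_eventually)
      (auto simp: eventually_at_filter bump0_def field_simps)
  moreover have "(bump0 q \<longlongrightarrow> 0) (at_left 0)"
    by (rule Lim_transform_eventually[OF tendsto_const])
      (auto simp: eventually_at_filter bump0_def)
  ultimately show ?thesis by (simp add: filterlim_at_split)
qed

text \<open>Why \<open>bump0\<close> is indexed by a polynomial in y = 1/x: the derivative of q(1/x)
  exp(-1/x) is of the same kind, with the polynomial y^2 (q - q'). So \<open>range bump0\<close> is
  a possible \<open>F\<close> in \<open>C_order_compose\<close>, and smoothness of
  \<open>bump0 1\<close> follows without formulas for higher derivatives.\<close>

lemma bump0_deriv:
  "(bump0 q has_real_derivative bump0 (monom 1 2 * (q - pderiv q)) x) (at x)"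
proof -
  consider "x < 0" | "x = 0" | "x > 0" by linarith
  then show ?thesis
  proof cases
    case 1
    have "((\<lambda>x. 0) has_real_derivative 0) (at x)" by simp
    then have "(bump0 q has_real_derivative 0) (at x)"
      by (rule has_field_derivative_transform_within_open[of _ _ _ "{..<0}"])
        (use 1 in \<open>auto simp: bump0_def\<close>)
    with 1 show ?thesis by (simp add: bump0_def)
  next
    case 2
    \<comment> \<open>The difference quotient at 0 is again in the family: dividing by h multiplies
      the polynomial by y = 1/h, which is \<open>pCons 0\<close>.\<close>
    have "(bump0 (pCons 0 q) \<longlongrightarrow> 0) (at 0)" by (rule bump0_tendsto)
    then have "((\<lambda>h. (bump0 q (0 + h) - bump0 q 0) / h) \<longlongrightarrow> 0) (at 0)"
      by (rule Lim_transform_eventually)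
        (auto simp: eventually_at_filter bump0_def field_simps)
    with 2 show ?thesis by (simp add: DERIV_def bump0_def)
  next
    case 3
    have "((\<lambda>x. poly q (1 / x) * exp (- 1 / x)) has_real_derivative
        poly (monom 1 2 * (q - pderiv q)) (1 / x) * exp (- 1 / x)) (at x)"
      using 3
      by (auto intro!: derivative_eq_intros simp: poly_monom)
        (simp add: field_simps power2_eq_square)
    then have "(bump0 q has_real_derivative poly (monom 1 2 * (q - pderiv q)) (1 / x) * exp (- 1 / x)) (at x)"
      by (rule has_field_derivative_transform_within_open[of _ _ _ "{0<..}"])
        (use 3 in \<open>auto simp: bump0_def\<close>)
    with 3 show ?thesis by (simp add: bump0_def)
  qed
qed

lemma C_order_bump0:
  fixes f :: "real ^ 'n \<Rightarrow> real"
  assumes "\<And>k. C_order k f"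
  shows "C_order k (\<lambda>x. bump0 1 (f x))"
  by (rule C_order_compose[where F = "range bump0" and S = UNIV and g = "bump0 1" and f = f])
    (use assms bump0_deriv in auto)

lemma bump0_pos: "0 < x \<Longrightarrow> bump0 1 x > 0" and bump0_nonneg: "0 \<le> bump0 1 x"
  and bump0_zero: "x \<le> 0 \<Longrightarrow> bump0 1 x = 0"
  by (auto simp: bump0_def)

text \<open>The squared norm is used because it is smooth also at the origin. The numbers 4 - t and
  t - 1 are never both nonpositive, so the denominator does not vanish.\<close>

definition plateau1 :: "real ^ 'n \<Rightarrow> real" where
  "plateau1 x = bump0 1 (4 - (norm x)\<^sup>2) * inverse (bump0 1 (4 - (norm x)\<^sup>2) + bump0 1 ((norm x)\<^sup>2 - 1))"

definition plateau :: "real \<Rightarrow> real ^ 'n \<Rightarrow> real" where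
  "plateau r x = plateau1 (inverse r *\<^sub>R x)"

lemma plateau1_denom_pos:
  fixes x :: "real ^ 'n"
  shows "bump0 1 (4 - (norm x)\<^sup>2) + bump0 1 ((norm x)\<^sup>2 - 1) > 0"
  using bump0_pos[of "4 - (norm x)\<^sup>2"] bump0_pos[of "(norm x)\<^sup>2 - 1"] bump0_nonneg[of "4 - (norm x)\<^sup>2"]
    bump0_nonneg[of "(norm x)\<^sup>2 - 1"] by argo

lemma C_order_plateau: "C_order k (plateau r)"
proof -
  have "C_order k (plateau1 :: real ^ 'n \<Rightarrow> real)" for k
    unfolding plateau1_def[abs_def]
    by (intro C_order_mult C_order_inverse plateau1_denom_pos C_order_add C_order_bump0
        C_order_diff C_order_const C_order_norm_power2)
  then show ?thesis unfolding plateau_def[abs_def] by (rule C_order_scaleR_arg)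
qed

lemma plateau1_bounds: "0 \<le> plateau1 x" "plateau1 x \<le> 1"
proof -
  have *: "bump0 1 (4 - (norm x)\<^sup>2) \<le> bump0 1 (4 - (norm x)\<^sup>2) + bump0 1 ((norm x)\<^sup>2 - 1)"
    using bump0_nonneg by simp
  show "0 \<le> plateau1 x" "plateau1 x \<le> 1"
    using plateau1_denom_pos[of x] bump0_nonneg[of "4 - (norm x)\<^sup>2"] *
    by (auto simp: plateau1_def divide_inverse[symmetric] divide_simps)
qed

lemma plateau1_eq_1: "norm x \<le> 1 \<Longrightarrow> plateau1 x = 1"
proof -
  assume "norm x \<le> 1"
  then have "(norm x)\<^sup>2 \<le> 1" by (simp add: power_le_one)
  then have "bump0 1 ((norm x)\<^sup>2 - 1) = 0" by (simp add: bump0_zero)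
  with plateau1_denom_pos[of x] show ?thesis by (simp add: plateau1_def)
qed

lemma plateau1_eq_0: "norm x \<ge> 2 \<Longrightarrow> plateau1 x = 0"
proof -
  assume "norm x \<ge> 2"
  then have "2\<^sup>2 \<le> (norm x)\<^sup>2" by (intro power_mono) auto
  then show ?thesis by (simp add: plateau1_def bump0_zero)
qed

lemma plateau_bounds: "0 \<le> plateau r x" "plateau r x \<le> 1"
  by (auto simp: plateau_def plateau1_bounds)

lemma plateau_eq_1: "0 < r \<Longrightarrow> norm x \<le> r \<Longrightarrow> plateau r x = 1"
  unfolding plateau_def by (rule plateau1_eq_1) (simp add: field_simps)

lemma plateau_eq_0: "0 < r \<Longrightarrow> norm x \<ge> 2 * r \<Longrightarrow> plateau r x = 0"
  unfolding plateau_def by (rule plateau1_eq_0) (simp add: field_simps)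

section \<open>Test functions\<close>

lemma test_functionsI:
  assumes "\<And>k. C_order k f" and "\<And>x. f x \<noteq> 0 \<Longrightarrow> norm x \<le> r"
  shows "f \<in> test_functions"
proof -
  have "{x. f x \<noteq> 0} \<subseteq> cball 0 r" using assms(2) by auto
  then have "bounded {x. f x \<noteq> 0}" by (rule bounded_subset[OF bounded_cball])
  with assms(1) show ?thesis by (simp add: test_functions_def compact_closure)
qed

lemma test_functionsE:
  assumes "f \<in> test_functions"
  obtains r where "r > 0" "\<And>k. C_order k f" "\<And>x. f x \<noteq> 0 \<Longrightarrow> norm x \<le> r"
proof -
  have "bounded (closure {x. f x \<noteq> 0})" using assms
    by (auto simp: test_functions_def intro: compact_imp_bounded)
  then obtain r where "r > 0" "\<And>x. x \<in> closure {x. f x \<noteq> 0} \<Longrightarrow> norm x \<le> r"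
    by (auto simp: bounded_pos)
  with that show ?thesis using assms closure_subset[of "{x. f x \<noteq> 0}"]
    by (auto simp: test_functions_def)
qed

lemma test_functions_add: "f \<in> test_functions \<Longrightarrow> g \<in> test_functions \<Longrightarrow> (\<lambda>x. f x + g x) \<in> test_functions"
proof (elim test_functionsE)
  fix r1 r2 assume *: "\<And>k. C_order k f" "\<And>x. f x \<noteq> 0 \<Longrightarrow> norm x \<le> r1"
    "\<And>k. C_order k g" "\<And>x. g x \<noteq> 0 \<Longrightarrow> norm x \<le> r2"
  show ?thesis
  proof (rule test_functionsI[where r = "max r1 r2"])
    show "norm x \<le> max r1 r2" if "f x + g x \<noteq> 0" for x
      using that *(2)[of x] *(4)[of x] by (cases "f x = 0") auto
  qed (use * in \<open>auto intro: C_order_add\<close>)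
qed

lemma test_functions_mult: "f \<in> test_functions \<Longrightarrow> (\<And>k. C_order k g) \<Longrightarrow> (\<lambda>x. g x * f x) \<in> test_functions"
proof (elim test_functionsE)
  fix r assume *: "\<And>k. C_order k g" "\<And>k. C_order k f" "\<And>x. f x \<noteq> 0 \<Longrightarrow> norm x \<le> r"
  show ?thesis
    by (rule test_functionsI[where r = r]) (use * in \<open>simp_all add: C_order_mult\<close>)
qed

lemma test_functions_compose:
  assumes "f \<in> test_functions" and "\<And>k. C_order k (\<lambda>x. g (f x))" and "g 0 = 0"
  shows "(\<lambda>x. g (f x)) \<in> test_functions"
  using assms(1)
proof (elim test_functionsE)
  fix r assume *: "\<And>k. C_order k f" "\<And>x. f x \<noteq> 0 \<Longrightarrow> norm x \<le> r"
  show ?thesis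
  proof (rule test_functionsI[where r = r])
    show "norm x \<le> r" if "g (f x) \<noteq> 0" for x
      using that *(2)[of x] assms(3) by (cases "f x = 0") auto
  qed (rule assms(2))
qed

lemma test_functions_measurable: "f \<in> test_functions \<Longrightarrow> f \<in> borel_measurable borel"
  by (elim test_functionsE) (auto intro: borel_measurable_continuous_onI C_order_continuous_on)

lemma test_functions_bounded:
  assumes "f \<in> test_functions" obtains B where "B > 0" "\<And>x. \<bar>f x\<bar> \<le> B"
  using assms
proof (elim test_functionsE)
  fix r assume *: "\<And>k. C_order k f" "\<And>x. f x \<noteq> 0 \<Longrightarrow> norm x \<le> r"
  have "compact (f ` cball 0 r)"
    using C_order_continuous_on[OF *(1)] by (intro compact_continuous_image) auto
  then have "bounded (f ` cball 0 r)" by (rule compact_imp_bounded)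
  then obtain B where B: "B > 0" "\<And>x. norm x \<le> r \<Longrightarrow> \<bar>f x\<bar> \<le> B"
    by (auto simp: bounded_pos)
  have "\<bar>f x\<bar> \<le> B" for x using B(1) B(2)[of x] *(2)[of x] by (cases "f x = 0") auto
  with B(1) that show ?thesis by blast
qed

lemma test_functions_partial:
  assumes "f \<in> test_functions"
  shows "(\<lambda>x. frechet_derivative f (at x) (axis i 1)) \<in> test_functions"
  using assms
proof (elim test_functionsE)
  fix r assume *: "\<And>k. C_order k f" "\<And>x. f x \<noteq> 0 \<Longrightarrow> norm x \<le> r"
  show ?thesis
  proof (rule test_functionsI[where r = r])
    show "C_order k (\<lambda>x. frechet_derivative f (at x) (axis i 1))" for k
      using *(1)[of "Suc k"] by auto
    show "norm x \<le> r" if "frechet_derivative f (at x) (axis i 1) \<noteq> 0" for x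
    proof (rule ccontr)
      assume "\<not> norm x \<le> r"
      then have x: "x \<in> - cball 0 r" by auto
      have "(f has_derivative (\<lambda>h. 0)) (at x)"
      proof (rule has_derivative_transform_within_open[OF has_derivative_const open_Compl[OF closed_cball] x])
        show "0 = f y" if "y \<in> - cball 0 r" for y
          using *(2)[of y] that by (cases "f y = 0") auto
      qed
      with frechet_derivative_at[OF this, symmetric] that show False by simp
    qed
  qed
qed

text \<open>The partial derivatives are test functions again, hence bounded. Expanding the
  derivative along the coordinate axes, the sum of their bounds is a Lipschitz constant.\<close>

lemma test_functions_Lipschitz:
  fixes f :: "real ^ 'n \<Rightarrow> real"
  assumes "f \<in> test_functions"
  obtains L where "L > 0" "\<And>x y. \<bar>f x - f y\<bar> \<le> L * norm (x - y)"
proof -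
  have "\<exists>B>0. \<forall>x. \<bar>frechet_derivative f (at x) (axis i 1)\<bar> \<le> B" for i
    using test_functions_bounded[OF test_functions_partial[OF assms, of i]] by metis
  then obtain B where B: "\<And>i. B i > 0" "\<And>i x. \<bar>frechet_derivative f (at x) (axis i 1)\<bar> \<le> B i"
    by metis
  define L where "L = (\<Sum>i\<in>UNIV. B i)"
  have f: "C_order k f" for k using assms by (rule test_functionsE)
  have deriv: "(f has_derivative frechet_derivative f (at x)) (at x)" for x
    using f by (rule C_order_has_derivative[of 0])
  have *: "norm (frechet_derivative f (at x) h) \<le> L * norm h" for x h
  proof -
    interpret bounded_linear "frechet_derivative f (at x)"
      using deriv by (rule has_derivative_bounded_linear)
    have "(\<Sum>i\<in>UNIV. (h $ i) *\<^sub>R axis i 1) = h"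
      using basis_expansion[of h] by (simp add: scalar_mult_eq_scaleR)
    from arg_cong[OF this, of "frechet_derivative f (at x)"]
    have "frechet_derivative f (at x) h = (\<Sum>i\<in>UNIV. (h $ i) * frechet_derivative f (at x) (axis i 1))"
      by (simp add: sum scaleR)
    also have "\<bar>\<dots>\<bar> \<le> (\<Sum>i\<in>UNIV. \<bar>h $ i\<bar> * \<bar>frechet_derivative f (at x) (axis i 1)\<bar>)"
      by (rule order_trans[OF sum_abs]) (simp add: abs_mult)
    also have "\<dots> \<le> (\<Sum>i\<in>UNIV. norm h * B i)"
      by (intro sum_mono mult_mono component_le_norm_cart B) auto
    finally show ?thesis by (simp add: L_def sum_distrib_left mult.commute)
  qed
  have "norm (f x - f y) \<le> L * norm (x - y)" for x y
  proof (rule differentiable_bound[of UNIV])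
    show "onorm (frechet_derivative f (at x)) \<le> L" for x
      by (rule onorm_bound) (use * in auto, simp add: L_def sum_nonneg B less_imp_le)
  qed (use deriv in auto)
  moreover have "L > 0" unfolding L_def by (rule sum_pos) (use B in auto)
  ultimately show ?thesis using that by auto
qed

lemma plateau_test: "0 < r \<Longrightarrow> plateau r \<in> test_functions"
proof (rule test_functionsI[where r = "2 * r"])
  show "norm x \<le> 2 * r" if "0 < r" "plateau r x \<noteq> 0" for x
    using that plateau_eq_0[of r x] by (cases "norm x \<le> 2 * r") auto
qed (rule C_order_plateau)

lemma plateau_Lipschitz:
  obtains L where "L > 0"
    "\<And>r x y. r > 0 \<Longrightarrow> \<bar>plateau r x - plateau r (y :: real ^ 'n)\<bar> \<le> L * norm (x - y) / r"
proof -
  obtain L where L: "L > 0" "\<And>x y :: real ^ 'n. \<bar>plateau 1 x - plateau 1 y\<bar> \<le> L * norm (x - y)"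
    using test_functions_Lipschitz[OF plateau_test[of 1]] by auto
  have "\<bar>plateau r x - plateau r y\<bar> \<le> L * norm (x - y) / r" if "r > 0" for r and x y :: "real ^ 'n"
  proof -
    have "norm (inverse r *\<^sub>R x - inverse r *\<^sub>R y) = norm (x - y) / r"
      using that by (simp add: scaleR_diff_right[symmetric] divide_inverse_commute)
    with L(2)[of "inverse r *\<^sub>R x" "inverse r *\<^sub>R y"] show ?thesis
      by (simp add: plateau_def)
  qed
  with L(1) that show ?thesis by blast
qed

section \<open>Radial integrals\<close>

lemma dyadic_above:
  fixes r a :: real
  assumes "0 < r" "r \<le> a"
  obtains j :: nat where "2 ^ j * r \<le> a" "a < 2 ^ Suc j * r"
proof -
  obtain m :: nat where "a / r < 2 ^ m" using real_arch_pow[of 2 "a / r"] by auto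
  then have ex: "\<exists>m. a < 2 ^ m * r" using assms by (auto simp: field_simps)
  define m where "m = (LEAST m. a < 2 ^ m * r)"
  have m: "a < 2 ^ m * r" unfolding m_def by (rule LeastI_ex[OF ex])
  with assms obtain j where j: "m = Suc j" by (cases m) auto
  have "\<not> a < 2 ^ j * r" using not_less_Least[of j "\<lambda>m. a < 2 ^ m * r"] j m_def by auto
  with m j show ?thesis by (intro that[of j]) auto
qed

lemma dyadic_below:
  fixes r a :: real
  assumes "0 < a" "a < r"
  obtains j :: nat where "r / 2 ^ Suc j \<le> a" "a < r / 2 ^ j"
proof -
  obtain m :: nat where "r / a < 2 ^ m" using real_arch_pow[of 2 "r / a"] by auto
  then have ex: "\<exists>m. r / 2 ^ m \<le> a" using assms by (auto simp: field_simps intro!: exI[of _ m])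
  define m where "m = (LEAST m. r / 2 ^ m \<le> a)"
  have m: "r / 2 ^ m \<le> a" unfolding m_def by (rule LeastI_ex[OF ex])
  with assms obtain j where j: "m = Suc j" by (cases m) auto
  have "\<not> r / 2 ^ j \<le> a" using not_less_Least[of j "\<lambda>m. r / 2 ^ m \<le> a"] j m_def by auto
  with m j show ?thesis by (intro that[of j]) auto
qed

lemma suminf_ennreal_geometric:
  assumes "0 \<le> c" "0 \<le> q" "q < 1"
  shows "(\<Sum>j. ennreal (c * q ^ j)) = ennreal (c / (1 - q))"
proof -
  have "(\<lambda>j. c * q ^ j) sums (c * (1 / (1 - q)))"
    using assms by (intro sums_mult geometric_sums) auto
  then show ?thesis using assms by (subst suminf_ennreal_eq) auto
qed

lemma le_suminf_ennreal: "h j \<le> suminf h" for h :: "nat \<Rightarrow> ennreal"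
  using sum_le_suminf[of h "{j}"] by simp

lemma nn_integral_suminf_indicator:
  assumes [measurable]: "g \<in> borel_measurable M" "\<And>j. B j \<in> sets M"
  shows "(\<integral>\<^sup>+x. (\<Sum>j. c j * (g x * indicator (B j) x)) \<partial>M)
    = (\<Sum>j. c j * (\<integral>\<^sup>+x. g x * indicator (B j) x \<partial>M))"
  by (simp add: nn_integral_suminf nn_integral_cmult)

lemma powr_2_realpow_nat: "(2 ^ j) powr a = (2 powr a :: real) ^ j"
  by (simp add: powr_realpow[symmetric] powr_powr mult.commute)

text \<open>On the shell between 2^j r and 2^(j+1) r the weight is at most (2^j r)^(-\<gamma>) and
  the mass at most A (2^(j+1) r)^\<sigma>, so the shells are summed by a geometric series of ratio
  2^(\<sigma> - \<gamma>). The general density \<open>g\<close> admits the L1 growth bounds in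
  \<open>Xi_estimate\<close>.\<close>

lemma nn_integral_tail_le:
  fixes g :: "'a::euclidean_space \<Rightarrow> ennreal"
  assumes [measurable]: "g \<in> borel_measurable borel" and r: "0 < r" and "0 \<le> \<gamma>" "\<sigma> < \<gamma>" "0 \<le> A"
    and le: "\<And>t. r \<le> t \<Longrightarrow> (\<integral>\<^sup>+x. g x * indicator (ball 0 t) x \<partial>lborel) \<le> ennreal (A * t powr \<sigma>)"
  shows "(\<integral>\<^sup>+x. g x * ennreal (norm x powr - \<gamma>) * indicator {x. r \<le> norm x} x \<partial>lborel)
    \<le> ennreal (2 powr \<sigma> / (1 - 2 powr (\<sigma> - \<gamma>)) * (A * r powr (\<sigma> - \<gamma>)))"
proof -
  have "g x * ennreal (norm x powr - \<gamma>) * indicator {x. r \<le> norm x} x \<le>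
      (\<Sum>j. ennreal ((2 ^ j * r) powr - \<gamma>) * (g x * indicator (ball 0 (2 ^ Suc j * r)) x))" (is "_ \<le> suminf ?h") for x
  proof (cases "r \<le> norm x")
    case True
    then obtain j where j: "2 ^ j * r \<le> norm x" "norm x < 2 ^ Suc j * r"
      using dyadic_above[OF r] by metis
    have "norm x powr - \<gamma> \<le> (2 ^ j * r) powr - \<gamma>"
      using j r \<open>0 \<le> \<gamma>\<close> by (intro powr_mono2') auto
    then have "g x * ennreal (norm x powr - \<gamma>) * indicator {x. r \<le> norm x} x \<le> ?h j"
      using True j(2) by (auto simp: mult.commute intro!: mult_left_mono ennreal_leI)
    also have "?h j \<le> suminf ?h" by (rule le_suminf_ennreal)
    finally show ?thesis .
  qed auto
  then have "(\<integral>\<^sup>+x. g x * ennreal (norm x powr - \<gamma>) * indicator {x. r \<le> norm x} x \<partial>lborel)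
      \<le> (\<integral>\<^sup>+x. (\<Sum>j. ennreal ((2 ^ j * r) powr - \<gamma>) * (g x * indicator (ball 0 (2 ^ Suc j * r)) x)) \<partial>lborel)"
    by (intro nn_integral_mono)
  also have "\<dots> = (\<Sum>j. ennreal ((2 ^ j * r) powr - \<gamma>) * (\<integral>\<^sup>+x. g x * indicator (ball 0 (2 ^ Suc j * r)) x \<partial>lborel))"
    by (rule nn_integral_suminf_indicator) auto
  also have "\<dots> \<le> (\<Sum>j. ennreal (2 powr \<sigma> * (A * r powr (\<sigma> - \<gamma>)) * (2 powr (\<sigma> - \<gamma>)) ^ j))"
  proof (rule suminf_le)
    fix j :: nat
    have "1 * r \<le> 2 ^ Suc j * r" using r by (intro mult_right_mono one_le_power) auto
    then have "ennreal ((2 ^ j * r) powr - \<gamma>) * (\<integral>\<^sup>+x. g x * indicator (ball 0 (2 ^ Suc j * r)) x \<partial>lborel)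
      \<le> ennreal ((2 ^ j * r) powr - \<gamma>) * ennreal (A * (2 ^ Suc j * r) powr \<sigma>)"
      by (intro mult_left_mono le) auto
    also have "\<dots> = ennreal ((2 ^ j * r) powr - \<gamma> * (A * (2 ^ Suc j * r) powr \<sigma>))"
      using \<open>0 \<le> A\<close> by (simp add: ennreal_mult)
    also have "(2 ^ j * r) powr - \<gamma> * (A * (2 ^ Suc j * r) powr \<sigma>)
      = 2 powr \<sigma> * (A * r powr (\<sigma> - \<gamma>)) * (2 powr (\<sigma> - \<gamma>)) ^ j"
      using r by (simp add: powr_mult powr_2_realpow_nat diff_conv_add_uminus powr_add power_mult_distrib
          del: power_Suc add_uminus_conv_diff) (simp add: powr_minus mult_ac)
    finally show "ennreal ((2 ^ j * r) powr - \<gamma>) * (\<integral>\<^sup>+x. g x * indicator (ball 0 (2 ^ Suc j * r)) x \<partial>lborel)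
      \<le> ennreal (2 powr \<sigma> * (A * r powr (\<sigma> - \<gamma>)) * (2 powr (\<sigma> - \<gamma>)) ^ j)" .
  qed auto
  also have "\<dots> = ennreal (2 powr \<sigma> * (A * r powr (\<sigma> - \<gamma>)) / (1 - 2 powr (\<sigma> - \<gamma>)))"
    using \<open>0 \<le> A\<close> \<open>\<sigma> < \<gamma>\<close> by (intro suminf_ennreal_geometric) (auto simp: powr_less_one)
  finally show ?thesis by simp
qed

lemma emeasure_ball_powr:
  fixes x :: "real ^ 'n"
  assumes "0 \<le> r"
  shows "emeasure lborel (ball x r) = ennreal (unit_ball_vol (real CARD('n)) * r powr real CARD('n))"
  using assms by (cases "r = 0") (auto simp: emeasure_ball powr_realpow)

lemma nn_integral_tail_powr:
  fixes \<gamma> :: real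
  assumes r: "0 < r" and "0 < \<gamma>"
  defines "n \<equiv> real CARD('n)"
  shows "(\<integral>\<^sup>+x. ennreal (norm (x :: real ^ 'n) powr - (n + \<gamma>)) * indicator {x. r \<le> norm x} x \<partial>lborel)
    \<le> ennreal (2 powr n / (1 - 2 powr - \<gamma>) * unit_ball_vol n * r powr - \<gamma>)"
proof -
  have "(\<integral>\<^sup>+x. 1 * ennreal (norm (x :: real ^ 'n) powr - (n + \<gamma>)) * indicator {x. r \<le> norm x} x \<partial>lborel)
    \<le> ennreal (2 powr n / (1 - 2 powr (n - (n + \<gamma>))) * (unit_ball_vol n * r powr (n - (n + \<gamma>))))"
  proof (rule nn_integral_tail_le[OF _ r])
    show "(\<integral>\<^sup>+x. 1 * indicator (ball (0 :: real ^ 'n) t) x \<partial>lborel) \<le> ennreal (unit_ball_vol n * t powr n)"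
      if "r \<le> t" for t
      using that r by (simp add: emeasure_ball_powr n_def)
  qed (use \<open>0 < \<gamma>\<close> in \<open>auto simp: n_def\<close>)
  then show ?thesis by (simp add: mult.assoc)
qed

text \<open>Summation over shrinking balls. The factor \<open>max 1 (2 powr \<gamma>)\<close> covers
  both signs of \<gamma>, since the weight is largest at the inner or at the outer edge of a shell.
  Negative exponents do occur: n + 2s - 2 is negative in dimension one.\<close>

lemma nn_integral_ball_powr:
  fixes \<gamma> :: real
  assumes r: "0 < r" and \<gamma>: "\<gamma> < real CARD('n)"
  defines "n \<equiv> real CARD('n)"
  shows "(\<integral>\<^sup>+x. ennreal (norm (x :: real ^ 'n) powr - \<gamma>) * indicator (ball 0 r) x \<partial>lborel)
    \<le> ennreal (max 1 (2 powr \<gamma>) / (1 - 2 powr (\<gamma> - n)) * unit_ball_vol n * r powr (n - \<gamma>))"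
proof -
  let ?c = "max 1 (2 powr \<gamma>)"
  have "ennreal (norm x powr - \<gamma>) * indicator (ball 0 r) x \<le>
      (\<Sum>j. ennreal (?c * (r / 2 ^ j) powr - \<gamma>) * indicator (ball 0 (r / 2 ^ j)) x)" (is "_ \<le> suminf ?h") for x :: "real ^ 'n"
  proof (cases "norm x < r \<and> x \<noteq> 0")
    case True
    then obtain j where j: "r / 2 ^ Suc j \<le> norm x" "norm x < r / 2 ^ j"
      using dyadic_below[of "norm x" r] by (metis zero_less_norm_iff)
    have "norm x powr - \<gamma> \<le> ?c * (r / 2 ^ j) powr - \<gamma>"
    proof (cases "\<gamma> \<ge> 0")
      case True
      have "norm x powr - \<gamma> \<le> (r / 2 ^ Suc j) powr - \<gamma>"
        using j r True by (intro powr_mono2') auto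
      also have "\<dots> = (1 / 2 * (r / 2 ^ j)) powr - \<gamma>" by simp
      also have "\<dots> = 2 powr \<gamma> * (r / 2 ^ j) powr - \<gamma>"
        using r by (subst powr_mult) (auto simp: powr_divide powr_minus field_simps)
      also have "\<dots> \<le> ?c * (r / 2 ^ j) powr - \<gamma>" by (intro mult_right_mono) auto
      finally show ?thesis .
    next
      case False
      have "norm x powr - \<gamma> \<le> 1 * (r / 2 ^ j) powr - \<gamma>"
        using j False by (auto intro!: powr_mono2)
      also have "\<dots> \<le> ?c * (r / 2 ^ j) powr - \<gamma>" by (intro mult_right_mono) auto
      finally show ?thesis .
    qed
    then have "ennreal (norm x powr - \<gamma>) * indicator (ball 0 r) x \<le> ?h j"
      using True j(2) by (auto intro!: ennreal_leI)
    also have "?h j \<le> suminf ?h" by (rule le_suminf_ennreal)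
    finally show ?thesis .
  qed auto
  then have "(\<integral>\<^sup>+x. ennreal (norm (x :: real ^ 'n) powr - \<gamma>) * indicator (ball 0 r) x \<partial>lborel)
      \<le> (\<integral>\<^sup>+x. (\<Sum>j. ennreal (?c * (r / 2 ^ j) powr - \<gamma>) * indicator (ball 0 (r / 2 ^ j)) x) \<partial>(lborel :: (real ^ 'n) measure))"
    by (intro nn_integral_mono)
  also have "\<dots> = (\<Sum>j. ennreal (?c * (r / 2 ^ j) powr - \<gamma>) * emeasure lborel (ball (0 :: real ^ 'n) (r / 2 ^ j)))"
    using nn_integral_suminf_indicator[where g = "\<lambda>_. 1" and M = "lborel :: (real ^ 'n) measure"
        and B = "\<lambda>j. ball 0 (r / 2 ^ j)"] by simp
  also have "\<dots> = (\<Sum>j. ennreal ((?c * unit_ball_vol n * r powr (n - \<gamma>)) * (2 powr (\<gamma> - n)) ^ j))"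
  proof (rule suminf_cong)
    fix j :: nat
    have "ennreal (?c * (r / 2 ^ j) powr - \<gamma>) * emeasure lborel (ball (0 :: real ^ 'n) (r / 2 ^ j))
      = ennreal (?c * (r / 2 ^ j) powr - \<gamma> * (unit_ball_vol n * (r / 2 ^ j) powr n))"
      using r by (simp add: emeasure_ball_powr n_def ennreal_mult)
    also have "?c * (r / 2 ^ j) powr - \<gamma> * (unit_ball_vol n * (r / 2 ^ j) powr n)
      = ?c * unit_ball_vol n * (r / 2 ^ j) powr (n - \<gamma>)"
      using r by (simp add: powr_add[symmetric])
    also have "(r / 2 ^ j) powr (n - \<gamma>) = r powr (n - \<gamma>) * (2 powr (\<gamma> - n)) ^ j"
    proof -
      have "(2 :: real) powr (\<gamma> - n) = inverse (2 powr (n - \<gamma>))" by (simp add: powr_minus[symmetric])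
      moreover have "(r / 2 ^ j) powr (n - \<gamma>) = r powr (n - \<gamma>) / (2 powr (n - \<gamma>)) ^ j"
        using r by (simp add: powr_divide powr_2_realpow_nat)
      ultimately show ?thesis by (simp add: divide_inverse power_inverse)
    qed
    finally show "ennreal (?c * (r / 2 ^ j) powr - \<gamma>) * emeasure lborel (ball (0 :: real ^ 'n) (r / 2 ^ j))
      = ennreal ((?c * unit_ball_vol n * r powr (n - \<gamma>)) * (2 powr (\<gamma> - n)) ^ j)"
      by (simp only: mult.assoc)
  qed
  also have "\<dots> = ennreal (?c * unit_ball_vol n * r powr (n - \<gamma>) / (1 - 2 powr (\<gamma> - n)))"
    using \<gamma> by (intro suminf_ennreal_geometric) (auto simp: powr_less_one n_def)
  finally show ?thesis by simp
qed

lemma nn_integral_reflect_translate: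
  fixes g :: "real ^ 'n \<Rightarrow> ennreal"
  assumes [measurable]: "g \<in> borel_measurable borel"
  shows "(\<integral>\<^sup>+y. g (x - y) \<partial>lborel) = (\<integral>\<^sup>+z. g z \<partial>lborel)"
  by (subst lborel_affine[of "-1" x]) (simp_all add: nn_integral_density nn_integral_distr)

section \<open>The energy\<close>

locale fractional_energy =
  fixes dim :: "'n::finite itself" and n s \<alpha> :: real
  assumes n_def: "n = real CARD('n)" and s: "0 < s" "s < 1" "2 * s < n"
    and \<alpha>: "0 \<le> \<alpha>" "2 * \<alpha> < n - 2 * s"
begin

definition kern :: "real ^ 'n \<Rightarrow> real ^ 'n \<Rightarrow> real" where
  "kern x y = 1 / (norm x powr \<alpha> * norm (x - y) powr (n + 2 * s) * norm y powr \<alpha>)"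

text \<open>Besides squared increments, \<open>F\<close> will be a product such as an excess at
  \<open>x\<close> times a deficiency at \<open>y\<close>. With \<open>lborel\<close> and Borel
  functions, joint measurability and Tonelli's theorem are at hand; \<open>D_norm_sq_eq\<close>
  leads back to \<open>lebesgue\<close>.\<close>

definition J :: "(real ^ 'n \<Rightarrow> real ^ 'n \<Rightarrow> real) \<Rightarrow> ennreal" where
  "J F = (\<integral>\<^sup>+x. (\<integral>\<^sup>+y. ennreal (F x y * kern x y) \<partial>lborel) \<partial>lborel)"

definition Q :: "(real ^ 'n \<Rightarrow> real) \<Rightarrow> ennreal" where
  "Q u = J (\<lambda>x y. (u x - u y)\<^sup>2)"

abbreviation pm :: "(real ^ 'n \<Rightarrow> real ^ 'n \<Rightarrow> real) \<Rightarrow> bool" where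
  "pm F \<equiv> (\<lambda>z. F (fst z) (snd z)) \<in> borel_measurable (borel \<Otimes>\<^sub>M borel)"

lemma D_norm_sq_eq: "D_norm_sq s \<alpha> u = Q u"
  by (simp add: D_norm_sq_def Q_def J_def kern_def nn_integral_completion n_def[symmetric])

lemma n_ge_1: "1 \<le> n" and n_pos: "0 < n"
proof -
  have "1 \<le> CARD('n)" using zero_less_card_finite by (simp add: Suc_le_eq)
  then show "1 \<le> n" "0 < n" unfolding n_def by linarith+
qed

lemma kern_nonneg: "0 \<le> kern x y"
  by (simp add: kern_def)

lemma kern_commute: "kern x y = kern y x"
  by (simp add: kern_def norm_minus_commute mult_ac)

lemma kern_measurable' [measurable (raw)]:
  assumes [measurable]: "f \<in> borel_measurable M" "g \<in> borel_measurable M"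
  shows "(\<lambda>x. kern (f x) (g x)) \<in> borel_measurable M"
  unfolding kern_def by measurable

lemma sets_lborel_pair: "sets (lborel \<Otimes>\<^sub>M lborel :: ((real ^ 'n) \<times> (real ^ 'n)) measure) = sets (borel \<Otimes>\<^sub>M borel)"
  by (intro sets_pair_measure_cong) auto

lemma pm_lborel: "pm F \<Longrightarrow> (\<lambda>z. F (fst z) (snd z)) \<in> borel_measurable (lborel \<Otimes>\<^sub>M lborel)"
  by (simp add: measurable_cong_sets[OF sets_lborel_pair refl])

lemma pm_swap: "pm F \<Longrightarrow> pm (\<lambda>x y. F y x)"
proof -
  assume F: "pm F"
  have "(\<lambda>z. (snd z, fst z)) \<in> borel \<Otimes>\<^sub>M borel \<rightarrow>\<^sub>M (borel \<Otimes>\<^sub>M borel :: ((real ^ 'n) \<times> (real ^ 'n)) measure)"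
    by measurable
  from measurable_compose[OF this F] show ?thesis by simp
qed

lemma nn_integral_pair:
  fixes F :: "real ^ 'n \<Rightarrow> real ^ 'n \<Rightarrow> ennreal"
  assumes F: "(\<lambda>z. F (fst z) (snd z)) \<in> borel_measurable (borel \<Otimes>\<^sub>M borel)"
  shows "(\<integral>\<^sup>+x. (\<integral>\<^sup>+y. F x y \<partial>lborel) \<partial>lborel) = (\<integral>\<^sup>+z. F (fst z) (snd z) \<partial>(lborel \<Otimes>\<^sub>M lborel))"
    and "(\<lambda>x. \<integral>\<^sup>+y. F x y \<partial>lborel) \<in> borel_measurable borel"
    and "(\<integral>\<^sup>+x. (\<integral>\<^sup>+y. F x y \<partial>lborel) \<partial>lborel) = (\<integral>\<^sup>+y. (\<integral>\<^sup>+x. F x y \<partial>lborel) \<partial>lborel)"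
proof -
  have F': "(\<lambda>z. F (fst z) (snd z)) \<in> borel_measurable (lborel \<Otimes>\<^sub>M lborel)"
    using F by (simp add: measurable_cong_sets[OF sets_lborel_pair refl])
  show "(\<integral>\<^sup>+x. (\<integral>\<^sup>+y. F x y \<partial>lborel) \<partial>lborel) = (\<integral>\<^sup>+z. F (fst z) (snd z) \<partial>(lborel \<Otimes>\<^sub>M lborel))"
    using lborel.nn_integral_fst[OF F'] by simp
  show "(\<lambda>x. \<integral>\<^sup>+y. F x y \<partial>lborel) \<in> borel_measurable borel"
    using lborel.borel_measurable_nn_integral_fst[OF F'] by simp
  show "(\<integral>\<^sup>+x. (\<integral>\<^sup>+y. F x y \<partial>lborel) \<partial>lborel) = (\<integral>\<^sup>+y. (\<integral>\<^sup>+x. F x y \<partial>lborel) \<partial>lborel)"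
    using lborel_pair.Fubini[OF F'] by simp
qed

lemma J_pair:
  assumes [measurable]: "pm F"
  shows "J F = (\<integral>\<^sup>+z. ennreal (F (fst z) (snd z) * kern (fst z) (snd z)) \<partial>(lborel \<Otimes>\<^sub>M lborel))"
  unfolding J_def by (rule nn_integral_pair(1)) measurable

lemma J_swap:
  assumes [measurable]: "pm F"
  shows "J (\<lambda>x y. F y x) = J F"
proof -
  have "J (\<lambda>x y. F y x) = (\<integral>\<^sup>+x. (\<integral>\<^sup>+y. ennreal (F y x * kern y x) \<partial>lborel) \<partial>lborel)"
    by (simp add: J_def kern_commute)
  also have "\<dots> = J F" unfolding J_def by (rule nn_integral_pair(3)[symmetric]) measurable
  finally show ?thesis .
qed

lemma J_mono: "(\<And>x y. F x y \<le> G x y) \<Longrightarrow> J F \<le> J G"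
  unfolding J_def by (intro nn_integral_mono ennreal_leI mult_right_mono kern_nonneg)

lemma J_add:
  assumes [measurable]: "pm F" "pm G" and "\<And>x y. 0 \<le> F x y" "\<And>x y. 0 \<le> G x y"
  shows "J (\<lambda>x y. F x y + G x y) = J F + J G"
  using assms(3,4) kern_nonneg
  by (simp add: J_pair distrib_right ennreal_plus[symmetric] nn_integral_add[symmetric] pm_lborel
      measurable_cong_sets[OF sets_lborel_pair refl] del: ennreal_plus)

lemma J_cmult:
  assumes [measurable]: "pm F" and "0 \<le> c"
  shows "J (\<lambda>x y. c * F x y) = ennreal c * J F"
  using assms(2)
  by (simp add: J_pair mult.assoc ennreal_mult' nn_integral_cmult
      measurable_cong_sets[OF sets_lborel_pair refl])

lemma Q_cmult: "u \<in> borel_measurable borel \<Longrightarrow> Q (\<lambda>x. c * u x) = ennreal (c\<^sup>2) * Q u"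
  unfolding Q_def
  by (subst J_cmult[symmetric]) (auto simp: power_mult_distrib[symmetric] algebra_simps)

lemma Q_parallelogram:
  assumes [measurable]: "u \<in> borel_measurable borel" "v \<in> borel_measurable borel"
  shows "Q (\<lambda>x. u x + v x) + Q (\<lambda>x. u x - v x) = 2 * Q u + 2 * Q v"
proof -
  have "Q (\<lambda>x. u x + v x) + Q (\<lambda>x. u x - v x)
    = J (\<lambda>x y. ((u x + v x) - (u y + v y))\<^sup>2 + ((u x - v x) - (u y - v y))\<^sup>2)"
    unfolding Q_def by (subst J_add) auto
  also have "\<dots> = J (\<lambda>x y. 2 * (u x - u y)\<^sup>2 + 2 * (v x - v y)\<^sup>2)"
    by (intro arg_cong[where f = J] ext) (simp add: power2_eq_square algebra_simps)
  also have "\<dots> = 2 * Q u + 2 * Q v"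
    unfolding Q_def by (subst J_add) (auto simp: J_cmult)
  finally show ?thesis .
qed

lemma Q_add_le:
  assumes [measurable]: "u \<in> borel_measurable borel" "v \<in> borel_measurable borel"
  shows "Q (\<lambda>x. u x + v x) \<le> 2 * Q u + 2 * Q v"
  by (subst Q_parallelogram[OF assms, symmetric]) simp

lemma Q_uminus_diff: "Q (\<lambda>x. v x - u x) = Q (\<lambda>x. u x - v x)"
  unfolding Q_def by (intro arg_cong[where f = J] ext) (simp add: power2_eq_square algebra_simps)

lemma Q_le_of_diff:
  assumes [measurable]: "u \<in> borel_measurable borel" "v \<in> borel_measurable borel"
  shows "Q u \<le> 2 * Q v + 2 * Q (\<lambda>x. u x - v x)"
  using Q_add_le[of v "\<lambda>x. u x - v x"] by simp

lemma Q_mono_Lipschitz: "(\<And>x y. \<bar>u x - u y\<bar> \<le> \<bar>v x - v y\<bar>) \<Longrightarrow> Q u \<le> Q v"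
  unfolding Q_def by (intro J_mono) (simp add: abs_le_square_iff)

lemma Q_liminf:
  assumes [measurable]: "\<And>k. v k \<in> borel_measurable borel"
    and lim: "AE x in lborel. (\<lambda>k. v k x) \<longlonglongrightarrow> w x"
  shows "Q w \<le> liminf (\<lambda>k. Q (v k))"
proof -
  let ?F = "\<lambda>k x y. ennreal ((v k x - v k y)\<^sup>2 * kern x y)"
  have "Q w \<le> (\<integral>\<^sup>+x. (\<integral>\<^sup>+y. liminf (\<lambda>k. ?F k x y) \<partial>lborel) \<partial>lborel)"
    unfolding Q_def J_def
  proof (rule nn_integral_mono_AE)
    show "AE x in lborel. (\<integral>\<^sup>+y. ennreal ((w x - w y)\<^sup>2 * kern x y) \<partial>lborel)
        \<le> (\<integral>\<^sup>+y. liminf (\<lambda>k. ?F k x y) \<partial>lborel)"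
      using lim
    proof eventually_elim
      case (elim x)
      note lx = elim
      show ?case
      proof (rule nn_integral_mono_AE)
        show "AE y in lborel. ennreal ((w x - w y)\<^sup>2 * kern x y) \<le> liminf (\<lambda>k. ?F k x y)"
          using lim
        proof eventually_elim
          case (elim y)
          have "(\<lambda>k. ?F k x y) \<longlonglongrightarrow> ennreal ((w x - w y)\<^sup>2 * kern x y)"
            by (intro tendsto_ennrealI tendsto_intros lx elim)
          then show ?case by (simp add: lim_imp_Liminf)
        qed
      qed
    qed
  qed
  also have "\<dots> \<le> (\<integral>\<^sup>+x. liminf (\<lambda>k. \<integral>\<^sup>+y. ?F k x y \<partial>lborel) \<partial>lborel)"
    by (intro nn_integral_mono nn_integral_liminf) measurable
  also have "\<dots> \<le> liminf (\<lambda>k. \<integral>\<^sup>+x. (\<integral>\<^sup>+y. ?F k x y \<partial>lborel) \<partial>lborel)"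
    by (rule nn_integral_liminf) measurable
  finally show ?thesis by (simp add: Q_def J_def)
qed

lemma Q_cong_AE:
  assumes [measurable]: "u \<in> borel_measurable borel" "AE x in lborel. u x = v x"
  shows "Q v = Q u"
  unfolding Q_def J_def
proof (rule nn_integral_cong_AE)
  show "AE x in lborel. (\<integral>\<^sup>+y. ennreal ((v x - v y)\<^sup>2 * kern x y) \<partial>lborel)
      = (\<integral>\<^sup>+y. ennreal ((u x - u y)\<^sup>2 * kern x y) \<partial>lborel)"
    using assms(2)
  proof eventually_elim
    case (elim x)
    then show ?case using assms(2) by (intro nn_integral_cong_AE) auto
  qed
qed

definition kern1 :: "real ^ 'n \<Rightarrow> real ^ 'n \<Rightarrow> real" where
  "kern1 x y = norm x powr (- 2 * \<alpha>) * norm (x - y) powr - (n + 2 * s)"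

lemma kern1_nonneg: "0 \<le> kern1 x y" by (simp add: kern1_def)

lemma kern1_measurable' [measurable (raw)]:
  assumes [measurable]: "f \<in> borel_measurable M" "g \<in> borel_measurable M"
  shows "(\<lambda>x. kern1 (f x) (g x)) \<in> borel_measurable M"
  unfolding kern1_def by measurable

text \<open>The inequality between arithmetic and geometric mean for the two weights. For fixed
  \<open>x\<close>, \<open>kern1\<close> depends on \<open>y\<close> only through
  \<open>x - y\<close>, so inner integrals become translation invariant.\<close>

lemma kern_le_kern1: "kern x y \<le> (kern1 x y + kern1 y x) / 2"
proof (cases "x = 0 \<or> y = 0")
  case True
  then show ?thesis using kern1_nonneg[of x y] kern1_nonneg[of y x] by (auto simp: kern_def)
next
  case False
  let ?a = "norm x powr - \<alpha>" and ?b = "norm y powr - \<alpha>" and ?c = "norm (x - y) powr - (n + 2 * s)"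
  have "2 * (?a * ?b) \<le> ?a\<^sup>2 + ?b\<^sup>2" using sum_squares_bound[of ?a ?b] by simp
  then have "?a * ?b * ?c \<le> (?a\<^sup>2 + ?b\<^sup>2) / 2 * ?c" by (intro mult_right_mono) auto
  moreover have "kern x y = ?a * ?b * ?c"
    by (simp only: kern_def powr_minus[of _ \<alpha>] powr_minus[of _ "n + 2 * s"]) (simp add: divide_inverse mult_ac)
  moreover have "?a\<^sup>2 = norm x powr (- 2 * \<alpha>)" "?b\<^sup>2 = norm y powr (- 2 * \<alpha>)"
    using False by (simp_all add: power2_eq_square powr_add[symmetric])
  ultimately show ?thesis
    by (simp add: kern1_def norm_minus_commute[of y x] ring_distribs)
qed

text \<open>As \<open>F\<close> is symmetric, Tonelli makes the two halves of
  \<open>kern_le_kern1\<close> contribute equally.\<close>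

lemma J_le_kern1:
  assumes [measurable]: "pm F" and F: "\<And>x y. 0 \<le> F x y" "\<And>x y. F x y = F y x"
  shows "J F \<le> (\<integral>\<^sup>+x. (\<integral>\<^sup>+y. ennreal (F x y * kern1 x y) \<partial>lborel) \<partial>lborel)"
proof -
  have sw [measurable]: "pm (\<lambda>x y. F y x)" using assms(1) by (rule pm_swap)
  let ?G = "\<lambda>x y. ennreal (1/2 * (F x y * kern1 x y))"
  have "J F \<le> (\<integral>\<^sup>+x. (\<integral>\<^sup>+y. ?G x y + ?G y x \<partial>lborel) \<partial>lborel)"
    unfolding J_def
  proof (intro nn_integral_mono)
    fix x y
    have "F x y * kern x y \<le> F x y * ((kern1 x y + kern1 y x) / 2)"
      by (intro mult_left_mono kern_le_kern1 F)
    also have "\<dots> = 1/2 * (F x y * kern1 x y) + 1/2 * (F y x * kern1 y x)"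
      using F(2)[of x y] by (simp add: field_simps)
    finally show "ennreal (F x y * kern x y) \<le> ?G x y + ?G y x"
      using F(1) kern1_nonneg by (subst ennreal_plus[symmetric]) (auto intro!: ennreal_leI simp del: ennreal_plus)
  qed
  also have "\<dots> = (\<integral>\<^sup>+z. ?G (fst z) (snd z) + ?G (snd z) (fst z) \<partial>(lborel \<Otimes>\<^sub>M lborel))"
    by (intro nn_integral_pair(1)) measurable
  also have "\<dots> = (\<integral>\<^sup>+z. ?G (fst z) (snd z) \<partial>(lborel \<Otimes>\<^sub>M lborel)) + (\<integral>\<^sup>+z. ?G (snd z) (fst z) \<partial>(lborel \<Otimes>\<^sub>M lborel))"
    by (intro nn_integral_add; subst measurable_cong_sets[OF sets_lborel_pair refl]; measurable)
  also have "(\<integral>\<^sup>+z. ?G (fst z) (snd z) \<partial>(lborel \<Otimes>\<^sub>M lborel)) = (\<integral>\<^sup>+x. (\<integral>\<^sup>+y. ?G x y \<partial>lborel) \<partial>lborel)"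
    by (rule nn_integral_pair(1)[symmetric]) measurable
  also have "(\<integral>\<^sup>+z. ?G (snd z) (fst z) \<partial>(lborel \<Otimes>\<^sub>M lborel)) = (\<integral>\<^sup>+x. (\<integral>\<^sup>+y. ?G y x \<partial>lborel) \<partial>lborel)"
    by (rule nn_integral_pair(1)[symmetric]) measurable
  also have "\<dots> = (\<integral>\<^sup>+x. (\<integral>\<^sup>+y. ?G x y \<partial>lborel) \<partial>lborel)"
    by (rule nn_integral_pair(3)[symmetric]) measurable
  also have "(\<integral>\<^sup>+x. (\<integral>\<^sup>+y. ?G x y \<partial>lborel) \<partial>lborel) + (\<integral>\<^sup>+x. (\<integral>\<^sup>+y. ?G x y \<partial>lborel) \<partial>lborel)
      = (\<integral>\<^sup>+z. ?G (fst z) (snd z) + ?G (fst z) (snd z) \<partial>(lborel \<Otimes>\<^sub>M lborel))"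
    by (subst nn_integral_add; (subst measurable_cong_sets[OF sets_lborel_pair refl])?; measurable?)
      (subst (1 2) nn_integral_pair(1), measurable)
  also have "\<dots> = (\<integral>\<^sup>+z. ennreal (F (fst z) (snd z) * kern1 (fst z) (snd z)) \<partial>(lborel \<Otimes>\<^sub>M lborel))"
    using F(1) kern1_nonneg
    by (intro nn_integral_cong, subst ennreal_plus[symmetric]) (auto simp del: ennreal_plus)
  also have "\<dots> = (\<integral>\<^sup>+x. (\<integral>\<^sup>+y. ennreal (F x y * kern1 x y) \<partial>lborel) \<partial>lborel)"
    by (rule nn_integral_pair(1)[symmetric]) measurable
  finally show ?thesis .
qed

end

lemma nn_integral_linear2_le:
  assumes [measurable]: "f \<in> borel_measurable M" "g \<in> borel_measurable M"
    and "(\<integral>\<^sup>+x. f x \<partial>M) \<le> ennreal a" "(\<integral>\<^sup>+x. g x \<partial>M) \<le> ennreal b"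
    and "0 \<le> a" "0 \<le> b" "0 \<le> c" "0 \<le> d"
  shows "(\<integral>\<^sup>+x. ennreal c * f x + ennreal d * g x \<partial>M) \<le> ennreal (c * a + d * b)"
proof -
  have "(\<integral>\<^sup>+x. ennreal c * f x + ennreal d * g x \<partial>M) = ennreal c * (\<integral>\<^sup>+x. f x \<partial>M) + ennreal d * (\<integral>\<^sup>+x. g x \<partial>M)"
    by (simp add: nn_integral_add nn_integral_cmult)
  also have "\<dots> \<le> ennreal c * ennreal a + ennreal d * ennreal b"
    using assms by (intro add_mono mult_left_mono) auto
  also have "\<dots> = ennreal (c * a + d * b)"
    using assms by (simp add: ennreal_mult)
  finally show ?thesis .
qed

section \<open>The scaling exponent and the energy of cut-off functions\<close>

context fractional_energy
begin

text \<open>The scaling exponent of the energy: passing from u(x) to u(x/r) multiplies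
  \<open>Q\<close> by r^\<kappa>.\<close>

definition \<kappa> :: real where "\<kappa> = n - 2 * s - 2 * \<alpha>"

lemma kappa_pos: "0 < \<kappa>"
  using \<alpha> by (simp add: \<kappa>_def)

lemma ex_ball_powr:
  assumes "\<gamma> < n"
  obtains C where "C > 0" "\<And>r. r > 0 \<Longrightarrow>
    (\<integral>\<^sup>+x. ennreal (norm (x :: real ^ 'n) powr - \<gamma>) * indicator (ball 0 r) x \<partial>lborel) \<le> ennreal (C * r powr (n - \<gamma>))"
proof -
  define C where "C = max 1 (2 powr \<gamma>) / (1 - 2 powr (\<gamma> - n)) * unit_ball_vol n"
  have "C > 0" unfolding C_def using assms n_pos
    by (intro mult_pos_pos divide_pos_pos unit_ball_vol_pos) (auto simp: powr_less_one)
  then show ?thesis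
    using nn_integral_ball_powr[where 'n = 'n and \<gamma> = \<gamma>] assms by (intro that[of C]) (auto simp: C_def n_def)
qed

lemma ex_tail_powr:
  assumes "0 < \<gamma>"
  obtains C where "C > 0" "\<And>r. r > 0 \<Longrightarrow>
    (\<integral>\<^sup>+x. ennreal (norm (x :: real ^ 'n) powr - (n + \<gamma>)) * indicator {x. r \<le> norm x} x \<partial>lborel) \<le> ennreal (C * r powr - \<gamma>)"
proof -
  define C where "C = 2 powr n / (1 - 2 powr - \<gamma>) * unit_ball_vol n"
  have "C > 0" unfolding C_def using assms n_pos
    by (intro mult_pos_pos divide_pos_pos unit_ball_vol_pos) (auto simp: powr_less_one)
  then show ?thesis
    using nn_integral_tail_powr[where 'n = 'n and \<gamma> = \<gamma>] assms by (intro that[of C]) (auto simp: C_def n_def)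
qed

lemma V_pos: "0 < unit_ball_vol n" using n_pos by (intro unit_ball_vol_pos) auto

lemma ball_measurable [measurable]: "ball (x :: real ^ 'n) r \<in> sets borel"
  by simp

lemma emeasure_ball_n: "0 \<le> r \<Longrightarrow> emeasure lborel (ball (x :: real ^ 'n) r) = ennreal (unit_ball_vol n * r powr n)"
  unfolding n_def by (rule emeasure_ball_powr)

text \<open>Inner integrals in \<open>y\<close> are estimated separately for |x| < 4r and |x| \<ge>
  4r. In the first case they are O(r^(-2s)) times |x|^(-2\<alpha>), integrable over the ball as
  2\<alpha> < n. In the second case only \<open>y\<close> in the ball of radius 2r contributes and
  |x - y| \<ge> |x|/2, so they are O(r^n) times |x|^(-n-2s-2\<alpha>). The constant depends on
  \<open>g\<close> only through \<open>L\<close>.\<close>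

lemma Q_cutoff_le:
  assumes L: "0 < L"
  obtains C where "C > 0" "\<And>r g. r > 0 \<Longrightarrow> g \<in> borel_measurable borel \<Longrightarrow> (\<And>x. \<bar>g x\<bar> \<le> 1) \<Longrightarrow>
    (\<And>x y. \<bar>g x - g y\<bar> \<le> L * norm (x - y) / r) \<Longrightarrow> (\<And>x. 2 * r \<le> norm x \<Longrightarrow> g x = 0) \<Longrightarrow>
    Q g \<le> ennreal (C * r powr \<kappa>)"
proof -
  obtain C1 where C1: "C1 > 0" "\<And>r. r > 0 \<Longrightarrow>
      (\<integral>\<^sup>+x. ennreal (norm (x :: real ^ 'n) powr - (n + 2 * s - 2)) * indicator (ball 0 r) x \<partial>lborel)
      \<le> ennreal (C1 * r powr (n - (n + 2 * s - 2)))"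
    using ex_ball_powr[of "n + 2 * s - 2"] s by auto
  obtain C2 where C2: "C2 > 0" "\<And>r. r > 0 \<Longrightarrow>
      (\<integral>\<^sup>+x. ennreal (norm (x :: real ^ 'n) powr - (n + 2 * s)) * indicator {x. r \<le> norm x} x \<partial>lborel)
      \<le> ennreal (C2 * r powr - (2 * s))"
    using ex_tail_powr[of "2 * s"] s by auto
  obtain C3 where C3: "C3 > 0" "\<And>r. r > 0 \<Longrightarrow>
      (\<integral>\<^sup>+x. ennreal (norm (x :: real ^ 'n) powr - (2 * \<alpha>)) * indicator (ball 0 r) x \<partial>lborel)
      \<le> ennreal (C3 * r powr (n - 2 * \<alpha>))"
    using ex_ball_powr[of "2 * \<alpha>"] s \<alpha> by auto
  obtain C4 where C4: "C4 > 0" "\<And>r. r > 0 \<Longrightarrow>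
      (\<integral>\<^sup>+x. ennreal (norm (x :: real ^ 'n) powr - (n + (2 * s + 2 * \<alpha>))) * indicator {x. r \<le> norm x} x \<partial>lborel)
      \<le> ennreal (C4 * r powr - (2 * s + 2 * \<alpha>))"
    using ex_tail_powr[of "2 * s + 2 * \<alpha>"] s \<alpha> by auto
  define A where "A = L\<^sup>2 * C1 + 4 * C2"
  define B where "B = 2 powr (n + 2 * s) * (unit_ball_vol n * 2 powr n)"
  have AB: "A > 0" "B > 0" using L C1 C2 V_pos by (auto simp: A_def B_def intro!: add_pos_pos)
  define C where "C = A * (C3 * 4 powr (n - 2 * \<alpha>)) + B * (C4 * 4 powr - (2 * s + 2 * \<alpha>))"
  have "C > 0" using AB C3 C4 by (auto simp: C_def intro!: add_pos_pos)
  moreover have "Q g \<le> ennreal (C * r powr \<kappa>)"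
    if r: "r > 0" and [measurable]: "g \<in> borel_measurable borel" and g1: "\<And>x. \<bar>g x\<bar> \<le> 1"
      and gL: "\<And>x y. \<bar>g x - g y\<bar> \<le> L * norm (x - y) / r" and g0: "\<And>x. 2 * r \<le> norm x \<Longrightarrow> g x = 0" for r g
  proof -
    have inner: "(\<integral>\<^sup>+y. ennreal ((g x - g y)\<^sup>2 * kern1 x y) \<partial>lborel) \<le>
        ennreal (A * r powr - (2 * s)) * (ennreal (norm x powr - (2 * \<alpha>)) * indicator (ball 0 (4 * r)) x) +
        ennreal (B * r powr n) * (ennreal (norm x powr - (n + (2 * s + 2 * \<alpha>))) * indicator {x. 4 * r \<le> norm x} x)" for x
    proof (cases "norm x < 4 * r")
      case True
      \<comment> \<open>A majorant of the squared increment times the translation-invariant kernel: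
        the Lipschitz bound for |z| < r, where s < 1 makes |z|^(2-n-2s) integrable, and the trivial
        bound 4 elsewhere.\<close>
      define h where "h z = ennreal (L\<^sup>2 / r\<^sup>2) * (ennreal (norm (z :: real ^ 'n) powr - (n + 2 * s - 2)) * indicator (ball 0 r) z)
        + ennreal 4 * (ennreal (norm z powr - (n + 2 * s)) * indicator {x. r \<le> norm x} z)" for z
      have [measurable]: "ball (0 :: real ^ 'n) r \<in> sets borel" by simp
      have [measurable]: "h \<in> borel_measurable borel" unfolding h_def by measurable
      have "ennreal ((g x - g y)\<^sup>2 * kern1 x y) \<le> ennreal (norm x powr - (2 * \<alpha>)) * h (x - y)" for y
      proof -
        have "ennreal ((g x - g y)\<^sup>2 * norm (x - y) powr - (n + 2 * s)) \<le> h (x - y)"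
        proof (cases "norm (x - y) < r")
          case True
          have "(g x - g y)\<^sup>2 * norm (x - y) powr - (n + 2 * s) \<le> (L * norm (x - y) / r)\<^sup>2 * norm (x - y) powr - (n + 2 * s)"
            using power_mono[OF gL[of x y] abs_ge_zero, of 2] by (intro mult_right_mono) auto
          also have "\<dots> = L\<^sup>2 / r\<^sup>2 * ((norm (x - y))\<^sup>2 * norm (x - y) powr - (n + 2 * s))"
            by (simp add: power_mult_distrib power_divide)
          also have "(norm (x - y))\<^sup>2 * norm (x - y) powr - (n + 2 * s) = norm (x - y) powr - (n + 2 * s - 2)"
          proof (cases "x = y")
            case False
            then have "(norm (x - y))\<^sup>2 = norm (x - y) powr 2" using False by (simp add: powr_numeral)
            show ?thesis unfolding \<open>(norm (x - y))\<^sup>2 = _\<close> powr_add[symmetric]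
              by (rule arg_cong) simp
          qed auto
          finally show ?thesis using True by (simp add: h_def ennreal_mult'[symmetric] ennreal_leI)
        next
          case False
          have "\<bar>g x - g y\<bar> \<le> 2" using g1[of x] g1[of y] by linarith
          then have "(g x - g y)\<^sup>2 \<le> 4" using abs_le_square_iff[of "g x - g y" 2] by simp
          then have "(g x - g y)\<^sup>2 * norm (x - y) powr - (n + 2 * s) \<le> 4 * norm (x - y) powr - (n + 2 * s)"
            by (intro mult_right_mono) auto
          then show ?thesis using False by (simp add: h_def ennreal_mult'[symmetric] ennreal_leI del: ennreal_numeral)
        qed
        then have "ennreal (norm x powr - (2 * \<alpha>)) * ennreal ((g x - g y)\<^sup>2 * norm (x - y) powr - (n + 2 * s))
          \<le> ennreal (norm x powr - (2 * \<alpha>)) * h (x - y)" by (rule mult_left_mono) simp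
        then show ?thesis by (simp add: kern1_def ennreal_mult'[symmetric] mult_ac)
      qed
      note le_h = this
      have "(\<integral>\<^sup>+z. h z \<partial>lborel) \<le> ennreal (L\<^sup>2 / r\<^sup>2 * (C1 * r powr (n - (n + 2 * s - 2))) + 4 * (C2 * r powr - (2 * s)))"
        unfolding h_def
        by (rule nn_integral_linear2_le, measurable, measurable)
          (use C1(1) C2(1) C1(2)[of r] C2(2)[of r] r in auto)
      also have "L\<^sup>2 / r\<^sup>2 * (C1 * r powr (n - (n + 2 * s - 2))) + 4 * (C2 * r powr - (2 * s)) = A * r powr - (2 * s)"
      proof -
        have r2: "r\<^sup>2 = r powr 2" using r by (simp add: powr_numeral)
        have eq: "r powr (n - (n + 2 * s - 2)) = r powr - (2 * s) * r\<^sup>2"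
          unfolding r2 powr_add[symmetric] by (rule arg_cong) simp
        show ?thesis unfolding eq using r by (simp add: A_def distrib_right)
      qed
      finally have int_h: "(\<integral>\<^sup>+z. h z \<partial>lborel) \<le> ennreal (A * r powr - (2 * s))" .
      from le_h have "(\<integral>\<^sup>+y. ennreal ((g x - g y)\<^sup>2 * kern1 x y) \<partial>lborel) \<le> (\<integral>\<^sup>+y. ennreal (norm x powr - (2 * \<alpha>)) * h (x - y) \<partial>lborel)"
        by (rule nn_integral_mono)
      also have "\<dots> = ennreal (norm x powr - (2 * \<alpha>)) * (\<integral>\<^sup>+z. h z \<partial>lborel)"
        by (simp add: nn_integral_cmult nn_integral_reflect_translate[of h])
      also have "\<dots> \<le> ennreal (norm x powr - (2 * \<alpha>)) * ennreal (A * r powr - (2 * s))"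
        by (intro mult_left_mono int_h) simp
      finally show ?thesis using True by (simp add: mult.commute)
    next
      case False
      have "ennreal ((g x - g y)\<^sup>2 * kern1 x y) \<le>
          ennreal (2 powr (n + 2 * s) * norm x powr - (n + (2 * s + 2 * \<alpha>))) * indicator (ball 0 (2 * r)) y" for y
      proof (cases "norm y < 2 * r")
        case True
        have gx: "g x = 0" using False r by (intro g0) auto
        have xy: "norm x / 2 \<le> norm (x - y)" using False True norm_triangle_ineq2[of x y] r by linarith
        have "(g x - g y)\<^sup>2 \<le> 1" using g1[of y] gx by (simp add: abs_square_le_1)
        then have "(g x - g y)\<^sup>2 * kern1 x y \<le> 1 * (norm x powr (- 2 * \<alpha>) * (norm x / 2) powr - (n + 2 * s))"
          unfolding kern1_def using xy False r s n_pos \<alpha>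
          by (intro mult_mono powr_mono2') auto
        also have "\<dots> = 2 powr (n + 2 * s) * norm x powr - (n + (2 * s + 2 * \<alpha>))"
        proof -
          have "(norm x / 2) powr - (n + 2 * s) = norm x powr - (n + 2 * s) * 2 powr (n + 2 * s)"
            by (simp only: powr_divide norm_ge_zero) (simp only: powr_minus divide_inverse inverse_inverse_eq)
          then show ?thesis using False r by (simp add: powr_add[symmetric] algebra_simps)
        qed
        finally show ?thesis using True by (simp add: ennreal_leI)
      next
        case F: False
        with False g0[of x] g0[of y] r show ?thesis by simp
      qed
      note le = this
      have "(\<integral>\<^sup>+y. ennreal ((g x - g y)\<^sup>2 * kern1 x y) \<partial>lborel) \<le>
        (\<integral>\<^sup>+y. ennreal (2 powr (n + 2 * s) * norm x powr - (n + (2 * s + 2 * \<alpha>))) * indicator (ball (0 :: real ^ 'n) (2 * r)) y \<partial>lborel)"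
        by (intro nn_integral_mono le)
      also have "\<dots> = ennreal (2 powr (n + 2 * s) * norm x powr - (n + (2 * s + 2 * \<alpha>))) * ennreal (unit_ball_vol n * (2 * r) powr n)"
        using r by (simp add: nn_integral_cmult_indicator emeasure_ball_n)
      also have "\<dots> = ennreal (B * r powr n) * ennreal (norm x powr - (n + (2 * s + 2 * \<alpha>)))"
        using V_pos r by (simp add: ennreal_mult'[symmetric] B_def powr_mult mult_ac)
      finally show ?thesis using False by simp
    qed
    have "Q g \<le> (\<integral>\<^sup>+x. (\<integral>\<^sup>+y. ennreal ((g x - g y)\<^sup>2 * kern1 x y) \<partial>lborel) \<partial>lborel)"
      unfolding Q_def by (rule J_le_kern1) (measurable, auto simp: power2_commute)
    also have "\<dots> \<le> (\<integral>\<^sup>+x. ennreal (A * r powr - (2 * s)) * (ennreal (norm (x :: real ^ 'n) powr - (2 * \<alpha>)) * indicator (ball 0 (4 * r)) x) +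
        ennreal (B * r powr n) * (ennreal (norm x powr - (n + (2 * s + 2 * \<alpha>))) * indicator {x. 4 * r \<le> norm x} x) \<partial>lborel)"
      by (intro nn_integral_mono inner)
    also have "\<dots> \<le> ennreal (A * r powr - (2 * s) * (C3 * (4 * r) powr (n - 2 * \<alpha>))
        + B * r powr n * (C4 * (4 * r) powr - (2 * s + 2 * \<alpha>)))"
      by (rule nn_integral_linear2_le, measurable, measurable)
        (use C3(1) C4(1) C3(2)[of "4 * r"] C4(2)[of "4 * r"] AB r in auto)
    also have "A * r powr - (2 * s) * (C3 * (4 * r) powr (n - 2 * \<alpha>))
        + B * r powr n * (C4 * (4 * r) powr - (2 * s + 2 * \<alpha>)) = C * r powr \<kappa>"
    proof -
      have "r powr - (2 * s) * r powr (n - 2 * \<alpha>) = r powr \<kappa>" "r powr n * r powr - (2 * s + 2 * \<alpha>) = r powr \<kappa>"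
        by (simp_all add: powr_add[symmetric] \<kappa>_def algebra_simps)
      note eq = this
      have "A * r powr - (2 * s) * (C3 * (4 * r) powr (n - 2 * \<alpha>)) + B * r powr n * (C4 * (4 * r) powr - (2 * s + 2 * \<alpha>))
        = A * (C3 * 4 powr (n - 2 * \<alpha>)) * (r powr - (2 * s) * r powr (n - 2 * \<alpha>)) +
          B * (C4 * 4 powr - (2 * s + 2 * \<alpha>)) * (r powr n * r powr - (2 * s + 2 * \<alpha>))"
        using r by (simp only: powr_mult) (simp only: mult_ac)
      then show ?thesis unfolding eq by (simp add: C_def distrib_right)
    qed
    finally show ?thesis .
  qed
  ultimately show ?thesis using that by blast
qed

lemma Q_plateau_le:
  obtains C where "C > 0" "\<And>r. r > 0 \<Longrightarrow> Q (plateau r) \<le> ennreal (C * r powr \<kappa>)"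
proof -
  obtain L where L: "L > 0" "\<And>r x y. r > 0 \<Longrightarrow> \<bar>plateau r x - plateau r (y :: real ^ 'n)\<bar> \<le> L * norm (x - y) / r"
    using plateau_Lipschitz[where 'n = 'n] by metis
  obtain C where C: "C > 0" "\<And>r g. r > 0 \<Longrightarrow> g \<in> borel_measurable borel \<Longrightarrow> (\<And>x. \<bar>g x\<bar> \<le> 1) \<Longrightarrow>
    (\<And>x y. \<bar>g x - g y\<bar> \<le> L * norm (x - y) / r) \<Longrightarrow> (\<And>x. 2 * r \<le> norm x \<Longrightarrow> g x = 0) \<Longrightarrow>
    Q g \<le> ennreal (C * r powr \<kappa>)" using Q_cutoff_le[OF L(1)] by metis
  have "Q (plateau r) \<le> ennreal (C * r powr \<kappa>)" if "r > 0" for r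
    using that
    by (intro C(2) L(2) test_functions_measurable plateau_test plateau_eq_0)
      (simp_all add: abs_of_nonneg plateau_bounds)
  with C(1) that show ?thesis by blast
qed

lemma Q_test_finite:
  assumes "f \<in> test_functions"
  shows "Q f < \<infinity>"
proof -
  obtain B where B: "B > 0" "\<And>x. \<bar>f x\<bar> \<le> B" using test_functions_bounded[OF assms] by metis
  obtain L where L: "L > 0" "\<And>x y. \<bar>f x - f y\<bar> \<le> L * norm (x - y)" using test_functions_Lipschitz[OF assms] by metis
  obtain R where R: "R > 0" "\<And>x. f x \<noteq> 0 \<Longrightarrow> norm x \<le> R" using test_functionsE[OF assms] by metis
  have [measurable]: "f \<in> borel_measurable borel" by (rule test_functions_measurable[OF assms])
  \<comment> \<open>The Lipschitz constant of \<open>f\<close> divided by \<open>B\<close>, measured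
    at the scale \<open>R\<close> of the support.\<close>
  have "L * R / B > 0" using L R B by simp
  then obtain C where C: "C > 0" "\<And>r g. r > 0 \<Longrightarrow> g \<in> borel_measurable borel \<Longrightarrow> (\<And>x. \<bar>g x\<bar> \<le> 1) \<Longrightarrow>
    (\<And>x y. \<bar>g x - g y\<bar> \<le> L * R / B * norm (x - y) / r) \<Longrightarrow> (\<And>x. 2 * r \<le> norm x \<Longrightarrow> g x = 0) \<Longrightarrow>
    Q g \<le> ennreal (C * r powr \<kappa>)" using Q_cutoff_le by metis
  have "Q (\<lambda>x. (1 / B) * f x) \<le> ennreal (C * R powr \<kappa>)"
  proof (rule C(2))
    show "\<bar>1 / B * f x - 1 / B * f y\<bar> \<le> L * R / B * norm (x - y) / R" for x y
    proof -
      have "\<bar>1 / B * f x - 1 / B * f y\<bar> = \<bar>f x - f y\<bar> / B"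
        using B by (simp add: diff_divide_distrib[symmetric] abs_divide)
      also have "\<dots> \<le> L * norm (x - y) / B" using L B by (intro divide_right_mono) auto
      finally show ?thesis using R by simp
    qed
    show "1 / B * f x = 0" if "2 * R \<le> norm x" for x
      using R(2)[of x] that R(1) by (cases "f x = 0") auto
  qed (use B R in \<open>auto simp: abs_mult\<close>)
  moreover have "Q f = ennreal (B\<^sup>2) * Q (\<lambda>x. (1 / B) * f x)"
    using B by (subst Q_cmult[symmetric]) auto
  ultimately show ?thesis
    by (metis ennreal_less_top ennreal_mult_less_top infinity_ennreal_def le_less_trans)
qed

end

section \<open>The energy space\<close>

text \<open>Stands in for the convex hull of the tail from \<open>m\<close> on: the parallelogram
  law only ever asks for midpoints.\<close>

inductive_set midpoint_hull :: "(nat \<Rightarrow> 'a \<Rightarrow> real) \<Rightarrow> nat \<Rightarrow> ('a \<Rightarrow> real) set" for w m where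
  base: "m \<le> k \<Longrightarrow> w k \<in> midpoint_hull w m"
| mid: "f \<in> midpoint_hull w m \<Longrightarrow> g \<in> midpoint_hull w m \<Longrightarrow> (\<lambda>x. 1/2 * (f x + g x)) \<in> midpoint_hull w m"

lemma midpoint_hull_antimono:
  assumes "f \<in> midpoint_hull w l" "m \<le> l" shows "f \<in> midpoint_hull w m"
  using assms(1)
proof (induction rule: midpoint_hull.induct)
  case (mid f g)
  then show ?case by (intro midpoint_hull.mid)
qed (use assms(2) in \<open>auto intro: midpoint_hull.base\<close>)

lemma midpoint_hull_close:
  assumes "f \<in> midpoint_hull w m" and "\<And>k. m \<le> k \<Longrightarrow> \<bar>w k x - a\<bar> \<le> e"
  shows "\<bar>f x - a\<bar> \<le> e"
  using assms(1)
proof (induction rule: midpoint_hull.induct)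
  case (mid f g)
  then show ?case unfolding abs_le_iff by (auto simp: field_simps)
qed (use assms(2) in auto)

context fractional_energy
begin

text \<open>The Borel counterpart of \<open>D_space\<close>. By \<open>D_space_eq_D\<close> each
  member of \<open>D_space\<close> agrees a.e. with one of \<open>D\<close>, so the analysis can
  stay with Borel functions.\<close>

definition D :: "(real ^ 'n \<Rightarrow> real) set" where
  "D = {u. u \<in> borel_measurable borel \<and>
     (\<exists>\<phi> :: nat \<Rightarrow> real ^ 'n \<Rightarrow> real. (\<forall>k. \<phi> k \<in> test_functions) \<and>
        (AE x in lborel. (\<lambda>k. \<phi> k x) \<longlonglongrightarrow> u x) \<and>
        (\<lambda>k. Q (\<lambda>x. \<phi> k x - u x)) \<longlonglongrightarrow> 0)}"

lemma D_measurable: "u \<in> D \<Longrightarrow> u \<in> borel_measurable borel"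
  by (simp add: D_def)

lemma D_space_eq_D:
  assumes "u \<in> D_space s \<alpha>"
  obtains v where "v \<in> D" "AE x in lborel. u x = v x"
proof -
  from assms obtain \<phi> where u: "u \<in> borel_measurable lebesgue" and \<phi>: "\<And>k. \<phi> k \<in> test_functions"
    "AE x in lebesgue. (\<lambda>k. \<phi> k x) \<longlonglongrightarrow> u x" "(\<lambda>k. D_norm_sq s \<alpha> (\<lambda>x. \<phi> k x - u x)) \<longlonglongrightarrow> 0"
    by (auto simp: D_space_def)
  obtain v where v [measurable]: "v \<in> borel_measurable borel" and uv: "AE x in lborel. u x = v x"
    using completion_ex_borel_measurable_real[OF u] by auto
  have [measurable]: "\<phi> k \<in> borel_measurable borel" for k by (rule test_functions_measurable[OF \<phi>(1)])
  have "AE x in lborel. (\<lambda>k. \<phi> k x) \<longlonglongrightarrow> u x" using \<phi>(2) by (simp add: AE_completion_iff)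
  with uv have "AE x in lborel. (\<lambda>k. \<phi> k x) \<longlonglongrightarrow> v x" by eventually_elim simp
  moreover have "Q (\<lambda>x. \<phi> k x - v x) = D_norm_sq s \<alpha> (\<lambda>x. \<phi> k x - u x)" for k
    unfolding D_norm_sq_eq
    by (rule Q_cong_AE[symmetric]) (measurable, use uv in eventually_elim, simp)
  ultimately have "v \<in> D" using \<phi> v by (auto simp: D_def intro!: exI[of _ \<phi>])
  with uv that show ?thesis by blast
qed

lemma D_imp_D_space:
  assumes "u \<in> D" shows "u \<in> D_space s \<alpha>"
proof -
  from assms obtain \<phi> where u [measurable]: "u \<in> borel_measurable borel" and \<phi>: "\<And>k. \<phi> k \<in> test_functions"
    "AE x in lborel. (\<lambda>k. \<phi> k x) \<longlonglongrightarrow> u x" "(\<lambda>k. Q (\<lambda>x. \<phi> k x - u x)) \<longlonglongrightarrow> 0"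
    by (auto simp: D_def)
  have "u \<in> borel_measurable lebesgue" by (rule measurable_completion) simp
  moreover have "AE x in lebesgue. (\<lambda>k. \<phi> k x) \<longlonglongrightarrow> u x" using \<phi>(2) by (rule AE_completion)
  ultimately show ?thesis using \<phi>(1,3) by (auto simp: D_space_def D_norm_sq_eq)
qed

lemma D_test: "f \<in> test_functions \<Longrightarrow> f \<in> D"
  unfolding D_def by (auto intro!: test_functions_measurable exI[of _ "\<lambda>_. f"] simp: Q_def J_def)

lemma D_approx:
  assumes "u \<in> D" and "0 < e"
  obtains \<phi> where "\<And>k. \<phi> k \<in> test_functions" "AE x in lborel. (\<lambda>k. \<phi> k x) \<longlonglongrightarrow> u x"
    "\<And>k. Q (\<phi> k) \<le> 2 * Q u + ennreal e"
proof -
  from assms obtain \<phi> where u [measurable]: "u \<in> borel_measurable borel" and \<phi>: "\<And>k. \<phi> k \<in> test_functions"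
    "AE x in lborel. (\<lambda>k. \<phi> k x) \<longlonglongrightarrow> u x" "(\<lambda>k. Q (\<lambda>x. \<phi> k x - u x)) \<longlonglongrightarrow> 0"
    by (auto simp: D_def)
  have [measurable]: "\<phi> k \<in> borel_measurable borel" for k by (rule test_functions_measurable[OF \<phi>(1)])
  have "eventually (\<lambda>k. Q (\<lambda>x. \<phi> k x - u x) < ennreal (e / 2)) sequentially"
    using order_tendstoD(2)[OF \<phi>(3)] \<open>0 < e\<close> by auto
  then obtain N where N: "\<And>k. N \<le> k \<Longrightarrow> Q (\<lambda>x. \<phi> k x - u x) < ennreal (e / 2)"
    by (auto simp: eventually_sequentially)
  show ?thesis
  proof (rule that[of "\<lambda>k. \<phi> (k + N)"])
    show "AE x in lborel. (\<lambda>k. \<phi> (k + N) x) \<longlonglongrightarrow> u x"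
      using \<phi>(2) by eventually_elim (rule LIMSEQ_ignore_initial_segment)
    fix k
    have "Q (\<phi> (k + N)) \<le> 2 * Q u + 2 * Q (\<lambda>x. \<phi> (k + N) x - u x)" by (rule Q_le_of_diff) auto
    also have "\<dots> \<le> 2 * Q u + 2 * ennreal (e / 2)"
      by (intro add_left_mono mult_left_mono less_imp_le[OF N]) auto
    also have "2 * ennreal (e / 2) = ennreal e"
      using \<open>0 < e\<close> by (subst ennreal_numeral[symmetric], subst ennreal_mult[symmetric]) auto
    finally show "Q (\<phi> (k + N)) \<le> 2 * Q u + ennreal e" .
  qed (rule \<phi>)
qed

lemma D_finite: assumes "u \<in> D" shows "Q u < \<infinity>"
proof -
  from assms obtain \<phi> where [measurable]: "u \<in> borel_measurable borel" and \<phi>: "\<And>k. \<phi> k \<in> test_functions"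
    "(\<lambda>k. Q (\<lambda>x. \<phi> k x - u x)) \<longlonglongrightarrow> 0"
    by (auto simp: D_def)
  have [measurable]: "\<phi> k \<in> borel_measurable borel" for k by (rule test_functions_measurable[OF \<phi>(1)])
  have "eventually (\<lambda>k. Q (\<lambda>x. \<phi> k x - u x) < 1) sequentially"
    using order_tendstoD(2)[OF \<phi>(2), of 1] by simp
  then obtain k where k: "Q (\<lambda>x. \<phi> k x - u x) < 1" by (auto simp: eventually_sequentially)
  have "Q u \<le> 2 * Q (\<phi> k) + 2 * Q (\<lambda>x. u x - \<phi> k x)" by (rule Q_le_of_diff) auto
  also have "Q (\<lambda>x. u x - \<phi> k x) = Q (\<lambda>x. \<phi> k x - u x)" by (rule Q_uminus_diff)
  also have "2 * Q (\<phi> k) + 2 * Q (\<lambda>x. \<phi> k x - u x) < \<infinity>"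
    using k Q_test_finite[OF \<phi>(1)] by (auto simp: ennreal_mult_less_top less_trans[OF k] ennreal_one_less_top)
  finally show ?thesis .
qed

lemma Q_parallelogram_real:
  assumes [measurable]: "u \<in> borel_measurable borel" "v \<in> borel_measurable borel"
    and "Q u < \<infinity>" "Q v < \<infinity>"
  shows "Q (\<lambda>x. 1/2 * (u x + v x)) < \<infinity>" "Q (\<lambda>x. u x - v x) < \<infinity>"
    "enn2real (Q (\<lambda>x. u x - v x)) = 2 * enn2real (Q u) + 2 * enn2real (Q v) - 4 * enn2real (Q (\<lambda>x. 1/2 * (u x + v x)))"
proof -
  have *: "Q (\<lambda>x. u x + v x) + Q (\<lambda>x. u x - v x) = 2 * Q u + 2 * Q v" by (rule Q_parallelogram) auto
  also have "\<dots> < \<infinity>" using assms(3,4) by (auto simp: ennreal_mult_less_top)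
  finally have fin: "Q (\<lambda>x. u x + v x) < \<infinity>" "Q (\<lambda>x. u x - v x) < \<infinity>" by auto
  have h: "Q (\<lambda>x. 1/2 * (u x + v x)) = ennreal (1/4) * Q (\<lambda>x. u x + v x)"
    by (subst Q_cmult) (auto simp: power2_eq_square)
  show "Q (\<lambda>x. 1/2 * (u x + v x)) < \<infinity>" unfolding h using fin by (auto simp: ennreal_mult_less_top)
  show "Q (\<lambda>x. u x - v x) < \<infinity>" by (rule fin)
  have "enn2real (Q (\<lambda>x. u x + v x)) + enn2real (Q (\<lambda>x. u x - v x)) = 2 * enn2real (Q u) + 2 * enn2real (Q v)"
    using arg_cong[OF *, of enn2real] fin assms(3,4)
    by (simp add: enn2real_plus ennreal_mult_less_top enn2real_mult)
  moreover have "enn2real (Q (\<lambda>x. 1/2 * (u x + v x))) = 1/4 * enn2real (Q (\<lambda>x. u x + v x))"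
    unfolding h by (simp add: enn2real_mult)
  ultimately show "enn2real (Q (\<lambda>x. u x - v x)) = 2 * enn2real (Q u) + 2 * enn2real (Q v) - 4 * enn2real (Q (\<lambda>x. 1/2 * (u x + v x)))"
    by simp
qed

text \<open>Energy balls are closed under a.e. convergence: near-minimisers of the energy in the midpoint
  hulls of the tails are a Cauchy sequence by the parallelogram law.\<close>

lemma D_closed_bounded:
  assumes \<phi>: "\<And>k. \<phi> k \<in> test_functions" and lim: "AE x in lborel. (\<lambda>k. \<phi> k x) \<longlonglongrightarrow> w x"
    and w [measurable]: "w \<in> borel_measurable borel" and le: "\<And>k. Q (\<phi> k) \<le> ennreal C"
  shows "w \<in> D"
proof -
  let ?S = "midpoint_hull \<phi>" and ?q = "\<lambda>f. enn2real (Q f)"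
  have S: "f \<in> test_functions \<and> Q f < \<infinity> \<and> ?q f \<le> max C 0" if "f \<in> ?S m" for f m
    using that
  proof (induction rule: midpoint_hull.induct)
    case (base k)
    have "?q (\<phi> k) \<le> max C 0"
      by (rule enn2real_leI) (use le[of k] in \<open>auto simp: max_def ennreal_neg\<close>)
    with \<phi>[of k] Q_test_finite show ?case by auto
  next
    case (mid f g)
    then have [measurable]: "f \<in> borel_measurable borel" "g \<in> borel_measurable borel"
      by (auto intro: test_functions_measurable)
    note p = Q_parallelogram_real[of f g]
    have "(\<lambda>x. 1/2 * (f x + g x)) \<in> test_functions"
      using mid by (intro test_functions_mult[where g = "\<lambda>_. 1/2"] test_functions_add C_order_const) auto
    moreover have "4 * ?q (\<lambda>x. 1/2 * (f x + g x)) \<le> 2 * ?q f + 2 * ?q g"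
      using p(3) mid enn2real_nonneg[of "Q (\<lambda>x. f x - g x)"] by auto
    ultimately show ?case using p(1) mid by auto
  qed
  define d where "d m = Inf (?q ` ?S m)" for m
  have ne: "?q ` ?S m \<noteq> {}" for m using midpoint_hull.base[of m m \<phi>] by auto
  have bb: "bdd_below (?q ` ?S m)" for m by (rule bdd_belowI[of _ 0]) auto
  have d_le: "d m \<le> ?q f" if "f \<in> ?S m" for f m
    unfolding d_def using that bb by (intro cInf_lower) auto
  have d_mono: "d m \<le> d l" if "m \<le> l" for m l
    unfolding d_def using that by (intro cInf_superset_mono ne bb image_mono) (auto intro: midpoint_hull_antimono)
  have d_bdd: "d m \<le> max C 0" for m
    using d_le[OF midpoint_hull.base[of m m]] S[OF midpoint_hull.base[of m m]] by force
  have "incseq d" using d_mono by (auto simp: incseq_def)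
  then obtain d' where d': "d \<longlonglongrightarrow> d'" using d_bdd by (metis incseq_convergent)
  have d_le': "d m \<le> d'" for m
    by (rule LIMSEQ_le_const[OF d']) (auto intro!: exI[of _ m] d_mono)
  define i where "i m = inverse (real (Suc m))" for m
  have i_pos: "0 < i m" for m by (simp add: i_def)
  have "\<exists>f\<in>?S m. ?q f < d m + i m" for m
    using cInf_lessD[OF ne, of m "d m + i m"] i_pos[of m] by (auto simp: d_def)
  then obtain v where v: "\<And>m. v m \<in> ?S m" "\<And>m. ?q (v m) < d m + i m" by metis
  have [measurable]: "v m \<in> borel_measurable borel" for m
    using S[OF v(1)] by (auto intro: test_functions_measurable)
  define e where "e m = 2 * (d' - d m) + 4 * i m" for m
  \<comment> \<open>The midpoint of \<open>v m\<close> and \<open>v l\<close> lies in the hull of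
    the tail from \<open>m\<close> on, so its energy is at least \<open>d m\<close>, while the two
    energies are below \<open>d m + i m\<close> and \<open>d' + i m\<close>. Inserted into the
    parallelogram law, this gives \<open>e m\<close>.\<close>
  have qv: "Q (\<lambda>x. v m x - v l x) \<le> ennreal (e m)" if "m \<le> l" for m l
  proof -
    have "v l \<in> ?S m" using v(1) that by (rule midpoint_hull_antimono)
    then have "d m \<le> ?q (\<lambda>x. 1/2 * (v m x + v l x))"
      using v(1) by (intro d_le midpoint_hull.mid)
    moreover have "i l \<le> i m" using that by (simp add: i_def)
    moreover note p = Q_parallelogram_real[of "v m" "v l"]
    have "?q (\<lambda>x. v m x - v l x) = 2 * ?q (v m) + 2 * ?q (v l) - 4 * ?q (\<lambda>x. 1/2 * (v m x + v l x))"
      using S[OF v(1)[of m]] S[OF v(1)[of l]] by (intro p) auto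
    moreover have "X \<le> 2 * (d' - dm) + 4 * im"
      if "dm \<le> M" "il \<le> im" "X = 2 * A + 2 * B - 4 * M" "A < dm + im" "B < dl + il" "dl \<le> d'"
      for X A B M dm dl im il :: real using that by argo
    ultimately have "?q (\<lambda>x. v m x - v l x) \<le> e m"
      using v(2)[of m] v(2)[of l] d_le'[of l] unfolding e_def by blast
    moreover have "Q (\<lambda>x. v m x - v l x) < \<infinity>"
      using S[OF v(1)[of m]] S[OF v(1)[of l]] by (intro p) auto
    ultimately have "?q (\<lambda>x. v m x - v l x) \<le> e m" "Q (\<lambda>x. v m x - v l x) < \<infinity>" by auto
    then show ?thesis by (metis enn2real_le infinity_ennreal_def top.not_eq_extremum ennreal_enn2real ennreal_leI)
  qed
  have limv: "AE x in lborel. (\<lambda>m. v m x) \<longlonglongrightarrow> w x"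
    using lim
  proof eventually_elim
    case (elim x)
    show ?case
    proof (rule LIMSEQ_I)
      fix r :: real assume "0 < r"
      then obtain N where N: "\<And>k. N \<le> k \<Longrightarrow> \<bar>\<phi> k x - w x\<bar> < r / 2"
        using LIMSEQ_D[OF elim, of "r / 2"] by auto
      have "\<bar>v m x - w x\<bar> < r" if "N \<le> m" for m
      proof -
        have "\<bar>v m x - w x\<bar> \<le> r / 2"
          by (rule midpoint_hull_close[OF v(1)]) (use N that in \<open>auto intro: less_imp_le\<close>)
        with \<open>0 < r\<close> show ?thesis by simp
      qed
      then show "\<exists>N. \<forall>m\<ge>N. norm (v m x - w x) < r" by auto
    qed
  qed
  \<comment> \<open>Fatou's lemma in \<open>l\<close> turns the Cauchy estimate into an estimate for
    the distance to \<open>w\<close>.\<close>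
  have "Q (\<lambda>x. v m x - w x) \<le> ennreal (e m)" for m
  proof -
    have "Q (\<lambda>x. v m x - w x) \<le> liminf (\<lambda>l. Q (\<lambda>x. v m x - v l x))"
      by (rule Q_liminf, measurable) (use limv in \<open>eventually_elim, intro tendsto_intros\<close>)
    also have "\<dots> \<le> liminf (\<lambda>l. ennreal (e m))"
      by (rule Liminf_mono) (auto simp: eventually_sequentially intro!: exI[of _ m] qv)
    finally show ?thesis by (simp add: Liminf_const)
  qed
  moreover have "e \<longlonglongrightarrow> 2 * (d' - d') + 4 * 0"
    unfolding e_def i_def by (intro tendsto_intros d' LIMSEQ_inverse_real_of_nat)
  then have e0: "(\<lambda>m. ennreal (e m)) \<longlonglongrightarrow> 0" using tendsto_ennrealI by fastforce
  ultimately have "(\<lambda>m. Q (\<lambda>x. v m x - w x)) \<longlonglongrightarrow> 0"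
    using tendsto_sandwich[OF _ _ tendsto_const e0, of "\<lambda>m. Q (\<lambda>x. v m x - w x)"] by simp
  with S[OF v(1)] limv w show ?thesis unfolding D_def by blast
qed

section \<open>Linear and lattice operations on the energy space\<close>

lemma D_energy_bound:
  assumes "u \<in> D" obtains C where "2 * Q u + ennreal 1 = ennreal C"
proof -
  have "2 * Q u + ennreal 1 < \<infinity>" using D_finite[OF assms] by (auto simp: ennreal_mult_less_top)
  then show ?thesis by (cases "2 * Q u + ennreal 1") (auto intro: that)
qed

text \<open>The pattern of the closure properties: transform the approximating test functions and
  apply \<open>D_closed_bounded\<close>. Only bounded energies and convergence a.e. have to be
  checked, not continuity of the operation in the energy norm, which for absolute values would be a
  much harder matter.\<close>

lemma D_cmult: assumes "u \<in> D" shows "(\<lambda>x. c * u x) \<in> D"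
proof -
  obtain \<phi> where \<phi>: "\<And>k. \<phi> k \<in> test_functions" "AE x in lborel. (\<lambda>k. \<phi> k x) \<longlonglongrightarrow> u x"
    "\<And>k. Q (\<phi> k) \<le> 2 * Q u + ennreal 1" using D_approx[OF assms, of 1] by auto
  obtain C where C: "2 * Q u + ennreal 1 = ennreal C" using D_energy_bound[OF assms] .
  have [measurable]: "u \<in> borel_measurable borel" using assms by (rule D_measurable)
  show ?thesis
  proof (rule D_closed_bounded[of "\<lambda>k x. c * \<phi> k x" _ "c\<^sup>2 * C"])
    show "Q (\<lambda>x. c * \<phi> k x) \<le> ennreal (c\<^sup>2 * C)" for k
      using \<phi>(3)[of k] unfolding C
      by (subst Q_cmult) (auto intro!: mult_left_mono simp: ennreal_mult' test_functions_measurable[OF \<phi>(1)])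
    show "AE x in lborel. (\<lambda>k. c * \<phi> k x) \<longlonglongrightarrow> c * u x"
      using \<phi>(2) by eventually_elim (intro tendsto_intros)
  qed (auto intro!: test_functions_mult C_order_const \<phi>)
qed

lemma D_add: assumes "u \<in> D" "v \<in> D" shows "(\<lambda>x. u x + v x) \<in> D"
proof -
  obtain \<phi> where \<phi>: "\<And>k. \<phi> k \<in> test_functions" "AE x in lborel. (\<lambda>k. \<phi> k x) \<longlonglongrightarrow> u x"
    "\<And>k. Q (\<phi> k) \<le> 2 * Q u + ennreal 1" using D_approx[OF assms(1), of 1] by auto
  obtain \<psi> where \<psi>: "\<And>k. \<psi> k \<in> test_functions" "AE x in lborel. (\<lambda>k. \<psi> k x) \<longlonglongrightarrow> v x"
    "\<And>k. Q (\<psi> k) \<le> 2 * Q v + ennreal 1" using D_approx[OF assms(2), of 1] by auto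
  obtain A where A: "2 * Q u + ennreal 1 = ennreal A" using D_energy_bound[OF assms(1)] .
  obtain B where B: "2 * Q v + ennreal 1 = ennreal B" using D_energy_bound[OF assms(2)] .
  have [measurable]: "u \<in> borel_measurable borel" "v \<in> borel_measurable borel" using assms by (auto intro: D_measurable)
  show ?thesis
  proof (rule D_closed_bounded[of "\<lambda>k x. \<phi> k x + \<psi> k x" _ "2 * max A 0 + 2 * max B 0"])
    fix k
    have "Q (\<lambda>x. \<phi> k x + \<psi> k x) \<le> 2 * Q (\<phi> k) + 2 * Q (\<psi> k)"
      by (rule Q_add_le[OF test_functions_measurable[OF \<phi>(1)] test_functions_measurable[OF \<psi>(1)]])
    also have "\<dots> \<le> 2 * ennreal (max A 0) + 2 * ennreal (max B 0)"
      using \<phi>(3)[of k] \<psi>(3)[of k] unfolding A B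
      by (intro add_mono mult_left_mono) (auto elim!: order_trans intro!: ennreal_leI)
    also have "\<dots> = ennreal (2 * max A 0 + 2 * max B 0)"
      by (simp add: ennreal_mult)
    finally show "Q (\<lambda>x. \<phi> k x + \<psi> k x) \<le> ennreal (2 * max A 0 + 2 * max B 0)" .
    show "AE x in lborel. (\<lambda>k. \<phi> k x + \<psi> k x) \<longlonglongrightarrow> u x + v x"
      using \<phi>(2) \<psi>(2) by eventually_elim (intro tendsto_intros)
  qed (auto intro!: test_functions_add \<phi> \<psi>)
qed

lemma D_diff: "u \<in> D \<Longrightarrow> v \<in> D \<Longrightarrow> (\<lambda>x. u x - v x) \<in> D"
  using D_add[OF _ D_cmult[of v "-1"], of u] by simp

lemma sqrt_smooth_abs_Lipschitz:
  fixes a b e :: real assumes "0 < e"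
  shows "\<bar>sqrt (a\<^sup>2 + e) - sqrt (b\<^sup>2 + e)\<bar> \<le> \<bar>a - b\<bar>"
proof -
  have "\<bar>norm (a, sqrt e) - norm (b, sqrt e)\<bar> \<le> norm ((a, sqrt e) - (b, sqrt e))"
    by (rule norm_triangle_ineq3)
  then show ?thesis using assms by (simp add: norm_Pair)
qed

text \<open>Subtracting |c| makes the result vanish where \<open>u\<close> does, as compact support
  of the approximants requires. The smooth substitute sqrt((y - c)^2 + e) of |y - c| is 1-Lipschitz,
  so it does not raise energies. Maxima and truncations are linear combinations of such
  functions.\<close>

lemma D_abs: assumes "u \<in> D" shows "(\<lambda>x. \<bar>u x - c\<bar> - \<bar>c\<bar>) \<in> D"
proof -
  obtain \<phi> where \<phi>: "\<And>k. \<phi> k \<in> test_functions" "AE x in lborel. (\<lambda>k. \<phi> k x) \<longlonglongrightarrow> u x"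
    "\<And>k. Q (\<phi> k) \<le> 2 * Q u + ennreal 1" using D_approx[OF assms, of 1] by auto
  obtain C where C: "2 * Q u + ennreal 1 = ennreal C" using D_energy_bound[OF assms] .
  have [measurable]: "u \<in> borel_measurable borel" using assms by (rule D_measurable)
  let ?e = "\<lambda>k. inverse (real (Suc k))"
  let ?g = "\<lambda>k y. sqrt ((y - c)\<^sup>2 + ?e k) - sqrt (c\<^sup>2 + ?e k)"
  show ?thesis
  proof (rule D_closed_bounded[of "\<lambda>k x. ?g k (\<phi> k x)" _ C])
    fix k
    have *: "C_order j (\<phi> k)" for j using \<phi>(1)[of k] by (rule test_functionsE)
    show "(\<lambda>x. ?g k (\<phi> k x)) \<in> test_functions"
      by (rule test_functions_compose[OF \<phi>(1)])
        (auto intro!: C_order_diff C_order_sqrt C_order_add C_order_power C_order_const * add_nonneg_pos)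
    have "Q (\<lambda>x. ?g k (\<phi> k x)) \<le> Q (\<phi> k)"
    proof (rule Q_mono_Lipschitz)
      fix x y
      show "\<bar>?g k (\<phi> k x) - ?g k (\<phi> k y)\<bar> \<le> \<bar>\<phi> k x - \<phi> k y\<bar>"
        using sqrt_smooth_abs_Lipschitz[of "?e k" "\<phi> k x - c" "\<phi> k y - c"] by simp
    qed
    with \<phi>(3)[of k] C show "Q (\<lambda>x. ?g k (\<phi> k x)) \<le> ennreal C" by simp
  next
    show "AE x in lborel. (\<lambda>k. ?g k (\<phi> k x)) \<longlonglongrightarrow> \<bar>u x - c\<bar> - \<bar>c\<bar>"
      using \<phi>(2)
    proof eventually_elim
      case (elim x)
      have "(\<lambda>k. ?g k (\<phi> k x)) \<longlonglongrightarrow> sqrt ((u x - c)\<^sup>2 + 0) - sqrt (c\<^sup>2 + 0)"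
        by (intro tendsto_intros elim LIMSEQ_inverse_real_of_nat)
      then show ?case by simp
    qed
  qed auto
qed

lemma D_abs0: "u \<in> D \<Longrightarrow> (\<lambda>x. \<bar>u x\<bar>) \<in> D"
  using D_abs[of u 0] by simp

lemma D_max: assumes "u \<in> D" "v \<in> D" shows "(\<lambda>x. max (u x) (v x)) \<in> D"
proof -
  have "(\<lambda>x. 1/2 * (u x + v x + \<bar>u x - v x\<bar>)) \<in> D"
    using assms by (intro D_cmult D_add D_abs0 D_diff)
  also have "(\<lambda>x. 1/2 * (u x + v x + \<bar>u x - v x\<bar>)) = (\<lambda>x. max (u x) (v x))"
    by (auto simp: max_def field_simps)
  finally show ?thesis .
qed

lemma D_min_const: assumes "u \<in> D" "0 \<le> t" shows "(\<lambda>x. min (u x) t) \<in> D"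
proof -
  have "(\<lambda>x. 1/2 * (u x - (\<bar>u x - t\<bar> - \<bar>t\<bar>))) \<in> D"
    using assms by (intro D_cmult D_diff D_abs)
  also have "(\<lambda>x. 1/2 * (u x - (\<bar>u x - t\<bar> - \<bar>t\<bar>))) = (\<lambda>x. min (u x) t)"
    using assms(2) by (auto simp: min_def field_simps)
  finally show ?thesis .
qed

end

section \<open>Hardy and Sobolev inequalities\<close>

text \<open>Finiteness of \<open>h\<close> matters, since infinity satisfies the first assumption.
  This is why the absorption in Hardy's inequality takes place for test functions first.\<close>

lemma ennreal_absorb_half:
  assumes "h \<le> ennreal (1/2) * h + ennreal c" "h < \<infinity>" "0 \<le> c"
  shows "h \<le> ennreal (2 * c)"
proof -
  obtain r where r: "h = ennreal r" "0 \<le> r" using assms(2) by (cases h) auto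
  have "ennreal (1/2) * ennreal r + ennreal c = ennreal (1/2 * r + c)"
    using r(2) assms(3) by (subst ennreal_mult[symmetric]) (auto simp del: ennreal_plus simp: ennreal_plus[symmetric])
  then have "ennreal r \<le> ennreal (1/2 * r + c)" using assms(1) unfolding r(1) by simp
  then have "r \<le> 1/2 * r + c" using r(2) assms(3) by (subst (asm) ennreal_le_iff) auto
  then have "r \<le> 2 * c" by simp
  then show ?thesis unfolding r(1) by (rule ennreal_leI)
qed

context fractional_energy
begin

lemma nn_integral_pair_add:
  fixes F1 F2 :: "real ^ 'n \<Rightarrow> real ^ 'n \<Rightarrow> ennreal"
  assumes F1: "(\<lambda>z. F1 (fst z) (snd z)) \<in> borel_measurable (borel \<Otimes>\<^sub>M borel)"
    and F2: "(\<lambda>z. F2 (fst z) (snd z)) \<in> borel_measurable (borel \<Otimes>\<^sub>M borel)"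
  shows "(\<integral>\<^sup>+x. (\<integral>\<^sup>+y. F1 x y + F2 x y \<partial>lborel) \<partial>lborel)
    = (\<integral>\<^sup>+x. (\<integral>\<^sup>+y. F1 x y \<partial>lborel) \<partial>lborel) + (\<integral>\<^sup>+x. (\<integral>\<^sup>+y. F2 x y \<partial>lborel) \<partial>lborel)"
proof -
  have "(\<lambda>z. F1 (fst z) (snd z) + F2 (fst z) (snd z)) \<in> borel_measurable (borel \<Otimes>\<^sub>M borel)"
    using F1 F2 by (rule borel_measurable_add)
  from nn_integral_pair(1)[OF this] show ?thesis
    unfolding nn_integral_pair(1)[OF F1] nn_integral_pair(1)[OF F2]
    using F1 F2 by (simp add: nn_integral_add measurable_cong_sets[OF sets_lborel_pair refl])
qed

definition wt :: "(real ^ 'n \<Rightarrow> real) \<Rightarrow> real ^ 'n \<Rightarrow> real" where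
  "wt u x = \<bar>u x\<bar> * norm x powr - \<alpha>"

definition H :: "(real ^ 'n \<Rightarrow> real) \<Rightarrow> ennreal" where
  "H u = (\<integral>\<^sup>+x. ennreal ((u x)\<^sup>2 * norm x powr - (2 * s + 2 * \<alpha>)) \<partial>lborel)"

definition q :: real where "q = 2 * n / (n - 2 * s)"

definition G1 :: "(real ^ 'n \<Rightarrow> real) \<Rightarrow> real ^ 'n \<Rightarrow> ennreal" where
  "G1 u x = (\<integral>\<^sup>+y. ennreal ((u x - u y)\<^sup>2 * kern x y) \<partial>lborel)"

text \<open>The energy density plus the density of the Hardy term. In \<open>hedberg\<close> the
  second summand takes over for radii so large, compared with |x|, that the weight is no longer
  comparable on the ball around \<open>x\<close>.\<close>

definition G :: "(real ^ 'n \<Rightarrow> real) \<Rightarrow> real ^ 'n \<Rightarrow> ennreal" where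
  "G u x = G1 u x + ennreal ((u x)\<^sup>2 * norm x powr - (2 * s + 2 * \<alpha>))"

lemma wt_nonneg [simp]: "0 \<le> wt u x" by (simp add: wt_def)

lemma wt_measurable [measurable (raw)]:
  assumes [measurable]: "u \<in> borel_measurable borel" shows "wt u \<in> borel_measurable borel"
  unfolding wt_def by measurable

lemma wt_power2: "(wt u x)\<^sup>2 = (u x)\<^sup>2 * norm x powr - (2 * \<alpha>)"
  by (simp add: wt_def power_mult_distrib power2_eq_square[of "_ powr _"] powr_add[symmetric])

lemma G1_measurable [measurable (raw)]:
  assumes [measurable]: "u \<in> borel_measurable borel" shows "G1 u \<in> borel_measurable borel"
  unfolding G1_def by (rule nn_integral_pair(2)) measurable

lemma G_measurable [measurable (raw)]:
  assumes [measurable]: "u \<in> borel_measurable borel" shows "G u \<in> borel_measurable borel"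
  unfolding G_def by measurable

lemma nn_integral_G:
  assumes [measurable]: "u \<in> borel_measurable borel" shows "(\<integral>\<^sup>+x. G u x \<partial>lborel) = Q u + H u"
  unfolding G_def H_def by (subst nn_integral_add) (auto simp: Q_def J_def G1_def[symmetric])

lemma q_gt_2: "2 < q" and q_pos: "0 < q" and half_q: "q / 2 = n / (n - 2 * s)"
  using s n_pos by (auto simp: q_def field_simps)

text \<open>Passes integral bounds from test functions to \<open>D\<close>: the approximants have
  energy at most 2 Q u + E \<le> 3 E. Absorption arguments that presuppose finite integrals can thus
  be carried out on test functions.\<close>

lemma Fatou_D:
  assumes "u \<in> D" and Qu: "Q u \<le> ennreal E" and "0 < E"
    and F: "\<And>t x. 0 \<le> F t x" "\<And>x. continuous_on UNIV (\<lambda>t. F t x)" "\<And>v. v \<in> borel_measurable borel \<Longrightarrow> (\<lambda>x. F (v x) x) \<in> borel_measurable borel"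
    and test: "\<And>\<phi>. \<phi> \<in> test_functions \<Longrightarrow> Q \<phi> \<le> ennreal (3 * E) \<Longrightarrow> (\<integral>\<^sup>+x. ennreal (F (\<phi> x) x) \<partial>lborel) \<le> c"
  shows "(\<integral>\<^sup>+x. ennreal (F (u x) x) \<partial>(lborel :: (real ^ 'n) measure)) \<le> c"
proof -
  obtain \<phi> where \<phi>: "\<And>k. \<phi> k \<in> test_functions" "AE x in lborel. (\<lambda>k. \<phi> k x) \<longlonglongrightarrow> u x"
    "\<And>k. Q (\<phi> k) \<le> 2 * Q u + ennreal E" using D_approx[OF assms(1,3)] by auto
  have Q\<phi>: "Q (\<phi> k) \<le> ennreal (3 * E)" for k
  proof -
    have "Q (\<phi> k) \<le> 2 * ennreal E + ennreal E"
      by (rule order_trans[OF \<phi>(3)]) (intro add_mono mult_left_mono Qu; simp)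
    also have "\<dots> = ennreal (2 * E) + ennreal E" using \<open>0 < E\<close> by (simp add: ennreal_mult)
    also have "\<dots> = ennreal (3 * E)" using \<open>0 < E\<close> by (subst ennreal_plus[symmetric]) auto
    finally show ?thesis .
  qed
  have "(\<integral>\<^sup>+x. ennreal (F (u x) x) \<partial>lborel) \<le> (\<integral>\<^sup>+x. liminf (\<lambda>k. ennreal (F (\<phi> k x) x)) \<partial>lborel)"
  proof (rule nn_integral_mono_AE)
    show "AE x in lborel. ennreal (F (u x) x) \<le> liminf (\<lambda>k. ennreal (F (\<phi> k x) x))"
      using \<phi>(2)
    proof eventually_elim
      case (elim x)
      have "(\<lambda>k. F (\<phi> k x) x) \<longlonglongrightarrow> F (u x) x"
        using F(2)[of x] elim by (simp add: continuous_on_def tendsto_compose[of "\<lambda>t. F t x"] continuous_on_tendsto_compose)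
      then have "(\<lambda>k. ennreal (F (\<phi> k x) x)) \<longlonglongrightarrow> ennreal (F (u x) x)" by (rule tendsto_ennrealI)
      then show ?case by (simp add: lim_imp_Liminf)
    qed
  qed
  also have "\<dots> \<le> liminf (\<lambda>k. \<integral>\<^sup>+x. ennreal (F (\<phi> k x) x) \<partial>lborel)"
    using F(3)[OF test_functions_measurable[OF \<phi>(1)]] by (intro nn_integral_liminf) auto
  also have "\<dots> \<le> liminf (\<lambda>k. c)"
    by (intro Liminf_mono always_eventually allI test \<phi> Q\<phi>)
  finally show ?thesis by (simp add: Liminf_const)
qed

lemma test_weighted_finite:
  fixes \<phi> :: "real ^ 'n \<Rightarrow> real"
  assumes "\<phi> \<in> test_functions" "\<gamma> < n" "0 < p"
  shows "(\<integral>\<^sup>+x. ennreal (\<bar>\<phi> x\<bar> powr p * norm x powr - \<gamma>) \<partial>lborel) < \<infinity>"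
proof -
  obtain B where B: "B > 0" "\<And>x. \<bar>\<phi> x\<bar> \<le> B" using test_functions_bounded[OF assms(1)] by metis
  obtain R where R: "R > 0" "\<And>x. \<phi> x \<noteq> 0 \<Longrightarrow> norm x \<le> R" using test_functionsE[OF assms(1)] by metis
  obtain C where C: "C > 0" "\<And>r. r > 0 \<Longrightarrow>
    (\<integral>\<^sup>+x. ennreal (norm (x :: real ^ 'n) powr - \<gamma>) * indicator (ball 0 r) x \<partial>lborel) \<le> ennreal (C * r powr (n - \<gamma>))"
    using ex_ball_powr[OF assms(2)] by metis
  have "(\<integral>\<^sup>+x. ennreal (\<bar>\<phi> x\<bar> powr p * norm x powr - \<gamma>) \<partial>lborel)
    \<le> (\<integral>\<^sup>+x. ennreal (B powr p) * (ennreal (norm (x :: real ^ 'n) powr - \<gamma>) * indicator (ball 0 (R + 1)) x) \<partial>lborel)"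
  proof (intro nn_integral_mono)
    fix x
    show "ennreal (\<bar>\<phi> x\<bar> powr p * norm x powr - \<gamma>) \<le> ennreal (B powr p) * (ennreal (norm x powr - \<gamma>) * indicator (ball 0 (R + 1)) x)"
    proof (cases "\<phi> x = 0")
      case False
      then have "norm x < R + 1" using R(2)[of x] by simp
      moreover have "\<bar>\<phi> x\<bar> powr p * norm x powr - \<gamma> \<le> B powr p * norm x powr - \<gamma>"
        using B assms(3) by (intro mult_right_mono powr_mono2) auto
      ultimately show ?thesis by (simp add: ennreal_mult'[symmetric] ennreal_leI)
    qed auto
  qed
  also have "\<dots> = ennreal (B powr p) * (\<integral>\<^sup>+x. ennreal (norm (x :: real ^ 'n) powr - \<gamma>) * indicator (ball 0 (R + 1)) x \<partial>lborel)"
    by (rule nn_integral_cmult) measurable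
  also have "\<dots> < \<infinity>"
    using C(2)[of "R + 1"] R(1) by (auto simp: ennreal_mult_less_top intro: le_less_trans)
  finally show ?thesis .
qed

lemma nn_integral_ball_const:
  "0 \<le> r \<Longrightarrow> 0 \<le> b \<Longrightarrow>
    (\<integral>\<^sup>+x. ennreal b * indicator (ball (z :: real ^ 'n) r) x \<partial>lborel) = ennreal (b * (unit_ball_vol n * r powr n))"
  using V_pos by (simp add: nn_integral_cmult_indicator emeasure_ball_n ennreal_mult)

text \<open>Compare \<open>x\<close> with the annulus of radius \<open>K * norm x\<close>; for large \<open>K\<close> the resulting zero-order term
  is absorbed.\<close>

lemma Hardy_test:
  obtains C where "C > 0" "\<And>\<phi>. \<phi> \<in> test_functions \<Longrightarrow> H \<phi> \<le> ennreal C * Q \<phi>"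
proof -
  let ?\<gamma> = "2 * s + 2 * \<alpha>" and ?V = "unit_ball_vol n"
  define c1 where "c1 = ?V * (2 powr n - 1)"
  have c1: "c1 > 0" using V_pos n_pos by (simp add: c1_def)
  define A where "A = 2 * 2 powr (?\<gamma> + 2 * n) * ?V / c1"
  have A: "A > 0" using c1 V_pos by (simp add: A_def)
  \<comment> \<open>The zero-order term will come back with the factor
    \<open>A * K powr - \<kappa>\<close>; \<kappa> > 0 allows it to be pushed down to 1/2.\<close>
  define K where "K = max 2 ((2 * A) powr (1 / \<kappa>))"
  have K: "2 \<le> K" by (simp add: K_def)
  have AK: "A * K powr - \<kappa> \<le> 1 / 2"
  proof -
    have "2 * A = ((2 * A) powr (1 / \<kappa>)) powr \<kappa>" using A kappa_pos by (simp add: powr_powr)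
    also have "\<dots> \<le> K powr \<kappa>" using kappa_pos by (intro powr_mono2) (auto simp: K_def)
    finally show ?thesis using K by (simp add: powr_minus field_simps)
  qed
  \<comment> \<open>Normalises the average: the annulus around the origin belonging to
    \<open>x\<close> has volume c1 K^n |x|^n, so \<open>a\<close> |x|^(-n-\<gamma>) times this
    volume is the Hardy weight |x|^(-\<gamma>).\<close>
  define a where "a = 1 / (c1 * K powr n)"
  have a: "a > 0" using c1 K by (simp add: a_def)
  define CK where "CK = (3 * K) powr (n + 2 * s) * (2 * K) powr \<alpha>"
  have CK: "CK > 0" using K by (simp add: CK_def)
  define E where "E x y \<longleftrightarrow> K * norm x \<le> norm y \<and> norm y < 2 * K * norm x" for x y :: "real ^ 'n"
  have E_kern: "norm x powr - (n + ?\<gamma>) \<le> CK * kern x y" if "E x y" for x y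
  proof -
    have x: "x \<noteq> 0" using that by (auto simp: E_def)
    have "norm x < norm y" using that K mult_right_mono[of 2 K "norm x"] x unfolding E_def
      by (metis less_le_trans mult_2 less_add_same_cancel1 zero_less_norm_iff norm_ge_zero order_trans)
    then have xy: "norm (x - y) > 0" "norm y > 0" by auto
    have "norm x \<le> K * norm x" using K by (simp add: mult_le_cancel_right1)
    have "norm (x - y) \<le> norm x + norm y" by (rule norm_triangle_ineq4)
    also have "\<dots> \<le> 3 * K * norm x" using that \<open>norm x \<le> K * norm x\<close> by (auto simp: E_def)
    finally have d: "norm (x - y) powr (n + 2 * s) \<le> (3 * K * norm x) powr (n + 2 * s)"
      using n_pos s by (intro powr_mono2) auto
    have e: "norm y powr \<alpha> \<le> (2 * K * norm x) powr \<alpha>" using that \<alpha> by (intro powr_mono2) (auto simp: E_def)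
    have "norm x powr \<alpha> * norm (x - y) powr (n + 2 * s) * norm y powr \<alpha>
      \<le> norm x powr \<alpha> * (3 * K * norm x) powr (n + 2 * s) * (2 * K * norm x) powr \<alpha>"
      by (intro mult_mono d e) auto
    also have "\<dots> = CK * (norm x powr \<alpha> * norm x powr (n + 2 * s) * norm x powr \<alpha>)"
      using K by (simp add: CK_def powr_mult)
    also have "norm x powr \<alpha> * norm x powr (n + 2 * s) * norm x powr \<alpha> = norm x powr (n + ?\<gamma>)"
      using x by (simp add: powr_add[symmetric] algebra_simps)
    finally have "1 / (CK * norm x powr (n + ?\<gamma>)) \<le> kern x y"
      unfolding kern_def using x xy by (intro divide_left_mono mult_pos_pos CK) auto
    moreover have "norm x powr - (n + ?\<gamma>) = CK * (1 / (CK * norm x powr (n + ?\<gamma>)))"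
      using CK by (simp only: powr_minus) (simp add: field_simps)
    ultimately show ?thesis using CK mult_left_mono by (metis less_imp_le)
  qed
  have E_vol: "(\<integral>\<^sup>+y. (if E x y then 1 else 0) \<partial>lborel) = ennreal (c1 * (K * norm x) powr n)" if "x \<noteq> 0" for x
  proof -
    have "(\<integral>\<^sup>+y. (if E x y then 1 else 0) \<partial>lborel) = (\<integral>\<^sup>+y. indicator (ball 0 (2 * K * norm x) - ball 0 (K * norm x)) y \<partial>(lborel :: (real ^ 'n) measure))"
      by (intro nn_integral_cong) (auto simp: E_def indicator_def)
    also have "\<dots> = emeasure lborel (ball 0 (2 * K * norm x) - ball (0 :: real ^ 'n) (K * norm x))" by simp
    also have "\<dots> = emeasure lborel (ball (0 :: real ^ 'n) (2 * K * norm x)) - emeasure lborel (ball (0 :: real ^ 'n) (K * norm x))"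
    proof (rule emeasure_Diff)
      have "K * norm x \<le> 2 * K * norm x" using K by (intro mult_right_mono) auto
      then show "ball 0 (K * norm x) \<subseteq> ball (0 :: real ^ 'n) (2 * K * norm x)" by auto
    qed (use K in \<open>auto simp: emeasure_ball_n\<close>)
    also have "\<dots> = ennreal (?V * (2 * K * norm x) powr n - ?V * (K * norm x) powr n)"
      using K V_pos by (simp add: emeasure_ball_n ennreal_minus)
    also have "?V * (2 * K * norm x) powr n - ?V * (K * norm x) powr n = c1 * (K * norm x) powr n"
      using K by (simp add: c1_def powr_mult algebra_simps)
    finally show ?thesis .
  qed
  have "H \<phi> \<le> ennreal (2 * (2 * a * CK)) * Q \<phi>" if test: "\<phi> \<in> test_functions" for \<phi>
  proof -
    have [measurable]: "\<phi> \<in> borel_measurable borel" by (rule test_functions_measurable[OF test])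
    have Efn: "(\<lambda>z. if E (fst z) (snd z) then f z else 0) \<in> borel_measurable (borel \<Otimes>\<^sub>M borel)"
      if [measurable]: "f \<in> borel_measurable (borel \<Otimes>\<^sub>M borel)" for f :: "(real ^ 'n) \<times> (real ^ 'n) \<Rightarrow> real"
      unfolding E_def by measurable
    let ?F = "\<lambda>x y. if E x y then 2 * a * norm x powr - (n + ?\<gamma>) * (\<phi> y)\<^sup>2 else 0"
    let ?F2 = "\<lambda>x y. 2 * a * CK * ((\<phi> x - \<phi> y)\<^sup>2 * kern x y)"
    have F [measurable]: "pm ?F" by (rule Efn) measurable
    have F2 [measurable]: "pm ?F2" by measurable
    have "H \<phi> \<le> (\<integral>\<^sup>+x. (\<integral>\<^sup>+y. ennreal (?F x y) + ennreal (?F2 x y) \<partial>lborel) \<partial>lborel)"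
      unfolding H_def
    proof (rule nn_integral_mono)
      fix x
      show "ennreal ((\<phi> x)\<^sup>2 * norm x powr - ?\<gamma>) \<le> (\<integral>\<^sup>+y. ennreal (?F x y) + ennreal (?F2 x y) \<partial>lborel)"
      proof (cases "x = 0")
        case False
        have "ennreal ((\<phi> x)\<^sup>2 * norm x powr - ?\<gamma>) = ennreal (a * norm x powr - (n + ?\<gamma>) * (\<phi> x)\<^sup>2) * ennreal (c1 * (K * norm x) powr n)"
        proof -
          have "a * norm x powr - (n + ?\<gamma>) * (\<phi> x)\<^sup>2 * (c1 * (K * norm x) powr n)
            = (\<phi> x)\<^sup>2 * (norm x powr - (n + ?\<gamma>) * norm x powr n)"
            using c1 K by (simp add: a_def powr_mult)
          also have "norm x powr - (n + ?\<gamma>) * norm x powr n = norm x powr - ?\<gamma>"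
            by (simp add: powr_add[symmetric])
          finally have eq: "a * norm x powr - (n + ?\<gamma>) * (\<phi> x)\<^sup>2 * (c1 * (K * norm x) powr n) = (\<phi> x)\<^sup>2 * norm x powr - ?\<gamma>" .
          show ?thesis unfolding eq[symmetric] by (rule ennreal_mult) (use a c1 in auto)
        qed
        also have "\<dots> = ennreal (a * norm x powr - (n + ?\<gamma>) * (\<phi> x)\<^sup>2) * (\<integral>\<^sup>+y. (if E x y then 1 else 0) \<partial>lborel)"
          using E_vol[OF False] by simp
        also have "\<dots> = (\<integral>\<^sup>+y. ennreal (a * norm x powr - (n + ?\<gamma>) * (\<phi> x)\<^sup>2) * (if E x y then 1 else 0) \<partial>lborel)"
          unfolding E_def by (rule nn_integral_cmult[symmetric]) measurable
        also have "\<dots> \<le> (\<integral>\<^sup>+y. ennreal (?F x y) + ennreal (?F2 x y) \<partial>lborel)"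
        proof (rule nn_integral_mono)
          fix y
          show "ennreal (a * norm x powr - (n + ?\<gamma>) * (\<phi> x)\<^sup>2) * (if E x y then 1 else 0) \<le> ennreal (?F x y) + ennreal (?F2 x y)"
          proof (cases "E x y")
            case True
            have "(\<phi> x)\<^sup>2 \<le> 2 * (\<phi> y)\<^sup>2 + 2 * (\<phi> x - \<phi> y)\<^sup>2"
              using zero_le_power2[of "\<phi> x - 2 * \<phi> y"] by (simp add: power2_eq_square algebra_simps)
            then have "a * norm x powr - (n + ?\<gamma>) * (\<phi> x)\<^sup>2 \<le> a * norm x powr - (n + ?\<gamma>) * (2 * (\<phi> y)\<^sup>2 + 2 * (\<phi> x - \<phi> y)\<^sup>2)"
              using a by (intro mult_left_mono) auto
            also have "\<dots> = ?F x y + 2 * a * (\<phi> x - \<phi> y)\<^sup>2 * norm x powr - (n + ?\<gamma>)"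
              using True by (simp add: algebra_simps)
            also have "2 * a * (\<phi> x - \<phi> y)\<^sup>2 * norm x powr - (n + ?\<gamma>) \<le> 2 * a * (\<phi> x - \<phi> y)\<^sup>2 * (CK * kern x y)"
              using a by (intro mult_left_mono E_kern True) auto
            finally have "a * norm x powr - (n + ?\<gamma>) * (\<phi> x)\<^sup>2 \<le> ?F x y + ?F2 x y"
              by (simp add: mult_ac)
            then show ?thesis using True a CK kern_nonneg[of x y]
              by (subst ennreal_plus[symmetric]) (auto intro!: ennreal_leI simp del: ennreal_plus)
          qed auto
        qed
        finally show ?thesis .
      qed (use s \<alpha> in auto)
    qed
    also have "\<dots> = (\<integral>\<^sup>+x. (\<integral>\<^sup>+y. ennreal (?F x y) \<partial>lborel) \<partial>lborel) + (\<integral>\<^sup>+x. (\<integral>\<^sup>+y. ennreal (?F2 x y) \<partial>lborel) \<partial>lborel)"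
      by (rule nn_integral_pair_add) measurable
    also have "(\<integral>\<^sup>+x. (\<integral>\<^sup>+y. ennreal (?F2 x y) \<partial>lborel) \<partial>lborel) = ennreal (2 * a * CK) * Q \<phi>"
      using a CK by (simp add: Q_def J_cmult[symmetric]) (simp add: J_def mult.assoc)
    \<comment> \<open>The term with \<open>\<phi> y\<close> is integrated in \<open>x\<close> first.
      For given \<open>y\<close> all relevant \<open>x\<close> lie in a ball of radius 2|y|/K and
      satisfy |x| \<ge> |y|/(2K), which yields the factor K^(-\<kappa>).\<close>
    also have "(\<integral>\<^sup>+x. (\<integral>\<^sup>+y. ennreal (?F x y) \<partial>lborel) \<partial>lborel) = (\<integral>\<^sup>+y. (\<integral>\<^sup>+x. ennreal (?F x y) \<partial>lborel) \<partial>lborel)"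
      by (rule nn_integral_pair(3)) measurable
    also have "\<dots> \<le> (\<integral>\<^sup>+y. ennreal (1/2) * ennreal ((\<phi> y)\<^sup>2 * norm y powr - ?\<gamma>) \<partial>lborel)"
    proof (rule nn_integral_mono)
      fix y
      have E_y: "norm y \<noteq> 0" "norm y / (2 * K) \<le> norm x" "norm x < 2 * (norm y / K)" if "E x y" for x
      proof -
        have "0 < norm x" using that by (auto simp: E_def)
        then have "0 < K * norm x" using K by auto
        then show "norm y \<noteq> 0" using that unfolding E_def by linarith
        show "norm y / (2 * K) \<le> norm x" "norm x < 2 * (norm y / K)"
          using that K \<open>0 < K * norm x\<close> by (auto simp: E_def field_simps)
      qed
      let ?b = "2 * a * (norm y / (2 * K)) powr - (n + ?\<gamma>) * (\<phi> y)\<^sup>2"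
      have "ennreal (?F x y) \<le> ennreal ?b * indicator (ball 0 (2 * (norm y / K))) x" for x
      proof (cases "E x y")
        case True
        have "norm x powr - (n + ?\<gamma>) \<le> (norm y / (2 * K)) powr - (n + ?\<gamma>)"
          using E_y[OF True] K n_pos s \<alpha> by (intro powr_mono2') auto
        then show ?thesis using True E_y[OF True] a by (auto intro!: ennreal_leI mult_right_mono mult_left_mono)
      qed auto
      then have "(\<integral>\<^sup>+x. ennreal (?F x y) \<partial>lborel) \<le> (\<integral>\<^sup>+x. ennreal ?b * indicator (ball (0 :: real ^ 'n) (2 * (norm y / K))) x \<partial>lborel)"
        by (intro nn_integral_mono)
      also have "\<dots> = ennreal (?b * (?V * (2 * (norm y / K)) powr n))"
        by (rule nn_integral_ball_const) (use K a in auto)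
      also have "?b * (?V * (2 * (norm y / K)) powr n) = A * K powr - \<kappa> * ((\<phi> y)\<^sup>2 * norm y powr - ?\<gamma>)"
      proof (cases "y = 0")
        case False
        have K': "(1 / K) powr e = K powr - e" "(1 / 2) powr e = (2 :: real) powr - e" for e
          using K by (simp_all add: powr_divide powr_minus_divide)
        have "norm y / (2 * K) = norm y * (1 / 2) * (1 / K)" by simp
        also have "\<dots> powr - (n + ?\<gamma>) = norm y powr - (n + ?\<gamma>) * (2 powr (n + ?\<gamma>) * K powr (n + ?\<gamma>))"
          by (simp only: powr_mult K' minus_minus mult.assoc)
        finally have "(norm y / (2 * K)) powr - (n + ?\<gamma>) = norm y powr - (n + ?\<gamma>) * (2 powr (n + ?\<gamma>) * K powr (n + ?\<gamma>))" .
        moreover have "2 * (norm y / K) = 2 * (norm y * (1 / K))" by simp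
        then have "(2 * (norm y / K)) powr n = 2 powr n * (norm y powr n * K powr - n)"
          using K by (simp only: powr_mult K')
        ultimately have "?b * (?V * (2 * (norm y / K)) powr n)
          = 2 * a * ?V * (2 powr (n + ?\<gamma>) * 2 powr n) * (K powr (n + ?\<gamma>) * K powr - n) * (\<phi> y)\<^sup>2 * (norm y powr - (n + ?\<gamma>) * norm y powr n)"
          by (simp only: mult_ac)
        also have "2 powr (n + ?\<gamma>) * 2 powr n = (2 :: real) powr (?\<gamma> + 2 * n)" by (simp add: powr_add[symmetric] add.commute)
        also have "norm y powr - (n + ?\<gamma>) * norm y powr n = norm y powr - ?\<gamma>" by (simp add: powr_add[symmetric])
        also have "K powr (n + ?\<gamma>) * K powr - n = K powr ?\<gamma>" by (simp add: powr_add[symmetric])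
        also have "2 * a * ?V * 2 powr (?\<gamma> + 2 * n) * K powr ?\<gamma> * (\<phi> y)\<^sup>2 * norm y powr - ?\<gamma>
          = A * (K powr - n * K powr ?\<gamma>) * ((\<phi> y)\<^sup>2 * norm y powr - ?\<gamma>)"
          using K by (simp add: A_def a_def powr_minus field_simps)
        also have "K powr - n * K powr ?\<gamma> = K powr - \<kappa>" by (simp add: powr_add[symmetric] \<kappa>_def algebra_simps)
        finally show ?thesis .
      qed (use n_pos s \<alpha> in auto)
      also have "ennreal (A * K powr - \<kappa> * ((\<phi> y)\<^sup>2 * norm y powr - ?\<gamma>)) \<le> ennreal (1 / 2 * ((\<phi> y)\<^sup>2 * norm y powr - ?\<gamma>))"
        by (intro ennreal_leI mult_right_mono AK) auto
      also have "\<dots> = ennreal (1/2) * ennreal ((\<phi> y)\<^sup>2 * norm y powr - ?\<gamma>)"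
        by (rule ennreal_mult) auto
      finally show "(\<integral>\<^sup>+x. ennreal (?F x y) \<partial>lborel) \<le> ennreal (1/2) * ennreal ((\<phi> y)\<^sup>2 * norm y powr - ?\<gamma>)" .
    qed
    also have "\<dots> = ennreal (1/2) * H \<phi>" unfolding H_def by (rule nn_integral_cmult) measurable
    finally have le: "H \<phi> \<le> ennreal (1/2) * H \<phi> + ennreal (2 * a * CK) * Q \<phi>" by simp
    have "H \<phi> < \<infinity>" using test_weighted_finite[OF test, of ?\<gamma> 2] \<alpha> by (simp add: H_def powr_numeral)
    obtain qq where qq: "Q \<phi> = ennreal qq" "0 \<le> qq" using Q_test_finite[OF test] by (cases "Q \<phi>") auto
    have Qq: "ennreal c * Q \<phi> = ennreal (c * qq)" if "0 \<le> c" for c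
      unfolding qq(1) by (rule ennreal_mult[symmetric]) (use that qq(2) in auto)
    have "H \<phi> \<le> ennreal (2 * (2 * a * CK * qq))"
      by (rule ennreal_absorb_half) (use le Qq[of "2 * a * CK"] a CK qq(2) \<open>H \<phi> < \<infinity>\<close> in auto)
    then show ?thesis using Qq[of "2 * (2 * a * CK)"] a CK by (simp add: mult.assoc)
  qed
  with a CK that[of "2 * (2 * a * CK)"] show ?thesis by simp
qed

lemma Hardy:
  obtains C where "C > 0" "\<And>u E. u \<in> D \<Longrightarrow> 0 < E \<Longrightarrow> Q u \<le> ennreal E \<Longrightarrow> H u \<le> ennreal (C * E)"
proof -
  obtain C where C: "C > 0" "\<And>\<phi>. \<phi> \<in> test_functions \<Longrightarrow> H \<phi> \<le> ennreal C * Q \<phi>" using Hardy_test by metis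
  have "H u \<le> ennreal (3 * C * E)" if u: "u \<in> D" "0 < E" "Q u \<le> ennreal E" for u E
    unfolding H_def
  proof (rule Fatou_D[OF u(1,3,2)])
    fix \<phi> assume \<phi>: "\<phi> \<in> test_functions" "Q \<phi> \<le> ennreal (3 * E)"
    have "H \<phi> \<le> ennreal C * ennreal (3 * E)"
      by (rule order_trans[OF C(2)[OF \<phi>(1)]]) (intro mult_left_mono \<phi>; simp)
    then show "(\<integral>\<^sup>+x. ennreal ((\<phi> x)\<^sup>2 * norm x powr - (2 * s + 2 * \<alpha>)) \<partial>lborel) \<le> ennreal (3 * C * E)"
      using C(1) u(2) by (simp add: H_def ennreal_mult'[symmetric] mult_ac)
  qed (auto intro!: continuous_intros)
  with C(1) that[of "3 * C"] show ?thesis by simp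
qed

section \<open>A pointwise inequality of Hedberg type, and Sobolev's inequality\<close>

lemma markov_ball:
  fixes g :: "real ^ 'n \<Rightarrow> real"
  assumes [measurable]: "g \<in> borel_measurable borel" and r: "0 < r" and A: "0 < A"
    and le: "(\<integral>\<^sup>+y. ennreal (g y) * indicator (ball x r) y \<partial>lborel) \<le> ennreal A"
  shows "ennreal (unit_ball_vol n * r powr n / 2)
    \<le> emeasure lborel {y \<in> ball x r. g y \<le> 2 * A / (unit_ball_vol n * r powr n)}"
proof -
  let ?v = "unit_ball_vol n * r powr n"
  have v: "?v > 0" using r V_pos by simp
  define t where "t = 2 * A / ?v"
  have t: "t > 0" using v A by (simp add: t_def)
  let ?S = "{y \<in> ball x r. g y \<le> t}" and ?T = "{y \<in> ball x r. t < g y}"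
  have [measurable]: "?S \<in> sets borel" "?T \<in> sets borel" by measurable
  have "ennreal t * emeasure lborel ?T = (\<integral>\<^sup>+y. ennreal t * indicator ?T y \<partial>lborel)"
    by (simp add: nn_integral_cmult_indicator)
  also have "\<dots> \<le> (\<integral>\<^sup>+y. ennreal (g y) * indicator (ball x r) y \<partial>lborel)"
    by (intro nn_integral_mono) (auto simp: indicator_def intro!: ennreal_leI)
  finally have *: "ennreal t * emeasure lborel ?T \<le> ennreal A" using le by (rule order_trans)
  have "emeasure lborel ?T = ennreal (1 / t) * (ennreal t * emeasure lborel ?T)"
    using t by (simp add: mult.assoc[symmetric] ennreal_mult'[symmetric])
  also have "\<dots> \<le> ennreal (1 / t) * ennreal A" by (rule mult_left_mono[OF *]) simp
  also have "\<dots> = ennreal (?v / 2)" using t A v by (simp add: ennreal_mult'[symmetric] t_def)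
  finally have T: "emeasure lborel ?T \<le> ennreal (?v / 2)" .
  have "ennreal ?v = emeasure lborel (ball x r)" using r by (simp add: emeasure_ball_n)
  also have "ball x r = ?S \<union> ?T" by auto
  also have "emeasure lborel (?S \<union> ?T) = emeasure lborel ?S + emeasure lborel ?T"
    by (intro plus_emeasure[symmetric]) auto
  also have "\<dots> \<le> emeasure lborel ?S + ennreal (?v / 2)" by (intro add_left_mono T)
  finally have "ennreal (?v / 2) + ennreal (?v / 2) \<le> emeasure lborel ?S + ennreal (?v / 2)"
    using v by (subst ennreal_plus[symmetric]) auto
  then show ?thesis by (simp add: t_def)
qed

text \<open>Averages u(x)^2 \<le> 2 (u(x) - u(y))^2 + 2 u(y)^2 over \<open>y\<close> in
  \<open>S\<close>. As r \<le> |x|/2, one has |y| \<le> 3|x|/2, so the kernel is at least a multiple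
  of r^(-n-2s) |x|^(-2\<alpha>) and the increments are paid by \<open>G1 u x\<close>.\<close>

lemma hedberg_set:
  obtains C where "C > 0" "\<And>u x r S b g. u \<in> borel_measurable borel \<Longrightarrow> x \<noteq> 0 \<Longrightarrow> 0 < r \<Longrightarrow> r \<le> norm x / 2 \<Longrightarrow>
    S \<in> sets borel \<Longrightarrow> S \<subseteq> ball x r \<Longrightarrow> ennreal (unit_ball_vol n * r powr n / 2) \<le> emeasure lborel S \<Longrightarrow>
    (\<And>y. y \<in> S \<Longrightarrow> wt u y \<le> b) \<Longrightarrow> 0 \<le> g \<Longrightarrow> G1 u x \<le> ennreal g \<Longrightarrow>
    (wt u x)\<^sup>2 \<le> C * (r powr (2 * s) * g + b\<^sup>2)"
proof -
  let ?V = "unit_ball_vol n"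
  define c1 where "c1 = 2 * (3 / 2) powr \<alpha>"
  define c2 where "c2 = 2 * ((3 / 2) powr \<alpha>)\<^sup>2"
  have c: "c1 > 0" "c2 > 0" by (auto simp: c1_def c2_def)
  define C where "C = max (2 * c1 / ?V) c2"
  have "C > 0" using c by (simp add: C_def less_max_iff_disj)
  moreover have "(wt u x)\<^sup>2 \<le> C * (r powr (2 * s) * g + b\<^sup>2)"
    if [measurable]: "u \<in> borel_measurable borel" and x: "x \<noteq> 0" and r: "0 < r" "r \<le> norm x / 2"
      and S [measurable]: "S \<in> sets borel" and SB: "S \<subseteq> ball x r"
      and vol: "ennreal (?V * r powr n / 2) \<le> emeasure lborel S"
      and b: "\<And>y. y \<in> S \<Longrightarrow> wt u y \<le> b" and g: "0 \<le> g" "G1 u x \<le> ennreal g" for u x r S b g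
  proof -
    have Sfin: "emeasure lborel S < \<infinity>"
      using emeasure_mono[OF SB, of lborel] r by (simp add: emeasure_ball_n le_less_trans)
    define m where "m = measure lborel S"
    have m: "emeasure lborel S = ennreal m" using Sfin by (simp add: m_def emeasure_eq_ennreal_measure)
    have m_ge: "?V * r powr n / 2 \<le> m"
      using vol unfolding m by (subst (asm) ennreal_le_iff) (auto simp: m_def)
    have m_pos: "m > 0" using m_ge V_pos r by (smt (verit) divide_pos_pos mult_pos_pos powr_gt_zero)
    have pt: "(wt u x)\<^sup>2 \<le> c1 * r powr (n + 2 * s) * ((u x - u y)\<^sup>2 * kern x y) + c2 * b\<^sup>2" if y: "y \<in> S" for y
    proof -
      have xy: "norm (x - y) < r" using y SB by (auto simp: dist_norm)
      then have y0: "y \<noteq> 0" using r x by auto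
      have ny: "norm y \<le> 3 / 2 * norm x" using xy r norm_triangle_ineq2[of y x] by (simp add: norm_minus_commute)
      have y\<alpha>: "norm y powr \<alpha> \<le> (3 / 2) powr \<alpha> * norm x powr \<alpha>"
        using ny \<alpha> by (subst powr_mult[symmetric]) (auto intro!: powr_mono2)
      have e1: "(u x - u y)\<^sup>2 * norm x powr - (2 * \<alpha>) \<le> (3 / 2) powr \<alpha> * r powr (n + 2 * s) * ((u x - u y)\<^sup>2 * kern x y)"
      proof (cases "x = y")
        case False
        have "norm x powr \<alpha> * norm (x - y) powr (n + 2 * s) * norm y powr \<alpha>
          \<le> norm x powr \<alpha> * r powr (n + 2 * s) * ((3 / 2) powr \<alpha> * norm x powr \<alpha>)"
          using xy n_pos s \<alpha> by (intro mult_mono y\<alpha> powr_mono2) auto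
        also have "\<dots> = (3 / 2) powr \<alpha> * r powr (n + 2 * s) * norm x powr (2 * \<alpha>)"
          by (simp add: powr_add[symmetric] mult_ac)
        finally have "1 / ((3 / 2) powr \<alpha> * r powr (n + 2 * s) * norm x powr (2 * \<alpha>)) \<le> kern x y"
          unfolding kern_def using False x y0 r by (intro divide_left_mono mult_pos_pos) auto
        then have "(3 / 2) powr \<alpha> * r powr (n + 2 * s) * (1 / ((3 / 2) powr \<alpha> * r powr (n + 2 * s) * norm x powr (2 * \<alpha>)))
          \<le> (3 / 2) powr \<alpha> * r powr (n + 2 * s) * kern x y" by (rule mult_left_mono) auto
        then have "norm x powr - (2 * \<alpha>) \<le> (3 / 2) powr \<alpha> * r powr (n + 2 * s) * kern x y"
          using r by (simp add: powr_minus_divide)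
        from mult_left_mono[OF this, of "(u x - u y)\<^sup>2"] show ?thesis by (simp add: mult_ac)
      qed simp
      have "\<bar>u y\<bar> = wt u y * norm y powr \<alpha>" using y0 by (simp add: wt_def mult.assoc powr_add[symmetric])
      also have "\<dots> \<le> b * ((3 / 2) powr \<alpha> * norm x powr \<alpha>)"
        using b[OF y] order_trans[OF wt_nonneg b[OF y]] by (intro mult_mono y\<alpha>) auto
      finally have "\<bar>u y\<bar> \<le> b * ((3 / 2) powr \<alpha> * norm x powr \<alpha>)" .
      from power_mono[OF this abs_ge_zero, of 2]
      have "(u y)\<^sup>2 \<le> b\<^sup>2 * ((3 / 2) powr \<alpha>)\<^sup>2 * (norm x powr \<alpha>)\<^sup>2" by (simp add: power_mult_distrib mult.assoc)
      from mult_right_mono[OF this, of "norm x powr - (2 * \<alpha>)"]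
      have e2: "(u y)\<^sup>2 * norm x powr - (2 * \<alpha>) \<le> b\<^sup>2 * ((3 / 2) powr \<alpha>)\<^sup>2"
        using x by (simp add: mult.assoc power2_eq_square[of "norm x powr \<alpha>"] powr_add[symmetric])
      have "(u x)\<^sup>2 \<le> 2 * (u x - u y)\<^sup>2 + 2 * (u y)\<^sup>2"
        using zero_le_power2[of "u x - 2 * u y"] by (simp add: power2_eq_square algebra_simps)
      from mult_right_mono[OF this, of "norm x powr - (2 * \<alpha>)"]
      have "(wt u x)\<^sup>2 \<le> 2 * ((u x - u y)\<^sup>2 * norm x powr - (2 * \<alpha>)) + 2 * ((u y)\<^sup>2 * norm x powr - (2 * \<alpha>))"
        by (simp add: wt_power2 algebra_simps)
      also have "\<dots> \<le> 2 * ((3 / 2) powr \<alpha> * r powr (n + 2 * s) * ((u x - u y)\<^sup>2 * kern x y)) + 2 * (b\<^sup>2 * ((3 / 2) powr \<alpha>)\<^sup>2)"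
        using e1 e2 by linarith
      finally show ?thesis by (simp add: c1_def c2_def mult_ac)
    qed
    have "ennreal ((wt u x)\<^sup>2 * m) = (\<integral>\<^sup>+y. ennreal ((wt u x)\<^sup>2) * indicator S y \<partial>lborel)"
      using m by (simp add: nn_integral_cmult_indicator ennreal_mult')
    also have "\<dots> \<le> (\<integral>\<^sup>+y. ennreal (c1 * r powr (n + 2 * s)) * ennreal ((u x - u y)\<^sup>2 * kern x y) + ennreal (c2 * b\<^sup>2) * indicator S y \<partial>lborel)"
    proof (rule nn_integral_mono)
      fix y
      show "ennreal ((wt u x)\<^sup>2) * indicator S y \<le> ennreal (c1 * r powr (n + 2 * s)) * ennreal ((u x - u y)\<^sup>2 * kern x y) + ennreal (c2 * b\<^sup>2) * indicator S y"
      proof (cases "y \<in> S")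
        case True
        have "ennreal ((wt u x)\<^sup>2) \<le> ennreal (c1 * r powr (n + 2 * s) * ((u x - u y)\<^sup>2 * kern x y) + c2 * b\<^sup>2)"
          by (intro ennreal_leI pt True)
        also have "\<dots> = ennreal (c1 * r powr (n + 2 * s)) * ennreal ((u x - u y)\<^sup>2 * kern x y) + ennreal (c2 * b\<^sup>2)"
          using c kern_nonneg[of x y] by (subst ennreal_plus) (auto simp: ennreal_mult)
        finally show ?thesis using True by simp
      qed simp
    qed
    also have "\<dots> \<le> ennreal (c1 * r powr (n + 2 * s) * g + c2 * b\<^sup>2 * m)"
      by (rule nn_integral_linear2_le, measurable, measurable)
        (use g c m in \<open>auto simp: G1_def m_def\<close>)
    finally have "(wt u x)\<^sup>2 * m \<le> c1 * r powr (n + 2 * s) * g + c2 * b\<^sup>2 * m"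
      using c g by (subst (asm) ennreal_le_iff) (auto simp: m_def)
    then have "(wt u x)\<^sup>2 \<le> (c1 * r powr (n + 2 * s) * g + c2 * b\<^sup>2 * m) / m"
      using m_pos by (simp add: pos_le_divide_eq)
    also have "\<dots> = c1 * r powr (n + 2 * s) * g / m + c2 * b\<^sup>2" using m_pos by (simp add: add_divide_distrib)
    also have "c1 * r powr (n + 2 * s) * g / m \<le> c1 * r powr (n + 2 * s) * g / (?V * r powr n / 2)"
      using m_ge m_pos V_pos r g c by (intro divide_left_mono) auto
    also have "c1 * r powr (n + 2 * s) * g / (?V * r powr n / 2) = 2 * c1 / ?V * (r powr (2 * s) * g)"
      using r V_pos by (simp add: powr_add field_simps)
    also have "\<dots> \<le> C * (r powr (2 * s) * g)" using g by (intro mult_right_mono) (auto simp: C_def)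
    also have "c2 * b\<^sup>2 \<le> C * b\<^sup>2" by (intro mult_right_mono) (auto simp: C_def)
    finally show ?thesis by (simp add: distrib_left)
  qed
  ultimately show ?thesis using that by blast
qed

lemma G1_le_G: "G1 u x \<le> G u x"
  unfolding G_def by (rule add_increasing2) auto

lemma zero_order_le_G: "ennreal ((u x)\<^sup>2 * norm x powr - (2 * s + 2 * \<alpha>)) \<le> G u x"
  unfolding G_def by (rule add_increasing) auto

text \<open>On at least half of the ball around \<open>x\<close> the p-th power of
  \<open>wt u\<close> is at most twice its mean, which is O(A r^(-n)). So \<open>hedberg_set\<close>
  bounds (wt u x)^2 by r^(2s) G + (A r^(-n))^(2/p) up to constants, and the stated inequality is
  what remains after optimising \<open>r\<close>.\<close>

lemma hedberg:
  fixes p :: real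
  assumes p: "0 < p"
  obtains C where "C > 0" "\<And>u x A. u \<in> borel_measurable borel \<Longrightarrow> x \<noteq> 0 \<Longrightarrow> 0 < A \<Longrightarrow>
    (\<forall>r. 0 < r \<longrightarrow> r \<le> norm x / 2 \<longrightarrow> (\<integral>\<^sup>+y. ennreal (wt u y powr p) * indicator (ball x r) y \<partial>lborel) \<le> ennreal A) \<Longrightarrow>
    ennreal (wt u x powr (2 + 2 * s * p / n)) \<le> ennreal (C * A powr (2 * s / n)) * G u x"
proof -
  let ?V = "unit_ball_vol n"
  obtain C0 where C0: "C0 > 0" "\<And>u x r S b g. u \<in> borel_measurable borel \<Longrightarrow> x \<noteq> 0 \<Longrightarrow> 0 < r \<Longrightarrow> r \<le> norm x / 2 \<Longrightarrow>
    S \<in> sets borel \<Longrightarrow> S \<subseteq> ball x r \<Longrightarrow> ennreal (?V * r powr n / 2) \<le> emeasure lborel S \<Longrightarrow>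
    (\<And>y. y \<in> S \<Longrightarrow> wt u y \<le> b) \<Longrightarrow> 0 \<le> g \<Longrightarrow> G1 u x \<le> ennreal g \<Longrightarrow>
    (wt u x)\<^sup>2 \<le> C0 * (r powr (2 * s) * g + b\<^sup>2)" using hedberg_set by metis
  define C1 where "C1 = max C0 (2 powr (2 * s))"
  have C1: "C1 > 0" using C0 by (simp add: C1_def)
  define e where "e = 2 / p"
  define k where "k = 1 + s * p / n"
  have e: "e > 0" using p by (simp add: e_def)
  have k: "k > 1" using p s n_pos by (simp add: k_def)
  have ke: "2 * s + n * e = n * e * k" using p n_pos by (simp add: e_def k_def field_simps)
  define C where "C = (2 * C1) powr k * (2 / ?V) powr (2 * s / n)"
  have C: "C > 0" using C1 V_pos by (simp add: C_def)
  have main: "wt u x powr (2 + 2 * s * p / n) \<le> C * A powr (2 * s / n) * g"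
    if [measurable]: "u \<in> borel_measurable borel" and x: "x \<noteq> 0" and A: "0 < A" and g: "0 < g" "G u x \<le> ennreal g"
      and int: "\<And>r. 0 < r \<Longrightarrow> r \<le> norm x / 2 \<Longrightarrow> (\<integral>\<^sup>+y. ennreal (wt u y powr p) * indicator (ball x r) y \<partial>lborel) \<le> ennreal A"
    for u x A g
  proof -
    define B where "B = 2 * A / ?V"
    have B: "B > 0" using A V_pos by (simp add: B_def)
    have step: "(wt u x)\<^sup>2 \<le> C1 * (r powr (2 * s) * g + (B / r powr n) powr e)" if r: "0 < r" for r
    proof (cases "r \<le> norm x / 2")
      case True
      let ?t = "2 * A / (?V * r powr n)"
      let ?S = "{y \<in> ball x r. wt u y powr p \<le> ?t}"
      have t: "?t = B / r powr n" by (simp add: B_def)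
      have "(wt u x)\<^sup>2 \<le> C0 * (r powr (2 * s) * g + (?t powr (1 / p))\<^sup>2)"
      proof (rule C0(2)[OF _ x r True])
        show "?S \<in> sets borel" by measurable
        show "ennreal (?V * r powr n / 2) \<le> emeasure lborel ?S"
          by (rule markov_ball) (use r A int[OF r True] in auto)
        show "wt u y \<le> ?t powr (1 / p)" if "y \<in> ?S" for y
        proof -
          have "wt u y = (wt u y powr p) powr (1 / p)" using p by (simp add: powr_powr)
          also have "\<dots> \<le> ?t powr (1 / p)" using that p by (intro powr_mono2) auto
          finally show ?thesis .
        qed
        show "G1 u x \<le> ennreal g" by (rule order_trans[OF G1_le_G g(2)])
      qed (use g in auto)
      also have "(?t powr (1 / p))\<^sup>2 = (B / r powr n) powr e"
        unfolding t e_def by (simp add: power2_eq_square powr_add[symmetric])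
      also have "C0 * (r powr (2 * s) * g + (B / r powr n) powr e) \<le> C1 * (r powr (2 * s) * g + (B / r powr n) powr e)"
        using g by (intro mult_right_mono) (auto simp: C1_def)
      finally show ?thesis .
    next
      \<comment> \<open>Here the zero-order part of \<open>G\<close> gives the bound, so
        \<open>step\<close> holds for all radii and the optimal one may be chosen freely.\<close>
      case False
      have "ennreal ((u x)\<^sup>2 * norm x powr - (2 * s + 2 * \<alpha>)) \<le> ennreal g"
        by (rule order_trans[OF zero_order_le_G g(2)])
      then have h: "(u x)\<^sup>2 * norm x powr - (2 * s + 2 * \<alpha>) \<le> g" using g by (subst (asm) ennreal_le_iff) auto
      have "(wt u x)\<^sup>2 = norm x powr (2 * s) * ((u x)\<^sup>2 * norm x powr - (2 * s + 2 * \<alpha>))"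
      proof -
        have "norm x powr - (2 * \<alpha>) = norm x powr (2 * s) * norm x powr - (2 * s + 2 * \<alpha>)"
          unfolding powr_add[symmetric] by (rule arg_cong) simp
        then show ?thesis by (simp add: wt_power2)
      qed
      also have "\<dots> \<le> (2 * r) powr (2 * s) * g"
        using h s False r by (intro mult_mono powr_mono2) auto
      also have "\<dots> = 2 powr (2 * s) * (r powr (2 * s) * g)" using r by (simp add: powr_mult)
      also have "\<dots> \<le> C1 * (r powr (2 * s) * g + (B / r powr n) powr e)"
        using g C1 by (intro mult_mono) (auto simp: C1_def)
      finally show ?thesis .
    qed
    \<comment> \<open>The radius that makes the two terms of \<open>step\<close> equal.\<close>
    define r where "r = (B powr e / g) powr (1 / (n * e * k))"
    have r: "r > 0" using B g by (simp add: r_def)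
    have nek: "n * e * k > 0" using n_pos e k by simp
    have rk: "r powr (n * e * k) = B powr e / g"
      using nek B g n_pos e k by (simp add: r_def powr_powr)
    have eq: "(B / r powr n) powr e = r powr (2 * s) * g"
    proof -
      have "r powr (2 * s) * r powr (n * e) * g = B powr e"
        using rk g unfolding ke[symmetric] powr_add by simp
      then show ?thesis using r B by (simp add: powr_divide powr_powr field_simps)
    qed
    have X: "(wt u x)\<^sup>2 \<le> 2 * C1 * (r powr (2 * s) * g)" using step[OF r] unfolding eq by (simp add: mult_ac)
    have "wt u x powr (2 + 2 * s * p / n) = ((wt u x)\<^sup>2) powr k"
    proof (cases "wt u x = 0")
      case False
      then have sq: "(wt u x)\<^sup>2 = wt u x powr 2" using wt_nonneg[of u x] by (simp add: powr_numeral)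
      show ?thesis unfolding sq powr_powr by (rule arg_cong[where f = "\<lambda>e. wt u x powr e"]) (simp add: k_def)
    qed simp
    also have "\<dots> \<le> (2 * C1 * (r powr (2 * s) * g)) powr k" using k by (intro powr_mono2 X) auto
    also have "\<dots> = (2 * C1) powr k * (r powr (2 * s * k) * g powr k)"
      using C1 g by (simp add: powr_mult powr_powr)
    also have "r powr (2 * s * k) * g powr k = B powr (2 * s / n) * g"
    proof -
      have "r powr (2 * s * k) = (r powr (n * e * k)) powr (2 * s / (n * e))"
        using n_pos e by (simp add: powr_powr mult_ac)
      also have "\<dots> = B powr (2 * s / n) / g powr (2 * s / (n * e))"
        unfolding rk using B g n_pos e by (simp add: powr_divide powr_powr)
      also have "2 * s / (n * e) = k - 1" using p n_pos by (simp add: e_def k_def)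
      finally have "r powr (2 * s * k) = B powr (2 * s / n) / g powr (k - 1)" .
      moreover have "g powr k = g powr (k - 1) * g" using g powr_add[of g "k - 1" 1] by simp
      ultimately show ?thesis using g by simp
    qed
    also have "B powr (2 * s / n) = (2 / ?V) powr (2 * s / n) * A powr (2 * s / n)"
      using A V_pos by (simp add: B_def powr_mult[symmetric])
    finally show ?thesis by (simp add: C_def mult_ac)
  qed
  have "ennreal (wt u x powr (2 + 2 * s * p / n)) \<le> ennreal (C * A powr (2 * s / n)) * G u x"
    if u: "u \<in> borel_measurable borel" and x: "x \<noteq> 0" and A: "0 < A"
      and int: "\<forall>r. 0 < r \<longrightarrow> r \<le> norm x / 2 \<longrightarrow> (\<integral>\<^sup>+y. ennreal (wt u y powr p) * indicator (ball x r) y \<partial>lborel) \<le> ennreal A"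
    for u x A
  proof (cases "G u x")
    case (real g)
    let ?c = "C * A powr (2 * s / n)"
    have c: "?c > 0" using C A by simp
    have "wt u x powr (2 + 2 * s * p / n) \<le> ?c * g"
    \<comment> \<open>\<open>main\<close> asks for a positive upper bound of \<open>G u x\<close>,
      whereas \<open>g\<close> may be zero.\<close>
    proof (rule field_le_epsilon)
      fix d :: real assume d: "0 < d"
      have "wt u x powr (2 + 2 * s * p / n) \<le> ?c * (g + d / ?c)"
        using d c real by (intro main u x A int[rule_format]) (auto intro!: add_nonneg_pos ennreal_leI)
      also have "\<dots> = ?c * g + d"
        using less_imp_neq[OF c] by (simp only: distrib_left) (metis nonzero_mult_div_cancel_left times_divide_eq_right)
      finally show "wt u x powr (2 + 2 * s * p / n) \<le> ?c * g + d" .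
    qed
    then show ?thesis using c real by (simp add: ennreal_mult'[symmetric] ennreal_leI)
  next
    case top
    have "ennreal (C * A powr (2 * s / n)) \<noteq> 0" using C A by (simp add: less_imp_neq[symmetric])
    then show ?thesis unfolding top by (simp only: ennreal_mult_top) simp
  qed
  with C that show ?thesis by blast
qed

lemma AE_nonzero: "AE x in lborel. x \<noteq> (0 :: real ^ 'n)"
  by (rule AE_lborel_singleton)

text \<open>For p = q the exponent of \<open>hedberg\<close> reproduces itself, 2 + 2sq/n = q, and
  the integral N of (wt \<phi>)^q can serve as \<open>A\<close>. Integration gives N \<le> C
  N^(2s/n) (Q + H); as 2s < n and N is finite for test functions, N^(2s/n) can be divided
  out.\<close>

lemma Sobolev:
  obtains C where "C > 0" "\<And>u E. u \<in> D \<Longrightarrow> 0 < E \<Longrightarrow> Q u \<le> ennreal E \<Longrightarrow>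
    (\<integral>\<^sup>+x. ennreal (wt u x powr q) \<partial>lborel) \<le> ennreal (C * E powr (q / 2))"
proof -
  obtain CH where CH: "CH > 0" "\<And>u E. u \<in> D \<Longrightarrow> 0 < E \<Longrightarrow> Q u \<le> ennreal E \<Longrightarrow> H u \<le> ennreal (CH * E)"
    using Hardy by metis
  have qn: "q * (n - 2 * s) = 2 * n" using s by (simp add: q_def)
  have qq: "2 + 2 * s * q / n = q"
  proof -
    have "2 * n + 2 * s * q = q * n" using qn by (simp add: algebra_simps)
    then show ?thesis using n_pos by (simp add: add_divide_eq_iff)
  qed
  obtain C0 where C0: "C0 > 0" "\<And>u x A. u \<in> borel_measurable borel \<Longrightarrow> x \<noteq> 0 \<Longrightarrow> 0 < A \<Longrightarrow>
    (\<forall>r. 0 < r \<longrightarrow> r \<le> norm x / 2 \<longrightarrow> (\<integral>\<^sup>+y. ennreal (wt u y powr q) * indicator (ball x r) y \<partial>lborel) \<le> ennreal A) \<Longrightarrow>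
    ennreal (wt u x powr q) \<le> ennreal (C0 * A powr (2 * s / n)) * G u x"
    by (rule hedberg[OF q_pos, unfolded qq]) (rule that, assumption, blast)
  define C1 where "C1 = (C0 * (1 + CH)) powr (q / 2)"
  have C1: "C1 > 0" using C0 CH by (simp add: C1_def)
  have test: "(\<integral>\<^sup>+x. ennreal (wt \<phi> x powr q) \<partial>lborel) \<le> ennreal (C1 * E powr (q / 2))"
    if \<phi>: "\<phi> \<in> test_functions" and E: "0 < E" "Q \<phi> \<le> ennreal E" for \<phi> E
  proof -
    have [measurable]: "\<phi> \<in> borel_measurable borel" by (rule test_functions_measurable[OF \<phi>])
    let ?S = "\<integral>\<^sup>+x. ennreal (wt \<phi> x powr q) \<partial>lborel"
    have "2 * \<alpha> * n < (n - 2 * s) * n" using \<alpha> n_pos by (intro mult_strict_right_mono) auto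
    then have "\<alpha> * q < n" using s by (simp add: q_def pos_divide_less_eq mult_ac)
    from test_weighted_finite[OF \<phi> this q_pos] have "?S < \<infinity>"
      by (simp add: wt_def powr_mult powr_powr)
    then obtain N where N: "?S = ennreal N" "0 \<le> N" by (cases ?S) auto
    show ?thesis
    proof (cases "N = 0")
      case False
      with N have N0: "N > 0" by simp
      have "?S \<le> (\<integral>\<^sup>+x. ennreal (C0 * N powr (2 * s / n)) * G \<phi> x \<partial>lborel)"
      proof (rule nn_integral_mono_AE)
        show "AE x in lborel. ennreal (wt \<phi> x powr q) \<le> ennreal (C0 * N powr (2 * s / n)) * G \<phi> x"
          using AE_nonzero
        proof eventually_elim
          case (elim x)
          show ?case
          proof (intro C0(2)[OF _ elim N0] allI impI)
            fix r :: real
            have "(\<integral>\<^sup>+y. ennreal (wt \<phi> y powr q) * indicator (ball x r) y \<partial>lborel) \<le> ?S"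
              by (intro nn_integral_mono) (auto simp: indicator_def)
            then show "(\<integral>\<^sup>+y. ennreal (wt \<phi> y powr q) * indicator (ball x r) y \<partial>lborel) \<le> ennreal N"
              using N by simp
          qed simp
        qed
      qed
      also have "\<dots> = ennreal (C0 * N powr (2 * s / n)) * (Q \<phi> + H \<phi>)"
        by (simp add: nn_integral_cmult nn_integral_G)
      also have "\<dots> \<le> ennreal (C0 * N powr (2 * s / n)) * (ennreal E + ennreal (CH * E))"
        using E by (intro mult_left_mono add_mono CH D_test \<phi>) auto
      also have "\<dots> = ennreal (C0 * (1 + CH) * E * N powr (2 * s / n))"
        using E CH C0 by (subst ennreal_plus[symmetric])
          (auto simp: ennreal_mult'[symmetric] algebra_simps simp del: ennreal_plus)
      finally have le: "N \<le> C0 * (1 + CH) * E * N powr (2 * s / n)"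
        unfolding N(1) using C0 CH E by (subst (asm) ennreal_le_iff) auto
      have "N = N powr (1 - 2 * s / n) * N powr (2 * s / n)" using N0 by (simp add: powr_add[symmetric])
      with le N0 have "N powr (1 - 2 * s / n) \<le> C0 * (1 + CH) * E"
        by (metis mult_le_cancel_right_pos powr_gt_zero less_irrefl)
      then have "(N powr (1 - 2 * s / n)) powr (q / 2) \<le> (C0 * (1 + CH) * E) powr (q / 2)"
        using q_pos by (intro powr_mono2) auto
      moreover have "(1 - 2 * s / n) * (q / 2) = 1"
      proof -
        have "(1 - 2 * s / n) = (n - 2 * s) / n" using n_pos by (simp add: diff_divide_distrib)
        then show ?thesis using qn n_pos by (simp add: mult.commute)
      qed
      ultimately have "N \<le> C1 * E powr (q / 2)"
        using N0 C0 CH E by (simp add: powr_powr C1_def powr_mult)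
      then show ?thesis unfolding N(1) by (rule ennreal_leI)
    qed (use N in simp)
  qed
  have "(\<integral>\<^sup>+x. ennreal (wt u x powr q) \<partial>lborel) \<le> ennreal (C1 * 3 powr (q / 2) * E powr (q / 2))"
    if u: "u \<in> D" "0 < E" "Q u \<le> ennreal E" for u E
    unfolding wt_def
  proof (rule Fatou_D[OF u(1,3,2), where F = "\<lambda>t x. (\<bar>t\<bar> * norm x powr - \<alpha>) powr q"])
    fix \<phi> assume \<phi>: "\<phi> \<in> test_functions" "Q \<phi> \<le> ennreal (3 * E)"
    show "(\<integral>\<^sup>+x. ennreal ((\<bar>\<phi> x\<bar> * norm x powr - \<alpha>) powr q) \<partial>lborel) \<le> ennreal (C1 * 3 powr (q / 2) * E powr (q / 2))"
      using test[OF \<phi>(1) _ \<phi>(2)] u(2) by (simp add: wt_def powr_mult mult_ac)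
  next
    fix x :: "real ^ 'n"
    show "continuous_on UNIV (\<lambda>t. (\<bar>t\<bar> * norm x powr - \<alpha>) powr q)"
      using q_pos by (intro continuous_on_powr' continuous_intros) auto
  qed auto
  with C1 that[of "C1 * 3 powr (q / 2)"] show ?thesis by simp
qed

end

section \<open>Truncation, cut-off and localisation\<close>

lemma power_diff_le:
  fixes a b :: real
  assumes "0 \<le> a" "0 \<le> b"
  shows "\<bar>a ^ N - b ^ N\<bar> \<le> real N * \<bar>a - b\<bar> * max a b ^ (N - 1)"
proof -
  have "\<bar>\<Sum>i<N. b ^ (N - Suc i) * a ^ i\<bar> \<le> (\<Sum>i<N. max a b ^ (N - 1))"
  proof (rule order_trans[OF sum_abs sum_mono])
    fix i assume "i \<in> {..<N}"
    then have "N - 1 = (N - Suc i) + i" by auto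
    then have "max a b ^ (N - 1) = max a b ^ (N - Suc i) * max a b ^ i" by (metis power_add)
    moreover have "b ^ (N - Suc i) * a ^ i \<le> max a b ^ (N - Suc i) * max a b ^ i"
      using assms by (intro mult_mono power_mono) auto
    ultimately show "\<bar>b ^ (N - Suc i) * a ^ i\<bar> \<le> max a b ^ (N - 1)" using assms by simp
  qed
  then have "\<bar>a - b\<bar> * \<bar>\<Sum>i<N. b ^ (N - Suc i) * a ^ i\<bar> \<le> \<bar>a - b\<bar> * (real N * max a b ^ (N - 1))"
    by (intro mult_left_mono) auto
  then show ?thesis by (simp add: power_diff_sumr2[of a N b] abs_mult mult_ac)
qed

text \<open>The exponent \<open>M + 1\<close> leaves room for splitting \<open>a ^ M\<close> and \<open>b ^ M\<close> symmetrically.\<close>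

lemma power_diff_square_le:
  fixes a b :: real
  assumes "0 \<le> a" "0 \<le> b"
  shows "(a ^ Suc M - b ^ Suc M)\<^sup>2 \<le> (real (Suc M))\<^sup>2 * 4 ^ M * ((a - b)\<^sup>2 * (a ^ M * b ^ M) + ((a - b)\<^sup>2) ^ Suc M)"
proof -
  let ?d = "a - b"
  have mx: "(max a b)\<^sup>2 \<le> 2 * (a * b) + ?d\<^sup>2"
    using assms zero_le_power2[of a] zero_le_power2[of b]
    by (simp add: max_def power2_eq_square algebra_simps)
  have "((max a b)\<^sup>2) ^ M \<le> (2 * (a * b) + ?d\<^sup>2) ^ M" using mx by (intro power_mono) auto
  also have "\<dots> \<le> (2 * max (2 * (a * b)) (?d\<^sup>2)) ^ M"
    using assms by (intro power_mono) auto
  also have "\<dots> = 2 ^ M * max (2 * (a * b)) (?d\<^sup>2) ^ M" by (rule power_mult_distrib)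
  also have "\<dots> \<le> 2 ^ M * ((2 * (a * b)) ^ M + (?d\<^sup>2) ^ M)"
    using assms by (intro mult_left_mono) (auto simp: max_def)
  also have "\<dots> \<le> 2 ^ M * (2 ^ M * (a * b) ^ M + 2 ^ M * (?d\<^sup>2) ^ M)"
  proof (intro mult_left_mono add_mono)
    have "(1 :: real) \<le> 2 ^ M" by simp
    then have "1 * (?d\<^sup>2) ^ M \<le> 2 ^ M * (?d\<^sup>2) ^ M" by (rule mult_right_mono) simp
    then show "(?d\<^sup>2) ^ M \<le> 2 ^ M * (?d\<^sup>2) ^ M" by simp
    show "(2 * (a * b)) ^ M \<le> 2 ^ M * (a * b) ^ M" by (simp only: power_mult_distrib[of 2])
  qed simp
  also have "\<dots> = (2 * 2) ^ M * ((a * b) ^ M + (?d\<^sup>2) ^ M)"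
    unfolding power_mult_distrib[of 2 2] by (simp only: distrib_left mult.assoc)
  finally have key: "((max a b)\<^sup>2) ^ M \<le> 4 ^ M * ((a * b) ^ M + (?d\<^sup>2) ^ M)" by simp
  have "(a ^ Suc M - b ^ Suc M)\<^sup>2 \<le> (real (Suc M) * \<bar>?d\<bar> * max a b ^ M)\<^sup>2"
    using power_mono[OF power_diff_le[OF assms, of "Suc M"] abs_ge_zero, of 2] by simp
  also have "\<dots> = (real (Suc M))\<^sup>2 * ?d\<^sup>2 * ((max a b)\<^sup>2) ^ M"
  proof -
    have "(max a b ^ M)\<^sup>2 = ((max a b)\<^sup>2) ^ M" unfolding power_mult[symmetric] by (simp only: mult.commute)
    then show ?thesis by (simp only: power_mult_distrib power2_abs)
  qed
  also have "\<dots> \<le> (real (Suc M))\<^sup>2 * ?d\<^sup>2 * (4 ^ M * ((a * b) ^ M + (?d\<^sup>2) ^ M))"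
    by (rule mult_left_mono[OF key]) simp
  also have "\<dots> = (real (Suc M))\<^sup>2 * 4 ^ M * (?d\<^sup>2 * (a ^ M * b ^ M) + (?d\<^sup>2) ^ Suc M)"
  proof -
    have "c * d * (e * (f + g)) = c * e * (d * f + d * g)" for c d e f g :: real by (simp add: algebra_simps)
    from this[of "(real (Suc M))\<^sup>2" "?d\<^sup>2" "4 ^ M" "(a * b) ^ M" "(?d\<^sup>2) ^ M"]
    show ?thesis unfolding power_mult_distrib[of a b] power_Suc .
  qed
  finally show ?thesis .
qed

context fractional_energy
begin

text \<open>Pointwise there is equality unless u - v has opposite signs at \<open>x\<close> and
  \<open>y\<close>. There, exchanging the values gains twice the product of excess and deficiency;
  of the two orders of \<open>x\<close> and \<open>y\<close> only one is kept.\<close>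

lemma Q_max_min_le:
  assumes [measurable]: "u \<in> borel_measurable borel" "v \<in> borel_measurable borel"
  shows "Q (\<lambda>x. max (u x) (v x)) + Q (\<lambda>x. min (u x) (v x)) + 2 * J (\<lambda>x y. max (u x - v x) 0 * max (v y - u y) 0) \<le> Q u + Q v"
proof -
  let ?F = "\<lambda>x y. (max (u x) (v x) - max (u y) (v y))\<^sup>2"
  let ?G = "\<lambda>x y. (min (u x) (v x) - min (u y) (v y))\<^sup>2"
  let ?K = "\<lambda>x y. max (u x - v x) 0 * max (v y - u y) 0"
  have [measurable]: "pm ?F" "pm ?G" "pm ?K" by measurable
  have "J (\<lambda>x y. ?F x y + ?G x y + 2 * ?K x y) = J (\<lambda>x y. ?F x y + ?G x y) + J (\<lambda>x y. 2 * ?K x y)"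
    by (rule J_add) simp_all
  also have "J (\<lambda>x y. ?F x y + ?G x y) = J ?F + J ?G" by (rule J_add) simp_all
  also have "J (\<lambda>x y. 2 * ?K x y) = 2 * J ?K" using J_cmult[of ?K 2] by simp
  finally have "Q (\<lambda>x. max (u x) (v x)) + Q (\<lambda>x. min (u x) (v x)) + 2 * J (\<lambda>x y. max (u x - v x) 0 * max (v y - u y) 0)
    = J (\<lambda>x y. (max (u x) (v x) - max (u y) (v y))\<^sup>2 + (min (u x) (v x) - min (u y) (v y))\<^sup>2
       + 2 * (max (u x - v x) 0 * max (v y - u y) 0))"
    unfolding Q_def by (rule sym)
  also have "\<dots> \<le> J (\<lambda>x y. (u x - u y)\<^sup>2 + (v x - v y)\<^sup>2)"
  proof (rule J_mono)
    fix x y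
    have *: "0 \<le> (u y - v y) * (v x - u x)" if "u x \<le> v x" "v y \<le> u y" using that by simp
    consider "u x \<le> v x" "u y \<le> v y" | "u x \<le> v x" "v y \<le> u y" | "v x \<le> u x" "u y \<le> v y" | "v x \<le> u x" "v y \<le> u y"
      by linarith
    then show "(max (u x) (v x) - max (u y) (v y))\<^sup>2 + (min (u x) (v x) - min (u y) (v y))\<^sup>2
       + 2 * (max (u x - v x) 0 * max (v y - u y) 0) \<le> (u x - u y)\<^sup>2 + (v x - v y)\<^sup>2"
    proof cases
      case 2
      then show ?thesis using *[OF 2] by (simp add: max_absorb1 max_absorb2 min_absorb1 min_absorb2 power2_eq_square algebra_simps)
    qed (simp_all add: max_absorb1 max_absorb2 min_absorb1 min_absorb2 power2_eq_square algebra_simps)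
  qed
  also have "\<dots> = Q u + Q v" unfolding Q_def by (subst J_add) auto
  finally show ?thesis .
qed

definition c_spread :: real where "c_spread = unit_ball_vol n / 2 * 2 powr - (n + 2 * s)"

lemma c_spread_pos: "0 < c_spread" using V_pos by (simp add: c_spread_def)

text \<open>For \<open>x\<close> and \<open>y\<close> in the ball the kernel is at least
  |x|^(-\<alpha>) (2r)^(-n-2s) r^(-\<alpha>), where \<alpha> \<ge> 0 enters. So if z \<ge> b on half
  of the ball, every point of the ball interacts with that half, and the interaction energy controls
  a weighted L1 norm of \<open>P\<close>.\<close>

lemma J_spread:
  assumes [measurable]: "P \<in> borel_measurable borel" "z \<in> borel_measurable borel" "S \<in> sets borel"
    and nn: "\<And>x. 0 \<le> P x" "\<And>y. 0 \<le> z y" and r: "0 < r" and S: "S \<subseteq> ball 0 r"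
    and vol: "ennreal (unit_ball_vol n * r powr n / 2) \<le> emeasure lborel S"
    and b: "0 \<le> b" "\<And>y. y \<in> S \<Longrightarrow> b \<le> z y"
  shows "ennreal (c_spread * b * r powr - (2 * s + \<alpha>)) * (\<integral>\<^sup>+x. ennreal (P x * norm x powr - \<alpha>) * indicator (ball 0 r) x \<partial>lborel)
    \<le> J (\<lambda>x y. P x * z y)"
proof -
  let ?k = "b * ((2 * r) powr - (n + 2 * s) * r powr - \<alpha>)"
  have "ennreal (c_spread * b * r powr - (2 * s + \<alpha>)) * (ennreal (P x * norm x powr - \<alpha>) * indicator (ball 0 r) x)
      \<le> (\<integral>\<^sup>+y. ennreal (P x * z y * kern x y) \<partial>lborel)" for x
  proof (cases "x \<in> ball 0 r \<and> x \<noteq> 0")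
    case True
    have pt: "P x * norm x powr - \<alpha> * ?k \<le> P x * z y * kern x y" if y: "y \<in> S" "y \<noteq> 0" "y \<noteq> x" for y
    proof -
      have ny: "norm y < r" using y S by auto
      have "norm (x - y) \<le> norm x + norm y" by (rule norm_triangle_ineq4)
      then have nxy: "norm (x - y) \<le> 2 * r" using True ny by auto
      have "norm x powr - \<alpha> * ((2 * r) powr - (n + 2 * s) * r powr - \<alpha>)
        \<le> norm x powr - \<alpha> * (norm (x - y) powr - (n + 2 * s) * norm y powr - \<alpha>)"
        using y ny nxy n_pos s \<alpha> True by (intro mult_left_mono mult_mono powr_mono2') auto
      also have "\<dots> = kern x y"
        unfolding kern_def by (simp only: powr_minus) (simp add: divide_inverse mult_ac)
      finally have "norm x powr - \<alpha> * ((2 * r) powr - (n + 2 * s) * r powr - \<alpha>) \<le> kern x y" .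
      from mult_mono[OF b(2)[OF y(1)] this _ _] have "b * (norm x powr - \<alpha> * ((2 * r) powr - (n + 2 * s) * r powr - \<alpha>)) \<le> z y * kern x y"
        using nn(2)[of y] by simp
      from mult_left_mono[OF this nn(1)[of x]] show ?thesis by (simp add: mult_ac)
    qed
    have "ennreal (c_spread * b * r powr - (2 * s + \<alpha>)) * (ennreal (P x * norm x powr - \<alpha>) * indicator (ball 0 r) x)
      = ennreal (P x * norm x powr - \<alpha> * ?k) * ennreal (unit_ball_vol n * r powr n / 2)"
    proof -
      have "r powr n * r powr - (n + 2 * s) * r powr - \<alpha> = r powr - (2 * s + \<alpha>)"
        unfolding powr_add[symmetric] by (rule arg_cong) simp
      then have "P x * norm x powr - \<alpha> * ?k * (unit_ball_vol n * r powr n / 2)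
        = c_spread * b * r powr - (2 * s + \<alpha>) * (P x * norm x powr - \<alpha>)"
        using r by (simp only: powr_mult c_spread_def) (simp add: mult_ac)
      then show ?thesis using True nn(1)[of x] b(1) V_pos r c_spread_pos
        by (simp only: indicator_simps mult_1_right) (subst (1 2) ennreal_mult[symmetric], auto)
    qed
    also have "\<dots> \<le> ennreal (P x * norm x powr - \<alpha> * ?k) * emeasure lborel S"
      by (intro mult_left_mono vol) auto
    also have "\<dots> = (\<integral>\<^sup>+y. ennreal (P x * norm x powr - \<alpha> * ?k) * indicator S y \<partial>lborel)"
      by (simp add: nn_integral_cmult_indicator)
    also have "\<dots> \<le> (\<integral>\<^sup>+y. ennreal (P x * z y * kern x y) \<partial>lborel)"
    proof (rule nn_integral_mono_AE)
      show "AE y in lborel. ennreal (P x * norm x powr - \<alpha> * ?k) * indicator S y \<le> ennreal (P x * z y * kern x y)"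
        using AE_nonzero AE_lborel_singleton[of x]
      proof eventually_elim
        case (elim y)
        show ?case
        proof (cases "y \<in> S")
          case True
          from ennreal_leI[OF pt[OF True elim]] show ?thesis using True by (simp only: indicator_simps mult_1_right)
        qed simp
      qed
    qed
    finally show ?thesis .
  qed auto
  then have "(\<integral>\<^sup>+x. ennreal (c_spread * b * r powr - (2 * s + \<alpha>)) * (ennreal (P x * norm x powr - \<alpha>) * indicator (ball 0 r) x) \<partial>lborel)
    \<le> J (\<lambda>x y. P x * z y)" unfolding J_def by (intro nn_integral_mono)
  then show ?thesis by (subst (asm) nn_integral_cmult) auto
qed

text \<open>Large for two reasons, recorded in \<open>N_ge\<close>: in \<open>Xi_estimate\<close>
  the power 2(N + 1) of a difference of \<open>cut\<close> has to cancel the singularity of the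
  kernel, and \<theta> = 2/(N + 1) has to be small enough for the interpolation in
  \<open>cutoff_L2_bound\<close>.\<close>

definition N :: nat where "N = nat \<lceil>(n + 2 * s) / (2 * s)\<rceil> + CARD('n) + 2"

section \<open>The quadratic partition of unity\<close>

definition cut :: "real \<Rightarrow> real ^ 'n \<Rightarrow> real" where "cut \<rho> x = 1 - plateau \<rho> x"
definition \<tau> :: "real \<Rightarrow> real ^ 'n \<Rightarrow> real" where "\<tau> \<rho> x = cut \<rho> x ^ Suc N"
text \<open>With \<open>\<chi>2\<close> this is the rational parametrisation of the unit circle by
  \<tau>: the squares add up to 1 and both functions are smooth, without square roots near their
  zeros.\<close>

definition \<chi>1 :: "real \<Rightarrow> real ^ 'n \<Rightarrow> real" where "\<chi>1 \<rho> x = (1 - (\<tau> \<rho> x)\<^sup>2) * inverse (1 + (\<tau> \<rho> x)\<^sup>2)"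
definition \<chi>2 :: "real \<Rightarrow> real ^ 'n \<Rightarrow> real" where "\<chi>2 \<rho> x = 2 * \<tau> \<rho> x * inverse (1 + (\<tau> \<rho> x)\<^sup>2)"

lemma cut_bounds: "0 \<le> cut \<rho> x" "cut \<rho> x \<le> 1"
  using plateau_bounds[of \<rho> x] by (auto simp: cut_def)

lemma \<tau>_bounds: "0 \<le> \<tau> \<rho> x" "\<tau> \<rho> x \<le> 1"
  unfolding \<tau>_def using cut_bounds[of \<rho> x] by (auto intro: power_le_one simp del: power_Suc)

lemma one_plus_square_pos: "0 < 1 + (a :: real)\<^sup>2" by (simp add: add_pos_nonneg)

lemma \<chi>_nonneg: "0 \<le> \<chi>1 \<rho> x" "0 \<le> \<chi>2 \<rho> x"
  using \<tau>_bounds[of \<rho> x] by (auto simp: \<chi>1_def \<chi>2_def power_le_one)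

lemma \<chi>_squares: "(\<chi>1 \<rho> x)\<^sup>2 + (\<chi>2 \<rho> x)\<^sup>2 = 1"
proof -
  have "(1 + (\<tau> \<rho> x)\<^sup>2)\<^sup>2 \<noteq> 0" using one_plus_square_pos[of "\<tau> \<rho> x"] by simp
  moreover have "(1 - (\<tau> \<rho> x)\<^sup>2)\<^sup>2 + (2 * \<tau> \<rho> x)\<^sup>2 = (1 + (\<tau> \<rho> x)\<^sup>2)\<^sup>2"
    by (simp add: power2_eq_square algebra_simps)
  ultimately show ?thesis
    by (simp add: \<chi>1_def \<chi>2_def divide_inverse[symmetric] power_divide add_divide_distrib[symmetric])
qed

lemma \<chi>_le_1: "\<chi>1 \<rho> x \<le> 1" "\<chi>2 \<rho> x \<le> 1"
proof -
  have "(\<chi>1 \<rho> x)\<^sup>2 \<le> 1\<^sup>2" "(\<chi>2 \<rho> x)\<^sup>2 \<le> 1\<^sup>2"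
    using \<chi>_squares[of \<rho> x] zero_le_power2[of "\<chi>1 \<rho> x"] zero_le_power2[of "\<chi>2 \<rho> x"]
    unfolding one_power2 by linarith+
  then show "\<chi>1 \<rho> x \<le> 1" "\<chi>2 \<rho> x \<le> 1" by (auto intro: power2_le_imp_le)
qed

lemma \<chi>_sum_ge_1: "1 \<le> \<chi>1 \<rho> x + \<chi>2 \<rho> x"
proof -
  have "(\<chi>1 \<rho> x)\<^sup>2 \<le> \<chi>1 \<rho> x" "(\<chi>2 \<rho> x)\<^sup>2 \<le> \<chi>2 \<rho> x"
    using \<chi>_nonneg[of \<rho> x] \<chi>_le_1[of \<rho> x] by (auto simp: power2_eq_square mult_left_le_one_le)
  then show ?thesis using \<chi>_squares[of \<rho> x] by linarith
qed

lemma \<tau>_le_\<chi>2: "\<tau> \<rho> x \<le> \<chi>2 \<rho> x"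
proof -
  have "\<tau> \<rho> x * (1 + (\<tau> \<rho> x)\<^sup>2) \<le> \<tau> \<rho> x * 2"
    using \<tau>_bounds[of \<rho> x] by (intro mult_left_mono) (auto simp: power_le_one)
  then show ?thesis using one_plus_square_pos[of "\<tau> \<rho> x"]
    by (simp add: \<chi>2_def divide_inverse[symmetric] pos_le_divide_eq mult.commute)
qed

lemma cut_inner: "0 < \<rho> \<Longrightarrow> norm x \<le> \<rho> \<Longrightarrow> cut \<rho> x = 0"
  and cut_outer: "0 < \<rho> \<Longrightarrow> 2 * \<rho> \<le> norm x \<Longrightarrow> cut \<rho> x = 1"
  by (auto simp: cut_def plateau_eq_1 plateau_eq_0)

lemma \<chi>_inner: assumes "0 < \<rho>" "norm x \<le> \<rho>" shows "\<chi>1 \<rho> x = 1" "\<chi>2 \<rho> x = 0"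
  using cut_inner[OF assms] by (simp_all add: \<chi>1_def \<chi>2_def \<tau>_def)

lemma \<chi>_outer: assumes "0 < \<rho>" "2 * \<rho> \<le> norm x" shows "\<chi>1 \<rho> x = 0" "\<chi>2 \<rho> x = 1"
  using cut_outer[OF assms] by (simp_all add: \<chi>1_def \<chi>2_def \<tau>_def)

lemma C_order_\<tau>: "C_order k (\<tau> \<rho>)"
  unfolding \<tau>_def[abs_def] cut_def[abs_def] by (intro C_order_power C_order_diff C_order_const C_order_plateau)

lemma C_order_\<chi>: "C_order k (\<chi>1 \<rho>)" "C_order k (\<chi>2 \<rho>)"
  unfolding \<chi>1_def[abs_def] \<chi>2_def[abs_def]
  by (intro C_order_mult C_order_inverse one_plus_square_pos C_order_add C_order_diff C_order_const C_order_power C_order_\<tau>)+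

lemma cutoff_measurable [measurable]:
  "cut \<rho> \<in> borel_measurable borel" "\<tau> \<rho> \<in> borel_measurable borel" "\<chi>1 \<rho> \<in> borel_measurable borel" "\<chi>2 \<rho> \<in> borel_measurable borel"
proof -
  show "cut \<rho> \<in> borel_measurable borel" unfolding cut_def[abs_def]
    by (intro borel_measurable_continuous_onI continuous_on_diff continuous_on_const C_order_continuous_on[OF C_order_plateau])
  show "\<tau> \<rho> \<in> borel_measurable borel" "\<chi>1 \<rho> \<in> borel_measurable borel" "\<chi>2 \<rho> \<in> borel_measurable borel"
    by (intro borel_measurable_continuous_onI C_order_continuous_on C_order_\<tau> C_order_\<chi>)+
qed

section \<open>The localisation error\<close>

definition Xi :: "real \<Rightarrow> (real ^ 'n \<Rightarrow> real) \<Rightarrow> ennreal" where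
  "Xi \<rho> u = J (\<lambda>x y. \<bar>u x\<bar> * \<bar>u y\<bar> * (\<tau> \<rho> x - \<tau> \<rho> y)\<^sup>2)"

text \<open>The squared chord between the points of the circle with parameters a and b equals 4 (a -
  b)^2 / ((1 + a^2)(1 + b^2)).\<close>

lemma \<chi>_diff: "(\<chi>1 \<rho> x - \<chi>1 \<rho> y)\<^sup>2 + (\<chi>2 \<rho> x - \<chi>2 \<rho> y)\<^sup>2 \<le> 4 * (\<tau> \<rho> x - \<tau> \<rho> y)\<^sup>2"
proof -
  let ?a = "\<tau> \<rho> x" and ?b = "\<tau> \<rho> y"
  let ?A = "1 + ?a\<^sup>2" and ?B = "1 + ?b\<^sup>2"
  have AB: "?A \<ge> 1" "?B \<ge> 1" by auto
  have inv: "?A * inverse ?A = 1" "?B * inverse ?B = 1"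
    using one_plus_square_pos[of ?a] one_plus_square_pos[of ?b] by simp_all
  have "A * B * ((p * i) * (p' * j) + (c * i) * (d * j)) = p * p' + c * d"
    if "A * i = 1" "B * j = 1" for A B i j p p' c d :: real
  proof -
    have "A * B * ((p * i) * (p' * j) + (c * i) * (d * j)) = (A * i) * (B * j) * (p * p' + c * d)"
      by (simp add: algebra_simps)
    then show ?thesis using that by simp
  qed
  from this[OF inv] have "?A * ?B * (\<chi>1 \<rho> x * \<chi>1 \<rho> y + \<chi>2 \<rho> x * \<chi>2 \<rho> y) = (1 - ?a\<^sup>2) * (1 - ?b\<^sup>2) + (2 * ?a) * (2 * ?b)"
    unfolding \<chi>1_def \<chi>2_def .
  then have "?A * ?B * (2 - 2 * (\<chi>1 \<rho> x * \<chi>1 \<rho> y + \<chi>2 \<rho> x * \<chi>2 \<rho> y)) = 4 * (?a - ?b)\<^sup>2"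
    by (simp add: right_diff_distrib mult.left_commute[of _ 2]) (simp add: power2_eq_square algebra_simps)
  moreover have "(\<chi>1 \<rho> x - \<chi>1 \<rho> y)\<^sup>2 + (\<chi>2 \<rho> x - \<chi>2 \<rho> y)\<^sup>2 = 2 - 2 * (\<chi>1 \<rho> x * \<chi>1 \<rho> y + \<chi>2 \<rho> x * \<chi>2 \<rho> y)"
    using \<chi>_squares[of \<rho> x] \<chi>_squares[of \<rho> y] by (simp add: power2_eq_square algebra_simps)
  ultimately have eq: "?A * ?B * ((\<chi>1 \<rho> x - \<chi>1 \<rho> y)\<^sup>2 + (\<chi>2 \<rho> x - \<chi>2 \<rho> y)\<^sup>2) = 4 * (?a - ?b)\<^sup>2" by simp
  have "1 * 1 \<le> ?A * ?B" using AB by (intro mult_mono) auto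
  then have "1 * ((\<chi>1 \<rho> x - \<chi>1 \<rho> y)\<^sup>2 + (\<chi>2 \<rho> x - \<chi>2 \<rho> y)\<^sup>2) \<le> ?A * ?B * ((\<chi>1 \<rho> x - \<chi>1 \<rho> y)\<^sup>2 + (\<chi>2 \<rho> x - \<chi>2 \<rho> y)\<^sup>2)"
    by (intro mult_right_mono) auto
  then show ?thesis using eq by simp
qed

text \<open>Because the squares of the cut-offs sum to 1, the squared increments of the two pieces
  add up exactly to (u x - u y)^2 plus u x u y times the squared chord. Only this last term is
  estimated.\<close>

lemma IMS_localisation:
  assumes [measurable]: "u \<in> borel_measurable borel"
  shows "Q (\<lambda>x. \<chi>1 \<rho> x * u x) + Q (\<lambda>x. \<chi>2 \<rho> x * u x) \<le> Q u + 4 * Xi \<rho> u"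
proof -
  have "Q (\<lambda>x. \<chi>1 \<rho> x * u x) + Q (\<lambda>x. \<chi>2 \<rho> x * u x)
    = J (\<lambda>x y. (\<chi>1 \<rho> x * u x - \<chi>1 \<rho> y * u y)\<^sup>2 + (\<chi>2 \<rho> x * u x - \<chi>2 \<rho> y * u y)\<^sup>2)"
    unfolding Q_def by (subst J_add) auto
  also have "\<dots> \<le> J (\<lambda>x y. (u x - u y)\<^sup>2 + 4 * (\<bar>u x\<bar> * \<bar>u y\<bar> * (\<tau> \<rho> x - \<tau> \<rho> y)\<^sup>2))"
  proof (rule J_mono)
    fix x y
    let ?S = "(\<chi>1 \<rho> x - \<chi>1 \<rho> y)\<^sup>2 + (\<chi>2 \<rho> x - \<chi>2 \<rho> y)\<^sup>2"
    have "(\<chi>1 \<rho> x * u x - \<chi>1 \<rho> y * u y)\<^sup>2 + (\<chi>2 \<rho> x * u x - \<chi>2 \<rho> y * u y)\<^sup>2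
      = ((\<chi>1 \<rho> x)\<^sup>2 + (\<chi>2 \<rho> x)\<^sup>2) * (u x)\<^sup>2 + ((\<chi>1 \<rho> y)\<^sup>2 + (\<chi>2 \<rho> y)\<^sup>2) * (u y)\<^sup>2
        - 2 * (u x * u y) * (\<chi>1 \<rho> x * \<chi>1 \<rho> y + \<chi>2 \<rho> x * \<chi>2 \<rho> y)"
      by (simp add: power2_eq_square algebra_simps)
    moreover have "?S = ((\<chi>1 \<rho> x)\<^sup>2 + (\<chi>2 \<rho> x)\<^sup>2) + ((\<chi>1 \<rho> y)\<^sup>2 + (\<chi>2 \<rho> y)\<^sup>2) - 2 * (\<chi>1 \<rho> x * \<chi>1 \<rho> y + \<chi>2 \<rho> x * \<chi>2 \<rho> y)"
      by (simp add: power2_eq_square algebra_simps)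
    ultimately have "(\<chi>1 \<rho> x * u x - \<chi>1 \<rho> y * u y)\<^sup>2 + (\<chi>2 \<rho> x * u x - \<chi>2 \<rho> y * u y)\<^sup>2 = (u x - u y)\<^sup>2 + u x * u y * ?S"
      unfolding \<chi>_squares by (simp add: power2_eq_square algebra_simps)
    also have "u x * u y * ?S \<le> \<bar>u x\<bar> * \<bar>u y\<bar> * (4 * (\<tau> \<rho> x - \<tau> \<rho> y)\<^sup>2)"
      by (rule mult_mono[OF _ \<chi>_diff]) (auto simp: abs_mult[symmetric])
    finally show "(\<chi>1 \<rho> x * u x - \<chi>1 \<rho> y * u y)\<^sup>2 + (\<chi>2 \<rho> x * u x - \<chi>2 \<rho> y * u y)\<^sup>2
      \<le> (u x - u y)\<^sup>2 + 4 * (\<bar>u x\<bar> * \<bar>u y\<bar> * (\<tau> \<rho> x - \<tau> \<rho> y)\<^sup>2)" by simp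
  qed
  also have "\<dots> = Q u + 4 * Xi \<rho> u"
    using J_cmult[of "\<lambda>x y. \<bar>u x\<bar> * \<bar>u y\<bar> * (\<tau> \<rho> x - \<tau> \<rho> y)\<^sup>2" 4]
    unfolding Q_def Xi_def by (subst J_add) simp_all
  finally show ?thesis .
qed

abbreviation L1 :: "(real ^ 'n \<Rightarrow> real) \<Rightarrow> real \<Rightarrow> ennreal" where
  "L1 u r \<equiv> (\<integral>\<^sup>+x. ennreal (wt u x) * indicator (ball 0 r) x \<partial>lborel)"

text \<open>Hoelder's inequality up to a factor 2, by splitting at a level t: w \<le> t + t^(1-q)
  w^q. The chosen level makes both contributions equal to \<sigma> a^(1-1/q).\<close>

lemma L1_set_le:
  assumes [measurable]: "u \<in> borel_measurable borel" "A \<in> sets borel" and \<sigma>: "0 < \<sigma>"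
    and Sq: "(\<integral>\<^sup>+x. ennreal (wt u x powr q) \<partial>lborel) \<le> ennreal (\<sigma> powr q)"
    and A: "emeasure lborel A \<le> ennreal a" "0 < a"
  shows "(\<integral>\<^sup>+x. ennreal (wt u x) * indicator A x \<partial>lborel) \<le> ennreal (2 * \<sigma> * a powr (1 / 2 + s / n))"
proof -
  define t where "t = \<sigma> * a powr - (1 / q)"
  have t: "t > 0" using \<sigma> A by (simp add: t_def)
  have "wt u x \<le> t + t powr (1 - q) * wt u x powr q" for x
  proof (cases "wt u x \<le> t")
    case False
    then have w: "0 < wt u x" using t by linarith
    have "wt u x = wt u x powr (1 - q) * wt u x powr q" using w by (simp add: powr_add[symmetric])
    also have "\<dots> \<le> t powr (1 - q) * wt u x powr q"
      using False t q_gt_2 by (intro mult_right_mono powr_mono2') auto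
    finally show ?thesis using t by simp
  qed (simp add: add_increasing2)
  then have "ennreal (wt u x) * indicator A x \<le> ennreal t * indicator A x + ennreal (t powr (1 - q)) * ennreal (wt u x powr q)" for x
    using t by (auto simp: indicator_def ennreal_mult'[symmetric] ennreal_plus[symmetric] simp del: ennreal_plus intro!: ennreal_leI)
  then have "(\<integral>\<^sup>+x. ennreal (wt u x) * indicator A x \<partial>lborel)
    \<le> (\<integral>\<^sup>+x. ennreal t * indicator A x + ennreal (t powr (1 - q)) * ennreal (wt u x powr q) \<partial>lborel)"
    by (intro nn_integral_mono)
  also have "\<dots> \<le> ennreal (t * a + t powr (1 - q) * \<sigma> powr q)"
    by (rule nn_integral_linear2_le, measurable, measurable) (use A Sq t in auto)
  also have "t * a = \<sigma> * a powr (1 - 1 / q)" using A by (simp add: t_def powr_diff powr_minus field_simps)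
  also have "t powr (1 - q) * \<sigma> powr q = \<sigma> * a powr (1 - 1 / q)"
  proof -
    have "- (1 / q) * (1 - q) = 1 - 1 / q" using q_pos by (simp add: field_simps)
    then have "t powr (1 - q) = \<sigma> powr (1 - q) * a powr (1 - 1 / q)"
      using \<sigma> A by (simp only: t_def powr_mult powr_powr)
    moreover have "\<sigma> powr (1 - q) * \<sigma> powr q = \<sigma>" using \<sigma> by (simp add: powr_add[symmetric])
    ultimately show ?thesis by (metis mult.assoc mult.commute)
  qed
  also have "1 - 1 / q = 1 / 2 + s / n" using s n_pos by (simp add: q_def field_simps)
  finally show ?thesis by (simp add: mult.assoc)
qed

end

lemma nn_integral_linear3_le:
  assumes [measurable]: "f \<in> borel_measurable M" "g \<in> borel_measurable M" "h \<in> borel_measurable M"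
    and "(\<integral>\<^sup>+x. f x \<partial>M) \<le> ennreal a" "(\<integral>\<^sup>+x. g x \<partial>M) \<le> ennreal b" "(\<integral>\<^sup>+x. h x \<partial>M) \<le> ennreal w"
    and "0 \<le> a" "0 \<le> b" "0 \<le> w" "0 \<le> c" "0 \<le> d" "0 \<le> e"
  shows "(\<integral>\<^sup>+x. ennreal c * f x + ennreal d * g x + ennreal e * h x \<partial>M) \<le> ennreal (c * a + d * b + e * w)"
proof -
  have "(\<integral>\<^sup>+x. ennreal 1 * (ennreal c * f x + ennreal d * g x) + ennreal e * h x \<partial>M) \<le> ennreal (1 * (c * a + d * b) + e * w)"
    by (intro nn_integral_linear2_le) (use assms in auto)
  then show ?thesis by simp
qed

lemma ennreal_double: "0 \<le> a \<Longrightarrow> ennreal a + ennreal a = ennreal (2 * a)"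
  unfolding mult_2 by (rule ennreal_plus[symmetric])

context fractional_energy
begin

lemma N_ge: "n + 2 * s \<le> real (2 * Suc N)" "(n + 2 * s) / (2 * s) \<le> real N" "2 \<le> N"
proof -
  have "(n + 2 * s) / (2 * s) \<le> real (nat \<lceil>(n + 2 * s) / (2 * s)\<rceil>)" by (rule real_nat_ceiling_ge)
  then show "(n + 2 * s) / (2 * s) \<le> real N" by (simp add: N_def)
  have "CARD('n) \<le> N" by (simp add: N_def)
  then have "n \<le> real N" unfolding n_def by simp
  then show "n + 2 * s \<le> real (2 * Suc N)" using s n_pos by simp
  show "2 \<le> N" by (simp add: N_def)
qed

text \<open>If |y| \<ge> 4\<rho>, the integrand vanishes for |x| \<ge> 2\<rho>, and otherwise |x -
  y| \<ge> |y|/2, so the L1 bounds sum up dyadically. If both points lie in the ball of radius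
  4\<rho>, \<open>power_diff_square_le\<close> yields two terms: one with the integrable kernel
  |z|^(2-n-2s) and the cut-off L2 norm \<open>B\<close>, and one in which the kernel is cancelled
  and a product of two L1 norms remains.\<close>

lemma Xi_estimate:
  obtains C where "C > 0" "\<And>u \<rho> m B. u \<in> borel_measurable borel \<Longrightarrow> 0 < \<rho> \<Longrightarrow> 0 < m \<Longrightarrow> 0 \<le> B \<Longrightarrow>
    (\<forall>r\<ge>\<rho>. L1 u r \<le> ennreal (m * r powr (n / 2 + s))) \<Longrightarrow>
    (\<integral>\<^sup>+x. ennreal ((wt u x * cut \<rho> x ^ N)\<^sup>2) * indicator (ball 0 (4 * \<rho>)) x \<partial>lborel) \<le> ennreal B \<Longrightarrow>
    Xi \<rho> u \<le> ennreal (C * (m\<^sup>2 + \<rho> powr - (2 * s) * B))"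
proof -
  obtain L where L: "L > 0" "\<And>r x y. r > 0 \<Longrightarrow> \<bar>plateau r x - plateau r (y :: real ^ 'n)\<bar> \<le> L * norm (x - y) / r"
    using plateau_Lipschitz[where 'n = 'n] by metis
  obtain C1 where C1: "C1 > 0" "\<And>r. r > 0 \<Longrightarrow>
      (\<integral>\<^sup>+x. ennreal (norm (x :: real ^ 'n) powr - (n + 2 * s - 2)) * indicator (ball 0 r) x \<partial>lborel)
      \<le> ennreal (C1 * r powr (n - (n + 2 * s - 2)))"
    using ex_ball_powr[of "n + 2 * s - 2"] s by auto
  let ?\<sigma> = "n / 2 + s"
  define cN where "cN = (real (Suc N))\<^sup>2 * 4 ^ N"
  have cN: "cN > 0" by (simp add: cN_def)
  define CT where "CT = 2 powr ?\<sigma> / (1 - 2 powr - ?\<sigma>) * 4 powr - ?\<sigma>"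
  have \<sigma>: "?\<sigma> > 0" using n_pos s by simp
  have CT: "CT > 0" using \<sigma> by (simp add: CT_def powr_less_one)
  define K1 where "K1 = cN * L\<^sup>2 / 2 * (C1 * 8 powr (2 - 2 * s))"
  define K2 where "K2 = cN * L powr (n + 2 * s) / 2 * (4 powr ?\<sigma>)\<^sup>2 + 2 powr (n + 2 * s) * CT * 2 powr ?\<sigma>"
  have K: "K1 > 0" "K2 > 0" using cN L C1 CT by (auto simp: K1_def K2_def intro!: add_pos_pos)
  define C where "C = 2 * (K1 + K2)"
  have "C > 0" using K by (simp add: C_def)
  moreover have "Xi \<rho> u \<le> ennreal (C * (m\<^sup>2 + \<rho> powr - (2 * s) * B))"
    if [measurable]: "u \<in> borel_measurable borel" and \<rho>: "0 < \<rho>" and m: "0 < m" and B: "0 \<le> B"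
      and L1: "\<forall>r\<ge>\<rho>. L1 u r \<le> ennreal (m * r powr (n / 2 + s))"
      and L2: "(\<integral>\<^sup>+x. ennreal ((wt u x * cut \<rho> x ^ N)\<^sup>2) * indicator (ball 0 (4 * \<rho>)) x \<partial>lborel) \<le> ennreal B"
    for u \<rho> m B
  proof -
    define g where "g x = (wt u x * cut \<rho> x ^ N)\<^sup>2 * indicator (ball 0 (4 * \<rho>)) x" for x
    define k where "k z = norm (z :: real ^ 'n) powr - (n + 2 * s - 2) * indicator (ball 0 (8 * \<rho>)) z" for z
    define f1 where "f1 x = wt u x * indicator (ball 0 (4 * \<rho>)) x" for x
    define f2 where "f2 x = wt u x * indicator (ball 0 (2 * \<rho>)) x" for x
    define h where "h x = wt u x * norm x powr - (n + 2 * s) * indicator {x. 4 * \<rho> \<le> norm x} x" for x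
    have [measurable]: "g \<in> borel_measurable borel" "k \<in> borel_measurable borel" "f1 \<in> borel_measurable borel"
      "f2 \<in> borel_measurable borel" "h \<in> borel_measurable borel"
      unfolding g_def k_def f1_def f2_def h_def by measurable
    have nn: "0 \<le> g x" "0 \<le> k x" "0 \<le> f1 x" "0 \<le> f2 x" "0 \<le> h x" for x
      by (auto simp: g_def k_def f1_def f2_def h_def)
    define c1 where "c1 = cN * L\<^sup>2 / 2 * (1 / \<rho>\<^sup>2)"
    define c2 where "c2 = cN / 2 * (L / \<rho>) powr (n + 2 * s)"
    define c3 where "c3 = (2 :: real) powr (n + 2 * s)"
    have c: "c1 > 0" "c2 > 0" "c3 > 0" using cN L \<rho> by (auto simp: c1_def c2_def c3_def)
    \<comment> \<open>Half of a symmetric majorant: the integrand is at most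
      \<open>a x y + a y x\<close>, so only far interactions with \<open>x\<close> inside and
      \<open>y\<close> outside have to be listed.\<close>
    define a where "a x y = c1 * (g x * k (x - y)) + c2 * (f1 x * f1 y) + c3 * (f2 x * h y)" for x y
    have pm_a [measurable]: "pm a" unfolding a_def by measurable
    have [measurable]: "pm (\<lambda>x y. a y x)" by (rule pm_swap[OF pm_a])
    have a_nn: "0 \<le> a x y" for x y using nn c by (auto simp: a_def intro!: add_nonneg_nonneg mult_nonneg_nonneg)
    have far: "wt u x * wt u y * (\<tau> \<rho> x - \<tau> \<rho> y)\<^sup>2 * norm (x - y) powr - (n + 2 * s) \<le> c3 * (f2 x * h y)"
      if y: "4 * \<rho> \<le> norm y" for x y
    proof (cases "2 * \<rho> \<le> norm x")
      case True
      then have "\<tau> \<rho> x = \<tau> \<rho> y" using y \<rho> by (simp add: \<tau>_def cut_outer)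
      then show ?thesis using c nn by simp
    next
      case False
      have "(\<tau> \<rho> x - \<tau> \<rho> y)\<^sup>2 \<le> 1"
        using \<tau>_bounds[of \<rho> x] \<tau>_bounds[of \<rho> y] by (subst abs_square_le_1) auto
      moreover have "norm y / 2 \<le> norm (x - y)"
        using False y norm_triangle_ineq2[of y x] \<rho> by (simp add: norm_minus_commute)
      then have "norm (x - y) powr - (n + 2 * s) \<le> (norm y / 2) powr - (n + 2 * s)"
        using y \<rho> n_pos s by (intro powr_mono2') auto
      ultimately have "wt u x * wt u y * (\<tau> \<rho> x - \<tau> \<rho> y)\<^sup>2 * norm (x - y) powr - (n + 2 * s)
        \<le> wt u x * wt u y * 1 * (norm y / 2) powr - (n + 2 * s)"
        by (intro mult_mono mult_left_mono) auto
      also have "(norm y / 2) powr - (n + 2 * s) = c3 * norm y powr - (n + 2 * s)"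
        by (simp only: powr_divide norm_ge_zero c3_def powr_minus_divide) simp
      finally show ?thesis using False y by (simp add: f2_def h_def mult_ac)
    qed
    have near: "wt u x * wt u y * (\<tau> \<rho> x - \<tau> \<rho> y)\<^sup>2 * norm (x - y) powr - (n + 2 * s)
        \<le> c1 * (g x * k (x - y)) + c1 * (g y * k (y - x)) + 2 * (c2 * (f1 x * f1 y))"
      if xy: "norm x < 4 * \<rho>" "norm y < 4 * \<rho>" "x \<noteq> y" for x y
    proof -
      let ?d = "norm (x - y)" and ?D = "cut \<rho> x - cut \<rho> y" and ?w = "norm (x - y) powr - (n + 2 * s)"
      have d: "?d > 0" "?d < 8 * \<rho>" using xy norm_triangle_ineq4[of x y] by auto
      have DL: "\<bar>?D\<bar> \<le> L * ?d / \<rho>" using L(2)[OF \<rho>, of y x] by (simp add: cut_def norm_minus_commute)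
      have D1: "\<bar>?D\<bar> \<le> 1" using cut_bounds[of \<rho> x] cut_bounds[of \<rho> y] by (simp add: abs_le_iff)
      have D2: "?D\<^sup>2 * ?w \<le> L\<^sup>2 / \<rho>\<^sup>2 * k (x - y)"
      proof -
        have "?D\<^sup>2 \<le> (L * ?d / \<rho>)\<^sup>2" using power_mono[OF DL abs_ge_zero, of 2] by simp
        also have "\<dots> = L\<^sup>2 / \<rho>\<^sup>2 * ?d powr 2" using d by (simp add: power_mult_distrib power_divide powr_numeral)
        finally have "?D\<^sup>2 * ?w \<le> L\<^sup>2 / \<rho>\<^sup>2 * ?d powr 2 * ?w" by (rule mult_right_mono) simp
        also have "\<dots> = L\<^sup>2 / \<rho>\<^sup>2 * (?d powr 2 * ?w)" by (rule mult.assoc)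
        also have "?d powr 2 * ?w = ?d powr - (n + 2 * s - 2)" unfolding powr_add[symmetric] by (rule arg_cong) simp
        also have "\<dots> = k (x - y)" using d by (simp add: k_def)
        finally show ?thesis .
      qed
      \<comment> \<open>As |D| \<le> 1 and 2(N + 1) \<ge> n + 2s, the power may be lowered to n +
        2s, where the Lipschitz bound cancels the kernel exactly.\<close>
      have D3: "(?D\<^sup>2) ^ Suc N * ?w \<le> (L / \<rho>) powr (n + 2 * s)"
      proof (cases "?D = 0")
        case False
        have "(?D\<^sup>2) ^ Suc N = \<bar>?D\<bar> powr (real (2 * Suc N))"
          using False by (subst powr_realpow) (simp_all only: power_mult power2_abs zero_less_abs_iff not_False_eq_True)
        also have "\<dots> \<le> \<bar>?D\<bar> powr (n + 2 * s)" using D1 N_ge(1) by (intro powr_mono') auto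
        also have "\<dots> \<le> (L * ?d / \<rho>) powr (n + 2 * s)" using DL n_pos s by (intro powr_mono2) auto
        also have "\<dots> = (L / \<rho>) powr (n + 2 * s) * ?d powr (n + 2 * s)"
          using L \<rho> by (subst powr_mult[symmetric]) (auto simp: mult_ac)
        finally have "(?D\<^sup>2) ^ Suc N * ?w \<le> (L / \<rho>) powr (n + 2 * s) * ?d powr (n + 2 * s) * ?w"
          by (rule mult_right_mono) simp
        also have "\<dots> = (L / \<rho>) powr (n + 2 * s) * (?d powr (n + 2 * s) * ?w)" by (rule mult.assoc)
        also have "?d powr (n + 2 * s) * ?w = 1" using d unfolding powr_add[symmetric] by simp
        finally show ?thesis by simp
      qed simp
      let ?gx = "wt u x * cut \<rho> x ^ N" and ?gy = "wt u y * cut \<rho> y ^ N"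
      \<comment> \<open>Each point carries its own \<open>cut \<rho> ^ N\<close>, so the product
        separates into two squares and only the cut-off L2 norm enters.\<close>
      have g2: "?gx * ?gy \<le> (g x + g y) / 2"
        using sum_squares_bound[of ?gx ?gy] xy by (simp add: g_def)
      have g2': "0 \<le> ?gx * ?gy" using cut_bounds by (intro mult_nonneg_nonneg zero_le_power) auto
      have "(\<tau> \<rho> x - \<tau> \<rho> y)\<^sup>2 \<le> cN * (?D\<^sup>2 * (cut \<rho> x ^ N * cut \<rho> y ^ N) + (?D\<^sup>2) ^ Suc N)"
        unfolding \<tau>_def cN_def by (rule power_diff_square_le) (auto simp: cut_bounds)
      then have "wt u x * wt u y * (\<tau> \<rho> x - \<tau> \<rho> y)\<^sup>2 * ?w
        \<le> wt u x * wt u y * (cN * (?D\<^sup>2 * (cut \<rho> x ^ N * cut \<rho> y ^ N) + (?D\<^sup>2) ^ Suc N)) * ?w"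
        by (intro mult_right_mono mult_left_mono) auto
      also have "\<dots> = cN * (?gx * ?gy * (?D\<^sup>2 * ?w) + wt u x * wt u y * ((?D\<^sup>2) ^ Suc N * ?w))"
        by (simp only: distrib_left distrib_right mult_ac)
      also have "\<dots> \<le> cN * ((g x + g y) / 2 * (L\<^sup>2 / \<rho>\<^sup>2 * k (x - y)) + wt u x * wt u y * (L / \<rho>) powr (n + 2 * s))"
        using cN nn g2' by (intro mult_left_mono add_mono mult_mono g2 D2 D3) auto
      also have "\<dots> = c1 * (g x * k (x - y)) + c1 * (g y * k (x - y)) + 2 * (c2 * (f1 x * f1 y))"
      proof -
        have ring: "c * ((v + w) / 2 * (l * i * z) + ff * p) = c * l / 2 * i * (v * z) + c * l / 2 * i * (w * z) + 2 * (c / 2 * p * ff)"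
          for c v w l i z ff p :: real by (simp add: distrib_left distrib_right mult_ac add_divide_distrib)
        have f1: "f1 x = wt u x" "f1 y = wt u y" using xy by (simp_all add: f1_def)
        have div: "L\<^sup>2 / \<rho>\<^sup>2 = L\<^sup>2 * (1 / \<rho>\<^sup>2)" by simp
        show ?thesis unfolding c1_def c2_def f1 div by (rule ring)
      qed
      finally have le: "wt u x * wt u y * (\<tau> \<rho> x - \<tau> \<rho> y)\<^sup>2 * ?w
        \<le> c1 * (g x * k (x - y)) + c1 * (g y * k (x - y)) + 2 * (c2 * (f1 x * f1 y))" .
      have "k (y - x) = k (x - y)" unfolding k_def by (simp add: indicator_def norm_minus_commute[of y x])
      with le show ?thesis by simp
    qed
    have pt: "\<bar>u x\<bar> * \<bar>u y\<bar> * (\<tau> \<rho> x - \<tau> \<rho> y)\<^sup>2 * kern x y \<le> a x y + a y x" for x y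
    proof (cases "x = 0 \<or> y = 0 \<or> x = y")
      case True
      then have "kern x y = 0" using n_pos s by (auto simp: kern_def)
      then show ?thesis using a_nn[of x y] a_nn[of y x] by simp
    next
      case False
      have "kern x y = norm x powr - \<alpha> * norm (x - y) powr - (n + 2 * s) * norm y powr - \<alpha>"
        by (simp only: kern_def powr_minus) (simp add: divide_inverse mult_ac)
      then have eq: "\<bar>u x\<bar> * \<bar>u y\<bar> * (\<tau> \<rho> x - \<tau> \<rho> y)\<^sup>2 * kern x y
        = wt u x * wt u y * (\<tau> \<rho> x - \<tau> \<rho> y)\<^sup>2 * norm (x - y) powr - (n + 2 * s)"
        by (simp only: wt_def mult_ac)
      have t1: "0 \<le> c1 * (g x * k (x - y))" "0 \<le> c1 * (g y * k (y - x))" "0 \<le> c2 * (f1 x * f1 y)"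
        "0 \<le> c3 * (f2 x * h y)" "0 \<le> c3 * (f2 y * h x)" "c2 * (f1 x * f1 y) = c2 * (f1 y * f1 x)"
        using nn c by (auto simp: mult.commute)
      consider "4 * \<rho> \<le> norm y" | "4 * \<rho> \<le> norm x" | "norm x < 4 * \<rho>" "norm y < 4 * \<rho>" by linarith
      then show ?thesis
      proof cases
        case 1
        from far[OF this, of x] show ?thesis unfolding eq a_def using t1 by linarith
      next
        case 2
        have "wt u y * wt u x * (\<tau> \<rho> y - \<tau> \<rho> x)\<^sup>2 * norm (y - x) powr - (n + 2 * s)
          = wt u x * wt u y * (\<tau> \<rho> x - \<tau> \<rho> y)\<^sup>2 * norm (x - y) powr - (n + 2 * s)"
          by (simp add: power2_commute norm_minus_commute mult.commute)
        with far[OF 2, of y] show ?thesis unfolding eq a_def using t1 by linarith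
      next
        case 3
        from near[OF 3] False show ?thesis unfolding eq a_def using t1 by linarith
      qed
    qed
    define l where "l = m * (4 * \<rho>) powr ?\<sigma>"
    define l2 where "l2 = m * (2 * \<rho>) powr ?\<sigma>"
    define T where "T = CT * (m * \<rho> powr - ?\<sigma>)"
    define KK where "KK = C1 * (8 * \<rho>) powr (2 - 2 * s)"
    have pos: "0 \<le> l" "0 \<le> l2" "0 \<le> T" "0 \<le> KK" using m CT C1 \<rho> by (auto simp: l_def l2_def T_def KK_def)
    have int_f1: "(\<integral>\<^sup>+x. ennreal (f1 x) \<partial>lborel) \<le> ennreal l"
      using L1[rule_format, of "4 * \<rho>"] \<rho> by (simp add: f1_def l_def ennreal_mult ennreal_indicator)
    have int_f2: "(\<integral>\<^sup>+x. ennreal (f2 x) \<partial>lborel) \<le> ennreal l2"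
      using L1[rule_format, of "2 * \<rho>"] \<rho> by (simp add: f2_def l2_def ennreal_mult ennreal_indicator)
    have int_g: "(\<integral>\<^sup>+x. ennreal (g x) \<partial>lborel) \<le> ennreal B"
      using L2 by (simp add: g_def ennreal_mult ennreal_indicator)
    have int_k: "(\<integral>\<^sup>+y. ennreal (k (x - y)) \<partial>lborel) \<le> ennreal KK" for x
      using C1(2)[of "8 * \<rho>"] \<rho>
      by (subst nn_integral_reflect_translate[of "\<lambda>z. ennreal (k z)"]) (auto simp: k_def KK_def ennreal_mult ennreal_indicator)
    have int_h: "(\<integral>\<^sup>+x. ennreal (h x) \<partial>lborel) \<le> ennreal T"
    proof -
      have "(\<integral>\<^sup>+x. ennreal (wt u x) * ennreal (norm x powr - (n + 2 * s)) * indicator {x. 4 * \<rho> \<le> norm x} x \<partial>lborel)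
        \<le> ennreal (2 powr ?\<sigma> / (1 - 2 powr (?\<sigma> - (n + 2 * s))) * (m * (4 * \<rho>) powr (?\<sigma> - (n + 2 * s))))"
        by (rule nn_integral_tail_le) (use \<rho> n_pos s m L1 in auto)
      also have "?\<sigma> - (n + 2 * s) = - ?\<sigma>" by simp
      also have "2 powr ?\<sigma> / (1 - 2 powr - ?\<sigma>) * (m * (4 * \<rho>) powr - ?\<sigma>) = T"
        using \<rho> by (simp only: T_def CT_def powr_mult) (simp only: mult_ac)
      finally show ?thesis by (simp add: h_def ennreal_mult ennreal_indicator)
    qed
    have "Xi \<rho> u \<le> (\<integral>\<^sup>+x. (\<integral>\<^sup>+y. ennreal (a x y) + ennreal (a y x) \<partial>lborel) \<partial>lborel)"
      unfolding Xi_def J_def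
      by (intro nn_integral_mono) (use pt a_nn in \<open>auto simp: ennreal_plus[symmetric] simp del: ennreal_plus intro!: ennreal_leI\<close>)
    also have "\<dots> = (\<integral>\<^sup>+x. (\<integral>\<^sup>+y. ennreal (a x y) \<partial>lborel) \<partial>lborel) + (\<integral>\<^sup>+x. (\<integral>\<^sup>+y. ennreal (a y x) \<partial>lborel) \<partial>lborel)"
      by (intro nn_integral_pair_add) measurable
    also have "(\<integral>\<^sup>+x. (\<integral>\<^sup>+y. ennreal (a y x) \<partial>lborel) \<partial>lborel) = (\<integral>\<^sup>+x. (\<integral>\<^sup>+y. ennreal (a x y) \<partial>lborel) \<partial>lborel)"
      by (rule nn_integral_pair(3)[symmetric]) measurable
    finally have Xi_le: "Xi \<rho> u \<le> (\<integral>\<^sup>+x. (\<integral>\<^sup>+y. ennreal (a x y) \<partial>lborel) \<partial>lborel) + (\<integral>\<^sup>+x. (\<integral>\<^sup>+y. ennreal (a x y) \<partial>lborel) \<partial>lborel)" .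
    have inner: "(\<integral>\<^sup>+y. ennreal (a x y) \<partial>lborel) \<le> ennreal (c1 * KK) * ennreal (g x) + ennreal (c2 * l) * ennreal (f1 x) + ennreal (c3 * T) * ennreal (f2 x)" for x
    proof -
      have "(\<integral>\<^sup>+y. ennreal (a x y) \<partial>lborel) = (\<integral>\<^sup>+y. ennreal (c1 * g x) * ennreal (k (x - y)) + ennreal (c2 * f1 x) * ennreal (f1 y) + ennreal (c3 * f2 x) * ennreal (h y) \<partial>lborel)"
        unfolding a_def using nn c by (intro nn_integral_cong) (simp add: ennreal_mult ennreal_plus mult.assoc)
      also have "\<dots> \<le> ennreal (c1 * g x * KK + c2 * f1 x * l + c3 * f2 x * T)"
        by (rule nn_integral_linear3_le) (use int_f1 int_h int_k[of x] pos nn c in auto)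
      also have "\<dots> = ennreal (c1 * KK) * ennreal (g x) + ennreal (c2 * l) * ennreal (f1 x) + ennreal (c3 * T) * ennreal (f2 x)"
        using nn c pos by (simp add: ennreal_mult[symmetric] ennreal_plus[symmetric] mult_ac del: ennreal_plus)
      finally show ?thesis .
    qed
    have "(\<integral>\<^sup>+x. (\<integral>\<^sup>+y. ennreal (a x y) \<partial>lborel) \<partial>lborel)
      \<le> (\<integral>\<^sup>+x. ennreal (c1 * KK) * ennreal (g x) + ennreal (c2 * l) * ennreal (f1 x) + ennreal (c3 * T) * ennreal (f2 x) \<partial>lborel)"
      by (intro nn_integral_mono inner)
    also have "\<dots> \<le> ennreal (c1 * KK * B + c2 * l * l + c3 * T * l2)"
      by (rule nn_integral_linear3_le) (use int_f1 int_f2 int_g pos B c in auto)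
    also have "c1 * KK * B + c2 * l * l + c3 * T * l2 = K1 * (\<rho> powr - (2 * s) * B) + K2 * m\<^sup>2"
    proof -
      have p1: "1 / \<rho>\<^sup>2 * \<rho> powr (2 - 2 * s) = \<rho> powr - (2 * s)"
        using \<rho> by (simp add: powr_diff powr_minus powr_numeral field_simps)
      have "c1 * KK = K1 * (1 / \<rho>\<^sup>2 * \<rho> powr (2 - 2 * s))"
        using \<rho> by (simp only: c1_def KK_def K1_def powr_mult) (simp only: mult_ac)
      then have e1: "c1 * KK * B = K1 * (\<rho> powr - (2 * s) * B)" unfolding p1 by (simp only: mult.assoc)
      have p2: "(1 / \<rho>) powr (n + 2 * s) * (\<rho> powr ?\<sigma> * \<rho> powr ?\<sigma>) = 1"
        using \<rho> unfolding powr_add[symmetric] by (simp add: powr_divide)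
      have "(L / \<rho>) powr (n + 2 * s) = L powr (n + 2 * s) * (1 / \<rho>) powr (n + 2 * s)"
        by (subst powr_mult[symmetric]) simp
      then have "c2 * l * l = cN * L powr (n + 2 * s) / 2 * (4 powr ?\<sigma>)\<^sup>2 * m\<^sup>2 * ((1 / \<rho>) powr (n + 2 * s) * (\<rho> powr ?\<sigma> * \<rho> powr ?\<sigma>))"
        using \<rho> by (simp only: c2_def l_def powr_mult power2_eq_square) (simp only: mult_ac times_divide_eq_left times_divide_eq_right)
      then have e2: "c2 * l * l = cN * L powr (n + 2 * s) / 2 * (4 powr ?\<sigma>)\<^sup>2 * m\<^sup>2" unfolding p2 by simp
      have p3: "\<rho> powr - ?\<sigma> * \<rho> powr ?\<sigma> = 1" using \<rho> by (simp add: powr_add[symmetric])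
      have "c3 * T * l2 = 2 powr (n + 2 * s) * CT * 2 powr ?\<sigma> * m\<^sup>2 * (\<rho> powr - ?\<sigma> * \<rho> powr ?\<sigma>)"
        using \<rho> by (simp only: c3_def T_def l2_def powr_mult power2_eq_square) (simp only: mult_ac)
      then have e3: "c3 * T * l2 = 2 powr (n + 2 * s) * CT * 2 powr ?\<sigma> * m\<^sup>2" unfolding p3 by simp
      show ?thesis unfolding e1 e2 e3 by (simp add: K2_def distrib_right)
    qed
    finally have I: "(\<integral>\<^sup>+x. (\<integral>\<^sup>+y. ennreal (a x y) \<partial>lborel) \<partial>lborel) \<le> ennreal (K1 * (\<rho> powr - (2 * s) * B) + K2 * m\<^sup>2)" .
    have bp: "0 \<le> \<rho> powr - (2 * s) * B" using B by simp
    have "Xi \<rho> u \<le> ennreal (K1 * (\<rho> powr - (2 * s) * B) + K2 * m\<^sup>2) + ennreal (K1 * (\<rho> powr - (2 * s) * B) + K2 * m\<^sup>2)"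
      by (rule order_trans[OF Xi_le add_mono[OF I I]])
    also have "\<dots> = ennreal (2 * (K1 * (\<rho> powr - (2 * s) * B) + K2 * m\<^sup>2))"
      using K bp by (intro ennreal_double) (auto intro!: add_nonneg_nonneg mult_nonneg_nonneg)
    also have "\<dots> \<le> ennreal (C * (m\<^sup>2 + \<rho> powr - (2 * s) * B))"
    proof (rule ennreal_leI)
      have "0 \<le> K1 * m\<^sup>2" "0 \<le> K2 * (\<rho> powr - (2 * s) * B)" using K bp by auto
      then show "2 * (K1 * (\<rho> powr - (2 * s) * B) + K2 * m\<^sup>2) \<le> C * (m\<^sup>2 + \<rho> powr - (2 * s) * B)"
        unfolding C_def distrib_left distrib_right by linarith
    qed
    finally show ?thesis .
  qed
  ultimately show ?thesis using that by blast
qed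

text \<open>A qualitative use of \<open>Xi_estimate\<close>: Sobolev's inequality gives the
  approximants L1 growth bounds and, by t^2 \<le> 1 + t^q, a crude L2 bound, both uniform in
  \<open>k\<close>. The resulting bound on energies is all that \<open>D_closed_bounded\<close> asks
  for.\<close>

lemma D_cutoff:
  assumes u: "u \<in> D" and \<rho>: "0 < \<rho>"
  shows "(\<lambda>x. \<chi>1 \<rho> x * u x) \<in> D" "(\<lambda>x. \<chi>2 \<rho> x * u x) \<in> D"
proof -
  obtain \<phi> where \<phi>: "\<And>k. \<phi> k \<in> test_functions" "AE x in lborel. (\<lambda>k. \<phi> k x) \<longlonglongrightarrow> u x"
    "\<And>k. Q (\<phi> k) \<le> 2 * Q u + ennreal 1" using D_approx[OF u, of 1] by auto
  obtain E0 where E0: "2 * Q u + ennreal 1 = ennreal E0" using D_energy_bound[OF u] .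
  define E where "E = max E0 1"
  have E: "E > 0" by (simp add: E_def)
  have QE: "Q (\<phi> k) \<le> ennreal E" for k
    using \<phi>(3)[of k] unfolding E0 by (rule order_trans) (simp add: E_def ennreal_leI)
  have [measurable]: "u \<in> borel_measurable borel" using u by (rule D_measurable)
  have \<phi>m [measurable]: "\<phi> k \<in> borel_measurable borel" for k by (rule test_functions_measurable[OF \<phi>(1)])
  obtain CS where CS: "CS > 0" "\<And>u E. u \<in> D \<Longrightarrow> 0 < E \<Longrightarrow> Q u \<le> ennreal E \<Longrightarrow>
    (\<integral>\<^sup>+x. ennreal (wt u x powr q) \<partial>lborel) \<le> ennreal (CS * E powr (q / 2))" using Sobolev by metis
  define S where "S = CS * E powr (q / 2)"
  have S: "S > 0" using CS E by (simp add: S_def)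
  have Sq: "(\<integral>\<^sup>+x. ennreal (wt (\<phi> k) x powr q) \<partial>lborel) \<le> ennreal S" for k
    unfolding S_def by (rule CS(2)[OF D_test[OF \<phi>(1)] E QE])
  define \<sigma> where "\<sigma> = S powr (1 / q)"
  have \<sigma>: "\<sigma> > 0" "\<sigma> powr q = S" using S q_pos by (auto simp: \<sigma>_def powr_powr)
  define m where "m = 2 * \<sigma> * unit_ball_vol n powr (1 / 2 + s / n)"
  have m: "m > 0" using \<sigma> V_pos by (simp add: m_def)
  have L1: "L1 (\<phi> k) r \<le> ennreal (m * r powr (n / 2 + s))" if "r \<ge> \<rho>" for k r
  proof -
    have r: "r > 0" using that \<rho> by simp
    have "L1 (\<phi> k) r \<le> ennreal (2 * \<sigma> * (unit_ball_vol n * r powr n) powr (1 / 2 + s / n))"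
      by (rule L1_set_le) (use \<sigma> Sq[of k] r V_pos in \<open>auto simp: emeasure_ball_n\<close>)
    also have "2 * \<sigma> * (unit_ball_vol n * r powr n) powr (1 / 2 + s / n) = m * r powr (n / 2 + s)"
    proof -
      have "n * (1 / 2 + s / n) = n / 2 + s" using n_pos by (simp add: field_simps)
      then show ?thesis by (simp only: m_def powr_mult powr_powr mult.assoc)
    qed
    finally show ?thesis .
  qed
  define B where "B = unit_ball_vol n * (4 * \<rho>) powr n + S"
  have B: "B \<ge> 0" using V_pos S by (simp add: B_def)
  have L2: "(\<integral>\<^sup>+x. ennreal ((wt (\<phi> k) x * cut \<rho> x ^ N)\<^sup>2) * indicator (ball 0 (4 * \<rho>)) x \<partial>lborel) \<le> ennreal B" for k
  proof -
    have pt: "(wt (\<phi> k) x * cut \<rho> x ^ N)\<^sup>2 \<le> 1 + wt (\<phi> k) x powr q" for x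
    proof -
      have "cut \<rho> x ^ N \<le> 1" using cut_bounds by (intro power_le_one) auto
      then have "wt (\<phi> k) x * cut \<rho> x ^ N \<le> wt (\<phi> k) x * 1" by (intro mult_left_mono) auto
      then have "(wt (\<phi> k) x * cut \<rho> x ^ N)\<^sup>2 \<le> (wt (\<phi> k) x)\<^sup>2"
        using cut_bounds[of \<rho> x] by (intro power_mono) auto
      also have "\<dots> \<le> 1 + wt (\<phi> k) x powr q"
      proof (cases "wt (\<phi> k) x \<le> 1")
        case True
        then show ?thesis by (simp add: power_le_one add_increasing2)
      next
        case False
        then have "(wt (\<phi> k) x)\<^sup>2 = wt (\<phi> k) x powr 2" by (simp add: powr_numeral)
        also have "\<dots> \<le> wt (\<phi> k) x powr q" using False q_gt_2 by (intro powr_mono) auto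
        finally show ?thesis by simp
      qed
      finally show ?thesis .
    qed
    have "(\<integral>\<^sup>+x. ennreal ((wt (\<phi> k) x * cut \<rho> x ^ N)\<^sup>2) * indicator (ball 0 (4 * \<rho>)) x \<partial>lborel)
      \<le> (\<integral>\<^sup>+x. ennreal 1 * indicator (ball 0 (4 * \<rho>)) x + ennreal 1 * ennreal (wt (\<phi> k) x powr q) \<partial>lborel)"
      by (intro nn_integral_mono) (use ennreal_leI[OF pt] in \<open>auto simp: indicator_def\<close>)
    also have "\<dots> \<le> ennreal (1 * (unit_ball_vol n * (4 * \<rho>) powr n) + 1 * S)"
      by (rule nn_integral_linear2_le) (use \<rho> V_pos S Sq[of k] in \<open>auto simp: emeasure_ball_n\<close>)
    finally show ?thesis by (simp add: B_def)
  qed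
  obtain CX where CX: "CX > 0" "\<And>u \<rho> m B. u \<in> borel_measurable borel \<Longrightarrow> 0 < \<rho> \<Longrightarrow> 0 < m \<Longrightarrow> 0 \<le> B \<Longrightarrow>
    (\<forall>r\<ge>\<rho>. L1 u r \<le> ennreal (m * r powr (n / 2 + s))) \<Longrightarrow>
    (\<integral>\<^sup>+x. ennreal ((wt u x * cut \<rho> x ^ N)\<^sup>2) * indicator (ball 0 (4 * \<rho>)) x \<partial>lborel) \<le> ennreal B \<Longrightarrow>
    Xi \<rho> u \<le> ennreal (CX * (m\<^sup>2 + \<rho> powr - (2 * s) * B))"
    by (rule Xi_estimate) (rule that, assumption, blast)
  define W where "W = CX * (m\<^sup>2 + \<rho> powr - (2 * s) * B)"
  have W: "W \<ge> 0" using CX B by (simp add: W_def)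
  have "Q (\<lambda>x. \<chi>1 \<rho> x * \<phi> k x) + Q (\<lambda>x. \<chi>2 \<rho> x * \<phi> k x) \<le> ennreal (E + 4 * W)" for k
  proof -
    have "Xi \<rho> (\<phi> k) \<le> ennreal W" unfolding W_def
      by (rule CX(2)[OF \<phi>m \<rho> m B _ L2]) (use L1 in auto)
    then have "Q (\<phi> k) + 4 * Xi \<rho> (\<phi> k) \<le> ennreal E + 4 * ennreal W"
      by (intro add_mono mult_left_mono QE) auto
    also have "\<dots> = ennreal (E + 4 * W)" using E W by (simp add: ennreal_mult)
    finally show ?thesis using IMS_localisation[OF \<phi>m, of \<rho> k] by (rule order_trans[rotated])
  qed
  note sum_le = this
  have le: "Q (\<lambda>x. \<chi>1 \<rho> x * \<phi> k x) \<le> ennreal (E + 4 * W)" "Q (\<lambda>x. \<chi>2 \<rho> x * \<phi> k x) \<le> ennreal (E + 4 * W)" for k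
    by (rule order_trans[OF _ sum_le[of k]], simp)+
  show "(\<lambda>x. \<chi>1 \<rho> x * u x) \<in> D"
  proof (rule D_closed_bounded[of "\<lambda>k x. \<chi>1 \<rho> x * \<phi> k x"])
    show "AE x in lborel. (\<lambda>k. \<chi>1 \<rho> x * \<phi> k x) \<longlonglongrightarrow> \<chi>1 \<rho> x * u x"
      using \<phi>(2) by eventually_elim (intro tendsto_intros)
  qed (use le in \<open>auto intro!: test_functions_mult \<phi> C_order_\<chi>\<close>)
  show "(\<lambda>x. \<chi>2 \<rho> x * u x) \<in> D"
  proof (rule D_closed_bounded[of "\<lambda>k x. \<chi>2 \<rho> x * \<phi> k x"])
    show "AE x in lborel. (\<lambda>k. \<chi>2 \<rho> x * \<phi> k x) \<longlonglongrightarrow> \<chi>2 \<rho> x * u x"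
      using \<phi>(2) by eventually_elim (intro tendsto_intros)
  qed (use le in \<open>auto intro!: test_functions_mult \<phi> C_order_\<chi>\<close>)
qed

end

section \<open>The exterior estimate\<close>

text \<open>If q > m^2, then m^2 \<le> m^\<theta> q^(1-\<theta>/2), so after absorbing q/4
  everything is bounded by that power. Dividing by q^(1-\<theta>/2) leaves q^(\<theta>/2) \<le> 3K
  m^\<theta>.\<close>

lemma absorb_power:
  fixes e m \<theta> K q :: real
  assumes "0 < m" "0 < \<theta>" "\<theta> \<le> 2" "0 < K" and le: "q \<le> K * (m\<^sup>2 + m powr \<theta> * (max q (m\<^sup>2)) powr (1 - \<theta> / 2)) + max q (m\<^sup>2) / 4"
  shows "max q (m\<^sup>2) \<le> max 1 ((3 * K) powr (2 / \<theta>)) * m\<^sup>2"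
proof (cases "q \<le> m\<^sup>2")
  case True
  then have "max q (m\<^sup>2) = 1 * m\<^sup>2" by simp
  also have "\<dots> \<le> max 1 ((3 * K) powr (2 / \<theta>)) * m\<^sup>2" by (intro mult_right_mono) auto
  finally show ?thesis .
next
  case False
  then have mx: "max q (m\<^sup>2) = q" and q: "0 < q" "m\<^sup>2 \<le> q" using \<open>0 < m\<close> by (auto simp: less_trans[of 0 "m\<^sup>2"])
  let ?p = "q powr (1 - \<theta> / 2)"
  have m2: "m\<^sup>2 = m powr 2" using \<open>0 < m\<close> by (simp add: powr_numeral)
  have "m\<^sup>2 = m powr \<theta> * (m\<^sup>2) powr (1 - \<theta> / 2)"
    unfolding m2 powr_powr powr_add[symmetric] by (simp add: algebra_simps)
  also have "\<dots> \<le> m powr \<theta> * ?p" using q \<open>\<theta> \<le> 2\<close> by (intro mult_left_mono powr_mono2) auto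
  finally have "K * (m\<^sup>2 + m powr \<theta> * ?p) \<le> K * (m powr \<theta> * ?p + m powr \<theta> * ?p)"
    using \<open>0 < K\<close> by (intro mult_left_mono) auto
  then have q2: "q \<le> 2 * (K * (m powr \<theta> * ?p)) + q / 4" using le unfolding mx by (simp add: algebra_simps)
  have "q \<le> 3 * K * m powr \<theta> * ?p"
  proof -
    have "0 \<le> K * (m powr \<theta> * ?p)" using \<open>0 < K\<close> by simp
    with q2 have "q \<le> 3 * (K * (m powr \<theta> * ?p))" by linarith
    then show ?thesis by (simp only: mult.assoc)
  qed
  moreover have "q = q powr (\<theta> / 2) * ?p" using q unfolding powr_add[symmetric] by simp
  ultimately have "q powr (\<theta> / 2) \<le> 3 * K * m powr \<theta>"
    using q by (metis mult_le_cancel_right_pos powr_gt_zero less_irrefl)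
  then have "(q powr (\<theta> / 2)) powr (2 / \<theta>) \<le> (3 * K * m powr \<theta>) powr (2 / \<theta>)"
    using \<open>0 < \<theta>\<close> by (intro powr_mono2) auto
  then have "q \<le> (3 * K) powr (2 / \<theta>) * m\<^sup>2"
    using q \<open>0 < \<theta>\<close> \<open>0 < K\<close> \<open>0 < m\<close> unfolding m2 by (simp add: powr_powr powr_mult)
  also have "\<dots> \<le> max 1 ((3 * K) powr (2 / \<theta>)) * m\<^sup>2" by (intro mult_right_mono) auto
  finally show ?thesis unfolding mx .
qed

lemma powr_mult_le_sum:
  fixes a b \<mu> \<nu> :: real
  assumes "0 \<le> a" "0 \<le> b" "0 \<le> \<mu>" "0 \<le> \<nu>" "\<mu> + \<nu> \<le> 1"
  shows "a powr \<mu> * b powr \<nu> \<le> 1 + a + b"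
proof -
  let ?M = "1 + a + b"
  have M: "1 \<le> ?M" using assms by simp
  have "a powr \<mu> * b powr \<nu> \<le> ?M powr \<mu> * ?M powr \<nu>"
    using assms by (intro mult_mono powr_mono2) auto
  also have "\<dots> = ?M powr (\<mu> + \<nu>)" by (simp add: powr_add)
  also have "\<dots> \<le> ?M powr 1" using M assms by (intro powr_mono) auto
  finally show ?thesis using M by simp
qed

lemma powr_mult_le_sum':
  fixes a b \<mu> \<nu> :: real
  assumes "0 \<le> a" "0 \<le> b" "0 \<le> \<mu>" "0 \<le> \<nu>" "\<mu> + \<nu> = 1"
  shows "a powr \<mu> * b powr \<nu> \<le> a + b"
proof (cases "a + b = 0")
  case False
  have "a powr \<mu> * b powr \<nu> \<le> (a + b) powr \<mu> * (a + b) powr \<nu>"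
    using assms by (intro mult_mono powr_mono2) auto
  also have "\<dots> = a + b" using False assms by (simp add: powr_add[symmetric])
  finally show ?thesis .
qed (use assms in \<open>auto simp: add_nonneg_eq_0_iff\<close>)

section \<open>The weighted p-norm and the optimal constant\<close>

locale ckn = fractional_energy dim n s \<alpha> for dim :: "'n::finite itself" and n s \<alpha> :: real +
  fixes p \<beta> :: real
  assumes p: "2 < p" "p < 2 * n / (n - 2 * s)" and \<beta>: "\<beta> - \<alpha> = s - n * (1 / 2 - 1 / p)"
begin

definition bw :: "(real ^ 'n \<Rightarrow> real) \<Rightarrow> real ^ 'n \<Rightarrow> real" where "bw u x = \<bar>u x\<bar> * norm x powr - \<beta>"

definition Ip :: "(real ^ 'n \<Rightarrow> real) \<Rightarrow> ennreal" where "Ip u = (\<integral>\<^sup>+x. ennreal (bw u x powr p) \<partial>lborel)"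

definition \<Lambda> :: ennreal where "\<Lambda> = CKN_const TYPE('n) s p \<alpha> \<beta>"

lemma bw_nonneg [simp]: "0 \<le> bw u x" by (simp add: bw_def)

lemma bw_measurable [measurable (raw)]:
  assumes [measurable]: "u \<in> borel_measurable borel" shows "bw u \<in> borel_measurable borel"
  unfolding bw_def by measurable

lemma p_lt_q: "p < q" using p by (simp add: q_def)

lemma Lp_norm_eq: "Lp_norm p UNIV (\<lambda>x. u x * norm x powr - \<beta>) = (if Ip u = \<infinity> then \<infinity> else ennreal (enn2real (Ip u) powr (1 / p)))"
  by (simp add: Lp_norm_def Ip_def bw_def nn_integral_completion abs_mult Let_def)

lemma Lp_norm_square: "(Lp_norm p UNIV (\<lambda>x. u x * norm x powr - \<beta>))\<^sup>2 = (if Ip u = \<infinity> then \<infinity> else ennreal (enn2real (Ip u) powr (2 / p)))"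
proof (cases "Ip u = \<infinity>")
  case False
  have "(enn2real (Ip u) powr (1 / p))\<^sup>2 = enn2real (Ip u) powr (2 / p)"
    by (simp add: power2_eq_square powr_add[symmetric])
  with False show ?thesis by (simp add: Lp_norm_eq ennreal_power)
qed (simp add: Lp_norm_eq power2_eq_square ennreal_top_mult)

text \<open>Multiplication commutes with suprema in \<open>ennreal\<close>, so the supremum of the
  admissible constants is itself admissible.\<close>

lemma \<Lambda>_le: "u \<in> D \<Longrightarrow> \<Lambda> * (Lp_norm p UNIV (\<lambda>x. u x * norm x powr - \<beta>))\<^sup>2 \<le> Q u"
proof -
  assume u: "u \<in> D"
  define S where "S = {L. \<forall>u \<in> (D_space s \<alpha> :: (real ^ 'n \<Rightarrow> real) set).
     L * (Lp_norm p UNIV (\<lambda>x. u x * norm x powr - \<beta>))\<^sup>2 \<le> D_norm_sq s \<alpha> u}"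
  have "\<Lambda> * (Lp_norm p UNIV (\<lambda>x. u x * norm x powr - \<beta>))\<^sup>2 = (SUP L\<in>S. (Lp_norm p UNIV (\<lambda>x. u x * norm x powr - \<beta>))\<^sup>2 * L)"
    unfolding \<Lambda>_def CKN_const_def S_def[symmetric] SUP_mult_left_ennreal[symmetric] by (simp add: mult.commute)
  also have "\<dots> \<le> Q u"
  proof (rule SUP_least)
    fix L assume "L \<in> S"
    then show "(Lp_norm p UNIV (\<lambda>x. u x * norm x powr - \<beta>))\<^sup>2 * L \<le> Q u"
      using D_imp_D_space[OF u] by (auto simp: S_def D_norm_sq_eq mult.commute)
  qed
  finally show ?thesis .
qed

text \<open>The plateau function has finite energy and a nonzero weighted norm.\<close>

lemma \<Lambda>_finite: "\<Lambda> < \<infinity>"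
proof (rule ccontr)
  assume "\<not> \<Lambda> < \<infinity>"
  then have top: "\<Lambda> = \<infinity>" by (metis infinity_ennreal_def top.not_eq_extremum)
  let ?\<eta> = "plateau 1 :: real ^ 'n \<Rightarrow> real"
  have \<eta>: "?\<eta> \<in> test_functions" by (rule plateau_test) simp
  have [measurable]: "?\<eta> \<in> borel_measurable borel" by (rule test_functions_measurable[OF \<eta>])
  have "Ip ?\<eta> \<noteq> 0"
  proof
    assume "Ip ?\<eta> = 0"
    then have "AE x in lborel. ennreal (bw ?\<eta> x powr p) = 0"
      unfolding Ip_def by (subst (asm) nn_integral_0_iff_AE) auto
    then have "AE x in lborel. x \<notin> ball (0 :: real ^ 'n) 1"
      using AE_nonzero
    proof eventually_elim
      case (elim x)
      show ?case
      proof
        assume "x \<in> ball 0 1"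
        then have "plateau 1 x = 1" by (intro plateau_eq_1) auto
        then have "bw ?\<eta> x > 0" using elim(2) by (simp add: bw_def)
        then show False using elim(1) by (simp add: ennreal_eq_0_iff)
      qed
    qed
    then have "emeasure lborel (ball (0 :: real ^ 'n) 1) = 0" by (subst (asm) AE_iff_measurable[of "ball 0 1"]) auto
    then show False using V_pos by (simp add: emeasure_ball_n)
  qed
  then have "(Lp_norm p UNIV (\<lambda>x. ?\<eta> x * norm x powr - \<beta>))\<^sup>2 \<noteq> 0"
    by (cases "Ip ?\<eta>") (auto simp: Lp_norm_square ennreal_eq_0_iff)
  then have "\<Lambda> * (Lp_norm p UNIV (\<lambda>x. ?\<eta> x * norm x powr - \<beta>))\<^sup>2 = \<infinity>"
    by (simp add: top ennreal_top_mult)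
  then show False using \<Lambda>_le[OF D_test[OF \<eta>]] Q_test_finite[OF \<eta>] by (simp add: top_unique)
qed

definition lam :: real where "lam = enn2real \<Lambda>"

lemma \<Lambda>_eq: "\<Lambda> = ennreal lam" and lam_nonneg: "0 \<le> lam"
  using \<Lambda>_finite by (simp_all add: lam_def)

text \<open>Positivity of \<open>lam\<close> is what makes the weighted norm finite: with
  \<open>lam = 0\<close> an infinite norm would be consistent with \<open>\<Lambda>_le\<close>, as
  \<open>0 * \<infinity> = 0\<close> in \<open>ennreal\<close>.\<close>

lemma lam_Ip_le:
  assumes "u \<in> D" "0 < lam" "Q u \<le> ennreal E" "0 \<le> E"
  obtains X where "0 \<le> X" "Ip u = ennreal X" "lam * X powr (2 / p) \<le> E"
proof -
  have le: "ennreal lam * (Lp_norm p UNIV (\<lambda>x. u x * norm x powr - \<beta>))\<^sup>2 \<le> ennreal E"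
    using \<Lambda>_le[OF assms(1)] assms(3) unfolding \<Lambda>_eq by (rule order_trans)
  have "Ip u \<noteq> \<infinity>"
  proof
    assume "Ip u = \<infinity>"
    then have "ennreal lam * (Lp_norm p UNIV (\<lambda>x. u x * norm x powr - \<beta>))\<^sup>2 = \<infinity>"
      using assms(2) by (simp add: Lp_norm_square ennreal_mult_top)
    then show False using le by (simp add: top_unique)
  qed
  then obtain X where X: "0 \<le> X" "Ip u = ennreal X" by (cases "Ip u") auto
  have "ennreal (lam * X powr (2 / p)) \<le> ennreal E"
    using le X by (simp add: Lp_norm_square ennreal_mult lam_nonneg)
  then have "lam * X powr (2 / p) \<le> E" using assms(4) by (subst (asm) ennreal_le_iff) auto
  with X that show ?thesis by blast
qed

text \<open>With \<open>F = wt u x * norm x powr (n / 2 - s)\<close>, all norms involved are those of \<open>F\<close> in some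
  \<open>L\<^sup>r(norm x powr - n)\<close>: \<open>r = 2\<close> is Hardy, \<open>r = q\<close> is Sobolev, and \<open>r = 2 + 2 * s / n\<close> is small by
  \<open>hedberg\<close>. Hence so is \<open>r = p\<close>.\<close>

lemma exterior_Ip_small:
  assumes \<epsilon>: "0 < \<epsilon>" and E0: "0 < E0"
  obtains m0 where "m0 > 0" "\<And>u \<rho> m. u \<in> D \<Longrightarrow> Q u \<le> ennreal E0 \<Longrightarrow> 0 < \<rho> \<Longrightarrow> 0 < m \<Longrightarrow> m \<le> m0 \<Longrightarrow>
    (\<forall>r\<ge>\<rho>. L1 u r \<le> ennreal (m * r powr (n / 2 + s))) \<Longrightarrow>
    (\<integral>\<^sup>+x. ennreal (bw u x powr p) * indicator {x. \<rho> \<le> norm x} x \<partial>lborel) \<le> ennreal \<epsilon>"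
proof -
  obtain CH where CH: "CH > 0" "\<And>u E. u \<in> D \<Longrightarrow> 0 < E \<Longrightarrow> Q u \<le> ennreal E \<Longrightarrow> H u \<le> ennreal (CH * E)"
    using Hardy by metis
  obtain CS where CS: "CS > 0" "\<And>u E. u \<in> D \<Longrightarrow> 0 < E \<Longrightarrow> Q u \<le> ennreal E \<Longrightarrow>
    (\<integral>\<^sup>+x. ennreal (wt u x powr q) \<partial>lborel) \<le> ennreal (CS * E powr (q / 2))" using Sobolev by metis
  obtain C0 where C0: "C0 > 0" "\<And>u x A. u \<in> borel_measurable borel \<Longrightarrow> x \<noteq> 0 \<Longrightarrow> 0 < A \<Longrightarrow>
    (\<forall>r. 0 < r \<longrightarrow> r \<le> norm x / 2 \<longrightarrow> (\<integral>\<^sup>+y. ennreal (wt u y powr 1) * indicator (ball x r) y \<partial>lborel) \<le> ennreal A) \<Longrightarrow>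
    ennreal (wt u x powr (2 + 2 * s * 1 / n)) \<le> ennreal (C0 * A powr (2 * s / n)) * G u x"
    by (rule hedberg[OF zero_less_one]) (rule that, assumption, blast)
  let ?\<sigma> = "n / 2 + s"
  define q0 where "q0 = 2 + 2 * s / n"
  have pp: "0 < p - 2" "0 < q - p" using p p_lt_q by auto
  define A1 where "A1 = CH * E0"
  define A2 where "A2 = CS * E0 powr (q / 2)"
  have A: "A1 > 0" "A2 > 0" using CH CS E0 by (auto simp: A1_def A2_def)
  \<comment> \<open>Each of the ranges F \<le> a, F \<ge> b and a < F < b is to contribute at most
    \<epsilon>/3. The Hardy bound \<open>A1\<close> dictates \<open>a\<close>, the Sobolev bound
    \<open>A2\<close> dictates \<open>b\<close>, and the middle range then dictates
    \<open>m0\<close>.\<close>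
  define a where "a = (\<epsilon> / (3 * A1)) powr (1 / (p - 2))"
  define b where "b = (\<epsilon> / (3 * A2)) powr - (1 / (q - p))"
  have ab: "a > 0" "b > 0" using A \<epsilon> by (auto simp: a_def b_def)
  have a_eq: "a powr (p - 2) = \<epsilon> / (3 * A1)" using A \<epsilon> pp by (simp add: a_def powr_powr)
  have b_eq: "b powr (p - q) = \<epsilon> / (3 * A2)"
  proof -
    have "- (1 / (q - p)) * (p - q) = 1" using pp by (simp add: field_simps)
    then show ?thesis using A \<epsilon> by (simp only: b_def powr_powr) simp
  qed
  \<comment> \<open>The exponent p may lie on either side of q0; between the thresholds F^(p - q0)
    is at most its larger endpoint value.\<close>
  define c where "c = max (a powr (p - q0)) (b powr (p - q0))"
  have c: "c > 0" using ab by (simp add: c_def less_max_iff_disj)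
  define A3 where "A3 = c * (C0 * 2 powr (?\<sigma> * (2 * s / n))) * ((1 + CH) * E0)"
  have A3: "A3 > 0" using c C0 CH E0 by (simp add: A3_def)
  define m0 where "m0 = (\<epsilon> / (3 * A3)) powr (n / (2 * s))"
  have m0: "m0 > 0" "m0 powr (2 * s / n) = \<epsilon> / (3 * A3)" using A3 \<epsilon> s n_pos by (auto simp: m0_def powr_powr)
  have "(\<integral>\<^sup>+x. ennreal (bw u x powr p) * indicator {x. \<rho> \<le> norm x} x \<partial>lborel) \<le> ennreal \<epsilon>"
    if u: "u \<in> D" "Q u \<le> ennreal E0" and \<rho>: "0 < \<rho>" and m: "0 < m" "m \<le> m0"
      and L1: "\<forall>r\<ge>\<rho>. L1 u r \<le> ennreal (m * r powr (n / 2 + s))" for u \<rho> m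
  proof -
    have [measurable]: "u \<in> borel_measurable borel" by (rule D_measurable[OF u(1)])
    define M where "M = C0 * 2 powr (?\<sigma> * (2 * s / n)) * m powr (2 * s / n)"
    have M: "M > 0" using C0 m by (simp add: M_def)
    have pt: "ennreal (bw u x powr p) \<le> ennreal (a powr (p - 2)) * ennreal ((u x)\<^sup>2 * norm x powr - (2 * s + 2 * \<alpha>))
        + ennreal (b powr (p - q)) * ennreal (wt u x powr q) + ennreal (c * M) * G u x" if x: "\<rho> \<le> norm x" for x
    proof -
      have x0: "norm x > 0" using x \<rho> by linarith
      then have xn: "x \<noteq> 0" by auto
      define F where "F = wt u x * norm x powr (n / 2 - s)"
      have F: "0 \<le> F" by (simp add: F_def)
      have F_pow: "F powr r * norm x powr - n = wt u x powr r * norm x powr ((n / 2 - s) * r - n)" for r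
        unfolding F_def powr_mult powr_powr mult.assoc powr_add[symmetric] by simp
      have "bw u x = wt u x * norm x powr (\<alpha> - \<beta>)"
        unfolding bw_def wt_def mult.assoc powr_add[symmetric] by simp
      then have "bw u x powr p = wt u x powr p * norm x powr ((\<alpha> - \<beta>) * p)"
        by (simp only: powr_mult powr_powr)
      also have "(\<alpha> - \<beta>) * p = (n / 2 - s) * p - n"
      proof -
        have "\<alpha> - \<beta> = n * (1 / 2 - 1 / p) - s" using \<beta> by simp
        then show ?thesis using p by (simp add: field_simps)
      qed
      finally have bF: "bw u x powr p = F powr p * norm x powr - n" unfolding F_pow .
      have F2: "(u x)\<^sup>2 * norm x powr - (2 * s + 2 * \<alpha>) = F powr 2 * norm x powr - n"
      proof -
        have e2: "(n / 2 - s) * 2 - n = - (2 * s)" by simp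
        have "F powr 2 * norm x powr - n = (wt u x)\<^sup>2 * norm x powr - (2 * s)"
          unfolding F_pow e2 by (simp add: powr_numeral)
        also have "\<dots> = (u x)\<^sup>2 * (norm x powr - (2 * \<alpha>) * norm x powr - (2 * s))" by (simp add: wt_power2)
        also have "norm x powr - (2 * \<alpha>) * norm x powr - (2 * s) = norm x powr - (2 * s + 2 * \<alpha>)"
          unfolding powr_add[symmetric] by (simp add: algebra_simps)
        finally show ?thesis by simp
      qed
      have Fq: "wt u x powr q = F powr q * norm x powr - n"
      proof -
        have "(n / 2 - s) * q - n = 0" using s by (simp add: q_def field_simps)
        then show ?thesis unfolding F_pow using x0 by simp
      qed
      have FG: "ennreal (F powr q0 * norm x powr - n) \<le> ennreal M * G u x"
      proof -
        \<comment> \<open>Balls around \<open>x\<close> of radius at most |x|/2 lie in the ball of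
          radius 2|x| \<ge> \<rho> around the origin, where the growth hypothesis applies.\<close>
        define B where "B = m * (2 * norm x) powr ?\<sigma>"
        have B: "B > 0" using m x0 by (simp add: B_def)
        have "ennreal (wt u x powr q0) \<le> ennreal (C0 * B powr (2 * s / n)) * G u x"
          unfolding q0_def
        proof (rule C0(2)[OF _ xn B, simplified mult_1_right], measurable, intro allI impI)
          fix r :: real assume r: "0 < r" "r \<le> norm x / 2"
          have "ball x r \<subseteq> ball 0 (2 * norm x)"
          proof
            fix y assume "y \<in> ball x r"
            then have "norm y < 2 * norm x" using r norm_triangle_ineq2[of y x] by (auto simp: dist_norm norm_minus_commute)
            then show "y \<in> ball 0 (2 * norm x)" by simp
          qed
          then have "(\<integral>\<^sup>+y. ennreal (wt u y powr 1) * indicator (ball x r) y \<partial>lborel) \<le> L1 u (2 * norm x)"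
            by (intro nn_integral_mono) (auto simp: indicator_def)
          also have "\<dots> \<le> ennreal B" unfolding B_def using L1[rule_format, of "2 * norm x"] x x0 by simp
          finally show "(\<integral>\<^sup>+y. ennreal (wt u y powr 1) * indicator (ball x r) y \<partial>lborel) \<le> ennreal B" .
        qed
        then have "ennreal (norm x powr ((n / 2 - s) * q0 - n)) * ennreal (wt u x powr q0)
          \<le> ennreal (norm x powr ((n / 2 - s) * q0 - n)) * (ennreal (C0 * B powr (2 * s / n)) * G u x)"
          by (rule mult_left_mono) simp
        also have "\<dots> = ennreal (norm x powr ((n / 2 - s) * q0 - n) * (C0 * B powr (2 * s / n))) * G u x"
          using C0 by (simp add: ennreal_mult mult.assoc)
        also have "norm x powr ((n / 2 - s) * q0 - n) * (C0 * B powr (2 * s / n)) = M"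
        proof -
          let ?e = "?\<sigma> * (2 * s / n)"
          have e: "(n / 2 - s) * q0 - n = - ?e" using n_pos by (simp add: q0_def field_simps power2_eq_square)
          have "norm x powr - ?e * (C0 * B powr (2 * s / n))
            = norm x powr - ?e * (C0 * (m powr (2 * s / n) * (2 powr ?e * norm x powr ?e)))"
            by (simp only: B_def powr_mult powr_powr)
          also have "\<dots> = C0 * 2 powr ?e * m powr (2 * s / n) * (norm x powr - ?e * norm x powr ?e)"
            by (simp only: mult_ac)
          also have "norm x powr - ?e * norm x powr ?e = 1"
            using x0 unfolding powr_add[symmetric] by simp
          finally show ?thesis unfolding e M_def by simp
        qed
        finally show ?thesis unfolding F_pow by (simp add: ennreal_mult[symmetric] mult.commute)
      qed
      consider "F \<le> a" | "b \<le> F" | "a < F" "F < b" by linarith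
      then show ?thesis
      proof cases
        case 1
        have "F powr p = F powr (p - 2) * F powr 2" by (simp add: powr_add[symmetric])
        also have "\<dots> \<le> a powr (p - 2) * F powr 2" using 1 F pp by (intro mult_right_mono powr_mono2) auto
        finally have "bw u x powr p \<le> a powr (p - 2) * ((u x)\<^sup>2 * norm x powr - (2 * s + 2 * \<alpha>))"
          unfolding bF F2 mult.assoc[symmetric] by (rule mult_right_mono) simp
        then have "ennreal (bw u x powr p) \<le> ennreal (a powr (p - 2)) * ennreal ((u x)\<^sup>2 * norm x powr - (2 * s + 2 * \<alpha>))"
          by (subst ennreal_mult[symmetric]) (auto intro: ennreal_leI)
        then show ?thesis by (intro add_increasing2) auto
      next
        case 2
        have "F powr p = F powr (p - q) * F powr q" by (simp add: powr_add[symmetric])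
        also have "\<dots> \<le> b powr (p - q) * F powr q" using 2 F pp ab by (intro mult_right_mono powr_mono2') auto
        finally have "bw u x powr p \<le> b powr (p - q) * wt u x powr q"
          unfolding bF Fq mult.assoc[symmetric] by (rule mult_right_mono) simp
        then have "ennreal (bw u x powr p) \<le> ennreal (b powr (p - q)) * ennreal (wt u x powr q)"
          by (subst ennreal_mult[symmetric]) (auto intro: ennreal_leI)
        then show ?thesis by (intro add_increasing2[OF _ add_increasing]) auto
      next
        case 3
        have "F powr (p - q0) \<le> c"
        proof (cases "p \<ge> q0")
          case True
          have "F powr (p - q0) \<le> b powr (p - q0)" using 3 F True by (intro powr_mono2) auto
          then show ?thesis by (simp add: c_def le_max_iff_disj)
        next
          case False
          have "F powr (p - q0) \<le> a powr (p - q0)" using 3 ab False by (intro powr_mono2') auto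
          then show ?thesis by (simp add: c_def le_max_iff_disj)
        qed
        moreover have "F powr p = F powr (p - q0) * F powr q0" by (simp add: powr_add[symmetric])
        ultimately have "F powr p \<le> c * F powr q0" by (simp add: mult_right_mono)
        then have "bw u x powr p \<le> c * (F powr q0 * norm x powr - n)"
          unfolding bF mult.assoc[symmetric] by (rule mult_right_mono) simp
        then have "ennreal (bw u x powr p) \<le> ennreal c * ennreal (F powr q0 * norm x powr - n)"
          using c by (subst ennreal_mult[symmetric]) (auto intro: ennreal_leI)
        also have "\<dots> \<le> ennreal c * (ennreal M * G u x)" by (rule mult_left_mono[OF FG]) simp
        also have "\<dots> = ennreal (c * M) * G u x" using c M by (simp add: ennreal_mult mult.assoc)
        finally show ?thesis by (intro add_increasing) auto
      qed
    qed
    have GE: "(\<integral>\<^sup>+x. G u x \<partial>lborel) \<le> ennreal ((1 + CH) * E0)"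
    proof -
      have "Q u + H u \<le> ennreal E0 + ennreal (CH * E0)" by (intro add_mono u CH E0)
      also have "\<dots> = ennreal ((1 + CH) * E0)"
        using E0 CH by (subst ennreal_plus[symmetric]) (auto simp: distrib_right)
      finally show ?thesis by (simp add: nn_integral_G)
    qed
    have "(\<integral>\<^sup>+x. ennreal (bw u x powr p) * indicator {x. \<rho> \<le> norm x} x \<partial>lborel)
      \<le> (\<integral>\<^sup>+x. ennreal (a powr (p - 2)) * ennreal ((u x)\<^sup>2 * norm x powr - (2 * s + 2 * \<alpha>))
        + ennreal (b powr (p - q)) * ennreal (wt u x powr q) + ennreal (c * M) * G u x \<partial>lborel)"
      by (intro nn_integral_mono) (use pt in \<open>auto simp: indicator_def\<close>)
    also have "\<dots> \<le> ennreal (a powr (p - 2) * A1 + b powr (p - q) * A2 + c * M * ((1 + CH) * E0))"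
    proof (rule nn_integral_linear3_le)
      show "(\<integral>\<^sup>+x. ennreal ((u x)\<^sup>2 * norm x powr - (2 * s + 2 * \<alpha>)) \<partial>lborel) \<le> ennreal A1"
        using CH(2)[OF u(1) E0 u(2)] by (simp add: H_def A1_def)
      show "(\<integral>\<^sup>+x. ennreal (wt u x powr q) \<partial>lborel) \<le> ennreal A2"
        using CS(2)[OF u(1) E0 u(2)] by (simp add: A2_def)
    qed (use GE A c M CH E0 in auto)
    also have "\<dots> \<le> ennreal \<epsilon>"
    proof (rule ennreal_leI)
      have "c * M * ((1 + CH) * E0) = A3 * m powr (2 * s / n)" by (simp add: A3_def M_def)
      also have "\<dots> \<le> A3 * m0 powr (2 * s / n)" using A3 m s n_pos by (intro mult_left_mono powr_mono2) auto
      also have "\<dots> = \<epsilon> / 3" unfolding m0(2) using A3 by simp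
      finally have 3: "c * M * ((1 + CH) * E0) \<le> \<epsilon> / 3" .
      have "a powr (p - 2) * A1 = \<epsilon> / 3" "b powr (p - q) * A2 = \<epsilon> / 3" unfolding a_eq b_eq using A by auto
      with 3 show "a powr (p - 2) * A1 + b powr (p - q) * A2 + c * M * ((1 + CH) * E0) \<le> \<epsilon>" by linarith
    qed
    finally show ?thesis .
  qed
  with m0(1) that show ?thesis by blast
qed

end

lemma ennreal_linear2:
  "0 \<le> a \<Longrightarrow> 0 \<le> b \<Longrightarrow> 0 \<le> x \<Longrightarrow> 0 \<le> y \<Longrightarrow> ennreal (a * x + b * y) = ennreal a * ennreal x + ennreal b * ennreal y"
  by (simp add: ennreal_plus ennreal_mult)

context ckn
begin

text \<open>The solution of (N + 1)(2 - \<theta>) = 2N, so that (f c^N)^2 = f^\<theta> (f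
  c^(N+1))^(2-\<theta>).\<close>

definition \<theta> :: real where "\<theta> = 2 / real (Suc N)"

lemma \<theta>: "0 < \<theta>" "\<theta> \<le> 1" "\<theta> + (2 - \<theta>) / q \<le> 1"
proof -
  show "0 < \<theta>" by (simp add: \<theta>_def)
  show "\<theta> \<le> 1" using N_ge(3) by (simp add: \<theta>_def)
  have "(n + 2 * s) / (2 * s) \<le> real (Suc N)" using N_ge(2) by simp
  then have "n + 2 * s \<le> real (Suc N) * (2 * s)" using s by (simp add: pos_divide_le_eq)
  then have "\<theta> * (n + 2 * s) \<le> 2 * (2 * s)"
    unfolding \<theta>_def by (simp add: pos_divide_le_eq mult.commute)
  moreover have "\<theta> + (2 - \<theta>) / q = (\<theta> * (n + 2 * s) + 2 * (n - 2 * s)) / (2 * n)"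
    using s n_pos by (simp add: q_def field_simps)
  ultimately show "\<theta> + (2 - \<theta>) / q \<le> 1" using n_pos by (simp add: pos_divide_le_eq)
qed

text \<open>Here c = \<open>cut \<rho> x\<close> and f = \<open>wt u x\<close>, and f c^(N+1) is at
  most the weighted value of \<open>\<chi>2 u\<close>. So the integrand is f^\<theta> times a power
  2 - \<theta> of a function with known L^q norm. As \<theta> + (2 - \<theta>)/q \<le> 1,
  \<open>powr_mult_le_sum\<close> splits it, the bounded region supplying the missing
  exponent.\<close>

lemma cutoff_L2_bound:
  obtains C where "C > 0" "\<And>u \<rho> m S. u \<in> borel_measurable borel \<Longrightarrow> 0 < \<rho> \<Longrightarrow> 0 < m \<Longrightarrow> 0 < S \<Longrightarrow>
    L1 u (4 * \<rho>) \<le> ennreal (m * (4 * \<rho>) powr (n / 2 + s)) \<Longrightarrow>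
    (\<integral>\<^sup>+x. ennreal (wt (\<lambda>x. \<chi>2 \<rho> x * u x) x powr q) \<partial>lborel) \<le> ennreal (S powr q) \<Longrightarrow>
    (\<integral>\<^sup>+x. ennreal ((wt u x * cut \<rho> x ^ N)\<^sup>2) * indicator (ball 0 (4 * \<rho>)) x \<partial>lborel)
      \<le> ennreal (C * (m powr \<theta> * S powr (2 - \<theta>)) * \<rho> powr (2 * s))"
proof -
  let ?\<sigma> = "n / 2 + s" and ?h = "n / 2 - s" and ?V = "unit_ball_vol n"
  define C where "C = ?V * 4 powr n + 4 powr ?\<sigma> + 1"
  have C: "C > 0" using V_pos by (simp add: C_def add_pos_pos)
  have "(\<integral>\<^sup>+x. ennreal ((wt u x * cut \<rho> x ^ N)\<^sup>2) * indicator (ball 0 (4 * \<rho>)) x \<partial>lborel)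
      \<le> ennreal (C * (m powr \<theta> * S powr (2 - \<theta>)) * \<rho> powr (2 * s))"
    if [measurable]: "u \<in> borel_measurable borel" and \<rho>: "0 < \<rho>" and m: "0 < m" and S: "0 < S"
      and L1: "L1 u (4 * \<rho>) \<le> ennreal (m * (4 * \<rho>) powr ?\<sigma>)"
      and Sq: "(\<integral>\<^sup>+x. ennreal (wt (\<lambda>x. \<chi>2 \<rho> x * u x) x powr q) \<partial>lborel) \<le> ennreal (S powr q)"
    for u \<rho> m S
  proof -
    let ?v = "\<lambda>x. \<chi>2 \<rho> x * u x"
    \<comment> \<open>\<open>P\<close> and \<open>R\<close> are the mean sizes, over a ball of
      radius \<rho>, that the L1 bound allows to \<open>wt u\<close> and the L^q bound to the
      exterior part.\<close>
    define P where "P = m * \<rho> powr - ?h"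
    define R where "R = S * \<rho> powr - ?h"
    have PR: "P > 0" "R > 0" using m S \<rho> by (auto simp: P_def R_def)
    define K where "K = P powr \<theta> * R powr (2 - \<theta>)"
    have K: "K > 0" using PR by (simp add: K_def)
    have pt: "(wt u x * cut \<rho> x ^ N)\<^sup>2 \<le> K * (1 + wt u x / P + wt ?v x powr q / R powr q)" for x
    proof -
      let ?f = "wt u x" and ?c = "cut \<rho> x"
      have "(?f * ?c ^ N)\<^sup>2 = ?f powr \<theta> * (?f * ?c ^ Suc N) powr (2 - \<theta>)"
      proof (cases "?f = 0 \<or> ?c = 0")
        case True
        then show ?thesis using N_ge(3) \<theta> by auto
      next
        case False
        then have f: "?f > 0" "?c > 0" using wt_nonneg[of u x] cut_bounds[of \<rho> x] by (auto simp: less_le)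
        have e: "real (Suc N) * (2 - \<theta>) = real (2 * N)" by (simp add: \<theta>_def field_simps)
        have "?f powr \<theta> * (?f * ?c ^ Suc N) powr (2 - \<theta>) = (?f powr \<theta> * ?f powr (2 - \<theta>)) * (?c powr real (Suc N)) powr (2 - \<theta>)"
          using f by (simp only: powr_mult powr_realpow mult.assoc)
        also have "(?c powr real (Suc N)) powr (2 - \<theta>) = ?c powr real (2 * N)" by (simp only: powr_powr e)
        also have "?c powr real (2 * N) = (?c ^ N)\<^sup>2" using f by (subst powr_realpow) (auto simp: power_mult[symmetric] mult.commute)
        also have "?f powr \<theta> * ?f powr (2 - \<theta>) = ?f\<^sup>2"
          using f unfolding powr_add[symmetric] by (simp add: powr_numeral)
        finally show ?thesis by (simp add: power_mult_distrib)
      qed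
      also have "?f * ?c ^ Suc N \<le> wt ?v x"
      proof -
        have "?f * \<tau> \<rho> x \<le> ?f * \<chi>2 \<rho> x" by (intro mult_left_mono \<tau>_le_\<chi>2) simp
        also have "\<dots> = wt ?v x" using \<chi>_nonneg[of \<rho> x] by (simp add: wt_def abs_mult)
        finally show ?thesis by (simp only: \<tau>_def)
      qed
      then have "?f powr \<theta> * (?f * ?c ^ Suc N) powr (2 - \<theta>) \<le> ?f powr \<theta> * wt ?v x powr (2 - \<theta>)"
        using \<theta> cut_bounds[of \<rho> x] by (intro mult_left_mono powr_mono2 mult_nonneg_nonneg zero_le_power) auto
      also have "\<dots> = K * ((?f / P) powr \<theta> * ((wt ?v x / R) powr q) powr ((2 - \<theta>) / q))"
        using PR q_pos by (simp add: K_def powr_powr powr_divide)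
      also have "\<dots> \<le> K * (1 + ?f / P + (wt ?v x / R) powr q)"
        using K PR \<theta> q_pos by (intro mult_left_mono powr_mult_le_sum) auto
      finally show ?thesis using PR by (simp add: powr_divide)
    qed
    have "(\<integral>\<^sup>+x. ennreal ((wt u x * cut \<rho> x ^ N)\<^sup>2) * indicator (ball 0 (4 * \<rho>)) x \<partial>lborel)
      \<le> (\<integral>\<^sup>+x. ennreal K * indicator (ball 0 (4 * \<rho>)) x + ennreal (K / P) * (ennreal (wt u x) * indicator (ball 0 (4 * \<rho>)) x)
          + ennreal (K / R powr q) * ennreal (wt ?v x powr q) \<partial>lborel)"
    proof (rule nn_integral_mono)
      fix x
      have "ennreal ((wt u x * cut \<rho> x ^ N)\<^sup>2) \<le> ennreal (K + K / P * wt u x + K / R powr q * wt ?v x powr q)"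
        using pt[of x] by (intro ennreal_leI) (simp add: distrib_left)
      also have "\<dots> = ennreal K + ennreal (K / P) * ennreal (wt u x) + ennreal (K / R powr q) * ennreal (wt ?v x powr q)"
      proof -
        have nn: "0 \<le> K / P" "0 \<le> K / R powr q" using K PR by auto
        have "ennreal (K + K / P * wt u x + K / R powr q * wt ?v x powr q)
          = ennreal K + ennreal (K / P * wt u x + K / R powr q * wt ?v x powr q)"
          unfolding add.assoc by (rule ennreal_plus) (use K PR in \<open>simp_all add: add_nonneg_nonneg\<close>)
        then show ?thesis
          unfolding ennreal_linear2[OF nn wt_nonneg powr_ge_zero] by (simp only: add.assoc)
      qed
      finally show "ennreal ((wt u x * cut \<rho> x ^ N)\<^sup>2) * indicator (ball 0 (4 * \<rho>)) x
        \<le> ennreal K * indicator (ball 0 (4 * \<rho>)) x + ennreal (K / P) * (ennreal (wt u x) * indicator (ball 0 (4 * \<rho>)) x)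
          + ennreal (K / R powr q) * ennreal (wt ?v x powr q)"
        by (simp add: indicator_def)
    qed
    also have "\<dots> \<le> ennreal (K * (?V * (4 * \<rho>) powr n) + K / P * (m * (4 * \<rho>) powr ?\<sigma>) + K / R powr q * S powr q)"
      by (rule nn_integral_linear3_le) (use L1 Sq \<rho> V_pos K PR m in \<open>auto simp: emeasure_ball_n\<close>)
    also have "K * (?V * (4 * \<rho>) powr n) + K / P * (m * (4 * \<rho>) powr ?\<sigma>) + K / R powr q * S powr q
      = C * (m powr \<theta> * S powr (2 - \<theta>)) * \<rho> powr (2 * s)"
    proof -
      have "m * (4 * \<rho>) powr ?\<sigma> / P = 4 powr ?\<sigma> * (\<rho> powr ?\<sigma> * \<rho> powr ?h)"
        using m \<rho> by (simp add: P_def powr_mult powr_minus field_simps)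
      also have "\<rho> powr ?\<sigma> * \<rho> powr ?h = \<rho> powr n" unfolding powr_add[symmetric] by simp
      finally have 1: "K / P * (m * (4 * \<rho>) powr ?\<sigma>) = K * (4 powr ?\<sigma> * \<rho> powr n)"
        using PR by (simp add: field_simps)
      have hq: "- ?h * q = - n" using s by (simp add: q_def field_simps)
      have "R powr q = S powr q * \<rho> powr - n" unfolding R_def powr_mult powr_powr hq ..
      then have "S powr q = R powr q * \<rho> powr n" using \<rho> by (simp add: powr_minus)
      then have 2: "K / R powr q * S powr q = K * \<rho> powr n" using PR by simp
      have "K = m powr \<theta> * S powr (2 - \<theta>) * (\<rho> powr (- ?h * \<theta>) * \<rho> powr (- ?h * (2 - \<theta>)))"
        by (simp only: K_def P_def R_def powr_mult powr_powr mult_ac)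
      also have "\<rho> powr (- ?h * \<theta>) * \<rho> powr (- ?h * (2 - \<theta>)) = \<rho> powr (2 * s - n)"
        unfolding powr_add[symmetric] by (rule arg_cong) (simp add: algebra_simps)
      finally have "K * \<rho> powr n = m powr \<theta> * S powr (2 - \<theta>) * (\<rho> powr (2 * s - n) * \<rho> powr n)" by (simp only: mult.assoc)
      also have "\<rho> powr (2 * s - n) * \<rho> powr n = \<rho> powr (2 * s)" unfolding powr_add[symmetric] by simp
      finally have 3: "K * \<rho> powr n = m powr \<theta> * S powr (2 - \<theta>) * \<rho> powr (2 * s)" .
      have "K * (?V * (4 * \<rho>) powr n) + K / P * (m * (4 * \<rho>) powr ?\<sigma>) + K / R powr q * S powr q = C * (K * \<rho> powr n)"
        unfolding 1 2 C_def powr_mult[of 4 \<rho> n] by (simp add: distrib_left distrib_right mult_ac)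
      then show ?thesis unfolding 3 by (simp only: mult.assoc)
    qed
    finally show ?thesis .
  qed
  with C that show ?thesis by blast
qed

text \<open>With k the ceiling of p/2 and c = \<open>\<chi>1 \<rho> x\<close>, c^p \<ge> c^(2k) and
  1 - c^(2k) \<le> k (1 - c^2), so the loss is at most k times the integral of bw^p
  (\<open>\<chi>2\<close>)^2. Since this integrand is bw^(p-2) times the square of \<open>bw\<close>
  of the exterior part, Hoelder's inequality bounds it by the small exterior mass to the power
  (p-2)/p times \<open>E / lam\<close>, up to a constant: linear in the energy of the exterior part,
  as absorption requires.\<close>

lemma Ip_localise:
  assumes [measurable]: "u \<in> borel_measurable borel" and \<rho>: "0 < \<rho>"
    and lam: "0 < lam" and E: "0 < E" and \<epsilon>: "0 < \<epsilon>"
    and v: "(\<lambda>x. \<chi>2 \<rho> x * u x) \<in> D" "Q (\<lambda>x. \<chi>2 \<rho> x * u x) \<le> ennreal E"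
    and Z: "(\<integral>\<^sup>+x. ennreal (bw u x powr p) * indicator {x. \<rho> \<le> norm x} x \<partial>lborel) \<le> ennreal \<epsilon>"
  shows "Ip u \<le> Ip (\<lambda>x. \<chi>1 \<rho> x * u x) + ennreal (real (nat \<lceil>p / 2\<rceil>) * (2 * \<epsilon> powr ((p - 2) / p) * (E / lam)))"
proof -
  let ?v = "\<lambda>x. \<chi>2 \<rho> x * u x" and ?w = "\<lambda>x. \<chi>1 \<rho> x * u x" and ?k = "nat \<lceil>p / 2\<rceil>"
  have k: "p / 2 \<le> real ?k" by (rule real_nat_ceiling_ge)
  obtain Xv where Xv: "0 \<le> Xv" "Ip ?v = ennreal Xv" "lam * Xv powr (2 / p) \<le> E"
    using lam_Ip_le[OF v(1) lam v(2)] E by auto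
  define y where "y = (E / lam) powr (p / 2)"
  have y: "y > 0" using E lam by (simp add: y_def)
  have "Xv = (Xv powr (2 / p)) powr (p / 2)" using Xv(1) p by (simp add: powr_powr)
  also have "\<dots> \<le> y" unfolding y_def using Xv lam p by (intro powr_mono2) (auto simp: pos_le_divide_eq mult.commute)
  finally have Xy: "Xv \<le> y" .
  have y2: "y powr (2 / p) = E / lam" using E lam p by (simp add: y_def powr_powr)
  define K where "K = \<epsilon> powr ((p - 2) / p) * (E / lam)"
  have K: "K > 0" using \<epsilon> E lam by (simp add: K_def)
  have bv: "bw ?v x = \<chi>2 \<rho> x * bw u x" and bW: "bw ?w x = \<chi>1 \<rho> x * bw u x" for x
    using \<chi>_nonneg[of \<rho> x] by (simp_all add: bw_def abs_mult)
  have pt1: "bw u x powr p * (\<chi>2 \<rho> x)\<^sup>2 \<le> K * (bw u x powr p * indicator {x. \<rho> \<le> norm x} x / \<epsilon> + bw ?v x powr p / y)" for x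
  proof (cases "\<rho> \<le> norm x \<and> bw u x \<noteq> 0")
    case True
    then have b: "bw u x > 0" using bw_nonneg[of u x] by linarith
    have "bw u x powr p * (\<chi>2 \<rho> x)\<^sup>2 = bw u x powr (p - 2) * (bw ?v x)\<^sup>2"
    proof -
      have "bw u x powr p = bw u x powr (p - 2) * (bw u x)\<^sup>2" using b by (simp add: powr_numeral[symmetric] powr_add[symmetric] del: powr_numeral)
      then show ?thesis unfolding bv power_mult_distrib by (simp only: mult_ac)
    qed
    also have "\<dots> = (bw u x powr p) powr ((p - 2) / p) * (bw ?v x powr p) powr (2 / p)"
    proof -
      have "(bw ?v x)\<^sup>2 = bw ?v x powr 2" using bw_nonneg[of ?v x] by (cases "bw ?v x = 0") (auto simp: powr_numeral less_le)
      then show ?thesis using p by (simp add: powr_powr)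
    qed
    also have "\<dots> = K * ((bw u x powr p / \<epsilon>) powr ((p - 2) / p) * (bw ?v x powr p / y) powr (2 / p))"
      using \<epsilon> y E lam by (simp add: K_def powr_divide y2)
    also have "\<dots> \<le> K * (bw u x powr p / \<epsilon> + bw ?v x powr p / y)"
      using K \<epsilon> y p by (intro mult_left_mono powr_mult_le_sum') (auto simp: field_simps)
    finally show ?thesis using True by simp
  next
    case False
    have "bw u x powr p * (\<chi>2 \<rho> x)\<^sup>2 = 0" using False \<chi>_inner(2)[OF \<rho>, of x] p by auto
    moreover have "0 \<le> K * (bw u x powr p * indicator {x. \<rho> \<le> norm x} x / \<epsilon> + bw ?v x powr p / y)"
      using K \<epsilon> y by (intro mult_nonneg_nonneg add_nonneg_nonneg divide_nonneg_nonneg) auto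
    ultimately show ?thesis by linarith
  qed
  have W: "(\<integral>\<^sup>+x. ennreal (bw u x powr p * (\<chi>2 \<rho> x)\<^sup>2) \<partial>lborel) \<le> ennreal (2 * K)"
  proof -
    have "(\<integral>\<^sup>+x. ennreal (bw u x powr p * (\<chi>2 \<rho> x)\<^sup>2) \<partial>lborel)
      \<le> (\<integral>\<^sup>+x. ennreal (K / \<epsilon>) * (ennreal (bw u x powr p) * indicator {x. \<rho> \<le> norm x} x) + ennreal (K / y) * ennreal (bw ?v x powr p) \<partial>lborel)"
    proof (rule nn_integral_mono)
      fix x
      have "ennreal (bw u x powr p * (\<chi>2 \<rho> x)\<^sup>2) \<le> ennreal (K / \<epsilon> * (bw u x powr p * indicator {x. \<rho> \<le> norm x} x) + K / y * bw ?v x powr p)"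
        using pt1[of x] by (intro ennreal_leI) (simp add: distrib_left)
      also have "\<dots> = ennreal (K / \<epsilon>) * (ennreal (bw u x powr p) * indicator {x. \<rho> \<le> norm x} x) + ennreal (K / y) * ennreal (bw ?v x powr p)"
        using K \<epsilon> y by (subst ennreal_linear2) (auto simp: ennreal_mult ennreal_indicator)
      finally show "ennreal (bw u x powr p * (\<chi>2 \<rho> x)\<^sup>2) \<le> ennreal (K / \<epsilon>) * (ennreal (bw u x powr p) * indicator {x. \<rho> \<le> norm x} x) + ennreal (K / y) * ennreal (bw ?v x powr p)" .
    qed
    also have "\<dots> \<le> ennreal (K / \<epsilon> * \<epsilon> + K / y * y)"
      by (rule nn_integral_linear2_le) (use Z K \<epsilon> y Xv(2) Xy in \<open>auto simp: Ip_def[symmetric] ennreal_leI\<close>)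
    finally show ?thesis using \<epsilon> y by simp
  qed
  have pt2: "ennreal (bw u x powr p) \<le> ennreal (bw ?w x powr p) + ennreal (real ?k) * ennreal (bw u x powr p * (\<chi>2 \<rho> x)\<^sup>2)" for x
  proof -
    let ?c = "\<chi>1 \<rho> x"
    have c: "0 \<le> ?c" "?c \<le> 1" by (rule \<chi>_nonneg \<chi>_le_1)+
    have "(?c\<^sup>2) ^ ?k \<le> ?c powr p"
    proof (cases "?c = 0")
      case True
      have "0 < ?k" using k p by (intro gr0I) auto
      then have 0: "(0 :: real) ^ ?k = 0" by (rule zero_power)
      show ?thesis unfolding True zero_power2 0 by simp
    next
      case False
      have "(?c\<^sup>2) ^ ?k = ?c powr (real (2 * ?k))" using c False by (subst powr_realpow) (auto simp: power_mult)
      also have "\<dots> \<le> ?c powr p" using c k by (intro powr_mono') auto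
      finally show ?thesis .
    qed
    moreover have "1 - (?c\<^sup>2) ^ ?k \<le> real ?k * (1 - ?c\<^sup>2)"
      using power_diff_le[of 1 "?c\<^sup>2" ?k] c by (simp add: max_absorb1 power_le_one)
    moreover have "1 - ?c\<^sup>2 = (\<chi>2 \<rho> x)\<^sup>2" using \<chi>_squares[of \<rho> x] by linarith
    ultimately have "1 \<le> ?c powr p + real ?k * (\<chi>2 \<rho> x)\<^sup>2" by simp
    from mult_left_mono[OF this, of "bw u x powr p"]
    have "bw u x powr p \<le> bw ?w x powr p + real ?k * (bw u x powr p * (\<chi>2 \<rho> x)\<^sup>2)"
      unfolding bW powr_mult by (simp add: distrib_left mult_ac)
    then have "ennreal (bw u x powr p) \<le> ennreal (bw ?w x powr p + real ?k * (bw u x powr p * (\<chi>2 \<rho> x)\<^sup>2))" by (rule ennreal_leI)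
    then show ?thesis by (simp add: ennreal_plus ennreal_mult)
  qed
  have "Ip u \<le> (\<integral>\<^sup>+x. ennreal (bw ?w x powr p) + ennreal (real ?k) * ennreal (bw u x powr p * (\<chi>2 \<rho> x)\<^sup>2) \<partial>lborel)"
    unfolding Ip_def by (intro nn_integral_mono pt2)
  also have "\<dots> = Ip ?w + ennreal (real ?k) * (\<integral>\<^sup>+x. ennreal (bw u x powr p * (\<chi>2 \<rho> x)\<^sup>2) \<partial>lborel)"
    unfolding Ip_def by (subst nn_integral_add) (auto simp: nn_integral_cmult)
  also have "\<dots> \<le> Ip ?w + ennreal (real ?k) * ennreal (2 * K)"
    by (intro add_left_mono mult_left_mono W) auto
  finally show ?thesis using K by (simp add: ennreal_mult[symmetric] K_def mult.assoc)
qed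

text \<open>Write X, Y for the p-mass of \<open>u\<close> and of \<open>\<chi>1 u\<close>. The
  localisation bounds the sum of the two energies by lam X^(2/p) + d + 4 Xi, while the interior
  energy is at least lam Y^(2/p) \<ge> lam X^(2/p) - Ev/4. The difference bounds the exterior energy
  by m^2 + 4 Xi + Ev/4, and Xi is O(m^2 + m^\<theta> Ev^(1-\<theta>/2)), so
  \<open>absorb_power\<close> closes the estimate.\<close>

lemma exterior_estimate:
  assumes lam: "0 < lam" and E0: "0 < E0" and X0: "0 < X0"
  obtains m0 C where "m0 > 0" "C > 0" "\<And>u \<rho> m d X. u \<in> D \<Longrightarrow> Q u \<le> ennreal E0 \<Longrightarrow> Ip u = ennreal X \<Longrightarrow> X0 \<le> X \<Longrightarrow>
    Q u \<le> ennreal (lam * X powr (2 / p) + d) \<Longrightarrow> 0 \<le> d \<Longrightarrow> d \<le> m\<^sup>2 \<Longrightarrow> 0 < \<rho> \<Longrightarrow> 0 < m \<Longrightarrow> m \<le> m0 \<Longrightarrow>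
    (\<forall>r\<ge>\<rho>. L1 u r \<le> ennreal (m * r powr (n / 2 + s))) \<Longrightarrow>
    Q (\<lambda>x. \<chi>2 \<rho> x * u x) \<le> ennreal (C * m\<^sup>2) \<and> (\<exists>Y. Ip (\<lambda>x. \<chi>1 \<rho> x * u x) = ennreal Y \<and> X / 2 \<le> Y \<and>
      Q (\<lambda>x. \<chi>1 \<rho> x * u x) \<le> ennreal (lam * Y powr (2 / p) + C * m\<^sup>2) \<and> Q (\<lambda>x. \<chi>1 \<rho> x * u x) \<le> ennreal (E0 + C * m\<^sup>2))"
proof -
  obtain CS where CS: "CS > 0" "\<And>u E. u \<in> D \<Longrightarrow> 0 < E \<Longrightarrow> Q u \<le> ennreal E \<Longrightarrow>
    (\<integral>\<^sup>+x. ennreal (wt u x powr q) \<partial>lborel) \<le> ennreal (CS * E powr (q / 2))" using Sobolev by metis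
  obtain CX where CX: "CX > 0" "\<And>u \<rho> m B. u \<in> borel_measurable borel \<Longrightarrow> 0 < \<rho> \<Longrightarrow> 0 < m \<Longrightarrow> 0 \<le> B \<Longrightarrow>
    (\<forall>r\<ge>\<rho>. L1 u r \<le> ennreal (m * r powr (n / 2 + s))) \<Longrightarrow>
    (\<integral>\<^sup>+x. ennreal ((wt u x * cut \<rho> x ^ N)\<^sup>2) * indicator (ball 0 (4 * \<rho>)) x \<partial>lborel) \<le> ennreal B \<Longrightarrow>
    Xi \<rho> u \<le> ennreal (CX * (m\<^sup>2 + \<rho> powr - (2 * s) * B))"
    by (rule Xi_estimate) (rule that, assumption, blast)
  obtain CB where CB: "CB > 0" "\<And>u \<rho> m S. u \<in> borel_measurable borel \<Longrightarrow> 0 < \<rho> \<Longrightarrow> 0 < m \<Longrightarrow> 0 < S \<Longrightarrow>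
    L1 u (4 * \<rho>) \<le> ennreal (m * (4 * \<rho>) powr (n / 2 + s)) \<Longrightarrow>
    (\<integral>\<^sup>+x. ennreal (wt (\<lambda>x. \<chi>2 \<rho> x * u x) x powr q) \<partial>lborel) \<le> ennreal (S powr q) \<Longrightarrow>
    (\<integral>\<^sup>+x. ennreal ((wt u x * cut \<rho> x ^ N)\<^sup>2) * indicator (ball 0 (4 * \<rho>)) x \<partial>lborel)
      \<le> ennreal (CB * (m powr \<theta> * S powr (2 - \<theta>)) * \<rho> powr (2 * s))"
    by (rule cutoff_L2_bound) (rule that, assumption, blast)
  define k where "k = real (nat \<lceil>p / 2\<rceil>)"
  have k: "k > 0" using real_nat_ceiling_ge[of "p / 2"] p unfolding k_def by linarith
  \<comment> \<open>Chosen to make the loss in \<open>gap\<close> exactly a quarter of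
    \<open>Ev\<close>; see the second property of \<open>e\<close>.\<close>
  define \<epsilon> where "\<epsilon> = (1 / (8 * k * X0 powr (2 / p - 1))) powr (p / (p - 2))"
  have \<epsilon>: "\<epsilon> > 0" using k X0 by (simp add: \<epsilon>_def)
  define e where "e = \<epsilon> powr ((p - 2) / p)"
  have e: "e > 0" "X0 powr (2 / p - 1) * (k * (2 * e)) = 1 / 4"
    using k X0 p by (auto simp: e_def \<epsilon>_def powr_powr)
  obtain m1 where m1: "m1 > 0" "\<And>u \<rho> m. u \<in> D \<Longrightarrow> Q u \<le> ennreal E0 \<Longrightarrow> 0 < \<rho> \<Longrightarrow> 0 < m \<Longrightarrow> m \<le> m1 \<Longrightarrow>
    (\<forall>r\<ge>\<rho>. L1 u r \<le> ennreal (m * r powr (n / 2 + s))) \<Longrightarrow>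
    (\<integral>\<^sup>+x. ennreal (bw u x powr p) * indicator {x. \<rho> \<le> norm x} x \<partial>lborel) \<le> ennreal \<epsilon>"
    by (rule exterior_Ip_small[OF \<epsilon> E0]) (rule that, assumption, blast)
  define K' where "K' = CX * max 1 (CB * CS powr ((2 - \<theta>) / q))"
  have K': "K' > 0" using CX by (simp add: K'_def less_max_iff_disj)
  define C1 where "C1 = max 1 ((3 * (4 * K' + 1)) powr (2 / \<theta>))"
  have C1: "C1 \<ge> 1" by (simp add: C1_def)
  define C2 where "C2 = K' * (1 + C1 powr (1 - \<theta> / 2))"
  have C2: "C2 > 0" using K' by (simp add: C2_def add_pos_nonneg)
  define C where "C = C1 + 1 + 4 * C2"
  have C: "C > 0" using C1 C2 by (simp add: C_def)
  \<comment> \<open>Ensures \<open>\<Delta> \<le> X0 / 2\<close>, so the interior part keeps half of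
    the p-mass and a further localisation can be applied to it.\<close>
  define m2 where "m2 = sqrt (X0 * lam / (4 * k * e * C1))"
  have m2: "m2 > 0" using X0 lam k e C1 by (simp add: m2_def)
  have "Q (\<lambda>x. \<chi>2 \<rho> x * u x) \<le> ennreal (C * m\<^sup>2) \<and> (\<exists>Y. Ip (\<lambda>x. \<chi>1 \<rho> x * u x) = ennreal Y \<and> X / 2 \<le> Y \<and>
      Q (\<lambda>x. \<chi>1 \<rho> x * u x) \<le> ennreal (lam * Y powr (2 / p) + C * m\<^sup>2) \<and> Q (\<lambda>x. \<chi>1 \<rho> x * u x) \<le> ennreal (E0 + C * m\<^sup>2))"
    if u: "u \<in> D" and QE: "Q u \<le> ennreal E0" and X: "Ip u = ennreal X" "X0 \<le> X"
      and Qd: "Q u \<le> ennreal (lam * X powr (2 / p) + d)" and d: "0 \<le> d" "d \<le> m\<^sup>2" and \<rho>: "0 < \<rho>"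
      and m: "0 < m" "m \<le> min m1 m2" and L1: "\<forall>r\<ge>\<rho>. L1 u r \<le> ennreal (m * r powr (n / 2 + s))"
    for u \<rho> m d X
  proof -
    let ?v = "\<lambda>x. \<chi>2 \<rho> x * u x" and ?w = "\<lambda>x. \<chi>1 \<rho> x * u x"
    have um [measurable]: "u \<in> borel_measurable borel" by (rule D_measurable[OF u])
    have v: "?v \<in> D" and w: "?w \<in> D" using D_cutoff[OF u \<rho>] by auto
    obtain qu where qu: "Q u = ennreal qu" "0 \<le> qu" using D_finite[OF u] by (cases "Q u") auto
    obtain qv where qv: "Q ?v = ennreal qv" "0 \<le> qv" using D_finite[OF v] by (cases "Q ?v") auto
    obtain qw where qw: "Q ?w = ennreal qw" "0 \<le> qw" using D_finite[OF w] by (cases "Q ?w") auto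
    have X_pos: "X > 0" using X X0 by linarith
    have quE: "qu \<le> E0" "qu \<le> lam * X powr (2 / p) + d"
      using QE Qd unfolding qu(1)
      by (subst (asm) (1 2) ennreal_le_iff; use E0 lam d in \<open>simp add: add_nonneg_nonneg\<close>)+
    define Ev where "Ev = max qv (m\<^sup>2)"
    have Ev: "Ev > 0" "Q ?v \<le> ennreal Ev" using m by (auto simp: Ev_def less_max_iff_disj qv ennreal_leI)
    define S where "S = CS powr (1 / q) * Ev powr (1 / 2)"
    have S: "S > 0" using CS Ev by (simp add: S_def)
    have Sq: "S powr q = CS * Ev powr (q / 2)" using CS q_pos by (simp add: S_def powr_mult powr_powr)
    have "(\<integral>\<^sup>+x. ennreal ((wt u x * cut \<rho> x ^ N)\<^sup>2) * indicator (ball 0 (4 * \<rho>)) x \<partial>lborel)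
      \<le> ennreal (CB * (m powr \<theta> * S powr (2 - \<theta>)) * \<rho> powr (2 * s))"
    proof (rule CB(2)[OF um \<rho> m(1) S])
      show "L1 u (4 * \<rho>) \<le> ennreal (m * (4 * \<rho>) powr (n / 2 + s))" using L1 \<rho> by simp
      show "(\<integral>\<^sup>+x. ennreal (wt ?v x powr q) \<partial>lborel) \<le> ennreal (S powr q)"
        unfolding Sq by (rule CS(2)[OF v Ev])
    qed
    from CX(2)[OF um \<rho> m(1) _ L1 this]
    have "Xi \<rho> u \<le> ennreal (CX * (m\<^sup>2 + \<rho> powr - (2 * s) * (CB * (m powr \<theta> * S powr (2 - \<theta>)) * \<rho> powr (2 * s))))"
      using CB by simp
    also have "\<rho> powr - (2 * s) * (CB * (m powr \<theta> * S powr (2 - \<theta>)) * \<rho> powr (2 * s)) = CB * CS powr ((2 - \<theta>) / q) * (m powr \<theta> * Ev powr (1 - \<theta> / 2))"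
    proof -
      have 1: "\<rho> powr - (2 * s) * \<rho> powr (2 * s) = 1" using \<rho> unfolding powr_add[symmetric] by simp
      have 2: "1 / 2 * (2 - \<theta>) = 1 - \<theta> / 2" "1 / q * (2 - \<theta>) = (2 - \<theta>) / q" by (simp_all add: field_simps)
      have "S powr (2 - \<theta>) = CS powr ((2 - \<theta>) / q) * Ev powr (1 - \<theta> / 2)" by (simp only: S_def powr_mult powr_powr 2)
      moreover have "\<rho> powr - (2 * s) * (CB * (m powr \<theta> * S powr (2 - \<theta>)) * \<rho> powr (2 * s))
        = (\<rho> powr - (2 * s) * \<rho> powr (2 * s)) * (CB * (m powr \<theta> * S powr (2 - \<theta>)))" by (simp only: mult_ac)
      ultimately show ?thesis unfolding 1 by (simp only: mult_1_left mult_ac)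
    qed
    also have "CX * (m\<^sup>2 + CB * CS powr ((2 - \<theta>) / q) * (m powr \<theta> * Ev powr (1 - \<theta> / 2))) \<le> K' * (m\<^sup>2 + m powr \<theta> * Ev powr (1 - \<theta> / 2))"
    proof -
      have "m\<^sup>2 + CB * CS powr ((2 - \<theta>) / q) * (m powr \<theta> * Ev powr (1 - \<theta> / 2))
        \<le> max 1 (CB * CS powr ((2 - \<theta>) / q)) * m\<^sup>2 + max 1 (CB * CS powr ((2 - \<theta>) / q)) * (m powr \<theta> * Ev powr (1 - \<theta> / 2))"
        using mult_right_mono[of 1 "max 1 (CB * CS powr ((2 - \<theta>) / q))" "m\<^sup>2"] by (intro add_mono mult_right_mono) auto
      from mult_left_mono[OF this, of CX] show ?thesis using CX by (simp add: K'_def distrib_left mult.assoc)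
    qed
    finally have Xi: "Xi \<rho> u \<le> ennreal (K' * (m\<^sup>2 + m powr \<theta> * Ev powr (1 - \<theta> / 2)))" by (simp add: ennreal_leI)
    define xi where "xi = K' * (m\<^sup>2 + m powr \<theta> * Ev powr (1 - \<theta> / 2))"
    have xi: "xi \<ge> 0" using K' by (simp add: xi_def)
    have "ennreal (qw + qv) \<le> ennreal (qu + 4 * xi)"
    proof -
      have "ennreal qw + ennreal qv \<le> ennreal qu + 4 * ennreal xi"
        using IMS_localisation[OF um, of \<rho>] Xi unfolding qu(1) qv(1) qw(1) xi_def[symmetric]
        by (rule order_trans[OF _ add_left_mono[OF mult_left_mono]]) auto
      then show ?thesis using qu qv qw xi by (simp add: ennreal_mult)
    qed
    then have sum: "qw + qv \<le> qu + 4 * xi" using qu xi by (subst (asm) ennreal_le_iff) auto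
    obtain Y where Y: "0 \<le> Y" "Ip ?w = ennreal Y" "lam * Y powr (2 / p) \<le> qw"
      using lam_Ip_le[OF w lam, of qw] qw by auto
    define \<Delta> where "\<Delta> = k * (2 * e * (Ev / lam))"
    have \<Delta>: "\<Delta> \<ge> 0" using k e Ev lam by (simp add: \<Delta>_def)
    have "Ip u \<le> Ip ?w + ennreal \<Delta>"
      unfolding \<Delta>_def k_def e_def
      by (rule Ip_localise[OF um \<rho> lam Ev(1) \<epsilon> v Ev(2) m1(2)[OF u QE \<rho> m(1) _ L1]]) (use m in auto)
    then have "ennreal X \<le> ennreal (Y + \<Delta>)" unfolding X(1) Y(2) using Y(1) \<Delta> by simp
    then have XY: "X \<le> Y + \<Delta>" by (rule iffD1[OF ennreal_le_iff, rotated]) (use Y(1) \<Delta> in simp)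
    have "Ip ?w \<le> Ip u" unfolding Ip_def
    proof (intro nn_integral_mono ennreal_leI powr_mono2)
      show "bw ?w x \<le> bw u x" for x
        unfolding bw_def using \<chi>_nonneg[of \<rho> x] \<chi>_le_1[of \<rho> x]
        by (intro mult_right_mono) (auto simp: abs_mult mult_left_le_one_le)
    qed (use p in auto)
    then have YX: "Y \<le> X" unfolding X(1) Y(2) using X_pos by (simp add: ennreal_le_iff)
    \<comment> \<open>As Y/X \<le> 1 and 2/p < 1, Y/X \<le> (Y/X)^(2/p), so X^(2/p) - Y^(2/p) \<le>
      X^(2/p-1) (X - Y). The lower bound \<open>X0\<close> controls the negative power.\<close>
    have gap: "lam * X powr (2 / p) \<le> lam * Y powr (2 / p) + Ev / 4"
    proof -
      have "Y / X \<le> (Y / X) powr (2 / p)"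
      proof (cases "Y = 0")
        case False
        have "(Y / X) powr 1 \<le> (Y / X) powr (2 / p)" using YX Y(1) X_pos p by (intro powr_mono') auto
        then show ?thesis using Y(1) X_pos by simp
      qed simp
      then have "X powr (2 / p) * (Y / X) \<le> X powr (2 / p) * (Y / X) powr (2 / p)" by (rule mult_left_mono) simp
      also have "\<dots> = Y powr (2 / p)" using X_pos Y(1) by (simp add: powr_divide)
      finally have "X powr (2 / p) - Y powr (2 / p) \<le> X powr (2 / p) * ((X - Y) / X)"
        using X_pos by (simp add: diff_divide_distrib right_diff_distrib)
      also have "\<dots> = X powr (2 / p - 1) * (X - Y)" using X_pos by (simp add: powr_diff)
      also have "\<dots> \<le> X0 powr (2 / p - 1) * \<Delta>"
        using X X0 XY YX \<Delta> p by (intro mult_mono powr_mono2') auto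
      also have "\<dots> = X0 powr (2 / p - 1) * (k * (2 * e)) * (Ev / lam)" by (simp add: \<Delta>_def)
      also have "\<dots> = Ev / lam / 4" unfolding e(2) by simp
      finally have "lam * (X powr (2 / p) - Y powr (2 / p)) \<le> lam * (Ev / lam / 4)" using lam by (intro mult_left_mono) auto
      then show ?thesis using lam by (simp add: right_diff_distrib)
    qed
    have "qv \<le> m\<^sup>2 + 4 * xi + Ev / 4" using sum quE(2) Y(3) gap d by linarith
    also have "m\<^sup>2 + 4 * xi \<le> (4 * K' + 1) * (m\<^sup>2 + m powr \<theta> * Ev powr (1 - \<theta> / 2))"
      unfolding xi_def by (simp add: distrib_right)
    finally have "qv \<le> (4 * K' + 1) * (m\<^sup>2 + m powr \<theta> * Ev powr (1 - \<theta> / 2)) + Ev / 4" by simp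
    then have Ev_le: "Ev \<le> C1 * m\<^sup>2"
      unfolding Ev_def C1_def using absorb_power[of m \<theta> "4 * K' + 1" qv] m \<theta> K' by simp
    have xi_le: "xi \<le> C2 * m\<^sup>2"
    proof -
      have "m powr \<theta> * Ev powr (1 - \<theta> / 2) \<le> m powr \<theta> * (C1 * m\<^sup>2) powr (1 - \<theta> / 2)"
        using Ev_le Ev \<theta> by (intro mult_left_mono powr_mono2) auto
      also have "\<dots> = C1 powr (1 - \<theta> / 2) * (m powr \<theta> * (m\<^sup>2) powr (1 - \<theta> / 2))" by (simp add: powr_mult)
      also have "m powr \<theta> * (m\<^sup>2) powr (1 - \<theta> / 2) = m\<^sup>2"
      proof -
        have m2: "m\<^sup>2 = m powr 2" using m by (simp add: powr_numeral)
        show ?thesis unfolding m2 powr_powr powr_add[symmetric] by (simp add: algebra_simps)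
      qed
      finally have "m\<^sup>2 + m powr \<theta> * Ev powr (1 - \<theta> / 2) \<le> m\<^sup>2 + C1 powr (1 - \<theta> / 2) * m\<^sup>2" by (rule add_left_mono)
      from mult_left_mono[OF this, of K'] show ?thesis using K' by (simp add: xi_def C2_def distrib_left distrib_right mult.assoc)
    qed
    have "\<Delta> \<le> X / 2"
    proof -
      have "m\<^sup>2 \<le> m2\<^sup>2" using m by (intro power_mono) auto
      also have "m2\<^sup>2 = X0 * lam / (4 * k * e * C1)" using X0 lam k e C1 by (simp add: m2_def)
      finally have "C1 * m\<^sup>2 \<le> C1 * (X0 * lam / (4 * k * e * C1))" using C1 by (intro mult_left_mono) auto
      also have "\<dots> = X0 * lam / (4 * k * e)" using C1 by simp
      finally have "Ev \<le> X0 * lam / (4 * k * e)" using Ev_le by linarith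
      then have "\<Delta> \<le> k * (2 * e * (X0 * lam / (4 * k * e) / lam))"
        unfolding \<Delta>_def using k e lam by (intro mult_left_mono divide_right_mono) auto
      also have "\<dots> = X0 / 2" using k e lam by (simp add: field_simps)
      finally show ?thesis using X by linarith
    qed
    then have "X / 2 \<le> Y" using XY by linarith
    moreover have Cm: "C * m\<^sup>2 = C1 * m\<^sup>2 + m\<^sup>2 + 4 * (C2 * m\<^sup>2)" by (simp add: C_def distrib_right)
    have nn: "0 \<le> C1 * m\<^sup>2" "0 \<le> C2 * m\<^sup>2" "0 \<le> m\<^sup>2" using C1 C2 by auto
    have "qv \<le> Ev" by (simp add: Ev_def)
    then have "qv \<le> C * m\<^sup>2" unfolding Cm using Ev_le nn by linarith
    moreover have "qw \<le> E0 + C * m\<^sup>2" unfolding Cm using sum quE(1) qv(2) xi_le nn by linarith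
    moreover have "qw \<le> lam * Y powr (2 / p) + C * m\<^sup>2"
      unfolding Cm using sum quE(2) gap qv(2) xi_le nn d Ev_le by linarith
    ultimately show ?thesis using Y(2) unfolding qv(1) qw(1) by (auto intro!: ennreal_leI)
  qed
  then show ?thesis using C m1(1) m2 by (intro that[of "min m1 m2" C]) auto
qed

end

section \<open>Consequences of a small deficit\<close>

lemma ennreal_mult_le_imp:
  assumes "0 < k" "0 \<le> e" "ennreal k * I \<le> ennreal e"
  shows "I \<le> ennreal (e / k)"
proof (cases I)
  case (real i)
  then have "ennreal (k * i) \<le> ennreal e" using assms by (simp add: ennreal_mult)
  then have "k * i \<le> e" using assms(2) by (simp add: ennreal_le_iff)
  then have "i \<le> e / k" using assms(1) by (simp add: pos_le_divide_eq mult.commute)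
  then show ?thesis using real by (simp add: ennreal_leI)
next
  case top
  then show ?thesis using assms by (simp add: ennreal_mult_top top_unique)
qed

section \<open>Pointwise inequalities for truncations\<close>

lemma truncation_increments:
  fixes x y :: real
  assumes "l \<le> t"
  shows "0 \<le> (x - y) * (min x t - min y t)"
    and "(min x t - min y t)\<^sup>2 \<le> (x - y) * (min x t - min y t)"
    and "0 \<le> (min x l - min y l) * (min x t - min y t)"
proof -
  let ?A = "min x l - min y l" and ?B = "min x t - min y t"
  have "0 \<le> ?A \<and> 0 \<le> ?B \<and> ?B \<le> x - y \<or> ?A \<le> 0 \<and> ?B \<le> 0 \<and> x - y \<le> ?B"
    using assms by (auto simp: min_def)
  then have "0 \<le> (x - y - ?B) * ?B \<and> 0 \<le> ?A * ?B"
    by (elim disjE conjE) (auto intro: mult_nonneg_nonneg mult_nonpos_nonpos)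
  then show "(min x t - min y t)\<^sup>2 \<le> (x - y) * ?B" "0 \<le> ?A * ?B"
    by (auto simp: left_diff_distrib power2_eq_square)
  then show "0 \<le> (x - y) * ?B" using zero_le_power2[of ?B] by linarith
qed

text \<open>Let U, A, B be the increments of the function and of its truncations at l and t. All
  have the same sign and A^2 \<le> UA, B^2 \<le> UB. In the expanded square the terms with \<mu> are
  at most -\<mu> UB, which is the gain, and the others cost A^2 + 2UA \<le> 3UA.\<close>

lemma truncation_competitor:
  fixes x y :: real
  assumes "l \<le> t" "0 \<le> \<mu>" "\<mu> \<le> 1"
  shows "((x + min x l - \<mu> * min x t) - (y + min y l - \<mu> * min y t))\<^sup>2 + \<mu> * ((x - y) * (min x t - min y t))
    \<le> (x - y)\<^sup>2 + 3 * ((x - y) * (min x l - min y l))"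
proof -
  define A where "A = min x l - min y l"
  define B where "B = min x t - min y t"
  define U where "U = x - y"
  have h: "A\<^sup>2 \<le> U * A" "B\<^sup>2 \<le> U * B" "0 \<le> A * B"
    using truncation_increments(2)[of l l x y] truncation_increments(2,3)[OF assms(1), of x y]
    by (simp_all add: A_def B_def U_def)
  have "\<mu> * (\<mu> * B\<^sup>2) \<le> \<mu> * (1 * (U * B))"
    using assms h(2) by (intro mult_left_mono mult_mono) auto
  moreover have "0 \<le> \<mu> * (A * B)" using assms h(3) by simp
  moreover have "((x + min x l - \<mu> * min x t) - (y + min y l - \<mu> * min y t))\<^sup>2
    = U\<^sup>2 + A\<^sup>2 + \<mu> * (\<mu> * B\<^sup>2) + 2 * (U * A) - 2 * (\<mu> * (U * B)) - 2 * (\<mu> * (A * B))"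
    by (simp add: A_def B_def U_def power2_eq_square algebra_simps)
  ultimately have "((x + min x l - \<mu> * min x t) - (y + min y l - \<mu> * min y t))\<^sup>2 + \<mu> * (U * B) \<le> U\<^sup>2 + 3 * (U * A)"
    using h(1) by linarith
  then show ?thesis by (simp only: A_def B_def U_def)
qed

text \<open>Beyond the square of the truncated increment, the product contains only an excess above
  l at one point times the gap to l at the other, a form that the interaction bounds can
  handle.\<close>

lemma truncation_product:
  fixes x y :: real
  shows "(x - y) * (min x l - min y l)
    = (min x l - min y l)\<^sup>2 + (max (x - l) 0 * (l - min y l) + max (y - l) 0 * (l - min x l))"
  by (cases "x \<le> l"; cases "y \<le> l") (auto simp: min_def max_def power2_eq_square algebra_simps)

lemma excess_deficiency_le:
  fixes x y :: real
  shows "max (x - t) 0 * max (t - y) 0 \<le> (x - y) * (min x t - min y t)"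
proof (cases "t < x \<and> y < t")
  case True
  then have "(x - t) * (t - y) \<le> (x - y) * (t - y)" by (intro mult_right_mono) auto
  with True show ?thesis by simp
next
  case False
  then have "max (x - t) 0 * max (t - y) 0 = 0" by auto
  with truncation_increments(1)[of t t x y] show ?thesis by linarith
qed

context fractional_energy
begin

text \<open>The bookkeeping of powers on balls: amplitudes are multiples of r^(-\<kappa>/2) or
  r^(-\<kappa>), \<open>J_spread_le\<close> produces r^(2s+\<alpha>), and constants have weighted
  mass of order r^(n-\<alpha>).\<close>

lemma scaling_exponents:
  "r powr (\<kappa> / 2) * r powr (2 * s + \<alpha>) = r powr (n / 2 + s)"
  "r powr - (\<kappa> / 2) * r powr (n - \<alpha>) = r powr (n / 2 + s)"
  "r powr - \<kappa> * r powr (n - \<alpha>) = r powr (2 * s + \<alpha>)"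
  "r powr - (\<kappa> / 2) * r powr (n / 2 + s) = r powr (2 * s + \<alpha>)"
  "r powr \<kappa> * r powr (2 * s + 2 * \<alpha>) = r powr n"
  unfolding powr_add[symmetric] by (rule arg_cong[where f = "\<lambda>e. r powr e"]; simp add: \<kappa>_def field_simps)+

lemma half_ball_remains:
  assumes [measurable]: "B \<in> sets borel" and r: "0 < r"
    and B: "emeasure lborel B \<le> ennreal (unit_ball_vol n * r powr n / 2)"
  shows "ennreal (unit_ball_vol n * r powr n / 2) \<le> emeasure lborel (ball (0 :: real ^ 'n) r - B)"
proof -
  let ?v = "ennreal (unit_ball_vol n * r powr n / 2)"
  have "?v + ?v = emeasure lborel (ball (0 :: real ^ 'n) r)"
    using r V_pos by (subst emeasure_ball_n) (auto simp: ennreal_double)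
  also have "\<dots> \<le> emeasure lborel (B \<union> (ball 0 r - B))" by (intro emeasure_mono) auto
  also have "\<dots> \<le> emeasure lborel B + emeasure lborel (ball 0 r - B)" by (intro emeasure_subadditive) auto
  also have "\<dots> \<le> ?v + emeasure lborel (ball 0 r - B)" by (intro add_right_mono B)
  finally show ?thesis by (simp add: ennreal_add_left_cancel_le)
qed

lemma J_spread_le:
  assumes [measurable]: "P \<in> borel_measurable borel" "z \<in> borel_measurable borel" "S \<in> sets borel"
    and "\<And>x. 0 \<le> P x" "\<And>y. 0 \<le> z y" and r: "0 < r" and "S \<subseteq> ball 0 r"
    and "ennreal (unit_ball_vol n * r powr n / 2) \<le> emeasure lborel S"
    and b: "0 < b" "\<And>y. y \<in> S \<Longrightarrow> b \<le> z y"
    and E: "J (\<lambda>x y. P x * z y) \<le> ennreal E" "0 \<le> E"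
  shows "(\<integral>\<^sup>+x. ennreal (P x * norm x powr - \<alpha>) * indicator (ball 0 r) x \<partial>lborel)
    \<le> ennreal (E / (c_spread * b) * r powr (2 * s + \<alpha>))"
proof -
  have "ennreal (c_spread * b * r powr - (2 * s + \<alpha>)) * (\<integral>\<^sup>+x. ennreal (P x * norm x powr - \<alpha>) * indicator (ball 0 r) x \<partial>lborel)
    \<le> J (\<lambda>x y. P x * z y)"
    by (rule J_spread[of P z S]) (use assms in auto)
  also note E(1)
  finally have "(\<integral>\<^sup>+x. ennreal (P x * norm x powr - \<alpha>) * indicator (ball 0 r) x \<partial>lborel)
    \<le> ennreal (E / (c_spread * b * r powr - (2 * s + \<alpha>)))"
    by (rule ennreal_mult_le_imp[rotated 2]) (use c_spread_pos b r E(2) in auto)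
  also have "E / (c_spread * b * r powr - (2 * s + \<alpha>)) = E / (c_spread * b) * r powr (2 * s + \<alpha>)"
    unfolding powr_minus by (simp add: field_simps)
  finally show ?thesis .
qed

lemma L1_excess_le:
  assumes [measurable]: "u \<in> borel_measurable borel" "P \<in> borel_measurable borel"
    and nn: "\<And>x. 0 \<le> u x" "\<And>x. 0 \<le> P x" "0 \<le> t" "0 \<le> A" "0 \<le> B"
    and le: "\<And>x. norm x < r \<Longrightarrow> u x \<le> P x + t"
    and A: "(\<integral>\<^sup>+x. ennreal (P x * norm x powr - \<alpha>) * indicator (ball 0 r) x \<partial>lborel) \<le> ennreal A"
    and B: "(\<integral>\<^sup>+x. ennreal (norm (x :: real ^ 'n) powr - \<alpha>) * indicator (ball 0 r) x \<partial>lborel) \<le> ennreal B"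
  shows "L1 u r \<le> ennreal (A + t * B)"
proof -
  have "L1 u r \<le> (\<integral>\<^sup>+x. ennreal 1 * (ennreal (P x * norm x powr - \<alpha>) * indicator (ball 0 r) x)
      + ennreal t * (ennreal (norm (x :: real ^ 'n) powr - \<alpha>) * indicator (ball 0 r) x) \<partial>lborel)"
  proof (rule nn_integral_mono)
    fix x :: "real ^ 'n"
    have "ennreal (wt u x) \<le> ennreal 1 * ennreal (P x * norm x powr - \<alpha>) + ennreal t * ennreal (norm x powr - \<alpha>)" if "norm x < r"
    proof -
      have "wt u x \<le> (P x + t) * norm x powr - \<alpha>"
        unfolding wt_def using le[OF that] nn(1)[of x] by (intro mult_right_mono) auto
      then have "ennreal (wt u x) \<le> ennreal (1 * (P x * norm x powr - \<alpha>) + t * norm x powr - \<alpha>)"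
        by (intro ennreal_leI) (simp add: distrib_right)
      then show ?thesis by (subst (asm) ennreal_linear2) (use nn in auto)
    qed
    then show "ennreal (wt u x) * indicator (ball 0 r) x
      \<le> ennreal 1 * (ennreal (P x * norm x powr - \<alpha>) * indicator (ball 0 r) x)
        + ennreal t * (ennreal (norm x powr - \<alpha>) * indicator (ball 0 r) x)"
      by (simp add: indicator_def)
  qed
  also have "\<dots> \<le> ennreal (1 * A + t * B)"
    by (rule nn_integral_linear2_le[OF _ _ A B]) (use nn in auto)
  finally show ?thesis by simp
qed

lemma Q_scaled_plateau_le:
  obtains C where "C > 0" "\<And>r d. 0 < r \<Longrightarrow> 0 < d \<Longrightarrow> Q (\<lambda>x. (sqrt d * r powr - (\<kappa> / 2)) * plateau r x) \<le> ennreal (C * d)"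
proof -
  obtain C where C: "C > 0" "\<And>r. r > 0 \<Longrightarrow> Q (plateau r) \<le> ennreal (C * r powr \<kappa>)" using Q_plateau_le by metis
  have "Q (\<lambda>x. (sqrt d * r powr - (\<kappa> / 2)) * plateau r x) \<le> ennreal (C * d)" if "0 < r" "0 < d" for r d
  proof -
    have "Q (\<lambda>x. (sqrt d * r powr - (\<kappa> / 2)) * plateau r x) = ennreal ((sqrt d * r powr - (\<kappa> / 2))\<^sup>2) * Q (plateau r)"
      by (rule Q_cmult) (rule D_measurable[OF D_test[OF plateau_test[OF that(1)]]])
    also have "\<dots> \<le> ennreal ((sqrt d * r powr - (\<kappa> / 2))\<^sup>2) * ennreal (C * r powr \<kappa>)"
      by (intro mult_left_mono C that) simp
    also have "\<dots> = ennreal ((sqrt d * r powr - (\<kappa> / 2))\<^sup>2 * (C * r powr \<kappa>))" using C by (simp add: ennreal_mult)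
    also have "(sqrt d * r powr - (\<kappa> / 2))\<^sup>2 * (C * r powr \<kappa>) = C * d"
    proof -
      have "(r powr - (\<kappa> / 2))\<^sup>2 = r powr - \<kappa>" unfolding power2_eq_square powr_add[symmetric] by simp
      then show ?thesis using that by (simp add: power_mult_distrib powr_minus)
    qed
    finally show ?thesis .
  qed
  with C(1) that show ?thesis by blast
qed

text \<open>For |x| < R and |y| \<ge> 2R one has |x - y| \<ge> |y|/2, so the kernel is at most a
  multiple of |x|^(-\<alpha>) |y|^(-n-2s-\<alpha>), whose tail integral in \<open>y\<close> is of
  order R^(-2s-\<alpha>).\<close>

lemma J_tail_le:
  obtains C where "C > 0" "\<And>P R. P \<in> borel_measurable borel \<Longrightarrow> (\<forall>x. 0 \<le> P x) \<Longrightarrow> 0 < R \<Longrightarrow> (\<forall>x. R \<le> norm x \<longrightarrow> P x = 0) \<Longrightarrow>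
    J (\<lambda>x y. P x * indicator {y. 2 * R \<le> norm y} y)
      \<le> ennreal (C * R powr - (2 * s + \<alpha>)) * (\<integral>\<^sup>+x. ennreal (P x * norm x powr - \<alpha>) * indicator (ball 0 (2 * R)) x \<partial>lborel)"
proof -
  have s\<alpha>: "0 < 2 * s + \<alpha>" using s \<alpha> by simp
  obtain C1 where C1: "C1 > 0" "\<And>r. r > 0 \<Longrightarrow>
    (\<integral>\<^sup>+x. ennreal (norm (x :: real ^ 'n) powr - (n + (2 * s + \<alpha>))) * indicator {x. r \<le> norm x} x \<partial>lborel) \<le> ennreal (C1 * r powr - (2 * s + \<alpha>))"
    by (rule ex_tail_powr[OF s\<alpha>]) (rule that, assumption, blast)
  define C where "C = 2 powr (n + 2 * s) * (C1 * 2 powr - (2 * s + \<alpha>))"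
  have "J (\<lambda>x y. P x * indicator {y. 2 * R \<le> norm y} y)
      \<le> ennreal (C * R powr - (2 * s + \<alpha>)) * (\<integral>\<^sup>+x. ennreal (P x * norm x powr - \<alpha>) * indicator (ball 0 (2 * R)) x \<partial>lborel)"
    if [measurable]: "P \<in> borel_measurable borel" and P: "\<forall>x. 0 \<le> P x" "\<forall>x. R \<le> norm x \<longrightarrow> P x = 0" and R: "0 < R" for P R
  proof -
    have inner: "(\<integral>\<^sup>+y. ennreal (P x * indicator {y. 2 * R \<le> norm y} y * kern x y) \<partial>lborel)
      \<le> ennreal (C * R powr - (2 * s + \<alpha>)) * (ennreal (P x * norm x powr - \<alpha>) * indicator (ball 0 (2 * R)) x)" for x
    proof (cases "norm x < R")
      case True
      let ?a = "P x * norm x powr - \<alpha> * 2 powr (n + 2 * s)"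
      have a: "0 \<le> ?a" using P by simp
      have "(\<integral>\<^sup>+y. ennreal (P x * indicator {y. 2 * R \<le> norm y} y * kern x y) \<partial>lborel)
        \<le> (\<integral>\<^sup>+y. ennreal ?a * (ennreal (norm (y :: real ^ 'n) powr - (n + (2 * s + \<alpha>))) * indicator {y. 2 * R \<le> norm y} y) \<partial>lborel)"
      proof (rule nn_integral_mono)
        fix y :: "real ^ 'n"
        have "P x * kern x y \<le> ?a * norm y powr - (n + (2 * s + \<alpha>))" if y: "2 * R \<le> norm y"
        proof -
          have "norm y - norm x \<le> norm (x - y)" by (metis norm_minus_commute norm_triangle_ineq2)
          then have "norm y / 2 \<le> norm (x - y)" using y True by simp
          then have "norm (x - y) powr - (n + 2 * s) \<le> (norm y / 2) powr - (n + 2 * s)"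
            using y R n_pos s by (intro powr_mono2') auto
          also have "\<dots> = 2 powr (n + 2 * s) * norm y powr - (n + 2 * s)"
          proof -
            have e: "(norm y / 2) powr (n + 2 * s) = norm y powr (n + 2 * s) / 2 powr (n + 2 * s)" by (simp add: powr_divide)
            show ?thesis unfolding powr_minus e inverse_divide by (rule divide_inverse)
          qed
          finally have "P x * (norm x powr - \<alpha> * norm (x - y) powr - (n + 2 * s) * norm y powr - \<alpha>)
            \<le> P x * (norm x powr - \<alpha> * (2 powr (n + 2 * s) * norm y powr - (n + 2 * s)) * norm y powr - \<alpha>)"
            using P by (intro mult_left_mono mult_right_mono) auto
          also have "\<dots> = ?a * (norm y powr - (n + 2 * s) * norm y powr - \<alpha>)" by (simp only: mult_ac)
          also have "norm y powr - (n + 2 * s) * norm y powr - \<alpha> = norm y powr - (n + (2 * s + \<alpha>))"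
            unfolding powr_add[symmetric] by (rule arg_cong[where f = "\<lambda>e. norm y powr e"]) simp
          also have "norm x powr - \<alpha> * norm (x - y) powr - (n + 2 * s) * norm y powr - \<alpha> = kern x y"
            unfolding kern_def powr_minus by (simp add: divide_inverse)
          finally show ?thesis .
        qed
        then show "ennreal (P x * indicator {y. 2 * R \<le> norm y} y * kern x y)
          \<le> ennreal ?a * (ennreal (norm y powr - (n + (2 * s + \<alpha>))) * indicator {y. 2 * R \<le> norm y} y)"
          using a by (auto simp: indicator_def ennreal_mult[symmetric] intro!: ennreal_leI)
      qed
      also have "\<dots> = ennreal ?a * (\<integral>\<^sup>+y. ennreal (norm (y :: real ^ 'n) powr - (n + (2 * s + \<alpha>))) * indicator {y. 2 * R \<le> norm y} y \<partial>lborel)"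
        by (rule nn_integral_cmult) measurable
      also have "\<dots> \<le> ennreal ?a * ennreal (C1 * (2 * R) powr - (2 * s + \<alpha>))"
        using R by (intro mult_left_mono C1(2)) auto
      also have "\<dots> = ennreal (?a * (C1 * (2 * R) powr - (2 * s + \<alpha>)))" using a C1 by (simp add: ennreal_mult)
      also have "?a * (C1 * (2 * R) powr - (2 * s + \<alpha>)) = C * R powr - (2 * s + \<alpha>) * (P x * norm x powr - \<alpha>)"
        unfolding C_def powr_mult by (simp only: mult_ac)
      also have "ennreal \<dots> = ennreal (C * R powr - (2 * s + \<alpha>)) * ennreal (P x * norm x powr - \<alpha>)"
        using P C1 by (intro ennreal_mult) (auto simp: C_def)
      also have "\<dots> = ennreal (C * R powr - (2 * s + \<alpha>)) * (ennreal (P x * norm x powr - \<alpha>) * indicator (ball 0 (2 * R)) x)"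
        using True R by (simp add: indicator_def)
      finally show ?thesis .
    next
      case False
      then show ?thesis using P(2) by simp
    qed
    have "J (\<lambda>x y. P x * indicator {y. 2 * R \<le> norm y} y)
      \<le> (\<integral>\<^sup>+x. ennreal (C * R powr - (2 * s + \<alpha>)) * (ennreal (P x * norm x powr - \<alpha>) * indicator (ball 0 (2 * R)) x) \<partial>lborel)"
      unfolding J_def by (rule nn_integral_mono) (rule inner)
    then show ?thesis by (subst (asm) nn_integral_cmult) auto
  qed
  moreover have "C > 0" using C1 by (simp add: C_def)
  ultimately show ?thesis using that by blast
qed

end

section \<open>Comparison with competitors\<close>

context ckn
begin

lemma energy_ge_of_le:
  assumes w: "w \<in> D" and [measurable]: "u \<in> borel_measurable borel" and le: "\<And>x. \<bar>u x\<bar> \<le> \<bar>w x\<bar>"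
    and lam: "0 < lam" and X: "Ip u = ennreal X" "0 \<le> X"
  shows "ennreal (lam * X powr (2 / p)) \<le> Q w"
proof -
  obtain qw where qw: "Q w = ennreal qw" "0 \<le> qw" using D_finite[OF w] by (cases "Q w") auto
  obtain Y where Y: "0 \<le> Y" "Ip w = ennreal Y" "lam * Y powr (2 / p) \<le> qw"
    using lam_Ip_le[OF w lam, of qw] qw by auto
  have "Ip u \<le> Ip w" unfolding Ip_def
  proof (intro nn_integral_mono ennreal_leI powr_mono2)
    show "bw u x \<le> bw w x" for x unfolding bw_def by (intro mult_right_mono le) simp
  qed (use p in auto)
  then have "X \<le> Y" unfolding X(1) Y(2) using Y(1) by (simp add: ennreal_le_iff)
  then have "lam * X powr (2 / p) \<le> lam * Y powr (2 / p)"
    using X(2) lam p by (intro mult_left_mono powr_mono2) auto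
  then show ?thesis using Y(3) unfolding qw(1) by (intro ennreal_leI) simp
qed

text \<open>The energy of the maximum is at least lam X^(2/p), hence at least Q u - d. In
  \<open>Q_max_min_le\<close> this leaves at most d + e for the energy of the minimum and the
  interaction together.\<close>

lemma lattice_deficit:
  assumes u: "u \<in> D" and v: "v \<in> D" and nn: "\<And>x. 0 \<le> u x"
    and lam: "0 < lam" and X: "Ip u = ennreal X" "0 \<le> X" and d: "0 \<le> d" "0 \<le> e"
    and Qu: "Q u \<le> ennreal (lam * X powr (2 / p) + d)" and Qv: "Q v \<le> ennreal e"
  shows "Q (\<lambda>x. min (u x) (v x)) \<le> ennreal (d + e)"
    and "J (\<lambda>x y. max (u x - v x) 0 * max (v y - u y) 0) \<le> ennreal (d + e)"
proof -
  note [measurable] = D_measurable[OF u] D_measurable[OF v]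
  let ?G = "ennreal (lam * X powr (2 / p))" and ?m = "Q (\<lambda>x. min (u x) (v x))"
  let ?J = "J (\<lambda>x y. max (u x - v x) 0 * max (v y - u y) 0)"
  have "?G \<le> Q (\<lambda>x. max (u x) (v x))"
  proof (rule energy_ge_of_le[OF D_max[OF u v] _ _ lam X])
    show "\<bar>u x\<bar> \<le> \<bar>max (u x) (v x)\<bar>" for x using nn[of x] by linarith
  qed measurable
  then have "?G + (?m + 2 * ?J) \<le> Q (\<lambda>x. max (u x) (v x)) + (?m + 2 * ?J)" by (rule add_right_mono)
  also have "\<dots> \<le> Q u + Q v" unfolding add.assoc[symmetric] by (rule Q_max_min_le) measurable
  also have "\<dots> \<le> ennreal (lam * X powr (2 / p) + d) + ennreal e" by (intro add_mono Qu Qv)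
  also have "\<dots> = ?G + ennreal (d + e)" using lam d by (simp add: add.assoc)
  finally have *: "?m + 2 * ?J \<le> ennreal (d + e)" by (simp add: ennreal_add_left_cancel_le)
  have "?m \<le> ?m + 2 * ?J" by simp
  also note *
  finally show "?m \<le> ennreal (d + e)" .
  have "?J \<le> ?m + 2 * ?J" unfolding mult_2 by (intro add_increasing zero_le order_refl)
  also note *
  finally show "?J \<le> ennreal (d + e)" .
qed

text \<open>On the zero set of \<open>u\<close> in the ball of radius r, at least half of that ball,
  the deficiency of \<open>u\<close> below the plateau is its full height l. So
  \<open>J_spread_le\<close> bounds the excess in L1, and the bound for \<open>u\<close> follows
  from u \<le> excess + l.\<close>

lemma L1_exterior_le:
  assumes lam: "0 < lam"
  obtains C where "C > 0" "\<And>u R d X r. u \<in> D \<Longrightarrow> (\<forall>x. 0 \<le> u x) \<Longrightarrow> 0 < R \<Longrightarrow>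
    emeasure lborel {x. u x \<noteq> 0} \<le> ennreal (unit_ball_vol n * R powr n / 2) \<Longrightarrow> Ip u = ennreal X \<Longrightarrow> 0 \<le> X \<Longrightarrow> 0 < d \<Longrightarrow>
    Q u \<le> ennreal (lam * X powr (2 / p) + d) \<Longrightarrow> R \<le> r \<Longrightarrow> L1 u r \<le> ennreal (C * sqrt d * r powr (n / 2 + s))"
proof -
  obtain C0 where C0: "C0 > 0" "\<And>r d. 0 < r \<Longrightarrow> 0 < d \<Longrightarrow> Q (\<lambda>x. (sqrt d * r powr - (\<kappa> / 2)) * plateau r x) \<le> ennreal (C0 * d)"
    using Q_scaled_plateau_le by metis
  have \<alpha>n: "\<alpha> < n" using \<alpha> s by linarith
  obtain C1 where C1: "C1 > 0" "\<And>r. r > 0 \<Longrightarrow>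
    (\<integral>\<^sup>+x. ennreal (norm (x :: real ^ 'n) powr - \<alpha>) * indicator (ball 0 r) x \<partial>lborel) \<le> ennreal (C1 * r powr (n - \<alpha>))"
    by (rule ex_ball_powr[OF \<alpha>n]) (rule that, assumption, blast)
  define C where "C = (1 + C0) / c_spread + C1"
  have "L1 u r \<le> ennreal (C * sqrt d * r powr (n / 2 + s))"
    if u: "u \<in> D" and nn: "\<forall>x. 0 \<le> u x" and R: "0 < R"
      and supp: "emeasure lborel {x. u x \<noteq> 0} \<le> ennreal (unit_ball_vol n * R powr n / 2)"
      and X: "Ip u = ennreal X" "0 \<le> X" and d: "0 < d" and Qu: "Q u \<le> ennreal (lam * X powr (2 / p) + d)" and r: "R \<le> r"
    for u R d X r
  proof -
    have r0: "0 < r" using R r by simp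
    define l where "l = sqrt d * r powr - (\<kappa> / 2)"
    have l: "0 < l" using d r0 by (simp add: l_def)
    let ?v = "\<lambda>x. l * plateau r x"
    have v: "?v \<in> D" by (rule D_cmult[OF D_test[OF plateau_test[OF r0]]])
    note [measurable] = D_measurable[OF u] D_measurable[OF v]
    have Jle: "J (\<lambda>x y. max (u x - ?v x) 0 * max (?v y - u y) 0) \<le> ennreal (d + C0 * d)"
      by (rule lattice_deficit(2)[OF u v _ lam X _ _ Qu]) (use nn d C0(1) C0(2)[OF r0 d] in \<open>auto simp: l_def\<close>)
    have pl: "?v x = l" if "norm x < r" for x :: "real ^ 'n" using plateau_eq_1[OF r0, of x] that by simp
    have half: "ennreal (unit_ball_vol n * r powr n / 2) \<le> emeasure lborel (ball 0 r - {x. u x \<noteq> 0})"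
    proof (rule half_ball_remains)
      have "unit_ball_vol n * R powr n / 2 \<le> unit_ball_vol n * r powr n / 2"
        using V_pos R r n_pos by (intro divide_right_mono mult_left_mono powr_mono2) auto
      then show "emeasure lborel {x. u x \<noteq> 0} \<le> ennreal (unit_ball_vol n * r powr n / 2)"
        by (intro order_trans[OF supp] ennreal_leI)
    qed (use r0 in auto)
    have P: "(\<integral>\<^sup>+x. ennreal (max (u x - ?v x) 0 * norm x powr - \<alpha>) * indicator (ball 0 r) x \<partial>lborel)
      \<le> ennreal ((d + C0 * d) / (c_spread * l) * r powr (2 * s + \<alpha>))"
    proof (rule J_spread_le[OF _ _ _ _ _ r0 _ half l _ Jle])
      show "l \<le> max (?v y - u y) 0" if "y \<in> ball 0 r - {x. u x \<noteq> 0}" for y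
      proof -
        have "?v y = l" by (rule pl) (use that in simp)
        moreover have "u y = 0" using that by simp
        ultimately show ?thesis by linarith
      qed
    qed (use d C0 in auto)
    have "L1 u r \<le> ennreal ((d + C0 * d) / (c_spread * l) * r powr (2 * s + \<alpha>) + l * (C1 * r powr (n - \<alpha>)))"
      by (rule L1_excess_le[OF _ _ _ _ _ _ _ _ P C1(2)[OF r0]])
        (use nn pl l d C0 C1 c_spread_pos in \<open>auto simp: max_def\<close>)
    also have "(d + C0 * d) / (c_spread * l) * r powr (2 * s + \<alpha>) + l * (C1 * r powr (n - \<alpha>)) = C * sqrt d * r powr (n / 2 + s)"
    proof -
      have "d = sqrt d * sqrt d" using d by simp
      then have dl: "d / l = sqrt d * r powr (\<kappa> / 2)" using d r0 unfolding l_def powr_minus by (simp add: field_simps)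
      have "(d + C0 * d) / (c_spread * l) = (1 + C0) / c_spread * (d / l)" using l c_spread_pos by (simp add: field_simps)
      then have "(d + C0 * d) / (c_spread * l) * r powr (2 * s + \<alpha>)
        = (1 + C0) / c_spread * (sqrt d * (r powr (\<kappa> / 2) * r powr (2 * s + \<alpha>)))"
        unfolding dl by (simp only: mult.assoc)
      moreover have "l * (C1 * r powr (n - \<alpha>)) = C1 * (sqrt d * (r powr - (\<kappa> / 2) * r powr (n - \<alpha>)))"
        unfolding l_def by (simp only: mult_ac)
      ultimately show ?thesis unfolding scaling_exponents C_def by (simp only: distrib_right mult.assoc)
    qed
    finally show ?thesis .
  qed
  moreover have "C > 0" using C0 C1 c_spread_pos by (simp add: C_def add_pos_pos)
  ultimately show ?thesis using that by blast
qed

text \<open>The case of the lowest level. \<open>lattice_deficit\<close> controls the energy of the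
  truncation itself; by \<open>truncation_product\<close> the remaining task is the interaction
  between excess above and gap below the level.\<close>

lemma truncation_energy_le:
  assumes lam: "0 < lam"
  obtains C where "C > 0" "\<And>u R d X. u \<in> D \<Longrightarrow> (\<forall>x. 0 \<le> u x) \<Longrightarrow> 0 < R \<Longrightarrow> (\<forall>x. R \<le> norm x \<longrightarrow> u x = 0) \<Longrightarrow>
    Ip u = ennreal X \<Longrightarrow> 0 \<le> X \<Longrightarrow> 0 < d \<Longrightarrow> Q u \<le> ennreal (lam * X powr (2 / p) + d) \<Longrightarrow>
    J (\<lambda>x y. (u x - u y) * (min (u x) (sqrt d * (2 * R) powr - (\<kappa> / 2)) - min (u y) (sqrt d * (2 * R) powr - (\<kappa> / 2)))) \<le> ennreal (C * d)"
proof -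
  obtain C0 where C0: "C0 > 0" "\<And>r d. 0 < r \<Longrightarrow> 0 < d \<Longrightarrow> Q (\<lambda>x. (sqrt d * r powr - (\<kappa> / 2)) * plateau r x) \<le> ennreal (C0 * d)"
    using Q_scaled_plateau_le by metis
  obtain CT where CT: "CT > 0" "\<And>P R. P \<in> borel_measurable borel \<Longrightarrow> (\<forall>x. 0 \<le> P x) \<Longrightarrow> 0 < R \<Longrightarrow> (\<forall>x. R \<le> norm x \<longrightarrow> P x = 0) \<Longrightarrow>
    J (\<lambda>x y. P x * indicator {y. 2 * R \<le> norm y} y)
      \<le> ennreal (CT * R powr - (2 * s + \<alpha>)) * (\<integral>\<^sup>+x. ennreal (P x * norm x powr - \<alpha>) * indicator (ball 0 (2 * R)) x \<partial>lborel)"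
    by (rule J_tail_le) (rule that, assumption, blast)
  define K where "K = CT * 2 powr (2 * s + \<alpha>) / c_spread"
  have K: "K > 0" using CT c_spread_pos by (simp add: K_def)
  define C where "C = (1 + C0) * (3 + 2 * K)"
  have "J (\<lambda>x y. (u x - u y) * (min (u x) (sqrt d * (2 * R) powr - (\<kappa> / 2)) - min (u y) (sqrt d * (2 * R) powr - (\<kappa> / 2)))) \<le> ennreal (C * d)"
    if u: "u \<in> D" and nn: "\<forall>x. 0 \<le> u x" and R: "0 < R" and supp: "\<forall>x. R \<le> norm x \<longrightarrow> u x = 0"
      and X: "Ip u = ennreal X" "0 \<le> X" and d: "0 < d" and Qu: "Q u \<le> ennreal (lam * X powr (2 / p) + d)"
    for u R d X
  proof -
    have r0: "0 < 2 * R" using R by simp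
    define l where "l = sqrt d * (2 * R) powr - (\<kappa> / 2)"
    have l: "0 < l" using d R by (simp add: l_def)
    define v :: "real ^ 'n \<Rightarrow> real" where "v = (\<lambda>x. l * plateau (2 * R) x)"
    have v: "v \<in> D" unfolding v_def by (rule D_cmult[OF D_test[OF plateau_test[OF r0]]])
    note [measurable] = D_measurable[OF u] D_measurable[OF v]
    define E where "E = d + C0 * d"
    have E: "E > 0" using d C0 by (simp add: E_def add_pos_pos)
    have Qv: "Q v \<le> ennreal (C0 * d)" using C0(2)[OF r0 d] by (simp add: l_def v_def)
    have nn': "0 \<le> u x" for x using nn by simp
    have d': "0 \<le> d" "0 \<le> C0 * d" using d C0 by auto
    note ld = lattice_deficit[OF u v nn' lam X d' Qu Qv, folded E_def]
    have pl: "v x = l" if "norm x < 2 * R" for x using plateau_eq_1[OF r0, of x] that by (simp add: v_def)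
    have vnn: "0 \<le> v x" for x using plateau_bounds[of "2 * R" x] l by (simp add: v_def)
    let ?a = "\<lambda>x. min (u x) l" and ?P = "\<lambda>x. max (u x - l) 0" and ?z = "\<lambda>y. max (v y - u y) 0"
    let ?I = "indicator {y :: real ^ 'n. 2 * R \<le> norm y} :: _ \<Rightarrow> real"
    \<comment> \<open>The plateau equals l on the ball of radius 2R, and \<open>u\<close> vanishes
      already outside radius R, so truncating at \<open>v\<close> and at l is the same.\<close>
    have P_eq: "max (u x - v x) 0 = ?P x" and a_eq: "min (u x) (v x) = ?a x" for x
      using pl[of x] supp vnn[of x] l R by (cases "norm x < 2 * R"; simp)+
    have Qa: "Q ?a \<le> ennreal E" using ld(1) by (simp only: a_eq)
    have JP: "J (\<lambda>x y. ?P x * ?z y) \<le> ennreal E" using ld(2) by (simp only: P_eq)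
    \<comment> \<open>The annulus between R and 2R, where \<open>u\<close> vanishes, is at least
      half of the ball because n \<ge> 1.\<close>
    have half: "ennreal (unit_ball_vol n * (2 * R) powr n / 2) \<le> emeasure lborel (ball (0 :: real ^ 'n) (2 * R) - ball 0 R)"
    proof (rule half_ball_remains[OF _ r0])
      have "(2 :: real) powr 1 \<le> 2 powr n" using n_ge_1 by (intro powr_mono) auto
      then have "unit_ball_vol n * R powr n * 1 \<le> unit_ball_vol n * R powr n * (2 powr n / 2)"
        using V_pos by (intro mult_left_mono) auto
      then have "unit_ball_vol n * R powr n \<le> unit_ball_vol n * (2 * R) powr n / 2" by (simp add: powr_mult mult_ac)
      then show "emeasure lborel (ball (0 :: real ^ 'n) R) \<le> ennreal (unit_ball_vol n * (2 * R) powr n / 2)"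
        using R by (simp add: emeasure_ball_n ennreal_leI)
    qed measurable
    have IP: "(\<integral>\<^sup>+x. ennreal (?P x * norm x powr - \<alpha>) * indicator (ball 0 (2 * R)) x \<partial>lborel)
      \<le> ennreal (E / (c_spread * l) * (2 * R) powr (2 * s + \<alpha>))"
      by (rule J_spread_le[OF _ _ _ _ _ r0 _ half l _ JP]) (use pl supp E in auto)
    have "J (\<lambda>x y. ?P x * ?I y)
      \<le> ennreal (CT * R powr - (2 * s + \<alpha>)) * (\<integral>\<^sup>+x. ennreal (?P x * norm x powr - \<alpha>) * indicator (ball 0 (2 * R)) x \<partial>lborel)"
      by (rule CT(2)) (use supp R l in auto)
    also have "\<dots> \<le> ennreal (CT * R powr - (2 * s + \<alpha>)) * ennreal (E / (c_spread * l) * (2 * R) powr (2 * s + \<alpha>))"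
      by (intro mult_left_mono IP) simp
    also have "\<dots> = ennreal (CT * R powr - (2 * s + \<alpha>) * (E / (c_spread * l) * (2 * R) powr (2 * s + \<alpha>)))"
      using CT E l c_spread_pos by (intro ennreal_mult[symmetric]) auto
    also have "CT * R powr - (2 * s + \<alpha>) * (E / (c_spread * l) * (2 * R) powr (2 * s + \<alpha>)) = K * E / l"
      using R unfolding powr_mult powr_minus K_def by (simp add: field_simps)
    finally have JI: "J (\<lambda>x y. ?P x * ?I y) \<le> ennreal (K * E / l)" .
    \<comment> \<open>Inside radius 2R the gap to l is the deficiency \<open>?z\<close>. Outside,
      the plateau may drop below l, so the gap is bounded by l and paid by
      \<open>J_tail_le\<close>.\<close>
    define G where "G = (\<lambda>x y. ?P x * ?z y + l * (?P x * ?I y))"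
    have Gm [measurable]: "pm G" unfolding G_def by measurable
    have Gnn: "0 \<le> G x y" for x y using l by (simp add: G_def)
    have "J G = J (\<lambda>x y. ?P x * ?z y) + ennreal l * J (\<lambda>x y. ?P x * ?I y)"
      unfolding G_def using l by (subst J_add) (auto simp: J_cmult)
    also have "\<dots> \<le> ennreal E + ennreal l * ennreal (K * E / l)" by (intro add_mono mult_left_mono JP JI) simp
    also have "\<dots> = ennreal (E + K * E)" using E K l by (simp add: ennreal_mult[symmetric] ennreal_plus[symmetric] del: ennreal_plus)
    finally have JG: "J G \<le> ennreal (E + K * E)" .
    have "J (\<lambda>x y. (u x - u y) * (?a x - ?a y)) \<le> J (\<lambda>x y. (?a x - ?a y)\<^sup>2 + (G x y + G y x))"
    proof (rule J_mono)
      fix x y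
      have "?P x * (l - ?a y) \<le> G x y" for x y
      proof (cases "norm y < 2 * R")
        case True
        then have "?P x * (l - ?a y) = ?P x * ?z y" using pl by (simp add: min_def max_def)
        moreover have "0 \<le> l * (?P x * ?I y)" using l by simp
        ultimately show ?thesis unfolding G_def by linarith
      next
        case False
        then have "?P x * (l - ?a y) \<le> l * (?P x * ?I y)" using nn l supp R by (simp add: mult.commute)
        moreover have "0 \<le> ?P x * ?z y" by simp
        ultimately show ?thesis unfolding G_def by linarith
      qed
      from add_mono[OF this[of x y] this[of y x]]
      show "(u x - u y) * (?a x - ?a y) \<le> (?a x - ?a y)\<^sup>2 + (G x y + G y x)" unfolding truncation_product by simp
    qed
    also have "\<dots> = Q ?a + (J G + J (\<lambda>x y. G y x))"
    proof -
      have "pm (\<lambda>x y. G y x)" unfolding G_def by measurable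
      then show ?thesis unfolding Q_def using Gnn by (subst J_add) (auto simp: J_add add_nonneg_nonneg)
    qed
    also have "\<dots> \<le> ennreal E + (ennreal (E + K * E) + ennreal (E + K * E))"
      unfolding J_swap[OF Gm] by (intro add_mono Qa JG)
    also have "\<dots> = ennreal (C * d)"
    proof -
      have "E + ((E + K * E) + (E + K * E)) = C * d" by (simp add: C_def E_def algebra_simps)
      moreover have "ennreal E + (ennreal (E + K * E) + ennreal (E + K * E)) = ennreal (E + ((E + K * E) + (E + K * E)))"
        using E K by (simp add: ennreal_plus[symmetric] del: ennreal_plus)
      ultimately show ?thesis by simp
    qed
    finally show ?thesis unfolding l_def .
  qed
  moreover have "C > 0" using C0 K by (simp add: C_def add_pos_pos)
  ultimately show ?thesis using that by blast
qed

text \<open>Compared with \<open>u\<close>, the competitor saves \<mu> times the product energy of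
  the truncation at t and spends three times the one at l, which is O(d). Dividing by \<mu> = l/t
  makes the bound linear in t.\<close>

lemma high_truncation_energy_le:
  assumes lam: "0 < lam"
  obtains C where "C > 0" "\<And>u R d X t. u \<in> D \<Longrightarrow> (\<forall>x. 0 \<le> u x) \<Longrightarrow> 0 < R \<Longrightarrow> (\<forall>x. R \<le> norm x \<longrightarrow> u x = 0) \<Longrightarrow>
    Ip u = ennreal X \<Longrightarrow> 0 \<le> X \<Longrightarrow> 0 < d \<Longrightarrow> Q u \<le> ennreal (lam * X powr (2 / p) + d) \<Longrightarrow>
    sqrt d * (2 * R) powr - (\<kappa> / 2) \<le> t \<Longrightarrow>
    J (\<lambda>x y. (u x - u y) * (min (u x) t - min (u y) t)) \<le> ennreal (C * (t * (sqrt d * (2 * R) powr (\<kappa> / 2))))"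
proof -
  obtain C0 where C0: "C0 > 0" "\<And>u R d X. u \<in> D \<Longrightarrow> (\<forall>x. 0 \<le> u x) \<Longrightarrow> 0 < R \<Longrightarrow> (\<forall>x. R \<le> norm x \<longrightarrow> u x = 0) \<Longrightarrow>
    Ip u = ennreal X \<Longrightarrow> 0 \<le> X \<Longrightarrow> 0 < d \<Longrightarrow> Q u \<le> ennreal (lam * X powr (2 / p) + d) \<Longrightarrow>
    J (\<lambda>x y. (u x - u y) * (min (u x) (sqrt d * (2 * R) powr - (\<kappa> / 2)) - min (u y) (sqrt d * (2 * R) powr - (\<kappa> / 2)))) \<le> ennreal (C0 * d)"
    by (rule truncation_energy_le[OF lam]) (rule that, assumption, blast)
  have "J (\<lambda>x y. (u x - u y) * (min (u x) t - min (u y) t)) \<le> ennreal ((1 + 3 * C0) * (t * (sqrt d * (2 * R) powr (\<kappa> / 2))))"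
    if u: "u \<in> D" and nn: "\<forall>x. 0 \<le> u x" and R: "0 < R" and supp: "\<forall>x. R \<le> norm x \<longrightarrow> u x = 0"
      and X: "Ip u = ennreal X" "0 \<le> X" and d: "0 < d" and Qu: "Q u \<le> ennreal (lam * X powr (2 / p) + d)"
      and t: "sqrt d * (2 * R) powr - (\<kappa> / 2) \<le> t"
    for u R d X t
  proof -
    define l where "l = sqrt d * (2 * R) powr - (\<kappa> / 2)"
    have l: "0 < l" "l \<le> t" using d R t by (auto simp: l_def)
    \<comment> \<open>The largest factor with \<mu> min(u, t) \<le> min(u, l) at all values of
      \<open>u\<close>, so that the competitor stays above \<open>u\<close>.\<close>
    define \<mu> where "\<mu> = l / t"
    have \<mu>: "0 < \<mu>" "\<mu> \<le> 1" using l by (auto simp: \<mu>_def)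
    let ?a = "\<lambda>x. min (u x) l" and ?T = "\<lambda>x. min (u x) t"
    let ?w = "\<lambda>x. u x + ?a x - \<mu> * ?T x"
    let ?JT = "J (\<lambda>x y. (u x - u y) * (?T x - ?T y))" and ?Ja = "J (\<lambda>x y. (u x - u y) * (?a x - ?a y))"
    have w: "?w \<in> D" using u l by (intro D_diff D_add D_cmult D_min_const) auto
    note [measurable] = D_measurable[OF u]
    have le: "\<bar>u x\<bar> \<le> \<bar>?w x\<bar>" for x
    proof -
      have "\<mu> * ?T x \<le> ?a x"
      proof (cases "u x \<le> l")
        case True
        then have "\<mu> * u x \<le> 1 * u x" using \<mu> nn by (intro mult_right_mono) auto
        then show ?thesis using True l by simp
      next
        case False
        then have "\<mu> * ?T x \<le> \<mu> * t" using \<mu> by (intro mult_left_mono) auto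
        also have "\<dots> = l" using l by (simp add: \<mu>_def)
        finally show ?thesis using False by simp
      qed
      then have "u x \<le> ?w x" by linarith
      then show ?thesis using nn[rule_format, of x] by linarith
    qed
    have Jnn: "0 \<le> (u x - u y) * (?T x - ?T y)" "0 \<le> (u x - u y) * (?a x - ?a y)" for x y
      by (rule truncation_increments(1), rule order_refl)+
    have "ennreal (lam * X powr (2 / p)) + ennreal \<mu> * ?JT \<le> Q ?w + ennreal \<mu> * ?JT"
      by (intro add_right_mono energy_ge_of_le[OF w _ le lam X]) measurable
    also have "\<dots> = J (\<lambda>x y. (?w x - ?w y)\<^sup>2 + \<mu> * ((u x - u y) * (?T x - ?T y)))"
      unfolding Q_def using \<mu> Jnn by (subst J_add) (auto simp: J_cmult)
    also have "\<dots> \<le> J (\<lambda>x y. (u x - u y)\<^sup>2 + 3 * ((u x - u y) * (?a x - ?a y)))"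
      by (intro J_mono truncation_competitor) (use l \<mu> in auto)
    also have "\<dots> = Q u + ennreal 3 * ?Ja"
      unfolding Q_def using Jnn by (subst J_add) (auto simp: J_cmult)
    also have "\<dots> \<le> ennreal (lam * X powr (2 / p) + d) + ennreal 3 * ennreal (C0 * d)"
      unfolding l_def by (intro add_mono mult_left_mono Qu C0(2)[OF u nn R supp X d Qu]) simp
    also have "\<dots> = ennreal (lam * X powr (2 / p)) + ennreal ((1 + 3 * C0) * d)"
    proof -
      have "ennreal 3 * ennreal (C0 * d) = ennreal (3 * (C0 * d))" by (rule ennreal_mult[symmetric]) (use C0 d in auto)
      moreover have "ennreal (lam * X powr (2 / p) + d) + ennreal (3 * (C0 * d)) = ennreal (lam * X powr (2 / p) + d + 3 * (C0 * d))"
        by (rule ennreal_plus[symmetric]) (use lam d C0 in auto)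
      moreover have "ennreal (lam * X powr (2 / p)) + ennreal ((1 + 3 * C0) * d) = ennreal (lam * X powr (2 / p) + (1 + 3 * C0) * d)"
        by (rule ennreal_plus[symmetric]) (use lam d C0 in auto)
      moreover have "lam * X powr (2 / p) + d + 3 * (C0 * d) = lam * X powr (2 / p) + (1 + 3 * C0) * d"
        by (simp add: distrib_right)
      ultimately show ?thesis by (simp only:)
    qed
    finally have "ennreal \<mu> * ?JT \<le> ennreal ((1 + 3 * C0) * d)" by (simp add: ennreal_add_left_cancel_le)
    then have "?JT \<le> ennreal ((1 + 3 * C0) * d / \<mu>)"
      by (rule ennreal_mult_le_imp[rotated 2]) (use \<mu> d C0 in auto)
    also have "(1 + 3 * C0) * d / \<mu> = (1 + 3 * C0) * (t * (sqrt d * (2 * R) powr (\<kappa> / 2)))"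
    proof -
      have "l * (sqrt d * (2 * R) powr (\<kappa> / 2)) = (sqrt d * sqrt d) * ((2 * R) powr - (\<kappa> / 2) * (2 * R) powr (\<kappa> / 2))"
        unfolding l_def by (simp only: mult_ac)
      also have "\<dots> = d" using d R unfolding powr_add[symmetric] by simp
      finally have "d = l * (sqrt d * (2 * R) powr (\<kappa> / 2))" by (rule sym)
      then have "d / \<mu> = t * (sqrt d * (2 * R) powr (\<kappa> / 2))" using l by (simp add: \<mu>_def field_simps)
      then show ?thesis by (simp only: times_divide_eq_right[symmetric])
    qed
    finally show ?thesis .
  qed
  moreover have "1 + 3 * C0 > 0" using C0 by simp
  ultimately show ?thesis using that by blast
qed

lemma L1_interior_le:
  assumes lam: "0 < lam"
  obtains C where "C > 0" "\<And>u R d X r. u \<in> D \<Longrightarrow> (\<forall>x. 0 \<le> u x) \<Longrightarrow> 0 < R \<Longrightarrow> (\<forall>x. R \<le> norm x \<longrightarrow> u x = 0) \<Longrightarrow>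
    Ip u = ennreal X \<Longrightarrow> 0 \<le> X \<Longrightarrow> 0 < d \<Longrightarrow> Q u \<le> ennreal (lam * X powr (2 / p) + d) \<Longrightarrow> 0 < r \<Longrightarrow> r \<le> R \<Longrightarrow>
    L1 u r \<le> ennreal (C * (sqrt d * (2 * R) powr (\<kappa> / 2)) * r powr (2 * s + \<alpha>))"
proof -
  obtain C2 where C2: "C2 > 0" "\<And>u R d X t. u \<in> D \<Longrightarrow> (\<forall>x. 0 \<le> u x) \<Longrightarrow> 0 < R \<Longrightarrow> (\<forall>x. R \<le> norm x \<longrightarrow> u x = 0) \<Longrightarrow>
    Ip u = ennreal X \<Longrightarrow> 0 \<le> X \<Longrightarrow> 0 < d \<Longrightarrow> Q u \<le> ennreal (lam * X powr (2 / p) + d) \<Longrightarrow>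
    sqrt d * (2 * R) powr - (\<kappa> / 2) \<le> t \<Longrightarrow>
    J (\<lambda>x y. (u x - u y) * (min (u x) t - min (u y) t)) \<le> ennreal (C2 * (t * (sqrt d * (2 * R) powr (\<kappa> / 2))))"
    by (rule high_truncation_energy_le[OF lam]) (rule that, assumption, blast)
  obtain CH where CH: "CH > 0" "\<And>u E. u \<in> D \<Longrightarrow> 0 < E \<Longrightarrow> Q u \<le> ennreal E \<Longrightarrow> H u \<le> ennreal (CH * E)"
    using Hardy by metis
  have \<alpha>n: "\<alpha> < n" using \<alpha> s by linarith
  obtain C1 where C1: "C1 > 0" "\<And>r. r > 0 \<Longrightarrow>
    (\<integral>\<^sup>+x. ennreal (norm (x :: real ^ 'n) powr - \<alpha>) * indicator (ball 0 r) x \<partial>lborel) \<le> ennreal (C1 * r powr (n - \<alpha>))"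
    by (rule ex_ball_powr[OF \<alpha>n]) (rule that, assumption, blast)
  let ?V = "unit_ball_vol n"
  \<comment> \<open>The entry 1 keeps t above the lowest level l; the other makes the set
    \<open>?B\<close> at most half of the ball.\<close>
  define K where "K = max 1 (8 * CH * C2 / ?V)"
  have K: "K \<ge> 1" "8 * CH * C2 \<le> ?V * K" using V_pos by (auto simp: K_def max_def pos_divide_le_eq mult.commute not_le less_imp_le)
  define C where "C = 2 * C2 / c_spread + K * C1"
  have "L1 u r \<le> ennreal (C * (sqrt d * (2 * R) powr (\<kappa> / 2)) * r powr (2 * s + \<alpha>))"
    if u: "u \<in> D" and nn: "\<forall>x. 0 \<le> u x" and R: "0 < R" and supp: "\<forall>x. R \<le> norm x \<longrightarrow> u x = 0"
      and X: "Ip u = ennreal X" "0 \<le> X" and d: "0 < d" and Qu: "Q u \<le> ennreal (lam * X powr (2 / p) + d)"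
      and r: "0 < r" "r \<le> R"
    for u R d X r
  proof -
    define M where "M = sqrt d * (2 * R) powr (\<kappa> / 2)"
    have M: "M > 0" using d R by (simp add: M_def)
    \<comment> \<open>Hardy's inequality and the linear energy bound give the set where u \<ge> t/2
      in the ball a measure O((M/t) r^(2s+2\<alpha>)). This is a small multiple of r^n exactly when
      t is a large multiple of M r^(-\<kappa>).\<close>
    define t where "t = K * M * r powr - \<kappa>"
    have t: "t > 0" using K M r by (simp add: t_def)
    have tl: "sqrt d * (2 * R) powr - (\<kappa> / 2) \<le> t"
    proof -
      have "(2 * R) powr - (\<kappa> / 2) = (2 * R) powr (\<kappa> / 2) * (2 * R) powr - \<kappa>" unfolding powr_add[symmetric] by simp
      then have "sqrt d * (2 * R) powr - (\<kappa> / 2) = 1 * M * (2 * R) powr - \<kappa>" by (simp add: M_def)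
      also have "\<dots> \<le> K * M * r powr - \<kappa>" using K M r kappa_pos by (intro mult_mono powr_mono2') auto
      finally show ?thesis by (simp add: t_def)
    qed
    note [measurable] = D_measurable[OF u]
    let ?T = "\<lambda>x. min (u x) t"
    define E where "E = C2 * (t * M)"
    have E: "E > 0" using C2 t M by (simp add: E_def)
    have JT: "J (\<lambda>x y. (u x - u y) * (?T x - ?T y)) \<le> ennreal E"
      unfolding E_def M_def by (rule C2(2)[OF u nn R supp X d Qu tl])
    have "Q ?T \<le> J (\<lambda>x y. (u x - u y) * (?T x - ?T y))"
      unfolding Q_def by (intro J_mono truncation_increments(2)) (rule order_refl)
    also note JT
    finally have QT: "Q ?T \<le> ennreal E" .
    have HT: "H ?T \<le> ennreal (CH * E)" by (rule CH(2)[OF D_min_const[OF u] E QT]) (use t in simp)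
    let ?B = "{x \<in> ball 0 r. t / 2 \<le> u x}"
    define k where "k = (t / 2)\<^sup>2 * r powr - (2 * s + 2 * \<alpha>)"
    have k: "k > 0" using t r by (simp add: k_def)
    have "ennreal k * emeasure lborel ?B = (\<integral>\<^sup>+x. ennreal k * indicator ?B x \<partial>lborel)"
      by (rule nn_integral_cmult_indicator[symmetric]) measurable
    also have "\<dots> \<le> H ?T" unfolding H_def
    proof (rule nn_integral_mono_AE)
      show "AE x in lborel. ennreal k * indicator ?B x \<le> ennreal ((?T x)\<^sup>2 * norm x powr - (2 * s + 2 * \<alpha>))"
        using AE_nonzero
      proof eventually_elim
        case (elim x)
        have "k \<le> (?T x)\<^sup>2 * norm x powr - (2 * s + 2 * \<alpha>)" if "x \<in> ?B"
          unfolding k_def using that elim t s \<alpha> by (intro mult_mono power_mono powr_mono2') auto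
        then show ?case by (auto simp: indicator_def intro: ennreal_leI)
      qed
    qed
    also note HT
    finally have "emeasure lborel ?B \<le> ennreal (CH * E / k)"
      by (rule ennreal_mult_le_imp[rotated 2]) (use k CH E in auto)
    also have "CH * E / k \<le> ?V * r powr n / 2"
    proof -
      have "k * (r powr \<kappa> * r powr (2 * s + 2 * \<alpha>)) = K * M * t / 4"
        using r unfolding k_def t_def powr_minus by (simp add: power2_eq_square field_simps)
      then have kn: "k * r powr n = K * M * t / 4" by (simp only: scaling_exponents)
      have "8 * CH * C2 * (t * M) \<le> ?V * K * (t * M)" using K t M by (intro mult_right_mono) auto
      then have "CH * E \<le> ?V / 2 * (K * M * t / 4)" unfolding E_def by (simp add: mult_ac)
      also have "\<dots> = ?V * r powr n / 2 * k" unfolding kn[symmetric] by simp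
      finally show ?thesis using k by (simp add: pos_divide_le_eq)
    qed
    finally have Bv: "emeasure lborel ?B \<le> ennreal (?V * r powr n / 2)" by (simp add: ennreal_leI)
    have half: "ennreal (?V * r powr n / 2) \<le> emeasure lborel (ball 0 r - ?B)"
      by (rule half_ball_remains[OF _ r(1) Bv]) measurable
    have "J (\<lambda>x y. max (u x - t) 0 * max (t - u y) 0) \<le> J (\<lambda>x y. (u x - u y) * (?T x - ?T y))"
      by (intro J_mono excess_deficiency_le)
    also note JT
    finally have JP: "J (\<lambda>x y. max (u x - t) 0 * max (t - u y) 0) \<le> ennreal E" .
    have P: "(\<integral>\<^sup>+x. ennreal (max (u x - t) 0 * norm x powr - \<alpha>) * indicator (ball 0 r) x \<partial>lborel)
      \<le> ennreal (E / (c_spread * (t / 2)) * r powr (2 * s + \<alpha>))"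
      by (rule J_spread_le[OF _ _ _ _ _ r(1) _ half _ _ JP]) (use t E in auto)
    have "L1 u r \<le> ennreal (E / (c_spread * (t / 2)) * r powr (2 * s + \<alpha>) + t * (C1 * r powr (n - \<alpha>)))"
      by (rule L1_excess_le[OF _ _ _ _ _ _ _ _ P C1(2)[OF r(1)]]) (use nn t E C1 c_spread_pos in auto)
    also have "E / (c_spread * (t / 2)) * r powr (2 * s + \<alpha>) + t * (C1 * r powr (n - \<alpha>)) = C * M * r powr (2 * s + \<alpha>)"
    proof -
      have "E / (c_spread * (t / 2)) = 2 * C2 / c_spread * M" using t by (simp add: E_def field_simps)
      moreover have "t * (C1 * r powr (n - \<alpha>)) = K * C1 * M * (r powr - \<kappa> * r powr (n - \<alpha>))"
        unfolding t_def by (simp only: mult_ac)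
      ultimately show ?thesis unfolding scaling_exponents C_def by (simp only: distrib_right)
    qed
    finally show ?thesis unfolding M_def .
  qed
  moreover have "C > 0" using C2 K C1 c_spread_pos by (simp add: C_def add_pos_pos)
  ultimately show ?thesis using that by blast
qed

end

section \<open>The weak-type remainder\<close>

context fractional_energy
begin

lemma L1_set_energy_le:
  obtains C where "C > 0" "\<And>v e A \<rho>. v \<in> D \<Longrightarrow> 0 < e \<Longrightarrow> Q v \<le> ennreal (e\<^sup>2) \<Longrightarrow> A \<in> sets borel \<Longrightarrow> 0 < \<rho> \<Longrightarrow>
    emeasure lborel A \<le> ennreal (unit_ball_vol n * \<rho> powr n) \<Longrightarrow>
    (\<integral>\<^sup>+x. ennreal (wt v x) * indicator A x \<partial>lborel) \<le> ennreal (C * e * \<rho> powr (n / 2 + s))"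
proof -
  obtain CS where CS: "CS > 0" "\<And>u E. u \<in> D \<Longrightarrow> 0 < E \<Longrightarrow> Q u \<le> ennreal E \<Longrightarrow>
    (\<integral>\<^sup>+x. ennreal (wt u x powr q) \<partial>lborel) \<le> ennreal (CS * E powr (q / 2))" using Sobolev by metis
  define C where "C = 2 * CS powr (1 / q) * unit_ball_vol n powr (1 / 2 + s / n)"
  have "(\<integral>\<^sup>+x. ennreal (wt v x) * indicator A x \<partial>lborel) \<le> ennreal (C * e * \<rho> powr (n / 2 + s))"
    if v: "v \<in> D" and e: "0 < e" and Qv: "Q v \<le> ennreal (e\<^sup>2)" and [measurable]: "A \<in> sets borel" and \<rho>: "0 < \<rho>"
      and A: "emeasure lborel A \<le> ennreal (unit_ball_vol n * \<rho> powr n)" for v e A \<rho>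
  proof -
    note [measurable] = D_measurable[OF v]
    let ?\<sigma> = "CS powr (1 / q) * e"
    have "?\<sigma> powr q = CS * (e\<^sup>2) powr (q / 2)"
    proof -
      have "e\<^sup>2 = e powr 2" using e by (simp add: powr_numeral)
      then show ?thesis using CS(1) q_pos by (simp add: powr_mult powr_powr)
    qed
    then have Sq: "(\<integral>\<^sup>+x. ennreal (wt v x powr q) \<partial>lborel) \<le> ennreal (?\<sigma> powr q)"
      using CS(2)[OF v _ Qv] e by simp
    have "(\<integral>\<^sup>+x. ennreal (wt v x) * indicator A x \<partial>lborel)
      \<le> ennreal (2 * ?\<sigma> * (unit_ball_vol n * \<rho> powr n) powr (1 / 2 + s / n))"
      by (rule L1_set_le[OF _ _ _ Sq A]) (use e CS V_pos \<rho> in auto)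
    also have "(unit_ball_vol n * \<rho> powr n) powr (1 / 2 + s / n) = unit_ball_vol n powr (1 / 2 + s / n) * \<rho> powr (n / 2 + s)"
    proof -
      have "n * (1 / 2 + s / n) = n / 2 + s" using n_pos by (simp add: field_simps)
      then show ?thesis by (simp only: powr_mult powr_powr)
    qed
    also have "2 * ?\<sigma> * (unit_ball_vol n powr (1 / 2 + s / n) * \<rho> powr (n / 2 + s)) = C * e * \<rho> powr (n / 2 + s)"
      unfolding C_def by (simp only: mult_ac)
    finally show ?thesis .
  qed
  moreover have "C > 0" using CS V_pos by (simp add: C_def)
  ultimately show ?thesis using that by blast
qed

text \<open>Numbers in [0,1] whose squares sum to 1 have sum at least 1.\<close>

lemma nn_integral_wt_split:
  assumes [measurable]: "u \<in> borel_measurable borel" "A \<in> sets borel"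
  shows "(\<integral>\<^sup>+x. ennreal (wt u x) * indicator A x \<partial>lborel)
    \<le> (\<integral>\<^sup>+x. ennreal (wt (\<lambda>x. \<chi>1 \<rho> x * u x) x) * indicator A x \<partial>lborel)
      + (\<integral>\<^sup>+x. ennreal (wt (\<lambda>x. \<chi>2 \<rho> x * u x) x) * indicator A x \<partial>lborel)"
proof -
  have "(\<integral>\<^sup>+x. ennreal (wt u x) * indicator A x \<partial>lborel)
    \<le> (\<integral>\<^sup>+x. ennreal (wt (\<lambda>x. \<chi>1 \<rho> x * u x) x) * indicator A x + ennreal (wt (\<lambda>x. \<chi>2 \<rho> x * u x) x) * indicator A x \<partial>lborel)"
  proof (rule nn_integral_mono)
    fix x
    have "wt (\<lambda>x. \<chi>1 \<rho> x * u x) x + wt (\<lambda>x. \<chi>2 \<rho> x * u x) x = (\<chi>1 \<rho> x + \<chi>2 \<rho> x) * wt u x"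
      using \<chi>_nonneg[of \<rho> x] by (simp add: wt_def abs_mult distrib_right)
    moreover have "1 * wt u x \<le> (\<chi>1 \<rho> x + \<chi>2 \<rho> x) * wt u x" by (intro mult_right_mono \<chi>_sum_ge_1) simp
    ultimately have "ennreal (wt u x) \<le> ennreal (wt (\<lambda>x. \<chi>1 \<rho> x * u x) x + wt (\<lambda>x. \<chi>2 \<rho> x * u x) x)"
      by (intro ennreal_leI) simp
    then show "ennreal (wt u x) * indicator A x
      \<le> ennreal (wt (\<lambda>x. \<chi>1 \<rho> x * u x) x) * indicator A x + ennreal (wt (\<lambda>x. \<chi>2 \<rho> x * u x) x) * indicator A x"
      by (simp add: indicator_def)
  qed
  then show ?thesis by (subst (asm) nn_integral_add) auto
qed

lemma nn_integral_wt_inner_le: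
  assumes "0 < \<rho>"
  shows "(\<integral>\<^sup>+x. ennreal (wt (\<lambda>x. \<chi>1 \<rho> x * u x) x) * indicator A x \<partial>lborel) \<le> L1 u (2 * \<rho>)"
proof (rule nn_integral_mono)
  fix x
  show "ennreal (wt (\<lambda>x. \<chi>1 \<rho> x * u x) x) * indicator A x \<le> ennreal (wt u x) * indicator (ball 0 (2 * \<rho>)) x"
  proof (cases "norm x < 2 * \<rho>")
    case True
    have "wt (\<lambda>x. \<chi>1 \<rho> x * u x) x = \<chi>1 \<rho> x * wt u x" using \<chi>_nonneg[of \<rho> x] by (simp add: wt_def abs_mult)
    also have "\<dots> \<le> 1 * wt u x" by (intro mult_right_mono \<chi>_le_1) simp
    finally show ?thesis using True by (auto simp: indicator_def intro: ennreal_leI)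
  next
    case False
    then show ?thesis using \<chi>_outer(1)[OF assms, of x] by (simp add: wt_def)
  qed
qed

end

context ckn
begin

text \<open>Splits \<open>u\<close> into three pieces: outside scale R, between \<rho> and R, and
  near the origin. The first two have small energy and are integrated over \<open>A\<close> by
  \<open>L1_set_energy_le\<close>; the last one is covered by the L1 bound on the ball of radius
  2\<rho>.\<close>

lemma normalized_L1_le:
  assumes lam: "0 < lam" and X0: "0 < X0"
  obtains C d0 where "C > 0" "d0 > 0" "\<And>u R d X \<rho> A. u \<in> D \<Longrightarrow> (\<forall>x. 0 \<le> u x) \<Longrightarrow> 0 < R \<Longrightarrow>
    emeasure lborel {x. u x \<noteq> 0} \<le> ennreal (unit_ball_vol n * R powr n / 2) \<Longrightarrow> Ip u = ennreal X \<Longrightarrow> X0 \<le> X \<Longrightarrow> 0 < d \<Longrightarrow> d \<le> d0 \<Longrightarrow>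
    Q u \<le> ennreal 1 \<Longrightarrow> Q u \<le> ennreal (lam * X powr (2 / p) + d) \<Longrightarrow> 0 < \<rho> \<Longrightarrow> \<rho> \<le> R \<Longrightarrow> A \<in> sets borel \<Longrightarrow>
    emeasure lborel A \<le> ennreal (unit_ball_vol n * \<rho> powr n) \<Longrightarrow>
    (\<integral>\<^sup>+x. ennreal (wt u x) * indicator A x \<partial>lborel) \<le> ennreal (C * (sqrt d * R powr (\<kappa> / 2)) * \<rho> powr (2 * s + \<alpha>))"
proof -
  obtain CE where CE: "CE > 0" "\<And>u R d X r. u \<in> D \<Longrightarrow> (\<forall>x. 0 \<le> u x) \<Longrightarrow> 0 < R \<Longrightarrow>
    emeasure lborel {x. u x \<noteq> 0} \<le> ennreal (unit_ball_vol n * R powr n / 2) \<Longrightarrow> Ip u = ennreal X \<Longrightarrow> 0 \<le> X \<Longrightarrow> 0 < d \<Longrightarrow>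
    Q u \<le> ennreal (lam * X powr (2 / p) + d) \<Longrightarrow> R \<le> r \<Longrightarrow> L1 u r \<le> ennreal (CE * sqrt d * r powr (n / 2 + s))"
    by (rule L1_exterior_le[OF lam]) (rule that, assumption, blast)
  obtain CI where CI: "CI > 0" "\<And>u R d X r. u \<in> D \<Longrightarrow> (\<forall>x. 0 \<le> u x) \<Longrightarrow> 0 < R \<Longrightarrow> (\<forall>x. R \<le> norm x \<longrightarrow> u x = 0) \<Longrightarrow>
    Ip u = ennreal X \<Longrightarrow> 0 \<le> X \<Longrightarrow> 0 < d \<Longrightarrow> Q u \<le> ennreal (lam * X powr (2 / p) + d) \<Longrightarrow> 0 < r \<Longrightarrow> r \<le> R \<Longrightarrow>
    L1 u r \<le> ennreal (CI * (sqrt d * (2 * R) powr (\<kappa> / 2)) * r powr (2 * s + \<alpha>))"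
    by (rule L1_interior_le[OF lam]) (rule that, assumption, blast)
  obtain CS where CS: "CS > 0" "\<And>v e A \<rho>. v \<in> D \<Longrightarrow> 0 < e \<Longrightarrow> Q v \<le> ennreal (e\<^sup>2) \<Longrightarrow> A \<in> sets borel \<Longrightarrow> 0 < \<rho> \<Longrightarrow>
    emeasure lborel A \<le> ennreal (unit_ball_vol n * \<rho> powr n) \<Longrightarrow>
    (\<integral>\<^sup>+x. ennreal (wt v x) * indicator A x \<partial>lborel) \<le> ennreal (CS * e * \<rho> powr (n / 2 + s))"
    by (rule L1_set_energy_le) (rule that, assumption, blast)
  obtain m1 C2 where m1: "m1 > 0" "C2 > 0" "\<And>u \<rho> m d X. u \<in> D \<Longrightarrow> Q u \<le> ennreal 1 \<Longrightarrow> Ip u = ennreal X \<Longrightarrow> X0 \<le> X \<Longrightarrow>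
    Q u \<le> ennreal (lam * X powr (2 / p) + d) \<Longrightarrow> 0 \<le> d \<Longrightarrow> d \<le> m\<^sup>2 \<Longrightarrow> 0 < \<rho> \<Longrightarrow> 0 < m \<Longrightarrow> m \<le> m1 \<Longrightarrow>
    (\<forall>r\<ge>\<rho>. L1 u r \<le> ennreal (m * r powr (n / 2 + s))) \<Longrightarrow>
    Q (\<lambda>x. \<chi>2 \<rho> x * u x) \<le> ennreal (C2 * m\<^sup>2) \<and> (\<exists>Y. Ip (\<lambda>x. \<chi>1 \<rho> x * u x) = ennreal Y \<and> X / 2 \<le> Y \<and>
      Q (\<lambda>x. \<chi>1 \<rho> x * u x) \<le> ennreal (lam * Y powr (2 / p) + C2 * m\<^sup>2) \<and> Q (\<lambda>x. \<chi>1 \<rho> x * u x) \<le> ennreal (1 + C2 * m\<^sup>2))"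
    apply (rule exterior_estimate[OF lam zero_less_one X0])
    subgoal premises prems by (rule that[OF prems(2,3)]) (rule prems(4))
    done
  \<comment> \<open>The second localisation acts on the interior part of the first, with the energy
    bound and the halved lower bound on the p-mass which that part inherits.\<close>
  define E1 where "E1 = 1 + C2 * m1\<^sup>2"
  have E1: "0 < E1" using m1 by (simp add: E1_def add_pos_nonneg)
  have X0': "0 < X0 / 2" using X0 by simp
  obtain m2 C4 where m2: "m2 > 0" "C4 > 0" "\<And>u \<rho> m d X. u \<in> D \<Longrightarrow> Q u \<le> ennreal E1 \<Longrightarrow> Ip u = ennreal X \<Longrightarrow> X0 / 2 \<le> X \<Longrightarrow>
    Q u \<le> ennreal (lam * X powr (2 / p) + d) \<Longrightarrow> 0 \<le> d \<Longrightarrow> d \<le> m\<^sup>2 \<Longrightarrow> 0 < \<rho> \<Longrightarrow> 0 < m \<Longrightarrow> m \<le> m2 \<Longrightarrow>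
    (\<forall>r\<ge>\<rho>. L1 u r \<le> ennreal (m * r powr (n / 2 + s))) \<Longrightarrow>
    Q (\<lambda>x. \<chi>2 \<rho> x * u x) \<le> ennreal (C4 * m\<^sup>2) \<and> (\<exists>Y. Ip (\<lambda>x. \<chi>1 \<rho> x * u x) = ennreal Y \<and> X / 2 \<le> Y \<and>
      Q (\<lambda>x. \<chi>1 \<rho> x * u x) \<le> ennreal (lam * Y powr (2 / p) + C4 * m\<^sup>2) \<and> Q (\<lambda>x. \<chi>1 \<rho> x * u x) \<le> ennreal (E1 + C4 * m\<^sup>2))"
    apply (rule exterior_estimate[OF lam E1 X0'])
    subgoal premises prems by (rule that[OF prems(2,3)]) (rule prems(4))
    done
  \<comment> \<open>At least 1, so that m = C1 sqrt d satisfies d \<le> m^2; \<open>d0\<close> then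
    ensures m \<le> m1.\<close>
  define C1 where "C1 = max CE 1"
  have C1: "1 \<le> C1" "CE \<le> C1" by (auto simp: C1_def)
  define d0 where "d0 = (m1 / C1)\<^sup>2"
  have d0: "d0 > 0" using m1 C1 by (simp add: d0_def)
  define G where "G = sqrt C2 * C1"
  have G: "G > 0" using m1 C1 by (simp add: G_def)
  define C5 where "C5 = max (CI * G * 4 powr (\<kappa> / 2)) G"
  have C5: "G \<le> C5" "CI * G * 4 powr (\<kappa> / 2) \<le> C5" "C5 > 0" using G by (auto simp: C5_def less_max_iff_disj)
  define C6 where "C6 = CS * sqrt C4 + 2 powr (n / 2 + s) + CS * sqrt E1 / m2"
  have C6: "CS * sqrt C4 + 2 powr (n / 2 + s) \<le> C6" "CS * sqrt E1 / m2 \<le> C6" "C6 > 0"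
    using CS E1 m2 by (auto simp: C6_def add_pos_pos)
  define C where "C = (C6 + CS) * C5"
  have "(\<integral>\<^sup>+x. ennreal (wt u x) * indicator A x \<partial>lborel) \<le> ennreal (C * (sqrt d * R powr (\<kappa> / 2)) * \<rho> powr (2 * s + \<alpha>))"
    if u: "u \<in> D" and nn: "\<forall>x. 0 \<le> u x" and R: "0 < R"
      and supp: "emeasure lborel {x. u x \<noteq> 0} \<le> ennreal (unit_ball_vol n * R powr n / 2)"
      and X: "Ip u = ennreal X" "X0 \<le> X" and d: "0 < d" "d \<le> d0" and Q1: "Q u \<le> ennreal 1"
      and Qu: "Q u \<le> ennreal (lam * X powr (2 / p) + d)" and \<rho>: "0 < \<rho>" "\<rho> \<le> R"
      and A [measurable]: "A \<in> sets borel" and Av: "emeasure lborel A \<le> ennreal (unit_ball_vol n * \<rho> powr n)"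
    for u R d X \<rho> A
  proof -
    have X_nn: "0 \<le> X" using X X0 by simp
    note um [measurable] = D_measurable[OF u]
    define a where "a = sqrt d"
    have a: "a > 0" "a\<^sup>2 = d" using d by (auto simp: a_def)
    define m where "m = C1 * a"
    have m: "0 < m" using C1 a by (simp add: m_def)
    have "a \<le> m1 / C1" unfolding a_def using d m1 C1 by (intro real_le_lsqrt) (auto simp: d0_def)
    then have mm1: "m \<le> m1" using C1 by (simp add: m_def pos_le_divide_eq mult.commute)
    have dm: "d \<le> m\<^sup>2"
    proof -
      have "1 * a \<le> m" unfolding m_def using C1 a by (intro mult_right_mono) auto
      then have "a\<^sup>2 \<le> m\<^sup>2" using a by (intro power_mono) auto
      then show ?thesis by (simp only: a)
    qed
    have ext: "\<forall>r\<ge>R. L1 u r \<le> ennreal (m * r powr (n / 2 + s))"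
    proof (intro allI impI)
      fix r assume r: "R \<le> r"
      have "L1 u r \<le> ennreal (CE * sqrt d * r powr (n / 2 + s))" by (rule CE(2)[OF u nn R supp X(1) X_nn d(1) Qu r])
      also have "\<dots> \<le> ennreal (m * r powr (n / 2 + s))"
        unfolding m_def a_def using C1 d by (intro ennreal_leI mult_right_mono) auto
      finally show "L1 u r \<le> ennreal (m * r powr (n / 2 + s))" .
    qed
    define u1 where "u1 = (\<lambda>x. \<chi>1 R x * u x)"
    let ?v = "\<lambda>x. \<chi>2 R x * u x"
    have u1: "u1 \<in> D" and v: "?v \<in> D" using D_cutoff[OF u R] by (auto simp: u1_def)
    note u1m [measurable] = D_measurable[OF u1]
    obtain Y where Qv: "Q ?v \<le> ennreal (C2 * m\<^sup>2)" and Y: "Ip u1 = ennreal Y" "X / 2 \<le> Y"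
      and Q1Y: "Q u1 \<le> ennreal (lam * Y powr (2 / p) + C2 * m\<^sup>2)" and Qu1: "Q u1 \<le> ennreal (1 + C2 * m\<^sup>2)"
      using m1(3)[OF u Q1 X Qu _ dm R m mm1 ext] d unfolding u1_def by auto
    have Q1E: "Q u1 \<le> ennreal E1"
    proof (rule order_trans[OF Qu1], rule ennreal_leI)
      have "m\<^sup>2 \<le> m1\<^sup>2" using m mm1 by (intro power_mono) auto
      then show "1 + C2 * m\<^sup>2 \<le> E1" using m1 by (simp add: E1_def)
    qed
    have Y_nn: "0 \<le> Y" "X0 / 2 \<le> Y" using Y X X_nn by auto
    have Ga: "sqrt (C2 * m\<^sup>2) = G * a" using m by (simp add: real_sqrt_mult G_def m_def)
    have d1: "0 < C2 * m\<^sup>2" using m1 m by simp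
    have u1nn: "\<forall>x. 0 \<le> u1 x" using nn \<chi>_nonneg by (simp add: u1_def)
    have u1supp: "\<forall>x. 2 * R \<le> norm x \<longrightarrow> u1 x = 0" using \<chi>_outer(1)[OF R] by (simp add: u1_def)
    have R2: "0 < 2 * R" using R by simp
    \<comment> \<open>The ratio of the amplitudes at the scales \<rho> and R. With it m'
      \<rho>^(n/2+s) is a multiple of sqrt d R^(\<kappa>/2) \<rho>^(2s+\<alpha>), the bound to be
      proved.\<close>
    define W where "W = R powr (\<kappa> / 2) * \<rho> powr - (\<kappa> / 2)"
    have W: "1 \<le> W"
    proof -
      have "\<rho> powr (\<kappa> / 2) * \<rho> powr - (\<kappa> / 2) \<le> W"
        unfolding W_def using \<rho> kappa_pos by (intro mult_right_mono powr_mono2) auto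
      moreover have "\<rho> powr (\<kappa> / 2) * \<rho> powr - (\<kappa> / 2) = 1" using \<rho> unfolding powr_add[symmetric] by simp
      ultimately show ?thesis by simp
    qed
    define m' where "m' = C5 * a * W"
    have m': "0 < m'" using C5 a W by (simp add: m'_def)
    have Gm: "G * a \<le> m'"
    proof -
      have "G * a * 1 \<le> C5 * a * W" using C5 a W G by (intro mult_mono) auto
      then show ?thesis by (simp add: m'_def)
    qed
    have d1m: "C2 * m\<^sup>2 \<le> m'\<^sup>2"
    proof -
      have "(G * a)\<^sup>2 \<le> m'\<^sup>2" using Gm G a by (intro power_mono) auto
      moreover have "(G * a)\<^sup>2 = C2 * m\<^sup>2" unfolding Ga[symmetric] using d1 by simp
      ultimately show ?thesis by simp
    qed
    have int: "\<forall>r\<ge>\<rho>. L1 u1 r \<le> ennreal (m' * r powr (n / 2 + s))"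
    proof (intro allI impI)
      fix r assume r: "\<rho> \<le> r"
      \<comment> \<open>Beyond 2R the function \<open>u1\<close> vanishes, so its L1 norm no longer
        grows, and \<open>L1_interior_le\<close> is applied at \<open>t\<close>.\<close>
      define t where "t = min r (2 * R)"
      have t: "\<rho> \<le> t" "t \<le> r" "0 < t" "t \<le> 2 * R" using r \<rho> R by (auto simp: t_def)
      have "L1 u1 r \<le> L1 u1 t"
      proof (rule nn_integral_mono)
        show "ennreal (wt u1 x) * indicator (ball 0 r) x \<le> ennreal (wt u1 x) * indicator (ball 0 t) x" for x
          using u1supp by (cases "norm x < 2 * R") (auto simp: indicator_def t_def wt_def)
      qed
      also have "\<dots> \<le> ennreal (CI * (sqrt (C2 * m\<^sup>2) * (2 * (2 * R)) powr (\<kappa> / 2)) * t powr (2 * s + \<alpha>))"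
        by (rule CI(2)[OF u1 u1nn R2 u1supp Y(1) Y_nn(1) d1 Q1Y t(3,4)])
      also have "CI * (sqrt (C2 * m\<^sup>2) * (2 * (2 * R)) powr (\<kappa> / 2)) * t powr (2 * s + \<alpha>)
        = CI * G * 4 powr (\<kappa> / 2) * (a * R powr (\<kappa> / 2) * (t powr - (\<kappa> / 2) * t powr (n / 2 + s)))"
      proof -
        have "2 * (2 * R) = 4 * R" by simp
        then show ?thesis unfolding Ga scaling_exponents by (simp only: powr_mult mult_ac)
      qed
      also have "\<dots> \<le> C5 * (a * R powr (\<kappa> / 2) * (\<rho> powr - (\<kappa> / 2) * r powr (n / 2 + s)))"
      proof (rule mult_mono[OF C5(2) mult_left_mono])
        show "t powr - (\<kappa> / 2) * t powr (n / 2 + s) \<le> \<rho> powr - (\<kappa> / 2) * r powr (n / 2 + s)"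
          using t \<rho> kappa_pos n_pos s by (intro mult_mono powr_mono2 powr_mono2') auto
      qed (use a C5 in auto)
      also have "\<dots> = m' * r powr (n / 2 + s)" unfolding m'_def W_def by (simp only: mult_ac)
      finally show "L1 u1 r \<le> ennreal (m' * r powr (n / 2 + s))" by (simp add: ennreal_leI)
    qed
    let ?r = "\<rho> powr (n / 2 + s)"
    have A1: "(\<integral>\<^sup>+x. ennreal (wt u1 x) * indicator A x \<partial>lborel) \<le> ennreal (C6 * m' * ?r)"
    proof (cases "m' \<le> m2")
      case True
      let ?w = "\<lambda>x. \<chi>2 \<rho> x * u1 x"
      have w: "?w \<in> D" using D_cutoff[OF u1 \<rho>(1)] by auto
      have "Q ?w \<le> ennreal (C4 * m'\<^sup>2)"
        using m2(3)[OF u1 Q1E Y(1) Y_nn(2) Q1Y _ d1m \<rho>(1) m' True int] d1 by auto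
      also have "C4 * m'\<^sup>2 = (sqrt C4 * m')\<^sup>2" using m2 by (simp add: power_mult_distrib)
      finally have Qw: "Q ?w \<le> ennreal ((sqrt C4 * m')\<^sup>2)" .
      have "(\<integral>\<^sup>+x. ennreal (wt ?w x) * indicator A x \<partial>lborel) \<le> ennreal (CS * (sqrt C4 * m') * ?r)"
        by (rule CS(2)[OF w _ Qw A \<rho>(1) Av]) (use m2 m' in simp)
      moreover have "(\<integral>\<^sup>+x. ennreal (wt (\<lambda>x. \<chi>1 \<rho> x * u1 x) x) * indicator A x \<partial>lborel) \<le> ennreal (m' * (2 * \<rho>) powr (n / 2 + s))"
        by (rule order_trans[OF nn_integral_wt_inner_le[OF \<rho>(1)]]) (use int \<rho> in simp)
      ultimately have "(\<integral>\<^sup>+x. ennreal (wt u1 x) * indicator A x \<partial>lborel)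
        \<le> ennreal (m' * (2 * \<rho>) powr (n / 2 + s)) + ennreal (CS * (sqrt C4 * m') * ?r)"
        by (intro order_trans[OF nn_integral_wt_split[OF u1m A, of \<rho>]] add_mono)
      also have "\<dots> = ennreal (m' * (2 * \<rho>) powr (n / 2 + s) + CS * (sqrt C4 * m') * ?r)"
        by (rule ennreal_plus[symmetric]) (use m' CS m2 in auto)
      also have "\<dots> \<le> ennreal (C6 * m' * ?r)"
      proof (rule ennreal_leI)
        have "m' * (2 * \<rho>) powr (n / 2 + s) + CS * (sqrt C4 * m') * ?r = (CS * sqrt C4 + 2 powr (n / 2 + s)) * (m' * ?r)"
          by (simp add: powr_mult distrib_left distrib_right mult_ac)
        also have "\<dots> \<le> C6 * (m' * ?r)" using C6(1) m' by (intro mult_right_mono) auto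
        finally show "m' * (2 * \<rho>) powr (n / 2 + s) + CS * (sqrt C4 * m') * ?r \<le> C6 * m' * ?r" by (simp only: mult.assoc)
      qed
      finally show ?thesis .
    next
      \<comment> \<open>Now m' is bounded below, so the Sobolev bound from the energy bound
        \<open>E1\<close> is already of the required order.\<close>
      case False
      have "(\<integral>\<^sup>+x. ennreal (wt u1 x) * indicator A x \<partial>lborel) \<le> ennreal (CS * sqrt E1 * ?r)"
        by (rule CS(2)[OF u1 _ _ A \<rho>(1) Av]) (use E1 Q1E in auto)
      also have "\<dots> \<le> ennreal (C6 * m' * ?r)"
      proof (intro ennreal_leI mult_right_mono)
        have "CS * sqrt E1 / m2 * m2 \<le> C6 * m'" using C6 False m2 m' by (intro mult_mono) auto
        then show "CS * sqrt E1 \<le> C6 * m'" using m2 by simp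
      qed simp
      finally show ?thesis .
    qed
    have A2: "(\<integral>\<^sup>+x. ennreal (wt ?v x) * indicator A x \<partial>lborel) \<le> ennreal (CS * m' * ?r)"
    proof -
      have "Q ?v \<le> ennreal (m'\<^sup>2)" by (rule order_trans[OF Qv ennreal_leI[OF d1m]])
      from CS(2)[OF v m' this A \<rho>(1) Av] show ?thesis .
    qed
    have "(\<integral>\<^sup>+x. ennreal (wt u x) * indicator A x \<partial>lborel) \<le> ennreal (C6 * m' * ?r) + ennreal (CS * m' * ?r)"
      using A1 A2 unfolding u1_def by (intro order_trans[OF nn_integral_wt_split[OF um A, of R]] add_mono)
    also have "\<dots> = ennreal (C6 * m' * ?r + CS * m' * ?r)"
      by (rule ennreal_plus[symmetric]) (use m' CS C6 in auto)
    also have "C6 * m' * ?r + CS * m' * ?r = C * (a * R powr (\<kappa> / 2)) * (\<rho> powr - (\<kappa> / 2) * ?r)"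
      unfolding C_def m'_def W_def by (simp add: distrib_left distrib_right mult_ac)
    finally show ?thesis unfolding scaling_exponents a_def .
  qed
  moreover have "C > 0" using C5 C6 CS by (simp add: C_def add_pos_pos)
  ultimately show ?thesis using that[of C d0] d0 by blast
qed

text \<open>Removes the normalisation. If the energy is at most a fixed multiple of d, Sobolev's
  inequality alone suffices. Otherwise \<open>u\<close> is scaled to energy 1, with a deficit as
  small as \<open>normalized_L1_le\<close> demands.\<close>

lemma deficit_L1_le:
  obtains C where "C > 0" "\<And>u R d \<rho> A. u \<in> D \<Longrightarrow> (\<forall>x. 0 \<le> u x) \<Longrightarrow> 0 < R \<Longrightarrow>
    emeasure lborel {x. u x \<noteq> 0} \<le> ennreal (unit_ball_vol n * R powr n / 2) \<Longrightarrow> 0 < d \<Longrightarrow>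
    Q u \<le> \<Lambda> * (Lp_norm p UNIV (\<lambda>x. u x * norm x powr - \<beta>))\<^sup>2 + ennreal d \<Longrightarrow> 0 < \<rho> \<Longrightarrow> \<rho> \<le> R \<Longrightarrow> A \<in> sets borel \<Longrightarrow>
    emeasure lborel A \<le> ennreal (unit_ball_vol n * \<rho> powr n) \<Longrightarrow>
    (\<integral>\<^sup>+x. ennreal (wt u x) * indicator A x \<partial>lborel) \<le> ennreal (C * (sqrt d * R powr (\<kappa> / 2)) * \<rho> powr (2 * s + \<alpha>))"
proof -
  obtain CS where CS: "CS > 0" "\<And>v e A \<rho>. v \<in> D \<Longrightarrow> 0 < e \<Longrightarrow> Q v \<le> ennreal (e\<^sup>2) \<Longrightarrow> A \<in> sets borel \<Longrightarrow> 0 < \<rho> \<Longrightarrow>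
    emeasure lborel A \<le> ennreal (unit_ball_vol n * \<rho> powr n) \<Longrightarrow>
    (\<integral>\<^sup>+x. ennreal (wt v x) * indicator A x \<partial>lborel) \<le> ennreal (CS * e * \<rho> powr (n / 2 + s))"
    by (rule L1_set_energy_le) (rule that, assumption, blast)
  have easy: "(\<integral>\<^sup>+x. ennreal (wt u x) * indicator A x \<partial>lborel) \<le> ennreal (CS * sqrt K * (sqrt d * R powr (\<kappa> / 2)) * \<rho> powr (2 * s + \<alpha>))"
    if u: "u \<in> D" and K: "0 < K" and d: "0 < d" and Qu: "Q u \<le> ennreal (K * d)" and \<rho>: "0 < \<rho>" "\<rho> \<le> R"
      and A: "A \<in> sets borel" and Av: "emeasure lborel A \<le> ennreal (unit_ball_vol n * \<rho> powr n)" for u R d \<rho> A K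
  proof -
    have "(\<integral>\<^sup>+x. ennreal (wt u x) * indicator A x \<partial>lborel) \<le> ennreal (CS * sqrt (K * d) * \<rho> powr (n / 2 + s))"
      by (rule CS(2)[OF u _ _ A \<rho>(1) Av]) (use K d Qu in auto)
    also have "\<dots> \<le> ennreal (CS * sqrt K * (sqrt d * R powr (\<kappa> / 2)) * \<rho> powr (2 * s + \<alpha>))"
    proof (rule ennreal_leI)
      have "CS * sqrt (K * d) * \<rho> powr (n / 2 + s) = CS * sqrt K * (sqrt d * \<rho> powr (\<kappa> / 2)) * \<rho> powr (2 * s + \<alpha>)"
        unfolding scaling_exponents(1)[symmetric] real_sqrt_mult by (simp only: mult_ac)
      also have "\<dots> \<le> CS * sqrt K * (sqrt d * R powr (\<kappa> / 2)) * \<rho> powr (2 * s + \<alpha>)"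
        using CS K d \<rho> kappa_pos by (intro mult_right_mono mult_left_mono powr_mono2) auto
      finally show "CS * sqrt (K * d) * \<rho> powr (n / 2 + s) \<le> CS * sqrt K * (sqrt d * R powr (\<kappa> / 2)) * \<rho> powr (2 * s + \<alpha>)" .
    qed
    finally show ?thesis .
  qed
  show ?thesis
  proof (cases "lam = 0")
    \<comment> \<open>The assumption now reads Q u \<le> d.\<close>
    case True
    then have \<Lambda>0: "\<Lambda> = 0" by (simp add: \<Lambda>_eq)
    show ?thesis
    proof (rule that[of "CS * sqrt 1"])
      fix u R d \<rho> and A :: "(real ^ 'n) set"
      assume u: "u \<in> D" and d: "0 < d" and Qu: "Q u \<le> \<Lambda> * (Lp_norm p UNIV (\<lambda>x. u x * norm x powr - \<beta>))\<^sup>2 + ennreal d"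
        and \<rho>: "0 < \<rho>" "\<rho> \<le> R" and A: "A \<in> sets borel" "emeasure lborel A \<le> ennreal (unit_ball_vol n * \<rho> powr n)"
      have "Q u \<le> ennreal (1 * d)" using Qu by (simp add: \<Lambda>0)
      from easy[OF u zero_less_one d this \<rho> A]
      show "(\<integral>\<^sup>+x. ennreal (wt u x) * indicator A x \<partial>lborel) \<le> ennreal (CS * sqrt 1 * (sqrt d * R powr (\<kappa> / 2)) * \<rho> powr (2 * s + \<alpha>))" .
    qed (use CS in simp)
  next
    case False
    then have lam: "0 < lam" using lam_nonneg by simp
    \<comment> \<open>The p-mass forced by energy 1 and deficit at most 1/2: then lam X^(2/p) \<ge>
      1/2.\<close>
    define X0 where "X0 = (1 / (2 * lam)) powr (p / 2)"
    have X0: "X0 > 0" using lam by (simp add: X0_def)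
    obtain C d0 where C: "C > 0" "d0 > 0" "\<And>u R d X \<rho> A. u \<in> D \<Longrightarrow> (\<forall>x. 0 \<le> u x) \<Longrightarrow> 0 < R \<Longrightarrow>
      emeasure lborel {x. u x \<noteq> 0} \<le> ennreal (unit_ball_vol n * R powr n / 2) \<Longrightarrow> Ip u = ennreal X \<Longrightarrow> X0 \<le> X \<Longrightarrow> 0 < d \<Longrightarrow> d \<le> d0 \<Longrightarrow>
      Q u \<le> ennreal 1 \<Longrightarrow> Q u \<le> ennreal (lam * X powr (2 / p) + d) \<Longrightarrow> 0 < \<rho> \<Longrightarrow> \<rho> \<le> R \<Longrightarrow> A \<in> sets borel \<Longrightarrow>
      emeasure lborel A \<le> ennreal (unit_ball_vol n * \<rho> powr n) \<Longrightarrow>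
      (\<integral>\<^sup>+x. ennreal (wt u x) * indicator A x \<partial>lborel) \<le> ennreal (C * (sqrt d * R powr (\<kappa> / 2)) * \<rho> powr (2 * s + \<alpha>))"
      apply (rule normalized_L1_le[OF lam X0])
    subgoal premises prems by (rule that[OF prems(2,3)]) (rule prems(4))
    done
    \<comment> \<open>If the energy exceeds K d, the normalised deficit is at most 1/K, hence at
      most 1/2 and at most \<open>d0\<close>.\<close>
    define K where "K = max 2 (1 / d0)"
    have K: "2 \<le> K" "1 / d0 \<le> K" by (auto simp: K_def)
    define C' where "C' = max C (CS * sqrt K)"
    have C': "C' > 0" "C \<le> C'" "CS * sqrt K \<le> C'" using C by (auto simp: C'_def less_max_iff_disj)
    show ?thesis
    proof (rule that[OF C'(1)])
      fix u R d \<rho> and A :: "(real ^ 'n) set"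
      assume u: "u \<in> D" and nn: "\<forall>x. 0 \<le> u x" and R: "0 < R"
        and supp: "emeasure lborel {x. u x \<noteq> 0} \<le> ennreal (unit_ball_vol n * R powr n / 2)" and d: "0 < d"
        and Qu: "Q u \<le> \<Lambda> * (Lp_norm p UNIV (\<lambda>x. u x * norm x powr - \<beta>))\<^sup>2 + ennreal d"
        and \<rho>: "0 < \<rho>" "\<rho> \<le> R" and A [measurable]: "A \<in> sets borel" and Av: "emeasure lborel A \<le> ennreal (unit_ball_vol n * \<rho> powr n)"
      note [measurable] = D_measurable[OF u]
      let ?b = "(sqrt d * R powr (\<kappa> / 2)) * \<rho> powr (2 * s + \<alpha>)"
      have b: "0 \<le> ?b" using d by simp
      obtain e where e: "Q u = ennreal e" "0 \<le> e" using D_finite[OF u] by (cases "Q u") auto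
      have "\<exists>B. B \<le> C' \<and> (\<integral>\<^sup>+x. ennreal (wt u x) * indicator A x \<partial>lborel) \<le> ennreal (B * ?b)"
      proof (cases "e \<le> K * d")
        case True
        have "Q u \<le> ennreal (K * d)" unfolding e(1) using True by (rule ennreal_leI)
        from easy[OF u _ d this \<rho> A Av] K C' show ?thesis by (intro exI[of _ "CS * sqrt K"]) (simp add: mult.assoc)
      next
        case False
        have Kd: "0 < K * d" using K d by simp
        then have e0: "0 < e" using False by linarith
        define c where "c = 1 / sqrt e"
        have c: "0 < c" "c\<^sup>2 * e = 1" using e0 by (auto simp: c_def power_divide)
        obtain X where X: "0 \<le> X" "Ip u = ennreal X" using lam_Ip_le[OF u lam, of e] e by auto
        have "Q u \<le> ennreal lam * ennreal (X powr (2 / p)) + ennreal d"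
          using Qu X by (simp add: Lp_norm_square \<Lambda>_eq)
        also have "\<dots> = ennreal (lam * X powr (2 / p) + d)" using lam d by (simp add: ennreal_mult)
        finally have eX: "e \<le> lam * X powr (2 / p) + d" unfolding e(1)
          by (rule iffD1[OF ennreal_le_iff, rotated]) (use lam d in simp)
        define w where "w = (\<lambda>x. c * u x)"
        have w: "w \<in> D" unfolding w_def by (rule D_cmult[OF u])
        have "Q w = ennreal (c\<^sup>2) * Q u" unfolding w_def by (rule Q_cmult) measurable
        also have "\<dots> = ennreal (c\<^sup>2 * e)" unfolding e(1) by (rule ennreal_mult[symmetric]) (use e in auto)
        finally have Qw: "Q w = ennreal 1" by (simp only: c)
        define X' where "X' = c powr p * X"
        have "Ip w = (\<integral>\<^sup>+x. ennreal (c powr p) * ennreal (bw u x powr p) \<partial>lborel)"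
          unfolding Ip_def w_def bw_def using c by (simp add: abs_mult powr_mult mult.assoc ennreal_mult)
        also have "\<dots> = ennreal (c powr p) * Ip u" unfolding Ip_def by (rule nn_integral_cmult) measurable
        also have "\<dots> = ennreal X'" unfolding X'_def X(2) by (rule ennreal_mult[symmetric]) (use X in auto)
        finally have Iw: "Ip w = ennreal X'" .
        have X'2: "X' powr (2 / p) = c\<^sup>2 * X powr (2 / p)"
          using c p by (simp add: X'_def powr_mult powr_powr powr_numeral)
        have "c\<^sup>2 * e \<le> c\<^sup>2 * (lam * X powr (2 / p) + d)" by (rule mult_left_mono[OF eX]) simp
        also have "\<dots> = lam * X' powr (2 / p) + c\<^sup>2 * d" unfolding X'2 by (simp add: distrib_left mult_ac)
        finally have 1: "1 \<le> lam * X' powr (2 / p) + c\<^sup>2 * d" by (simp only: c)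
        have cKd: "K * (c\<^sup>2 * d) \<le> 1"
        proof -
          have "c\<^sup>2 * (K * d) \<le> c\<^sup>2 * e" using False by (intro mult_left_mono) auto
          then show ?thesis unfolding c by (simp add: mult_ac)
        qed
        have cd: "0 < c\<^sup>2 * d" using c d by simp
        have "2 * (c\<^sup>2 * d) \<le> K * (c\<^sup>2 * d)" "1 / d0 * (c\<^sup>2 * d) \<le> K * (c\<^sup>2 * d)"
          using K cd by (auto intro!: mult_right_mono simp del: times_divide_eq_left)
        then have "2 * (c\<^sup>2 * d) \<le> 1" and "1 / d0 * (c\<^sup>2 * d) \<le> 1" using cKd by linarith+
        then have cd2: "2 * (c\<^sup>2 * d) \<le> 1" "c\<^sup>2 * d \<le> d0"
          using C(2) by (simp_all only: times_divide_eq_left mult_1_left pos_divide_le_eq)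
        have "X0 \<le> X'"
        proof -
          have "1 / 2 \<le> lam * X' powr (2 / p)" using 1 cd2 by linarith
          then have "1 / (2 * lam) \<le> X' powr (2 / p)" using lam by (simp add: pos_divide_le_eq mult_ac)
          then have "X0 \<le> (X' powr (2 / p)) powr (p / 2)" unfolding X0_def using lam p by (intro powr_mono2) auto
          also have "\<dots> = X'" using X c p by (simp add: powr_powr X'_def)
          finally show ?thesis .
        qed
        moreover have "emeasure lborel {x. w x \<noteq> 0} \<le> ennreal (unit_ball_vol n * R powr n / 2)"
          using supp c by (simp add: w_def)
        moreover have "\<forall>x. 0 \<le> w x" using nn c by (simp add: w_def)
        moreover have "Q w \<le> ennreal (lam * X' powr (2 / p) + c\<^sup>2 * d)" unfolding Qw by (rule ennreal_leI[OF 1])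
        ultimately have "(\<integral>\<^sup>+x. ennreal (wt w x) * indicator A x \<partial>lborel)
          \<le> ennreal (C * (sqrt (c\<^sup>2 * d) * R powr (\<kappa> / 2)) * \<rho> powr (2 * s + \<alpha>))"
          using C(3)[OF w _ R _ Iw _ cd cd2(2) _ _ \<rho> A Av] Qw by simp
        also have "C * (sqrt (c\<^sup>2 * d) * R powr (\<kappa> / 2)) * \<rho> powr (2 * s + \<alpha>) = c * (C * ?b)"
          using c by (simp add: real_sqrt_mult mult_ac)
        finally have W: "(\<integral>\<^sup>+x. ennreal (wt w x) * indicator A x \<partial>lborel) \<le> ennreal (c * (C * ?b))" .
        have "ennreal c * (\<integral>\<^sup>+x. ennreal (wt u x) * indicator A x \<partial>lborel)
          = (\<integral>\<^sup>+x. ennreal c * (ennreal (wt u x) * indicator A x) \<partial>lborel)"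
          by (rule nn_integral_cmult[symmetric]) measurable
        also have "\<dots> = (\<integral>\<^sup>+x. ennreal (wt w x) * indicator A x \<partial>lborel)"
          unfolding w_def wt_def using c by (simp add: abs_mult ennreal_mult mult.assoc)
        also note W
        finally have "(\<integral>\<^sup>+x. ennreal (wt u x) * indicator A x \<partial>lborel) \<le> ennreal (c * (C * ?b) / c)"
          by (rule ennreal_mult_le_imp[rotated 2]) (use c C b in auto)
        then show ?thesis using c C' by (intro exI[of _ C]) simp
      qed
      then obtain B where B: "B \<le> C'" "(\<integral>\<^sup>+x. ennreal (wt u x) * indicator A x \<partial>lborel) \<le> ennreal (B * ?b)" by blast
      note B(2)
      also have "ennreal (B * ?b) \<le> ennreal (C' * (sqrt d * R powr (\<kappa> / 2)) * \<rho> powr (2 * s + \<alpha>))"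
        unfolding mult.assoc[of C'] by (intro ennreal_leI mult_right_mono B b)
      finally show "(\<integral>\<^sup>+x. ennreal (wt u x) * indicator A x \<partial>lborel)
        \<le> ennreal (C' * (sqrt d * R powr (\<kappa> / 2)) * \<rho> powr (2 * s + \<alpha>))" .
    qed
  qed
qed

text \<open>The radius R is tied to the measure of \<Omega> and \<rho> to that of the test set
  \<open>A\<close>. In \<open>deficit_L1_le\<close> the factor \<rho>^(2s+\<alpha>) then cancels the
  power of |A| in the weak norm, whose exponent is -(2s + \<alpha>)/n, and R^\<kappa>, after
  squaring, becomes the power of the measure of \<Omega>.\<close>

lemma improved_ckn:
  obtains c where "c > 0" "\<And>\<Omega> u. \<Omega> \<in> lmeasurable \<Longrightarrow> u \<in> (D_space s \<alpha> :: (real ^ 'n \<Rightarrow> real) set) \<Longrightarrow>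
    (AE x in lebesgue. x \<notin> \<Omega> \<longrightarrow> u x = 0) \<Longrightarrow>
    \<Lambda> * (Lp_norm p \<Omega> (\<lambda>x. u x * norm x powr - \<beta>))\<^sup>2
      + ennreal (c * measure lebesgue \<Omega> powr (- (n - 2 * s - 2 * \<alpha>) / n))
        * (weak_norm (n / (n - 2 * s - \<alpha>)) (\<lambda>x. u x * norm x powr - \<alpha>))\<^sup>2 \<le> D_norm_sq s \<alpha> u"
proof -
  obtain C where C: "C > 0" "\<And>u R d \<rho> A. u \<in> D \<Longrightarrow> (\<forall>x. 0 \<le> u x) \<Longrightarrow> 0 < R \<Longrightarrow>
    emeasure lborel {x. u x \<noteq> 0} \<le> ennreal (unit_ball_vol n * R powr n / 2) \<Longrightarrow> 0 < d \<Longrightarrow>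
    Q u \<le> \<Lambda> * (Lp_norm p UNIV (\<lambda>x. u x * norm x powr - \<beta>))\<^sup>2 + ennreal d \<Longrightarrow> 0 < \<rho> \<Longrightarrow> \<rho> \<le> R \<Longrightarrow> A \<in> sets borel \<Longrightarrow>
    emeasure lborel A \<le> ennreal (unit_ball_vol n * \<rho> powr n) \<Longrightarrow>
    (\<integral>\<^sup>+x. ennreal (wt u x) * indicator A x \<partial>lborel) \<le> ennreal (C * (sqrt d * R powr (\<kappa> / 2)) * \<rho> powr (2 * s + \<alpha>))"
    by (rule deficit_L1_le) (rule that, assumption, blast)
  let ?V = "unit_ball_vol n" and ?g = "(2 * s + \<alpha>) / n" and ?h = "\<kappa> / 2 / n"
  define B where "B = C * (2 / ?V) powr ?h * (1 / ?V) powr ?g"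
  have B: "B > 0" using C V_pos by (simp add: B_def)
  have Vne: "?V \<noteq> 0" using V_pos by linarith
  have g: "0 < ?g" using s \<alpha> n_pos by simp
  have "\<Lambda> * (Lp_norm p \<Omega> (\<lambda>x. u x * norm x powr - \<beta>))\<^sup>2
      + ennreal (1 / B\<^sup>2 * measure lebesgue \<Omega> powr (- (n - 2 * s - 2 * \<alpha>) / n))
        * (weak_norm (n / (n - 2 * s - \<alpha>)) (\<lambda>x. u x * norm x powr - \<alpha>))\<^sup>2 \<le> D_norm_sq s \<alpha> u"
    if \<Omega>: "\<Omega> \<in> lmeasurable" and u: "u \<in> (D_space s \<alpha> :: (real ^ 'n \<Rightarrow> real) set)"
      and off: "AE x in lebesgue. x \<notin> \<Omega> \<longrightarrow> u x = 0" for \<Omega> u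
  proof -
    obtain v0 where v0: "v0 \<in> D" "AE x in lborel. u x = v0 x" by (rule D_space_eq_D[OF u])
    \<comment> \<open>The absolute value has the same weighted norms and no larger energy.\<close>
    define v where "v = (\<lambda>x. \<bar>v0 x\<bar>)"
    have v: "v \<in> D" unfolding v_def by (rule D_abs0[OF v0(1)])
    have vnn: "\<forall>x. 0 \<le> v x" by (simp add: v_def)
    note [measurable] = D_measurable[OF v] D_measurable[OF v0(1)]
    have uv: "AE x in lborel. \<bar>u x\<bar> = v x" using v0(2) by eventually_elim (simp add: v_def)
    have "Q v \<le> Q v0" unfolding v_def by (rule Q_mono_Lipschitz) (rule abs_triangle_ineq3)
    also have "Q v0 = Q u"
      by (rule Q_cong_AE[symmetric, OF D_measurable[OF v0(1)]]) (use v0(2) in \<open>eventually_elim, simp\<close>)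
    finally have Qvu: "Q v \<le> D_norm_sq s \<alpha> u" by (simp only: D_norm_sq_eq)
    have voff: "AE x in lborel. v x \<noteq> 0 \<longrightarrow> x \<in> \<Omega>"
      using uv off[unfolded AE_completion_iff] by eventually_elim auto
    have Lp: "Lp_norm p \<Omega> (\<lambda>x. u x * norm x powr - \<beta>) = Lp_norm p UNIV (\<lambda>x. v x * norm x powr - \<beta>)"
    proof -
      have "(\<integral>\<^sup>+x\<in>\<Omega>. ennreal (\<bar>u x * norm x powr - \<beta>\<bar> powr p) \<partial>lebesgue)
        = (\<integral>\<^sup>+x\<in>UNIV. ennreal (\<bar>v x * norm x powr - \<beta>\<bar> powr p) \<partial>lebesgue)"
        unfolding nn_integral_completion
      proof (rule nn_integral_cong_AE)
        show "AE x in lborel. ennreal (\<bar>u x * norm x powr - \<beta>\<bar> powr p) * indicator \<Omega> x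
          = ennreal (\<bar>v x * norm x powr - \<beta>\<bar> powr p) * indicator UNIV x"
          using uv voff
        proof eventually_elim
          case (elim x)
          then have "\<bar>u x * norm x powr - \<beta>\<bar> = \<bar>v x * norm x powr - \<beta>\<bar>" by (simp add: abs_mult v_def)
          with elim show ?case by (cases "v x = 0") (auto simp: indicator_def)
        qed
      qed
      then show ?thesis by (simp only: Lp_norm_def)
    qed
    define M where "M = measure lebesgue \<Omega>"
    have emM: "emeasure lebesgue \<Omega> = ennreal M" using \<Omega> by (simp add: M_def emeasure_eq_measure2)
    define L where "L = \<Lambda> * (Lp_norm p UNIV (\<lambda>x. v x * norm x powr - \<beta>))\<^sup>2"
    have LQ: "L \<le> Q v" unfolding L_def by (rule \<Lambda>_le[OF v])
    let ?W = "weak_norm (n / (n - 2 * s - \<alpha>)) (\<lambda>x. u x * norm x powr - \<alpha>)"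
    have "L + ennreal (1 / B\<^sup>2 * M powr (- (n - 2 * s - 2 * \<alpha>) / n)) * ?W\<^sup>2 \<le> Q v"
    proof (cases "M = 0")
      \<comment> \<open>For a null set \<Omega> the convention \<open>0 powr a = 0\<close> makes the
        coefficient of the remainder zero.\<close>
      case True
      then show ?thesis using LQ by simp
    next
      case False
      then have M: "M > 0" by (simp add: M_def less_le)
      have emv: "emeasure lborel T \<le> ennreal (measure lebesgue S)"
        if [measurable]: "T \<in> sets borel" and S: "S \<in> lmeasurable" "AE x in lborel. x \<in> T \<longrightarrow> x \<in> S" for S T :: "(real ^ 'n) set"
      proof -
        have "emeasure lborel T = (\<integral>\<^sup>+x. indicator T x \<partial>lborel)" by simp
        also have "\<dots> \<le> (\<integral>\<^sup>+x. indicator S x \<partial>lborel)"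
          by (rule nn_integral_mono_AE) (use S(2) in \<open>eventually_elim, auto simp: indicator_def\<close>)
        also have "\<dots> = (\<integral>\<^sup>+x. indicator S x \<partial>lebesgue)" by (simp only: nn_integral_completion)
        also have "\<dots> = emeasure lebesgue S" using S(1) by (intro nn_integral_indicator) auto
        also have "\<dots> = ennreal (measure lebesgue S)" using S(1) by (simp add: emeasure_eq_measure2)
        finally show ?thesis .
      qed
      \<comment> \<open>The ball of radius R has twice the measure of \<Omega>, so \<open>u\<close>
        vanishes on at least half of it.\<close>
      define R where "R = (2 * M / ?V) powr (1 / n)"
      have R: "0 < R" using M V_pos by (simp add: R_def)
      have Rn: "?V * R powr n / 2 = M" using M V_pos n_pos by (simp add: R_def powr_powr Vne)
      have supp: "emeasure lborel {x. v x \<noteq> 0} \<le> ennreal (?V * R powr n / 2)"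
        unfolding Rn M_def by (rule emv[OF _ \<Omega>]) (use voff in auto)
      have weak: "?W \<le> ennreal (sqrt d * (B * M powr ?h))"
        if d: "0 < d" and Qd: "Q v \<le> L + ennreal d" for d
        unfolding weak_norm_def
      proof (rule SUP_least)
        fix A :: "(real ^ 'n) set" assume "A \<in> {A. A \<in> lmeasurable \<and> measure lebesgue A > 0}"
        then have A: "A \<in> lmeasurable" "measure lebesgue A > 0" by auto
        define a where "a = measure lebesgue A"
        have a: "a > 0" using A by (simp add: a_def)
        have "(indicator A :: _ \<Rightarrow> real) \<in> borel_measurable lebesgue" using A(1) by (intro borel_measurable_indicator) auto
        then obtain f where f [measurable]: "f \<in> borel_measurable borel" and fA: "AE x in lborel. indicator A x = (f x :: real)"
          using completion_ex_borel_measurable_real[of "indicator A" lborel] by auto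
        \<comment> \<open>Up to null sets, the part of \<open>A\<close> where \<open>v\<close> does
          not vanish. It is Borel, and its measure is bounded by those of both \<open>A\<close> and
          \<Omega>.\<close>
        define T where "T = {x. f x = 1 \<and> v x \<noteq> 0}"
        have [measurable]: "T \<in> sets borel" unfolding T_def by measurable
        have TA: "AE x in lborel. x \<in> T \<longrightarrow> x \<in> A" using fA by eventually_elim (auto simp: T_def indicator_def split: if_splits)
        have T\<Omega>: "AE x in lborel. x \<in> T \<longrightarrow> x \<in> \<Omega>" using voff by eventually_elim (auto simp: T_def)
        \<comment> \<open>The minimum secures \<rho> \<le> R for large \<open>A\<close>. As the
          exponent \<open>?g\<close> is positive, replacing b by a at the end only enlarges the
          bound.\<close>
        define b where "b = min a M"
        have b: "0 < b" "b \<le> a" "b \<le> M" using a M by (auto simp: b_def)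
        define \<rho> where "\<rho> = (b / ?V) powr (1 / n)"
        have \<rho>: "0 < \<rho>" using b V_pos by (simp add: \<rho>_def)
        have \<rho>R: "\<rho> \<le> R" unfolding \<rho>_def R_def using b M V_pos n_pos by (intro powr_mono2 divide_right_mono) auto
        have \<rho>n: "?V * \<rho> powr n = b" using b V_pos n_pos by (simp add: \<rho>_def powr_powr Vne)
        have "emeasure lborel T \<le> ennreal a" "emeasure lborel T \<le> ennreal M"
          unfolding a_def M_def by (rule emv[OF _ A(1) TA] emv[OF _ \<Omega> T\<Omega>]; measurable)+
        then have Tv: "emeasure lborel T \<le> ennreal (?V * \<rho> powr n)" unfolding \<rho>n by (simp add: b_def min_def)
        have "(\<integral>\<^sup>+x\<in>A. ennreal \<bar>u x * norm x powr - \<alpha>\<bar> \<partial>lebesgue) = (\<integral>\<^sup>+x. ennreal (wt v x) * indicator T x \<partial>lborel)"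
          unfolding nn_integral_completion
        proof (rule nn_integral_cong_AE)
          show "AE x in lborel. ennreal \<bar>u x * norm x powr - \<alpha>\<bar> * indicator A x = ennreal (wt v x) * indicator T x"
            using uv fA
          proof eventually_elim
            case (elim x)
            then have "\<bar>u x * norm x powr - \<alpha>\<bar> = wt v x" by (simp add: abs_mult wt_def v_def)
            with elim(2) show ?case by (auto simp: T_def indicator_def wt_def split: if_splits)
          qed
        qed
        also have "\<dots> \<le> ennreal (C * (sqrt d * R powr (\<kappa> / 2)) * \<rho> powr (2 * s + \<alpha>))"
          by (rule C(2)[OF v vnn R supp d Qd[unfolded L_def] \<rho> \<rho>R _ Tv]) measurable
        finally have I: "(\<integral>\<^sup>+x\<in>A. ennreal \<bar>u x * norm x powr - \<alpha>\<bar> \<partial>lebesgue)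
          \<le> ennreal (C * (sqrt d * R powr (\<kappa> / 2)) * \<rho> powr (2 * s + \<alpha>))" .
        have ex: "1 / (n / (n - 2 * s - \<alpha>)) - 1 = - ?g" using n_pos by (simp add: field_simps)
        have "ennreal (a powr - ?g) * (\<integral>\<^sup>+x\<in>A. ennreal \<bar>u x * norm x powr - \<alpha>\<bar> \<partial>lebesgue)
          \<le> ennreal (a powr - ?g) * ennreal (C * (sqrt d * R powr (\<kappa> / 2)) * \<rho> powr (2 * s + \<alpha>))"
          by (rule mult_left_mono[OF I]) simp
        also have "\<dots> = ennreal (a powr - ?g * (C * (sqrt d * R powr (\<kappa> / 2)) * \<rho> powr (2 * s + \<alpha>)))"
          by (rule ennreal_mult[symmetric]) (use C d in auto)
        also have "\<dots> \<le> ennreal (sqrt d * (B * M powr ?h))"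
        proof (rule ennreal_leI)
          have Rh: "R powr (\<kappa> / 2) = (2 / ?V) powr ?h * M powr ?h"
          proof -
            have "R powr (\<kappa> / 2) = (2 / ?V * M) powr ?h" by (simp add: R_def powr_powr mult.commute[of 2 n])
            then show ?thesis by (simp only: powr_mult)
          qed
          have "\<rho> powr (2 * s + \<alpha>) = (1 / ?V * b) powr ?g" by (simp add: \<rho>_def powr_powr)
          also have "\<dots> = (1 / ?V) powr ?g * b powr ?g" by (simp only: powr_mult)
          finally have \<rho>g: "\<rho> powr (2 * s + \<alpha>) = (1 / ?V) powr ?g * b powr ?g" .
          have "a powr - ?g * (C * (sqrt d * R powr (\<kappa> / 2)) * \<rho> powr (2 * s + \<alpha>))
            = sqrt d * (B * M powr ?h) * (a powr - ?g * b powr ?g)"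
            unfolding Rh \<rho>g B_def by (simp only: mult_ac)
          also have "\<dots> \<le> sqrt d * (B * M powr ?h) * (a powr - ?g * a powr ?g)"
            using b g B d by (intro mult_left_mono powr_mono2) auto
          also have "a powr - ?g * a powr ?g = 1" using a unfolding powr_add[symmetric] by simp
          finally show "a powr - ?g * (C * (sqrt d * R powr (\<kappa> / 2)) * \<rho> powr (2 * s + \<alpha>)) \<le> sqrt d * (B * M powr ?h)" by simp
        qed
        finally show "ennreal (measure lebesgue A powr (1 / (n / (n - 2 * s - \<alpha>)) - 1))
          * (\<integral>\<^sup>+x\<in>A. ennreal \<bar>u x * norm x powr - \<alpha>\<bar> \<partial>lebesgue) \<le> ennreal (sqrt d * (B * M powr ?h))"
          unfolding ex a_def .
      qed
      let ?k = "1 / B\<^sup>2 * M powr (- (n - 2 * s - 2 * \<alpha>) / n)"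
      have rem: "ennreal ?k * ?W\<^sup>2 \<le> ennreal d" if d: "0 < d" "Q v \<le> L + ennreal d" for d
      proof -
        have "ennreal ?k * ?W\<^sup>2 \<le> ennreal ?k * (ennreal (sqrt d * (B * M powr ?h)))\<^sup>2"
          by (intro mult_left_mono power_mono weak d) auto
        also have "\<dots> = ennreal (?k * (sqrt d * (B * M powr ?h))\<^sup>2)"
        proof -
          have "(ennreal (sqrt d * (B * M powr ?h)))\<^sup>2 = ennreal ((sqrt d * (B * M powr ?h))\<^sup>2)"
            using d B by (intro ennreal_power) auto
          then show ?thesis by (simp only:) (rule ennreal_mult[symmetric]; simp)
        qed
        also have "?k * (sqrt d * (B * M powr ?h))\<^sup>2 = d"
        proof -
          have "(M powr ?h)\<^sup>2 = M powr (\<kappa> / n)" unfolding power2_eq_square powr_add[symmetric] by simp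
          moreover have "M powr (- (n - 2 * s - 2 * \<alpha>) / n) * M powr (\<kappa> / n) = 1"
            using M unfolding powr_add[symmetric] by (simp add: \<kappa>_def add_divide_distrib[symmetric])
          ultimately have "M powr (- (n - 2 * s - 2 * \<alpha>) / n) * (M powr ?h)\<^sup>2 = 1" by simp
          moreover have "?k * (sqrt d * (B * M powr ?h))\<^sup>2
            = (1 / B\<^sup>2 * B\<^sup>2) * (sqrt d)\<^sup>2 * (M powr (- (n - 2 * s - 2 * \<alpha>) / n) * (M powr ?h)\<^sup>2)"
            by (simp only: power_mult_distrib mult_ac)
          ultimately show ?thesis using B d by simp
        qed
        finally show ?thesis .
      qed
      obtain e where e: "Q v = ennreal e" "0 \<le> e" using D_finite[OF v] by (cases "Q v") auto
      obtain l where l: "L = ennreal l" "0 \<le> l" using LQ D_finite[OF v] by (cases L) (auto simp: top_unique)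
      have le: "l \<le> e" using LQ e l by (simp add: ennreal_le_iff)
      show ?thesis
      \<comment> \<open>\<open>rem\<close> asks for a positive d, but the deficit e - l may be
        zero.\<close>
      proof (rule ennreal_le_epsilon)
        fix \<epsilon> :: real assume \<epsilon>: "0 < \<epsilon>"
        have "Q v \<le> L + ennreal (e - l + \<epsilon>)"
          unfolding e(1) l(1) using le l \<epsilon> by (subst ennreal_plus[symmetric]) (auto intro: ennreal_leI)
        then have "ennreal ?k * ?W\<^sup>2 \<le> ennreal (e - l + \<epsilon>)" by (intro rem) (use le \<epsilon> in auto)
        then have "L + ennreal ?k * ?W\<^sup>2 \<le> L + ennreal (e - l + \<epsilon>)" by (rule add_left_mono)
        also have "\<dots> = ennreal (l + (e - l + \<epsilon>))" unfolding l(1) by (rule ennreal_plus[symmetric]) (use l le \<epsilon> in auto)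
        also have "\<dots> = Q v + ennreal \<epsilon>" unfolding e(1) using e \<epsilon> by simp
        finally show "L + ennreal ?k * ?W\<^sup>2 \<le> Q v + ennreal \<epsilon>" .
      qed
    qed
    also note Qvu
    finally show ?thesis unfolding L_def M_def Lp .
  qed
  then show ?thesis using B by (intro that[of "1 / B\<^sup>2"]) auto
qed

end

theorem corollary1p4:
  fixes n s p \<alpha> \<beta> :: real
  assumes "n = real CARD('n::finite)"
    and "0 < s" and "s < min 1 (n / 2)"
    and "2 < p" and "p < 2 * n / (n - 2 * s)"
    and "- 2 * s < \<alpha>" and "\<alpha> < n / 2 - s"
    and "\<beta> - \<alpha> = s - n * (1 / 2 - 1 / p)"
    and "\<alpha> \<ge> 0"
  shows "\<exists>c > 0. \<forall>\<Omega> \<in> lmeasurable. \<forall>u \<in> (D_space s \<alpha> :: (real ^ 'n \<Rightarrow> real) set).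
    (AE x in lebesgue. x \<notin> \<Omega> \<longrightarrow> u x = 0) \<longrightarrow>
    D_norm_sq s \<alpha> u \<ge>
      CKN_const TYPE('n) s p \<alpha> \<beta> * (Lp_norm p \<Omega> (\<lambda>x. u x * norm x powr (- \<beta>)))\<^sup>2
      + ennreal (c * measure lebesgue \<Omega> powr (- (n - 2 * s - 2 * \<alpha>) / n))
        * (weak_norm (n / (n - 2 * s - \<alpha>)) (\<lambda>x. u x * norm x powr (- \<alpha>)))\<^sup>2"
proof -
  interpret ckn "TYPE('n)" n s \<alpha> p \<beta> by unfold_locales (use assms in auto)
  show ?thesis
    by (rule improved_ckn) (auto simp: \<Lambda>_def)
qed

end
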